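(* Let $\mathbf{V}$ be a positive-dimensional dagger compact category. Define $L\colon\mathrm{CPM}[\mathbf{V}]\to\mathrm{CP}^*[\mathbf{V}]$ on objects by $L(A):=(A^*\otimes A,\ 1_{A^*}\otimes\varepsilon_A\otimes 1_A)$ (the object $A^*\otimes A$ with the pants algebra structure) and on morphisms by $L(f)=f$. Then $L$ is a well-defined functor that is full, faithful, and strongly dagger symmetric monoidal.
   Context: Conventions. In a dagger compact category $\mathbf{V}$, every object $A$ has a dual $A^*$ with maps $\eta_A\colon I\to A^*\otimes A$ and $\varepsilon_A\colon A\otimes A^*\to I$ satisfying the snake equations and $\varepsilon_A=\eta_A^\dagger\circ\sigma_{A,A^*}$, where $\sigma$ is the symmetry. For $f\colon A\to B$, $f^*\colon B^*\to A^*$ is its dual and $f_*:=(f^\dagger)^*\colon A^*\to B^*$. Coherence isomorphisms are suppressed, and $(A\otimes B)^*$ is identified with $B^*\otimes A^*$. A morphism $g\colon A\to A$ is positive if $g=h^\dagger\circ h$ for some $h$, and positive definite if it is positive and an isomorphism. $\mathbf{V}$ is positive-dimensional if for each object $X$ there is a positive definite scalar $z\colon I\to I$ with $(z\circ z\circ \mathrm{Tr}_X(1_X))\otimes 1_X=1_X$, where $\mathrm{Tr}_X(1_X)=\eta_X^\dagger\circ\eta_X$. A Frobenius algebra is an object $A$ with a monoid structure $(m\colon A\otimes A\to A,\ u\colon I\to A)$ and a comonoid structure $(\delta\colon A\to A\otimes A,\ e\colon A\to I)$ with $(1_A\otimes m)\circ(\delta\otimes 1_A)=\delta\circ m=(m\otimes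 1_A)\circ(1_A\otimes\delta)$. It is a dagger Frobenius algebra if $\delta=m^\dagger$ and $e=u^\dagger$; it is then denoted $(A,m)$. A map $z\colon A\to A$ is central if $m\circ(z\otimes 1_A)=z\circ m=m\circ(1_A\otimes z)$. A dagger Frobenius algebra is normalisable if there is a central positive definite $z\colon A\to A$ (a normaliser) with $\mathrm{Tr}_A(m)\circ z\circ z=e$, where $\mathrm{Tr}_A(m)=\varepsilon_A\circ(m\otimes 1_{A^*})\circ(1_A\otimes(\sigma_{A^*,A}\circ\eta_A))\colon A\to I$. The action map of $(A,m)$ is $\mathrm{act}_A=(1_{A^*}\otimes m)\circ(\eta_A\otimes 1_A)\colon A\to A^*\otimes A$, and the coaction map is $\mathrm{coact}_A=(\eta_A^\dagger\otimes 1_A)\circ(1_{A^*}\otimes\delta)\colon A^*\otimes A\to A$. The category $\mathrm{CP}^*[\mathbf{V}]$: objects are normalisable dagger Frobenius algebras in $\mathbf{V}$; morphisms $(A,m)\to(B,n)$ are morphisms $f\colon A\to B$ of $\mathbf{V}$ for which there exist an object $X$ and $g\colon A\to X\otimes B$ in $\mathbf{V}$ with $$\mathrm{act}_B\circ f\circ\mathrm{coact}_A=(1_{B^*}\otimes\eta_X^\dagger\otimes 1_B)\circ(g_*\otimes g).$$ Composition, identities and dagger are those of $\mathbf{V}$. The tensor is $(A,m)\otimes(B,n):=(A\otimes B,\ (m\otimes n)\circ(1_A\otimes\sigma_{B,A}\otimes 1_B))$, with unit $I$ and with tensor of morphisms, coherence maps and symmetry as in $\mathbf{V}$. Pants algebra: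 $A^*\otimes A$ has multiplication $1_{A^*}\otimes\varepsilon_A\otimes 1_A$, unit $\eta_A$, and comultiplication and counit the daggers of these. The category $\mathrm{CPM}[\mathbf{V}]$ (Selinger): objects are those of $\mathbf{V}$; morphisms $A\to B$ are $\mathbf{V}$-morphisms $f\colon A^*\otimes A\to B^*\otimes B$ for which there exist an object $X$ and $g\colon A\to X\otimes B$ with $f=(1_{B^*}\otimes\eta_X^\dagger\otimes 1_B)\circ(g_*\otimes g)$. Composition, identities, dagger and the tensor on objects are as in $\mathbf{V}$. The tensor of morphisms $f\colon A\to B$ and $g\colon C\to D$ is $f\otimes g\colon A^*\otimes A\otimes C^*\otimes C\to B^*\otimes B\otimes D^*\otimes D$ conjugated by the evident symmetry isomorphisms $C^*\otimes A^*\otimes A\otimes C\cong A^*\otimes A\otimes C^*\otimes C$ and $D^*\otimes B^*\otimes B\otimes D\cong B^*\otimes B\otimes D^*\otimes D$. A strongly dagger symmetric monoidal functor is a dagger-preserving functor $F$ that is strong symmetric monoidal with unitary structure isomorphisms, in particular with a unitary natural isomorphism $\varphi_{A,B}\colon F(A\otimes B)\to F(A)\otimes F(B)$. *)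

theory Defs
  imports Main
begin

section \<open>Dagger symmetric monoidal categories and functors between them\<close>

text \<open>
  Coherence isomorphisms are kept explicit throughout: categories are not assumed to be strict,
  and no equation between objects, such as the identification of \<open>(A \<otimes> B)\<^sup>\<star>\<close> with
  \<open>B\<^sup>\<star> \<otimes> A\<^sup>\<star>\<close>, is assumed. As coherence isomorphisms are unitary, their inverses are
  written as daggers. The values of all operations outside of the objects and arrows
  are irrelevant.
\<close>

record ('o, 'm) category_data =
  Obj :: "'o set"
  Arr :: "'m set"
  Dom :: "'m \<Rightarrow> 'o"
  Cod :: "'m \<Rightarrow> 'o"
  Id :: "'o \<Rightarrow> 'm" ("\<one>\<index>")
  Comp :: "'m \<Rightarrow> 'm \<Rightarrow> 'm" (infixr "\<cdot>\<index>" 55)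

definition hom :: "('o, 'm, 'x) category_data_scheme \<Rightarrow> 'o \<Rightarrow> 'o \<Rightarrow> 'm set" where
  "hom C A B = {f \<in> Arr C. Dom C f = A \<and> Cod C f = B}"

locale category =
  fixes C :: "('o, 'm, 'x) category_data_scheme" (structure)
  assumes Dom_in_Obj: "f \<in> Arr C \<Longrightarrow> Dom C f \<in> Obj C"
    and Cod_in_Obj: "f \<in> Arr C \<Longrightarrow> Cod C f \<in> Obj C"
    and Id_in_hom: "A \<in> Obj C \<Longrightarrow> \<one> A \<in> hom C A A"
    and Comp_in_hom: "f \<in> hom C A B \<Longrightarrow> g \<in> hom C B D \<Longrightarrow> g \<cdot> f \<in> hom C A D"
    and Comp_Id_left: "f \<in> hom C A B \<Longrightarrow> \<one> B \<cdot> f = f"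
    and Comp_Id_right: "f \<in> hom C A B \<Longrightarrow> f \<cdot> \<one> A = f"
    and Comp_assoc:
      "f \<in> hom C A B \<Longrightarrow> g \<in> hom C B D \<Longrightarrow> h \<in> hom C D E \<Longrightarrow> (h \<cdot> g) \<cdot> f = h \<cdot> (g \<cdot> f)"
begin

definition isomorphism :: "'o \<Rightarrow> 'o \<Rightarrow> 'm \<Rightarrow> bool" where
  "isomorphism A B f \<longleftrightarrow>
     f \<in> hom C A B \<and> (\<exists>g \<in> hom C B A. g \<cdot> f = \<one> A \<and> f \<cdot> g = \<one> B)"

end

record ('o, 'm) dsm_category_data = "('o, 'm) category_data" +
  Dagger :: "'m \<Rightarrow> 'm" ("_\<^sup>\<dagger>\<index>" [1000] 1000)
  TensorO :: "'o \<Rightarrow> 'o \<Rightarrow> 'o" (infixr "\<otimes>\<index>" 75)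
  TensorA :: "'m \<Rightarrow> 'm \<Rightarrow> 'm" (infixr "\<odot>\<index>" 70)
  TUnit :: "'o" ("\<I>\<index>")
  Assoc :: "'o \<Rightarrow> 'o \<Rightarrow> 'o \<Rightarrow> 'm" ("\<a>\<index>")
  Lunit :: "'o \<Rightarrow> 'm" ("\<l>\<index>")
  Runit :: "'o \<Rightarrow> 'm" ("\<r>\<index>")
  Sym :: "'o \<Rightarrow> 'o \<Rightarrow> 'm" ("\<sigma>\<index>")

locale dagger_category = category C
  for C :: "('o, 'm, 'x) dsm_category_data_scheme" (structure) +
  assumes Dagger_in_hom: "f \<in> hom C A B \<Longrightarrow> f\<^sup>\<dagger> \<in> hom C B A"
    and Dagger_Id: "A \<in> Obj C \<Longrightarrow> (\<one> A)\<^sup>\<dagger> = \<one> A"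
    and Dagger_Comp: "f \<in> hom C A B \<Longrightarrow> g \<in> hom C B D \<Longrightarrow> (g \<cdot> f)\<^sup>\<dagger> = f\<^sup>\<dagger> \<cdot> g\<^sup>\<dagger>"
    and Dagger_Dagger: "f \<in> hom C A B \<Longrightarrow> (f\<^sup>\<dagger>)\<^sup>\<dagger> = f"
begin

definition unitary :: "'o \<Rightarrow> 'o \<Rightarrow> 'm \<Rightarrow> bool" where
  "unitary A B f \<longleftrightarrow> f \<in> hom C A B \<and> f\<^sup>\<dagger> \<cdot> f = \<one> A \<and> f \<cdot> f\<^sup>\<dagger> = \<one> B"

definition positive :: "'o \<Rightarrow> 'm \<Rightarrow> bool" where
  "positive A g \<longleftrightarrow> (\<exists>B \<in> Obj C. \<exists>h \<in> hom C A B. g = h\<^sup>\<dagger> \<cdot> h)"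

definition positive_definite :: "'o \<Rightarrow> 'm \<Rightarrow> bool" where
  "positive_definite A g \<longleftrightarrow> positive A g \<and> isomorphism A A g"

end

locale dagger_symmetric_monoidal_category = dagger_category C
  for C :: "('o, 'm, 'x) dsm_category_data_scheme" (structure) +
  assumes TensorO_in_Obj: "A \<in> Obj C \<Longrightarrow> B \<in> Obj C \<Longrightarrow> A \<otimes> B \<in> Obj C"
    and TUnit_in_Obj: "\<I> \<in> Obj C"
    and TensorA_in_hom:
      "f \<in> hom C A B \<Longrightarrow> g \<in> hom C A' B' \<Longrightarrow> f \<odot> g \<in> hom C (A \<otimes> A') (B \<otimes> B')"
    and TensorA_Id: "A \<in> Obj C \<Longrightarrow> B \<in> Obj C \<Longrightarrow> \<one> A \<odot> \<one> B = \<one> (A \<otimes> B)"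
    and TensorA_Comp:
      "f \<in> hom C A B \<Longrightarrow> g \<in> hom C B D \<Longrightarrow> f' \<in> hom C A' B' \<Longrightarrow> g' \<in> hom C B' D' \<Longrightarrow>
       (g \<cdot> f) \<odot> (g' \<cdot> f') = (g \<odot> g') \<cdot> (f \<odot> f')"
    and Dagger_TensorA:
      "f \<in> hom C A B \<Longrightarrow> g \<in> hom C A' B' \<Longrightarrow> (f \<odot> g)\<^sup>\<dagger> = f\<^sup>\<dagger> \<odot> g\<^sup>\<dagger>"
    and Assoc_unitary:
      "A \<in> Obj C \<Longrightarrow> B \<in> Obj C \<Longrightarrow> D \<in> Obj C \<Longrightarrow>
       unitary ((A \<otimes> B) \<otimes> D) (A \<otimes> (B \<otimes> D)) (\<a> A B D)"
    and Lunit_unitary: "A \<in> Obj C \<Longrightarrow> unitary (\<I> \<otimes> A) A (\<l> A)"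
    and Runit_unitary: "A \<in> Obj C \<Longrightarrow> unitary (A \<otimes> \<I>) A (\<r> A)"
    and Sym_unitary: "A \<in> Obj C \<Longrightarrow> B \<in> Obj C \<Longrightarrow> unitary (A \<otimes> B) (B \<otimes> A) (\<sigma> A B)"
    and Assoc_natural:
      "f \<in> hom C A A' \<Longrightarrow> g \<in> hom C B B' \<Longrightarrow> h \<in> hom C D D' \<Longrightarrow>
       \<a> A' B' D' \<cdot> ((f \<odot> g) \<odot> h) = (f \<odot> (g \<odot> h)) \<cdot> \<a> A B D"
    and Lunit_natural: "f \<in> hom C A B \<Longrightarrow> \<l> B \<cdot> (\<one> \<I> \<odot> f) = f \<cdot> \<l> A"
    and Runit_natural: "f \<in> hom C A B \<Longrightarrow> \<r> B \<cdot> (f \<odot> \<one> \<I>) = f \<cdot> \<r> A"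
    and Sym_natural:
      "f \<in> hom C A A' \<Longrightarrow> g \<in> hom C B B' \<Longrightarrow> \<sigma> A' B' \<cdot> (f \<odot> g) = (g \<odot> f) \<cdot> \<sigma> A B"
    and pentagon:
      "A \<in> Obj C \<Longrightarrow> B \<in> Obj C \<Longrightarrow> D \<in> Obj C \<Longrightarrow> E \<in> Obj C \<Longrightarrow>
       \<a> A B (D \<otimes> E) \<cdot> \<a> (A \<otimes> B) D E =
       (\<one> A \<odot> \<a> B D E) \<cdot> \<a> A (B \<otimes> D) E \<cdot> (\<a> A B D \<odot> \<one> E)"
    and triangle:
      "A \<in> Obj C \<Longrightarrow> B \<in> Obj C \<Longrightarrow> (\<one> A \<odot> \<l> B) \<cdot> \<a> A \<I> B = \<r> A \<odot> \<one> B"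
    and Sym_Sym: "A \<in> Obj C \<Longrightarrow> B \<in> Obj C \<Longrightarrow> \<sigma> B A \<cdot> \<sigma> A B = \<one> (A \<otimes> B)"
    and hexagon:
      "A \<in> Obj C \<Longrightarrow> B \<in> Obj C \<Longrightarrow> D \<in> Obj C \<Longrightarrow>
       \<a> B D A \<cdot> \<sigma> A (B \<otimes> D) \<cdot> \<a> A B D =
       (\<one> B \<odot> \<sigma> A D) \<cdot> \<a> B A D \<cdot> (\<sigma> A B \<odot> \<one> D)"

locale category_functor = C: category C + D: category D
  for C :: "('o, 'm, 'x) category_data_scheme"
    and D :: "('o2, 'm2, 'y) category_data_scheme"
    and Fo :: "'o \<Rightarrow> 'o2"
    and Fa :: "'m \<Rightarrow> 'm2" +
  assumes Fo_in_Obj: "A \<in> Obj C \<Longrightarrow> Fo A \<in> Obj D"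
    and Fa_in_hom: "f \<in> hom C A B \<Longrightarrow> Fa f \<in> hom D (Fo A) (Fo B)"
    and Fa_Id: "A \<in> Obj C \<Longrightarrow> Fa (\<one>\<^bsub>C\<^esub> A) = \<one>\<^bsub>D\<^esub> (Fo A)"
    and Fa_Comp:
      "f \<in> hom C A B \<Longrightarrow> g \<in> hom C B E \<Longrightarrow> Fa (g \<cdot>\<^bsub>C\<^esub> f) = Fa g \<cdot>\<^bsub>D\<^esub> Fa f"

locale full_functor = category_functor +
  assumes full: "A \<in> Obj C \<Longrightarrow> B \<in> Obj C \<Longrightarrow> hom D (Fo A) (Fo B) \<subseteq> Fa ` hom C A B"

locale faithful_functor = category_functor +
  assumes faithful: "A \<in> Obj C \<Longrightarrow> B \<in> Obj C \<Longrightarrow> inj_on Fa (hom C A B)"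

text \<open>The structure isomorphisms go from \<open>F (A \<otimes> B)\<close> to \<open>F A \<otimes> F B\<close> and from \<open>F I\<close> to \<open>I\<close>.\<close>

locale strongly_dagger_symmetric_monoidal_functor =
  category_functor C D Fo Fa +
  C: dagger_symmetric_monoidal_category C + D: dagger_symmetric_monoidal_category D
  for C :: "('o, 'm, 'x) dsm_category_data_scheme"
    and D :: "('o2, 'm2, 'y) dsm_category_data_scheme"
    and Fo :: "'o \<Rightarrow> 'o2"
    and Fa :: "'m \<Rightarrow> 'm2"
    and \<phi> :: "'o \<Rightarrow> 'o \<Rightarrow> 'm2"
    and \<phi>\<^sub>0 :: "'m2" +
  assumes Fa_Dagger: "f \<in> hom C A B \<Longrightarrow> Fa (f\<^sup>\<dagger>\<^bsub>C\<^esub>) = (Fa f)\<^sup>\<dagger>\<^bsub>D\<^esub>"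
    and phi_unitary:
      "A \<in> Obj C \<Longrightarrow> B \<in> Obj C \<Longrightarrow>
       D.unitary (Fo (A \<otimes>\<^bsub>C\<^esub> B)) (Fo A \<otimes>\<^bsub>D\<^esub> Fo B) (\<phi> A B)"
    and phi0_unitary: "D.unitary (Fo \<I>\<^bsub>C\<^esub>) \<I>\<^bsub>D\<^esub> \<phi>\<^sub>0"
    and phi_natural:
      "f \<in> hom C A A' \<Longrightarrow> g \<in> hom C B B' \<Longrightarrow>
       \<phi> A' B' \<cdot>\<^bsub>D\<^esub> Fa (f \<odot>\<^bsub>C\<^esub> g) = (Fa f \<odot>\<^bsub>D\<^esub> Fa g) \<cdot>\<^bsub>D\<^esub> \<phi> A B"
    and phi_Assoc:
      "A \<in> Obj C \<Longrightarrow> B \<in> Obj C \<Longrightarrow> E \<in> Obj C \<Longrightarrow>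
       \<a>\<^bsub>D\<^esub> (Fo A) (Fo B) (Fo E) \<cdot>\<^bsub>D\<^esub> (\<phi> A B \<odot>\<^bsub>D\<^esub> \<one>\<^bsub>D\<^esub> (Fo E)) \<cdot>\<^bsub>D\<^esub> \<phi> (A \<otimes>\<^bsub>C\<^esub> B) E =
       (\<one>\<^bsub>D\<^esub> (Fo A) \<odot>\<^bsub>D\<^esub> \<phi> B E) \<cdot>\<^bsub>D\<^esub> \<phi> A (B \<otimes>\<^bsub>C\<^esub> E) \<cdot>\<^bsub>D\<^esub> Fa (\<a>\<^bsub>C\<^esub> A B E)"
    and phi_Lunit:
      "A \<in> Obj C \<Longrightarrow>
       \<l>\<^bsub>D\<^esub> (Fo A) \<cdot>\<^bsub>D\<^esub> (\<phi>\<^sub>0 \<odot>\<^bsub>D\<^esub> \<one>\<^bsub>D\<^esub> (Fo A)) \<cdot>\<^bsub>D\<^esub> \<phi> \<I>\<^bsub>C\<^esub> A = Fa (\<l>\<^bsub>C\<^esub> A)"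
    and phi_Runit:
      "A \<in> Obj C \<Longrightarrow>
       \<r>\<^bsub>D\<^esub> (Fo A) \<cdot>\<^bsub>D\<^esub> (\<one>\<^bsub>D\<^esub> (Fo A) \<odot>\<^bsub>D\<^esub> \<phi>\<^sub>0) \<cdot>\<^bsub>D\<^esub> \<phi> A \<I>\<^bsub>C\<^esub> = Fa (\<r>\<^bsub>C\<^esub> A)"
    and phi_Sym:
      "A \<in> Obj C \<Longrightarrow> B \<in> Obj C \<Longrightarrow>
       \<phi> B A \<cdot>\<^bsub>D\<^esub> Fa (\<sigma>\<^bsub>C\<^esub> A B) = \<sigma>\<^bsub>D\<^esub> (Fo A) (Fo B) \<cdot>\<^bsub>D\<^esub> \<phi> A B"


section \<open>Dagger Frobenius algebras\<close>

record ('o, 'm) algebra_data =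
  Car :: "'o"
  Mult :: "'m"
  Unt :: "'m"

context dagger_symmetric_monoidal_category
begin

definition monoid_structure :: "'o \<Rightarrow> 'm \<Rightarrow> 'm \<Rightarrow> bool" where
  "monoid_structure A m u \<longleftrightarrow>
     m \<in> hom C (A \<otimes> A) A \<and> u \<in> hom C \<I> A \<and>
     m \<cdot> (m \<odot> \<one> A) = m \<cdot> (\<one> A \<odot> m) \<cdot> \<a> A A A \<and>
     m \<cdot> (u \<odot> \<one> A) = \<l> A \<and>
     m \<cdot> (\<one> A \<odot> u) = \<r> A"

definition comonoid_structure :: "'o \<Rightarrow> 'm \<Rightarrow> 'm \<Rightarrow> bool" where
  "comonoid_structure A \<delta> e \<longleftrightarrow>
     \<delta> \<in> hom C A (A \<otimes> A) \<and> e \<in> hom C A \<I> \<and>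
     \<a> A A A \<cdot> (\<delta> \<odot> \<one> A) \<cdot> \<delta> = (\<one> A \<odot> \<delta>) \<cdot> \<delta> \<and>
     \<l> A \<cdot> (e \<odot> \<one> A) \<cdot> \<delta> = \<one> A \<and>
     \<r> A \<cdot> (\<one> A \<odot> e) \<cdot> \<delta> = \<one> A"

definition frobenius_algebra :: "'o \<Rightarrow> 'm \<Rightarrow> 'm \<Rightarrow> 'm \<Rightarrow> 'm \<Rightarrow> bool" where
  "frobenius_algebra A m u \<delta> e \<longleftrightarrow>
     A \<in> Obj C \<and> monoid_structure A m u \<and> comonoid_structure A \<delta> e \<and>
     (\<one> A \<odot> m) \<cdot> \<a> A A A \<cdot> (\<delta> \<odot> \<one> A) = \<delta> \<cdot> m \<and>
     (m \<odot> \<one> A) \<cdot> (\<a> A A A)\<^sup>\<dagger> \<cdot> (\<one> A \<odot> \<delta>) = \<delta> \<cdot> m"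

definition dagger_frobenius_algebra :: "('o, 'm) algebra_data \<Rightarrow> bool" where
  "dagger_frobenius_algebra M \<longleftrightarrow>
     frobenius_algebra (Car M) (Mult M) (Unt M) ((Mult M)\<^sup>\<dagger>) ((Unt M)\<^sup>\<dagger>)"

definition central :: "('o, 'm) algebra_data \<Rightarrow> 'm \<Rightarrow> bool" where
  "central M z \<longleftrightarrow>
     z \<in> hom C (Car M) (Car M) \<and>
     Mult M \<cdot> (z \<odot> \<one> (Car M)) = z \<cdot> Mult M \<and>
     Mult M \<cdot> (\<one> (Car M) \<odot> z) = z \<cdot> Mult M"

text \<open>The symmetry isomorphism exchanging the two inner factors.\<close>

definition mid_swap :: "'o \<Rightarrow> 'o \<Rightarrow> 'o \<Rightarrow> 'o \<Rightarrow> 'm" where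
  "mid_swap P Q R S =
     (\<a> P R (Q \<otimes> S))\<^sup>\<dagger> \<cdot> (\<one> P \<odot> \<a> R Q S) \<cdot> (\<one> P \<odot> (\<sigma> Q R \<odot> \<one> S))
       \<cdot> (\<one> P \<odot> (\<a> Q R S)\<^sup>\<dagger>) \<cdot> \<a> P Q (R \<otimes> S)"

definition tensor_algebra ::
  "('o, 'm) algebra_data \<Rightarrow> ('o, 'm) algebra_data \<Rightarrow> ('o, 'm) algebra_data" where
  "tensor_algebra M N =
     \<lparr> Car = Car M \<otimes> Car N,
       Mult = (Mult M \<odot> Mult N) \<cdot> mid_swap (Car M) (Car N) (Car M) (Car N),
       Unt = (Unt M \<odot> Unt N) \<cdot> (\<l> \<I>)\<^sup>\<dagger> \<rparr>"

definition unit_algebra :: "('o, 'm) algebra_data" where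
  "unit_algebra = \<lparr> Car = \<I>, Mult = \<l> \<I>, Unt = \<one> \<I> \<rparr>"

text \<open>Plugging \<open>e : Q \<otimes> R \<rightarrow> I\<close> into the inner factors, i.e. \<open>\<one> \<otimes> e \<otimes> \<one>\<close> as a
  morphism from \<open>(P \<otimes> Q) \<otimes> (R \<otimes> S)\<close> to \<open>P \<otimes> S\<close>.\<close>

definition mid_cap :: "'o \<Rightarrow> 'o \<Rightarrow> 'o \<Rightarrow> 'o \<Rightarrow> 'm \<Rightarrow> 'm" where
  "mid_cap P Q R S e =
     (\<one> P \<odot> \<l> S) \<cdot> (\<one> P \<odot> (e \<odot> \<one> S)) \<cdot> (\<one> P \<odot> (\<a> Q R S)\<^sup>\<dagger>) \<cdot> \<a> P Q (R \<otimes> S)"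

end


section \<open>Dagger compact categories\<close>

record ('o, 'm) dagger_compact_data = "('o, 'm) dsm_category_data" +
  Dual :: "'o \<Rightarrow> 'o" ("_\<^sup>\<star>\<index>" [1000] 1000)
  Eta :: "'o \<Rightarrow> 'm" ("\<eta>\<index>")
  Eps :: "'o \<Rightarrow> 'm" ("\<epsilon>\<index>")

locale dagger_compact_category = dagger_symmetric_monoidal_category V
  for V :: "('o, 'm) dagger_compact_data" (structure) +
  assumes Dual_in_Obj: "A \<in> Obj V \<Longrightarrow> A\<^sup>\<star> \<in> Obj V"
    and Eta_in_hom: "A \<in> Obj V \<Longrightarrow> \<eta> A \<in> hom V \<I> (A\<^sup>\<star> \<otimes> A)"
    and Eps_in_hom: "A \<in> Obj V \<Longrightarrow> \<epsilon> A \<in> hom V (A \<otimes> A\<^sup>\<star>) \<I>"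
    and snake:
      "A \<in> Obj V \<Longrightarrow>
       \<l> A \<cdot> (\<epsilon> A \<odot> \<one> A) \<cdot> (\<a> A (A\<^sup>\<star>) A)\<^sup>\<dagger> \<cdot> (\<one> A \<odot> \<eta> A) \<cdot> (\<r> A)\<^sup>\<dagger> = \<one> A"
    and snake_Dual:
      "A \<in> Obj V \<Longrightarrow>
       \<r> (A\<^sup>\<star>) \<cdot> (\<one> (A\<^sup>\<star>) \<odot> \<epsilon> A) \<cdot> \<a> (A\<^sup>\<star>) A (A\<^sup>\<star>) \<cdot> (\<eta> A \<odot> \<one> (A\<^sup>\<star>)) \<cdot> (\<l> (A\<^sup>\<star>))\<^sup>\<dagger>
         = \<one> (A\<^sup>\<star>)"
    and Eps_eq: "A \<in> Obj V \<Longrightarrow> \<epsilon> A = (\<eta> A)\<^sup>\<dagger> \<cdot> \<sigma> A (A\<^sup>\<star>)"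
begin

definition dual_arr :: "'m \<Rightarrow> 'm" where
  "dual_arr f = (let A = Dom V f; B = Cod V f in
     \<r> (A\<^sup>\<star>) \<cdot> (\<one> (A\<^sup>\<star>) \<odot> \<epsilon> B) \<cdot> \<a> (A\<^sup>\<star>) B (B\<^sup>\<star>)
       \<cdot> ((\<one> (A\<^sup>\<star>) \<odot> f) \<odot> \<one> (B\<^sup>\<star>)) \<cdot> (\<eta> A \<odot> \<one> (B\<^sup>\<star>)) \<cdot> (\<l> (B\<^sup>\<star>))\<^sup>\<dagger>)"

definition conj_arr :: "'m \<Rightarrow> 'm" where
  "conj_arr f = dual_arr (f\<^sup>\<dagger>)"

text \<open>
  The identification of \<open>(A \<otimes> B)\<^sup>\<star>\<close> with \<open>B\<^sup>\<star> \<otimes> A\<^sup>\<star>\<close> is the canonical isomorphism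
  relating the chosen unit \<open>\<eta> (A \<otimes> B)\<close> to the composite unit
  \<open>(\<one> \<otimes> \<eta> A \<otimes> \<one>) \<cdot> \<eta> B : I \<rightarrow> (B\<^sup>\<star> \<otimes> A\<^sup>\<star>) \<otimes> (A \<otimes> B)\<close>.
\<close>

definition tensor_eta :: "'o \<Rightarrow> 'o \<Rightarrow> 'm" where
  "tensor_eta A B = (mid_cap (B\<^sup>\<star>) (A\<^sup>\<star>) A B ((\<eta> A)\<^sup>\<dagger>))\<^sup>\<dagger> \<cdot> \<eta> B"

definition dual_tensor :: "'o \<Rightarrow> 'o \<Rightarrow> 'm" where
  "dual_tensor A B =
     \<r> (B\<^sup>\<star> \<otimes> A\<^sup>\<star>) \<cdot> (\<one> (B\<^sup>\<star> \<otimes> A\<^sup>\<star>) \<odot> \<epsilon> (A \<otimes> B))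
       \<cdot> \<a> (B\<^sup>\<star> \<otimes> A\<^sup>\<star>) (A \<otimes> B) ((A \<otimes> B)\<^sup>\<star>)
       \<cdot> (tensor_eta A B \<odot> \<one> ((A \<otimes> B)\<^sup>\<star>)) \<cdot> (\<l> ((A \<otimes> B)\<^sup>\<star>))\<^sup>\<dagger>"

definition dimension :: "'o \<Rightarrow> 'm" where
  "dimension X = (\<eta> X)\<^sup>\<dagger> \<cdot> \<eta> X"

definition trace_mult :: "('o, 'm) algebra_data \<Rightarrow> 'm" where
  "trace_mult M = (let A = Car M in
     \<epsilon> A \<cdot> (Mult M \<odot> \<one> (A\<^sup>\<star>)) \<cdot> (\<a> A A (A\<^sup>\<star>))\<^sup>\<dagger> \<cdot> (\<one> A \<odot> (\<sigma> (A\<^sup>\<star>) A \<cdot> \<eta> A)) \<cdot> (\<r> A)\<^sup>\<dagger>)"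

definition normaliser :: "('o, 'm) algebra_data \<Rightarrow> 'm \<Rightarrow> bool" where
  "normaliser M z \<longleftrightarrow>
     central M z \<and> positive_definite (Car M) z \<and> trace_mult M \<cdot> z \<cdot> z = (Unt M)\<^sup>\<dagger>"

definition normalisable :: "('o, 'm) algebra_data \<Rightarrow> bool" where
  "normalisable M \<longleftrightarrow> (\<exists>z. normaliser M z)"

definition action :: "('o, 'm) algebra_data \<Rightarrow> 'm" where
  "action M = (let A = Car M in
     (\<one> (A\<^sup>\<star>) \<odot> Mult M) \<cdot> \<a> (A\<^sup>\<star>) A A \<cdot> (\<eta> A \<odot> \<one> A) \<cdot> (\<l> A)\<^sup>\<dagger>)"

definition coaction :: "('o, 'm) algebra_data \<Rightarrow> 'm" where
  "coaction M = (let A = Car M in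
     \<l> A \<cdot> ((\<eta> A)\<^sup>\<dagger> \<odot> \<one> A) \<cdot> (\<a> (A\<^sup>\<star>) A A)\<^sup>\<dagger> \<cdot> (\<one> (A\<^sup>\<star>) \<odot> (Mult M)\<^sup>\<dagger>))"

definition pants_algebra :: "'o \<Rightarrow> ('o, 'm) algebra_data" where
  "pants_algebra A =
     \<lparr> Car = A\<^sup>\<star> \<otimes> A, Mult = mid_cap (A\<^sup>\<star>) A (A\<^sup>\<star>) A (\<epsilon> A), Unt = \<eta> A \<rparr>"

definition completely_positive :: "'o \<Rightarrow> 'o \<Rightarrow> 'm \<Rightarrow> bool" where
  "completely_positive A B f \<longleftrightarrow>
     f \<in> hom V (A\<^sup>\<star> \<otimes> A) (B\<^sup>\<star> \<otimes> B) \<and>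
     (\<exists>X \<in> Obj V. \<exists>g \<in> hom V A (X \<otimes> B).
        f = mid_cap (B\<^sup>\<star>) (X\<^sup>\<star>) X B ((\<eta> X)\<^sup>\<dagger>) \<cdot> ((dual_tensor X B \<cdot> conj_arr g) \<odot> g))"

end


section \<open>The categories CPM[V] and CP*[V], and the functor between them\<close>

text \<open>Arrows carry their source and target, since a morphism of \<open>V\<close> does not determine them.\<close>

datatype ('o, 'm) arrow = Arrow (src: 'o) (mor: 'm) (tgt: 'o)

context dagger_compact_category
begin

text \<open>
  The symmetry isomorphism \<open>C\<^sup>\<star> \<otimes> A\<^sup>\<star> \<otimes> A \<otimes> C \<cong> A\<^sup>\<star> \<otimes> A \<otimes> C\<^sup>\<star> \<otimes> C\<close>,
  with the left-hand side identified with \<open>(A \<otimes> C)\<^sup>\<star> \<otimes> (A \<otimes> C)\<close>.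
\<close>

definition double_tensor :: "'o \<Rightarrow> 'o \<Rightarrow> 'm" where
  "double_tensor A C =
     \<a> (A\<^sup>\<star> \<otimes> A) (C\<^sup>\<star>) C \<cdot> (\<sigma> (C\<^sup>\<star>) (A\<^sup>\<star> \<otimes> A) \<odot> \<one> C) \<cdot> (\<a> (C\<^sup>\<star>) (A\<^sup>\<star> \<otimes> A) C)\<^sup>\<dagger>
       \<cdot> (\<one> (C\<^sup>\<star>) \<odot> (\<a> (A\<^sup>\<star>) A C)\<^sup>\<dagger>) \<cdot> \<a> (C\<^sup>\<star>) (A\<^sup>\<star>) (A \<otimes> C)
       \<cdot> (dual_tensor A C \<odot> \<one> (A \<otimes> C))"

text \<open>The canonical functor \<open>f \<mapsto> f\<^sub>* \<otimes> f\<close> from \<open>V\<close> to CPM[V], through which CPM[V] obtains its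
  coherence isomorphisms.\<close>

definition pure_arrow :: "'m \<Rightarrow> ('o, 'm) arrow" where
  "pure_arrow f = Arrow (Dom V f) (conj_arr f \<odot> f) (Cod V f)"

definition CPM :: "('o, ('o, 'm) arrow) dsm_category_data" where
  "CPM =
     \<lparr> Obj = Obj V,
       Arr = {Arrow A f B | A f B. A \<in> Obj V \<and> B \<in> Obj V \<and> completely_positive A B f},
       Dom = src,
       Cod = tgt,
       Id = (\<lambda>A. Arrow A (\<one> (A\<^sup>\<star> \<otimes> A)) A),
       Comp = (\<lambda>g f. Arrow (src f) (mor g \<cdot> mor f) (tgt g)),
       Dagger = (\<lambda>f. Arrow (tgt f) ((mor f)\<^sup>\<dagger>) (src f)),
       TensorO = (\<lambda>A B. A \<otimes> B),
       TensorA = (\<lambda>f g. Arrow (src f \<otimes> src g)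
         ((double_tensor (tgt f) (tgt g))\<^sup>\<dagger> \<cdot> (mor f \<odot> mor g) \<cdot> double_tensor (src f) (src g))
         (tgt f \<otimes> tgt g)),
       TUnit = \<I>,
       Assoc = (\<lambda>A B D. pure_arrow (\<a> A B D)),
       Lunit = (\<lambda>A. pure_arrow (\<l> A)),
       Runit = (\<lambda>A. pure_arrow (\<r> A)),
       Sym = (\<lambda>A B. pure_arrow (\<sigma> A B)) \<rparr>"

definition CPstar ::
  "(('o, 'm) algebra_data, (('o, 'm) algebra_data, 'm) arrow) dsm_category_data" where
  "CPstar =
     (let Ob = {M. dagger_frobenius_algebra M \<and> normalisable M} in
     \<lparr> Obj = Ob,
       Arr = {Arrow M f N | M f N. M \<in> Ob \<and> N \<in> Ob \<and> f \<in> hom V (Car M) (Car N) \<and>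
                completely_positive (Car M) (Car N) (action N \<cdot> f \<cdot> coaction M)},
       Dom = src,
       Cod = tgt,
       Id = (\<lambda>M. Arrow M (\<one> (Car M)) M),
       Comp = (\<lambda>g f. Arrow (src f) (mor g \<cdot> mor f) (tgt g)),
       Dagger = (\<lambda>f. Arrow (tgt f) ((mor f)\<^sup>\<dagger>) (src f)),
       TensorO = tensor_algebra,
       TensorA = (\<lambda>f g. Arrow (tensor_algebra (src f) (src g)) (mor f \<odot> mor g)
         (tensor_algebra (tgt f) (tgt g))),
       TUnit = unit_algebra,
       Assoc = (\<lambda>M N K. Arrow (tensor_algebra (tensor_algebra M N) K)
         (\<a> (Car M) (Car N) (Car K)) (tensor_algebra M (tensor_algebra N K))),
       Lunit = (\<lambda>M. Arrow (tensor_algebra unit_algebra M) (\<l> (Car M)) M),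
       Runit = (\<lambda>M. Arrow (tensor_algebra M unit_algebra) (\<r> (Car M)) M),
       Sym = (\<lambda>M N. Arrow (tensor_algebra M N) (\<sigma> (Car M) (Car N)) (tensor_algebra N M)) \<rparr>)"

definition L_obj :: "'o \<Rightarrow> ('o, 'm) algebra_data" where
  "L_obj A = pants_algebra A"

definition L_arr :: "('o, 'm) arrow \<Rightarrow> (('o, 'm) algebra_data, 'm) arrow" where
  "L_arr f = Arrow (L_obj (src f)) (mor f) (L_obj (tgt f))"

end

text \<open>The scalar multiple of \<open>\<one> X\<close> is taken along the left unitor.\<close>

locale positive_dimensional_dagger_compact_category = dagger_compact_category +
  assumes positive_dimensional:
    "X \<in> Obj V \<Longrightarrow>
     \<exists>z. positive_definite \<I> z \<and> \<l> X \<cdot> ((z \<cdot> z \<cdot> dimension X) \<odot> \<one> X) \<cdot> (\<l> X)\<^sup>\<dagger> = \<one> X"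

end

theory Submission
  imports Defs
begin

text \<open>
  All diagrams are computed with \<^emph>\<open>elements\<close>: an element of \<open>A\<close> is a morphism into \<open>A\<close> out of the
  tensor product of a list of named variables, and two elements are paired by first sorting their
  variables into one list. As the names absorb all permutations of wires, associators, unitors and
  symmetries act on pairs of elements in the naive way, and an identity between composites of structure
  maps is checked by evaluating both sides at a tuple of distinct variables.

  With \<open>D A = A\<^sup>\<star> \<otimes> A\<close> the operation \<open>f \<mapsto> f\<^sub>* \<otimes> f\<close> is a strong monoidal dagger functor, and \<open>f\<close> is completely
  positive iff it is \<open>(tr\<^sub>X \<otimes> \<one>) \<cdot> (g\<^sub>* \<otimes> g)\<close> for some \<open>g\<close>. This makes CPM[V] a dagger symmetric monoidal category.
  For an algebra, the action \<open>a\<close> and the coaction \<open>a\<^sup>\<dagger>\<close> satisfy \<open>a\<^sup>\<dagger> \<cdot> (z\<^sub>* \<otimes> z) \<cdot> a = \<one>\<close> for a normaliser \<open>z\<close>, which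
  gives closure of CP*[V] under composition, while \<open>a \<cdot> a\<^sup>\<dagger>\<close> is completely positive because a normalisable
  algebra is symmetric, its form being a normalised trace. For the pants algebra on \<open>D A\<close> the action is the
  adjoint of a partial trace. Hence \<open>f\<close> is a morphism of CP*[V] between pants algebras iff it is completely positive,
  so that \<open>L\<close> is full and faithful, and the monoidal structure of \<open>D\<close> is that of \<open>L\<close>.
\<close>


section \<open>Coherence\<close>

text \<open>The difficulty lies in bookkeeping that cannot be suppressed: associators are explicit,
  and \<open>(A \<otimes> B)\<^sup>\<star>\<close> is only isomorphic to
  \<open>B\<^sup>\<star> \<otimes> A\<^sup>\<star>\<close>. Named variables dispose of the
  associators; their soundness rests on one coherence theorem, that splitting a list of variables
  into three parts does not depend on the bracketing. The comparison of duals is hardly ever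
  computed: an element of \<open>D A\<close> is an operator on \<open>A\<close>, this action is
  faithful, and \<open>double_tensor\<close> is pinned down by its compatibility with it, so its
  laws become plain laws for operators on tensor products. The dagger of CPM[V] needs an idea of its
  own: the adjoint of the partial trace over \<open>X\<close> tensors an operator with the identity
  of \<open>X\<close>, and this is again a partial trace, over the dual of \<open>X\<close>.
  Positive dimensionality has a single task. Multiplication in the pants algebra on
  \<open>D A\<close> has as its trace the dimension of \<open>A\<^sup>\<star>\<close> times
  \<open>tr A\<close>, while the counit is \<open>tr A\<close>; a scalar that cancels this dimension
  on \<open>A\<^sup>\<star>\<close> provides the normaliser.\<close>

context category
begin

lemma homD [dest]: "f \<in> hom C A B \<Longrightarrow> f \<in> Arr C" "f \<in> hom C A B \<Longrightarrow> Dom C f = A" "f \<in> hom C A B \<Longrightarrow> Cod C f = B"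
  by (simp_all add: hom_def)

lemma in_own_hom: "f \<in> Arr C \<Longrightarrow> f \<in> hom C (Dom C f) (Cod C f)"
  by (simp add: hom_def)

lemma Dom_Obj [simp]: "f \<in> Arr C \<Longrightarrow> Dom C f \<in> Obj C"
  and Cod_Obj [simp]: "f \<in> Arr C \<Longrightarrow> Cod C f \<in> Obj C"
  by (simp_all add: Dom_in_Obj Cod_in_Obj)

lemma hom_Obj: "f \<in> hom C A B \<Longrightarrow> A \<in> Obj C \<and> B \<in> Obj C"
  by (auto simp: hom_def)

lemma Id_typing [simp]:
  assumes "A \<in> Obj C"
  shows "\<one> A \<in> Arr C" "Dom C (\<one> A) = A" "Cod C (\<one> A) = A"
  using Id_in_hom[OF assms] by auto

lemma Comp_typing [simp]:
  assumes "f \<in> Arr C" "g \<in> Arr C" "Dom C g = Cod C f"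
  shows "g \<cdot> f \<in> Arr C" "Dom C (g \<cdot> f) = Dom C f" "Cod C (g \<cdot> f) = Cod C g"
  using Comp_in_hom[of f "Dom C f" "Cod C f" g "Cod C g"] assms by (auto simp: hom_def)

lemma Id_Comp [simp]: "f \<in> Arr C \<Longrightarrow> Cod C f = B \<Longrightarrow> \<one> B \<cdot> f = f"
  and Comp_Id [simp]: "f \<in> Arr C \<Longrightarrow> Dom C f = A \<Longrightarrow> f \<cdot> \<one> A = f"
  using Comp_Id_left Comp_Id_right in_own_hom by blast+

lemma comp_assoc:
  "\<lbrakk>f \<in> Arr C; g \<in> Arr C; h \<in> Arr C; Dom C g = Cod C f; Dom C h = Cod C g\<rbrakk> \<Longrightarrow> (h \<cdot> g) \<cdot> f = h \<cdot> (g \<cdot> f)"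
  using Comp_assoc[of f "Dom C f" "Cod C f" g "Cod C g" h "Cod C h"] by (auto simp: hom_def)

lemma comp_reassoc:
  "\<lbrakk>p \<cdot> q = r; k \<in> Arr C; q \<in> Arr C; p \<in> Arr C; Dom C q = Cod C k; Dom C p = Cod C q\<rbrakk> \<Longrightarrow> p \<cdot> (q \<cdot> k) = r \<cdot> k"
  by (metis comp_assoc)

end

context dagger_symmetric_monoidal_category
begin

lemma Dagger_typing [simp]:
  assumes "f \<in> Arr C"
  shows "f\<^sup>\<dagger> \<in> Arr C" "Dom C (f\<^sup>\<dagger>) = Cod C f" "Cod C (f\<^sup>\<dagger>) = Dom C f"
  using Dagger_in_hom[OF in_own_hom[OF assms]] by auto

lemma dagger_dagger [simp]: "f \<in> Arr C \<Longrightarrow> (f\<^sup>\<dagger>)\<^sup>\<dagger> = f"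
  using Dagger_Dagger in_own_hom by blast

lemma dagger_Id [simp]: "A \<in> Obj C \<Longrightarrow> (\<one> A)\<^sup>\<dagger> = \<one> A"
  by (rule Dagger_Id)

lemma dagger_Comp:
  "\<lbrakk>f \<in> Arr C; g \<in> Arr C; Dom C g = Cod C f\<rbrakk> \<Longrightarrow> (g \<cdot> f)\<^sup>\<dagger> = f\<^sup>\<dagger> \<cdot> g\<^sup>\<dagger>"
  using Dagger_Comp[of f "Dom C f" "Cod C f" g "Cod C g"] by (auto simp: hom_def)

lemma TensorO_Obj [simp]: "A \<in> Obj C \<Longrightarrow> B \<in> Obj C \<Longrightarrow> A \<otimes> B \<in> Obj C"
  by (rule TensorO_in_Obj)

lemma TUnit_Obj [simp]: "\<I> \<in> Obj C"
  by (rule TUnit_in_Obj)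

lemma TensorA_typing [simp]:
  assumes "f \<in> Arr C" "g \<in> Arr C"
  shows "f \<odot> g \<in> Arr C" "Dom C (f \<odot> g) = Dom C f \<otimes> Dom C g" "Cod C (f \<odot> g) = Cod C f \<otimes> Cod C g"
  using TensorA_in_hom[OF in_own_hom in_own_hom] assms by auto

lemma tensor_Id [simp]: "A \<in> Obj C \<Longrightarrow> B \<in> Obj C \<Longrightarrow> \<one> A \<odot> \<one> B = \<one> (A \<otimes> B)"
  by (rule TensorA_Id)

lemma interchange:
  "\<lbrakk>f \<in> Arr C; g \<in> Arr C; f' \<in> Arr C; g' \<in> Arr C; Dom C g = Cod C f; Dom C g' = Cod C f'\<rbrakk> \<Longrightarrow>
   (g \<odot> g') \<cdot> (f \<odot> f') = (g \<cdot> f) \<odot> (g' \<cdot> f')"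
  using TensorA_Comp[of f "Dom C f" "Cod C f" g "Cod C g" f' "Dom C f'" "Cod C f'" g' "Cod C g'"]
  by (auto simp: hom_def)

lemma dagger_TensorA [simp]: "f \<in> Arr C \<Longrightarrow> g \<in> Arr C \<Longrightarrow> (f \<odot> g)\<^sup>\<dagger> = f\<^sup>\<dagger> \<odot> g\<^sup>\<dagger>"
  using Dagger_TensorA in_own_hom by blast

lemma unitaryD:
  assumes "unitary A B f"
  shows "f \<in> Arr C" "Dom C f = A" "Cod C f = B" "f\<^sup>\<dagger> \<cdot> f = \<one> A" "f \<cdot> f\<^sup>\<dagger> = \<one> B"
  using assms by (auto simp: unitary_def)

lemma unitaryI:
  "\<lbrakk>f \<in> Arr C; Dom C f = A; Cod C f = B; f\<^sup>\<dagger> \<cdot> f = \<one> A; f \<cdot> f\<^sup>\<dagger> = \<one> B\<rbrakk> \<Longrightarrow> unitary A B f"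
  by (simp add: unitary_def hom_def)

lemma unitary_dagger: "unitary A B f \<Longrightarrow> unitary B A (f\<^sup>\<dagger>)"
  by (simp add: unitary_def hom_def)

lemma unitary_Id: "A \<in> Obj C \<Longrightarrow> unitary A A (\<one> A)"
  by (rule unitaryI) simp_all

lemma unitary_Comp:
  assumes "unitary A B f" "unitary B D g"
  shows "unitary A D (g \<cdot> f)"
proof (rule unitaryI)
  note f = unitaryD[OF assms(1)] and g = unitaryD[OF assms(2)]
  show "(g \<cdot> f)\<^sup>\<dagger> \<cdot> (g \<cdot> f) = \<one> A"
    using f g comp_reassoc[OF g(4), of f] by (simp add: dagger_Comp comp_assoc)
  show "(g \<cdot> f) \<cdot> (g \<cdot> f)\<^sup>\<dagger> = \<one> D"
    using f g comp_reassoc[OF f(5), of "g\<^sup>\<dagger>"] by (simp add: dagger_Comp comp_assoc)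
qed (use unitaryD[OF assms(1)] unitaryD[OF assms(2)] in simp_all)

lemma unitary_TensorA:
  assumes "unitary A B f" "unitary A' B' g"
  shows "unitary (A \<otimes> A') (B \<otimes> B') (f \<odot> g)"
proof -
  note f = unitaryD[OF assms(1)] and g = unitaryD[OF assms(2)]
  then have "A \<in> Obj C" "B \<in> Obj C" "A' \<in> Obj C" "B' \<in> Obj C" by auto
  with f g show ?thesis by (intro unitaryI) (simp_all add: interchange)
qed

lemma unitary_cancel_right:
  assumes "unitary A B w" "f \<in> Arr C" "g \<in> Arr C" "Dom C f = B" "Dom C g = B" "f \<cdot> w = g \<cdot> w"
  shows "f = g"
proof -
  note w = unitaryD[OF assms(1)]
  have "f = (f \<cdot> w) \<cdot> w\<^sup>\<dagger>" using w assms(2,4) by (simp add: comp_assoc)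
  also have "\<dots> = g" unfolding assms(6) using w assms(3,5) by (simp add: comp_assoc)
  finally show ?thesis .
qed

lemma unitary_cancel_left:
  assumes "unitary A B w" "f \<in> Arr C" "g \<in> Arr C" "Cod C f = A" "Cod C g = A" "w \<cdot> f = w \<cdot> g"
  shows "f = g"
proof -
  note w = unitaryD[OF assms(1)]
  have "f = w\<^sup>\<dagger> \<cdot> (w \<cdot> f)" using w assms(2,4) by (simp flip: comp_assoc)
  also have "\<dots> = g" unfolding assms(6) using w assms(3,5) by (simp flip: comp_assoc)
  finally show ?thesis .
qed

lemma Assoc_typing [simp]:
  assumes "A \<in> Obj C" "B \<in> Obj C" "D \<in> Obj C"
  shows "\<a> A B D \<in> Arr C" "Dom C (\<a> A B D) = (A \<otimes> B) \<otimes> D" "Cod C (\<a> A B D) = A \<otimes> (B \<otimes> D)"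
    "(\<a> A B D)\<^sup>\<dagger> \<cdot> \<a> A B D = \<one> ((A \<otimes> B) \<otimes> D)" "\<a> A B D \<cdot> (\<a> A B D)\<^sup>\<dagger> = \<one> (A \<otimes> (B \<otimes> D))"
  using unitaryD[OF Assoc_unitary[OF assms]] by simp_all

lemma Lunit_typing [simp]:
  assumes "A \<in> Obj C"
  shows "\<l> A \<in> Arr C" "Dom C (\<l> A) = \<I> \<otimes> A" "Cod C (\<l> A) = A"
    "(\<l> A)\<^sup>\<dagger> \<cdot> \<l> A = \<one> (\<I> \<otimes> A)" "\<l> A \<cdot> (\<l> A)\<^sup>\<dagger> = \<one> A"
  using unitaryD[OF Lunit_unitary[OF assms]] by simp_all

lemma Runit_typing [simp]:
  assumes "A \<in> Obj C"
  shows "\<r> A \<in> Arr C" "Dom C (\<r> A) = A \<otimes> \<I>" "Cod C (\<r> A) = A"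
    "(\<r> A)\<^sup>\<dagger> \<cdot> \<r> A = \<one> (A \<otimes> \<I>)" "\<r> A \<cdot> (\<r> A)\<^sup>\<dagger> = \<one> A"
  using unitaryD[OF Runit_unitary[OF assms]] by simp_all

lemma Sym_typing [simp]:
  assumes "A \<in> Obj C" "B \<in> Obj C"
  shows "\<sigma> A B \<in> Arr C" "Dom C (\<sigma> A B) = A \<otimes> B" "Cod C (\<sigma> A B) = B \<otimes> A"
    "(\<sigma> A B)\<^sup>\<dagger> \<cdot> \<sigma> A B = \<one> (A \<otimes> B)" "\<sigma> A B \<cdot> (\<sigma> A B)\<^sup>\<dagger> = \<one> (B \<otimes> A)"
  using unitaryD[OF Sym_unitary[OF assms]] by simp_all

lemma dagger_Sym [simp]:
  assumes "A \<in> Obj C" "B \<in> Obj C"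
  shows "(\<sigma> A B)\<^sup>\<dagger> = \<sigma> B A"
proof -
  have "(\<sigma> A B)\<^sup>\<dagger> = (\<sigma> B A \<cdot> \<sigma> A B) \<cdot> (\<sigma> A B)\<^sup>\<dagger>" using assms by (simp add: Sym_Sym)
  also have "\<dots> = \<sigma> B A" using assms by (simp add: comp_assoc)
  finally show ?thesis .
qed

lemma coherence_cancel [simp]:
  assumes "f \<in> Arr C" "A \<in> Obj C"
  shows "B \<in> Obj C \<Longrightarrow> D \<in> Obj C \<Longrightarrow> Cod C f = (A \<otimes> B) \<otimes> D \<Longrightarrow> (\<a> A B D)\<^sup>\<dagger> \<cdot> (\<a> A B D \<cdot> f) = f"
    and "B \<in> Obj C \<Longrightarrow> D \<in> Obj C \<Longrightarrow> Cod C f = A \<otimes> (B \<otimes> D) \<Longrightarrow> \<a> A B D \<cdot> ((\<a> A B D)\<^sup>\<dagger> \<cdot> f) = f"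
    and "Cod C f = \<I> \<otimes> A \<Longrightarrow> (\<l> A)\<^sup>\<dagger> \<cdot> (\<l> A \<cdot> f) = f"
    and "Cod C f = A \<Longrightarrow> \<l> A \<cdot> ((\<l> A)\<^sup>\<dagger> \<cdot> f) = f"
    and "Cod C f = A \<otimes> \<I> \<Longrightarrow> (\<r> A)\<^sup>\<dagger> \<cdot> (\<r> A \<cdot> f) = f"
    and "Cod C f = A \<Longrightarrow> \<r> A \<cdot> ((\<r> A)\<^sup>\<dagger> \<cdot> f) = f"
  using assms by (simp_all flip: comp_assoc)

lemma assoc_nat:
  assumes "f \<in> Arr C" "g \<in> Arr C" "h \<in> Arr C" "Cod C f = A'" "Cod C g = B'" "Cod C h = D'"
  shows "\<a> A' B' D' \<cdot> ((f \<odot> g) \<odot> h) = (f \<odot> (g \<odot> h)) \<cdot> \<a> (Dom C f) (Dom C g) (Dom C h)"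
  using Assoc_natural[OF in_own_hom in_own_hom in_own_hom] assms by auto

lemma assoc_dagger_nat:
  assumes "f \<in> Arr C" "g \<in> Arr C" "h \<in> Arr C" "Cod C f = A'" "Cod C g = B'" "Cod C h = D'"
  shows "(\<a> A' B' D')\<^sup>\<dagger> \<cdot> (f \<odot> (g \<odot> h)) = ((f \<odot> g) \<odot> h) \<cdot> (\<a> (Dom C f) (Dom C g) (Dom C h))\<^sup>\<dagger>"
proof -
  have o: "A' \<in> Obj C" "B' \<in> Obj C" "D' \<in> Obj C" using assms by auto
  let ?a = "\<a> (Dom C f) (Dom C g) (Dom C h)"
  have "(\<a> A' B' D')\<^sup>\<dagger> \<cdot> (f \<odot> (g \<odot> h)) = (\<a> A' B' D')\<^sup>\<dagger> \<cdot> ((f \<odot> (g \<odot> h)) \<cdot> ?a) \<cdot> ?a\<^sup>\<dagger>"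
    using assms o by (simp add: comp_assoc)
  also have "\<dots> = ((f \<odot> g) \<odot> h) \<cdot> ?a\<^sup>\<dagger>"
    using assms o by (simp add: comp_assoc flip: assoc_nat)
  finally show ?thesis .
qed

lemma lunit_nat: "f \<in> Arr C \<Longrightarrow> Cod C f = B \<Longrightarrow> \<l> B \<cdot> (\<one> \<I> \<odot> f) = f \<cdot> \<l> (Dom C f)"
  using Lunit_natural in_own_hom by blast

lemma runit_nat: "f \<in> Arr C \<Longrightarrow> Cod C f = B \<Longrightarrow> \<r> B \<cdot> (f \<odot> \<one> \<I>) = f \<cdot> \<r> (Dom C f)"
  using Runit_natural in_own_hom by blast

lemma lunit_dagger_nat:
  assumes "f \<in> Arr C" "Cod C f = B"
  shows "(\<l> B)\<^sup>\<dagger> \<cdot> f = (\<one> \<I> \<odot> f) \<cdot> (\<l> (Dom C f))\<^sup>\<dagger>"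
proof -
  have "(\<l> B)\<^sup>\<dagger> \<cdot> f = (\<l> B)\<^sup>\<dagger> \<cdot> (f \<cdot> \<l> (Dom C f)) \<cdot> (\<l> (Dom C f))\<^sup>\<dagger>"
    using assms by (auto simp: comp_assoc)
  also have "\<dots> = (\<one> \<I> \<odot> f) \<cdot> (\<l> (Dom C f))\<^sup>\<dagger>"
    using assms by (auto simp: comp_assoc simp flip: lunit_nat)
  finally show ?thesis .
qed

lemma runit_dagger_nat:
  assumes "f \<in> Arr C" "Cod C f = B"
  shows "(\<r> B)\<^sup>\<dagger> \<cdot> f = (f \<odot> \<one> \<I>) \<cdot> (\<r> (Dom C f))\<^sup>\<dagger>"
proof -
  have "(\<r> B)\<^sup>\<dagger> \<cdot> f = (\<r> B)\<^sup>\<dagger> \<cdot> (f \<cdot> \<r> (Dom C f)) \<cdot> (\<r> (Dom C f))\<^sup>\<dagger>"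
    using assms by (auto simp: comp_assoc)
  also have "\<dots> = (f \<odot> \<one> \<I>) \<cdot> (\<r> (Dom C f))\<^sup>\<dagger>"
    using assms by (auto simp: comp_assoc simp flip: runit_nat)
  finally show ?thesis .
qed

lemma sym_nat:
  "f \<in> Arr C \<Longrightarrow> g \<in> Arr C \<Longrightarrow> Cod C f = A' \<Longrightarrow> Cod C g = B' \<Longrightarrow>
   \<sigma> A' B' \<cdot> (f \<odot> g) = (g \<odot> f) \<cdot> \<sigma> (Dom C f) (Dom C g)"
  using Sym_natural in_own_hom by blast

section \<open>Kelly's derivation of the remaining unit laws from pentagon, triangle and
  hexagon\<close>

lemma tensor_unit_faithful:
  assumes "f \<in> Arr C" "g \<in> Arr C" "Dom C f = Dom C g" "Cod C f = Cod C g"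
  shows "\<one> \<I> \<odot> f = \<one> \<I> \<odot> g \<Longrightarrow> f = g" and "f \<odot> \<one> \<I> = g \<odot> \<one> \<I> \<Longrightarrow> f = g"
proof -
  assume "\<one> \<I> \<odot> f = \<one> \<I> \<odot> g"
  then have "f \<cdot> \<l> (Dom C f) = g \<cdot> \<l> (Dom C f)"
    using lunit_nat[of f "Cod C f"] lunit_nat[of g "Cod C f"] assms by simp
  then show "f = g" using unitary_cancel_right[OF Lunit_unitary] assms by (metis Dom_Obj)
next
  assume "f \<odot> \<one> \<I> = g \<odot> \<one> \<I>"
  then have "f \<cdot> \<r> (Dom C f) = g \<cdot> \<r> (Dom C f)"
    using runit_nat[of f "Cod C f"] runit_nat[of g "Cod C f"] assms by simp
  then show "f = g" using unitary_cancel_right[OF Runit_unitary] assms by (metis Dom_Obj)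
qed

text \<open>After tensoring with \<open>\<I>\<close> on the left and precomposing with the unitary
  \<open>?w\<close>, the pentagon for \<open>\<I>\<close>, \<open>\<I>\<close>, \<open>A\<close>,
  \<open>B\<close> and two triangles identify both sides. Tensoring with \<open>\<I>\<close> is
  faithful, because the unitors make it isomorphic to the identity functor.\<close>

lemma lunit_tensor:
  assumes o: "A \<in> Obj C" "B \<in> Obj C"
  shows "\<l> (A \<otimes> B) \<cdot> \<a> \<I> A B = \<l> A \<odot> \<one> B"
proof (rule tensor_unit_faithful(1))
  let ?I = \<I>
  have p: "\<a> ?I ?I (A \<otimes> B) \<cdot> \<a> (?I \<otimes> ?I) A B =
     (\<one> ?I \<odot> \<a> ?I A B) \<cdot> \<a> ?I (?I \<otimes> A) B \<cdot> (\<a> ?I ?I A \<odot> \<one> B)"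
    using o by (simp add: pentagon)
  let ?w = "\<a> ?I (?I \<otimes> A) B \<cdot> (\<a> ?I ?I A \<odot> \<one> B)"
  have w: "unitary (((?I \<otimes> ?I) \<otimes> A) \<otimes> B) (?I \<otimes> ((?I \<otimes> A) \<otimes> B)) ?w"
    using o by (intro unitary_Comp[OF unitary_TensorA[OF Assoc_unitary unitary_Id] Assoc_unitary]) simp_all
  have "(\<one> ?I \<odot> (\<l> (A \<otimes> B) \<cdot> \<a> ?I A B)) \<cdot> ?w
      = (\<one> ?I \<odot> \<l> (A \<otimes> B)) \<cdot> ((\<one> ?I \<odot> \<a> ?I A B) \<cdot> \<a> ?I (?I \<otimes> A) B \<cdot> (\<a> ?I ?I A \<odot> \<one> B))"
    using o by (simp add: interchange flip: comp_assoc)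
  also have "\<dots> = ((\<one> ?I \<odot> \<l> (A \<otimes> B)) \<cdot> \<a> ?I ?I (A \<otimes> B)) \<cdot> \<a> (?I \<otimes> ?I) A B"
    unfolding p[symmetric] using o by (simp add: comp_assoc)
  also have "\<dots> = (\<r> ?I \<odot> (\<one> A \<odot> \<one> B)) \<cdot> \<a> (?I \<otimes> ?I) A B"
    using o by (simp add: triangle)
  also have "\<dots> = \<a> ?I A B \<cdot> ((\<r> ?I \<odot> \<one> A) \<odot> \<one> B)"
    using o assoc_nat[of "\<r> ?I" "\<one> A" "\<one> B" ?I A B] by simp
  also have "\<dots> = \<a> ?I A B \<cdot> (((\<one> ?I \<odot> \<l> A) \<cdot> \<a> ?I ?I A) \<odot> \<one> B)"
    using o by (simp add: triangle)
  also have "\<dots> = (\<a> ?I A B \<cdot> ((\<one> ?I \<odot> \<l> A) \<odot> \<one> B)) \<cdot> (\<a> ?I ?I A \<odot> \<one> B)"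
    using o by (simp add: comp_assoc interchange)
  also have "\<dots> = (\<one> ?I \<odot> (\<l> A \<odot> \<one> B)) \<cdot> ?w"
    using o by (simp add: comp_assoc assoc_nat)
  finally show "\<one> ?I \<odot> (\<l> (A \<otimes> B) \<cdot> \<a> ?I A B) = \<one> ?I \<odot> (\<l> A \<odot> \<one> B)"
    by (rule unitary_cancel_right[OF w, rotated 4]) (use o in simp_all)
qed (use o in simp_all)

text \<open>The mirror image of the previous argument: the pentagon is that for \<open>A\<close>,
  \<open>B\<close>, \<open>\<I>\<close>, \<open>\<I>\<close>, the tensoring with \<open>\<I>\<close>
  happens on the right, and the unitary that is cancelled stands on the left.\<close>

lemma runit_tensor:
  assumes o: "A \<in> Obj C" "B \<in> Obj C"
  shows "(\<one> A \<odot> \<r> B) \<cdot> \<a> A B \<I> = \<r> (A \<otimes> B)"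
proof (rule tensor_unit_faithful(2))
  let ?I = \<I>
  have "((\<one> A \<odot> \<r> B) \<cdot> \<a> A B ?I) \<odot> \<one> ?I = \<r> (A \<otimes> B) \<odot> \<one> ?I"
  proof (rule unitary_cancel_left[where w = "\<a> A B ?I"])
    show "unitary ((A \<otimes> B) \<otimes> ?I) (A \<otimes> (B \<otimes> ?I)) (\<a> A B ?I)" using o by (simp add: Assoc_unitary)
    have "\<a> A B ?I \<cdot> (((\<one> A \<odot> \<r> B) \<cdot> \<a> A B ?I) \<odot> \<one> ?I)
        = (\<a> A B ?I \<cdot> ((\<one> A \<odot> \<r> B) \<odot> \<one> ?I)) \<cdot> (\<a> A B ?I \<odot> \<one> ?I)"
      using o by (simp add: comp_assoc interchange)
    also have "\<dots> = (\<one> A \<odot> ((\<one> B \<odot> \<l> ?I) \<cdot> \<a> B ?I ?I)) \<cdot> \<a> A (B \<otimes> ?I) ?I \<cdot> (\<a> A B ?I \<odot> \<one> ?I)"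
      using o by (simp add: assoc_nat comp_assoc triangle)
    also have "\<dots> = (\<one> A \<odot> (\<one> B \<odot> \<l> ?I)) \<cdot> ((\<one> A \<odot> \<a> B ?I ?I) \<cdot> \<a> A (B \<otimes> ?I) ?I \<cdot> (\<a> A B ?I \<odot> \<one> ?I))"
      using o by (simp add: interchange flip: comp_assoc)
    also have "\<dots> = ((\<one> A \<odot> (\<one> B \<odot> \<l> ?I)) \<cdot> \<a> A B (?I \<otimes> ?I)) \<cdot> \<a> (A \<otimes> B) ?I ?I"
      using o by (simp add: comp_assoc flip: pentagon)
    also have "\<dots> = \<a> A B ?I \<cdot> ((\<one> (A \<otimes> B) \<odot> \<l> ?I) \<cdot> \<a> (A \<otimes> B) ?I ?I)"
      using o assoc_nat[of "\<one> A" "\<one> B" "\<l> ?I" A B ?I] by (simp flip: comp_assoc)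
    also have "\<dots> = \<a> A B ?I \<cdot> (\<r> (A \<otimes> B) \<odot> \<one> ?I)"
      using o by (simp add: triangle)
    finally show "\<a> A B ?I \<cdot> (((\<one> A \<odot> \<r> B) \<cdot> \<a> A B ?I) \<odot> \<one> ?I) = \<a> A B ?I \<cdot> (\<r> (A \<otimes> B) \<odot> \<one> ?I)" .
  qed (use o in simp_all)
  then show "((\<one> A \<odot> \<r> B) \<cdot> \<a> A B ?I) \<odot> \<one> ?I = \<r> (A \<otimes> B) \<odot> \<one> ?I" .
qed (use o in simp_all)

text \<open>Naturality of \<open>\<l>\<close> at its own component \<open>\<l> \<I>\<close> gives
  \<open>\<one> \<I> \<odot> \<l> \<I> = \<l> (\<I> \<otimes> \<I>)\<close>; then
  \<open>lunit_tensor\<close> and the triangle compare the two unitors after tensoring with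
  \<open>\<I>\<close>.\<close>

lemma lunit_unit: "\<l> \<I> = \<r> \<I>"
proof (rule tensor_unit_faithful(2))
  have "\<l> \<I> \<cdot> (\<one> \<I> \<odot> \<l> \<I>) = \<l> \<I> \<cdot> \<l> (\<I> \<otimes> \<I>)" by (simp add: lunit_nat)
  then have l: "\<one> \<I> \<odot> \<l> \<I> = \<l> (\<I> \<otimes> \<I>)"
    by (rule unitary_cancel_left[OF Lunit_unitary, rotated 5]) simp_all
  have "\<l> \<I> \<odot> \<one> \<I> = (\<one> \<I> \<odot> \<l> \<I>) \<cdot> \<a> \<I> \<I> \<I>" unfolding l by (simp add: lunit_tensor)
  also have "\<dots> = \<r> \<I> \<odot> \<one> \<I>" by (simp add: triangle)
  finally show "\<l> \<I> \<odot> \<one> \<I> = \<r> \<I> \<odot> \<one> \<I>" .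
qed simp_all

text \<open>The hexagon with two of its objects equal to \<open>\<I>\<close> yields the equation
  tensored with \<open>\<I>\<close> and composed with the invertible
  \<open>\<sigma> A \<I>\<close>.\<close>

lemma lunit_sym:
  assumes o: "A \<in> Obj C"
  shows "\<l> A \<cdot> \<sigma> A \<I> = \<r> A"
proof (rule tensor_unit_faithful(2))
  let ?I = \<I>
  have "\<sigma> A ?I \<cdot> ((\<l> A \<cdot> \<sigma> A ?I) \<odot> \<one> ?I) = (\<sigma> A ?I \<cdot> (\<l> A \<odot> \<one> ?I)) \<cdot> (\<sigma> A ?I \<odot> \<one> ?I)"
    using o by (simp add: comp_assoc interchange)
  also have "\<dots> = ((\<sigma> A ?I \<cdot> \<l> (A \<otimes> ?I)) \<cdot> \<a> ?I A ?I) \<cdot> (\<sigma> A ?I \<odot> \<one> ?I)"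
    using o by (simp add: comp_assoc lunit_tensor)
  also have "\<dots> = \<l> (?I \<otimes> A) \<cdot> ((\<one> ?I \<odot> \<sigma> A ?I) \<cdot> \<a> ?I A ?I \<cdot> (\<sigma> A ?I \<odot> \<one> ?I))"
    using o by (simp add: comp_assoc lunit_nat flip: comp_assoc)
  also have "\<dots> = (\<l> (?I \<otimes> A) \<cdot> \<a> ?I ?I A) \<cdot> \<sigma> A (?I \<otimes> ?I) \<cdot> \<a> A ?I ?I"
    using o by (simp add: comp_assoc flip: hexagon)
  also have "\<dots> = ((\<l> ?I \<odot> \<one> A) \<cdot> \<sigma> A (?I \<otimes> ?I)) \<cdot> \<a> A ?I ?I"
    using o by (simp add: comp_assoc lunit_tensor)
  also have "\<dots> = \<sigma> A ?I \<cdot> ((\<one> A \<odot> \<l> ?I) \<cdot> \<a> A ?I ?I)"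
    using o sym_nat[of "\<one> A" "\<l> ?I" A ?I] by (simp flip: comp_assoc)
  also have "\<dots> = \<sigma> A ?I \<cdot> (\<r> A \<odot> \<one> ?I)"
    using o by (simp add: triangle)
  finally show "(\<l> A \<cdot> \<sigma> A ?I) \<odot> \<one> ?I = \<r> A \<odot> \<one> ?I"
    by (rule unitary_cancel_left[OF Sym_unitary, rotated 6]) (use o in simp_all)
qed (use assms in simp_all)

lemma runit_sym: "A \<in> Obj C \<Longrightarrow> \<r> A \<cdot> \<sigma> \<I> A = \<l> A"
  using lunit_sym[of A] by (simp add: comp_assoc Sym_Sym flip: lunit_sym)

text \<open>The second hexagon is the dagger of the first, as the dagger of a symmetry is the
  opposite symmetry.\<close>

lemma hexagon_dagger:
  assumes "A \<in> Obj C" "B \<in> Obj C" "D \<in> Obj C"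
  shows "(\<a> A B D)\<^sup>\<dagger> \<cdot> \<sigma> (B \<otimes> D) A \<cdot> (\<a> B D A)\<^sup>\<dagger> =
       (\<sigma> B A \<odot> \<one> D) \<cdot> (\<a> B A D)\<^sup>\<dagger> \<cdot> (\<one> B \<odot> \<sigma> D A)"
  using arg_cong[OF hexagon[OF assms], of "\<lambda>f. f\<^sup>\<dagger>"] assms by (simp add: dagger_Comp comp_assoc)

lemma pentagon_dagger:
  assumes "A \<in> Obj C" "B \<in> Obj C" "D \<in> Obj C" "E \<in> Obj C"
  shows "(\<a> (A \<otimes> B) D E)\<^sup>\<dagger> \<cdot> (\<a> A B (D \<otimes> E))\<^sup>\<dagger> =
     ((\<a> A B D)\<^sup>\<dagger> \<odot> \<one> E) \<cdot> (\<a> A (B \<otimes> D) E)\<^sup>\<dagger> \<cdot> (\<one> A \<odot> (\<a> B D E)\<^sup>\<dagger>)"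
  using arg_cong[OF pentagon[OF assms], of "\<lambda>f. f\<^sup>\<dagger>"] assms by (simp add: dagger_Comp comp_assoc)

end


section \<open>Elements\<close>

text \<open>The first component is the name of a variable and the second its type. On a tie the head
  of the second list goes first, a convention that \<open>unmerge\<close> repeats.\<close>

fun merge :: "(nat \<times> 'o) list \<Rightarrow> (nat \<times> 'o) list \<Rightarrow> (nat \<times> 'o) list" where
  "merge [] ys = ys"
| "merge xs [] = xs"
| "merge (x # xs) (y # ys) =
     (if fst x < fst y then x # merge xs (y # ys) else y # merge (x # xs) ys)"

lemma merge_Nil [simp]: "merge xs [] = xs"
  by (cases xs) simp_all

lemma set_merge [simp]: "set (merge xs ys) = set xs \<union> set ys"
  by (induction xs ys rule: merge.induct) auto

text \<open>This holds even for unsorted lists and repeated names, since the rule for ties chooses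
  consistently among three heads. The induction is on the total length, because any of the three
  lists may lose its head.\<close>

lemma merge_assoc: "merge (merge xs ys) zs = merge xs (merge ys zs)"
proof (induction "length xs + length ys + length zs" arbitrary: xs ys zs rule: less_induct)
  case less
  show ?case
  proof (cases "xs = [] \<or> ys = [] \<or> zs = []")
    case False
    then obtain x xs' y ys' z zs' where *: "xs = x # xs'" "ys = y # ys'" "zs = z # zs'"
      by (metis list.exhaust)
    show ?thesis
      using less[of xs' ys zs] less[of xs ys' zs] less[of xs ys zs'] unfolding *
      by (cases "fst x < fst y"; cases "fst y < fst z"; cases "fst x < fst z") simp_all
  qed auto
qed

text \<open>The treatment of ties is the only asymmetry of \<open>merge\<close>, and disjoint names
  exclude ties.\<close>

lemma merge_comm: "fst ` set xs \<inter> fst ` set ys = {} \<Longrightarrow> merge xs ys = merge ys xs"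
  by (induction xs ys rule: merge.induct) auto

text \<open>Fresh variables, with names above all those in use, are thus appended at the end of a
  context.\<close>

lemma merge_above:
  "\<forall>x \<in> set ys. fst x < i \<Longrightarrow> merge ((i, A) # xs) ys = ys @ (i, A) # xs"
  by (induction ys) auto

text \<open>\<open>val\<close> is meant as a morphism from the tensor product of the context
  \<open>ctx\<close> to \<open>cod\<close>. The codomain is stored although a valid
  \<open>val\<close> determines it, so that the rewrite rules for \<open>cod\<close> need no
  validity premise.\<close>

datatype ('o, 'm) elem = Elem (ctx: "(nat \<times> 'o) list") (val: 'm) (cod: 'o)

definition names :: "('o, 'm) elem \<Rightarrow> nat set" where
  "names x = fst ` set (ctx x)"

lemma disjnt_commute: "disjnt X Y \<longleftrightarrow> disjnt Y X"
  by (auto simp: disjnt_def)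

context dagger_symmetric_monoidal_category
begin

section \<open>Moving one factor past another, and the coherence of such moves\<close>

definition left_swap :: "'o \<Rightarrow> 'o \<Rightarrow> 'o \<Rightarrow> 'm" where
  "left_swap Y P Q = \<a> P Y Q \<cdot> (\<sigma> Y P \<odot> \<one> Q) \<cdot> (\<a> Y P Q)\<^sup>\<dagger>"

lemma left_swap_unitary:
  assumes "Y \<in> Obj C" "P \<in> Obj C" "Q \<in> Obj C"
  shows "unitary (Y \<otimes> (P \<otimes> Q)) (P \<otimes> (Y \<otimes> Q)) (left_swap Y P Q)"
  unfolding left_swap_def using assms
  by (intro unitary_Comp[OF unitary_Comp[OF unitary_dagger[OF Assoc_unitary]
        unitary_TensorA[OF Sym_unitary unitary_Id]] Assoc_unitary]) simp_all

lemma left_swap_typing [simp]: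
  assumes "Y \<in> Obj C" "P \<in> Obj C" "Q \<in> Obj C"
  shows "left_swap Y P Q \<in> Arr C" "Dom C (left_swap Y P Q) = Y \<otimes> (P \<otimes> Q)"
    "Cod C (left_swap Y P Q) = P \<otimes> (Y \<otimes> Q)"
  using unitaryD[OF left_swap_unitary[OF assms]] by simp_all

lemma left_swap_nat:
  assumes "f \<in> Arr C" "g \<in> Arr C" "Y \<in> Obj C" "Cod C f = P" "Cod C g = Q"
  shows "left_swap Y P Q \<cdot> (\<one> Y \<odot> (f \<odot> g)) = (f \<odot> (\<one> Y \<odot> g)) \<cdot> left_swap Y (Dom C f) (Dom C g)"
proof -
  have o: "P \<in> Obj C" "Q \<in> Obj C" using assms by auto
  have e: "(\<sigma> Y P \<odot> \<one> Q) \<cdot> ((\<one> Y \<odot> f) \<odot> g) = ((f \<odot> \<one> Y) \<odot> g) \<cdot> (\<sigma> Y (Dom C f) \<odot> \<one> (Dom C g))"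
    using assms o by (simp add: interchange sym_nat)
  have "left_swap Y P Q \<cdot> (\<one> Y \<odot> (f \<odot> g)) =
     \<a> P Y Q \<cdot> ((\<sigma> Y P \<odot> \<one> Q) \<cdot> ((\<one> Y \<odot> f) \<odot> g)) \<cdot> (\<a> Y (Dom C f) (Dom C g))\<^sup>\<dagger>"
    unfolding left_swap_def using assms o by (simp add: comp_assoc assoc_dagger_nat)
  also have "\<dots> = (\<a> P Y Q \<cdot> ((f \<odot> \<one> Y) \<odot> g)) \<cdot> (\<sigma> Y (Dom C f) \<odot> \<one> (Dom C g)) \<cdot> (\<a> Y (Dom C f) (Dom C g))\<^sup>\<dagger>"
    using assms o comp_reassoc[OF e] e by (simp add: comp_assoc)
  also have "\<dots> = (f \<odot> (\<one> Y \<odot> g)) \<cdot> left_swap Y (Dom C f) (Dom C g)"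
    unfolding left_swap_def using assms o by (simp add: comp_assoc assoc_nat flip: comp_assoc)
  finally show ?thesis .
qed

text \<open>This is a hexagon: to exchange \<open>X \<otimes> P\<close> with \<open>Q\<close>, first
  \<open>P\<close> and then \<open>X\<close> is moved past \<open>Q\<close>. It drives the induction
  for \<open>unmerge_sym\<close>.\<close>

lemma left_swap_sym:
  assumes o: "X \<in> Obj C" "P \<in> Obj C" "Q \<in> Obj C"
  shows "\<sigma> (X \<otimes> P) Q \<cdot> (\<a> X P Q)\<^sup>\<dagger> = left_swap X Q P \<cdot> (\<one> X \<odot> \<sigma> P Q)"
proof (rule unitary_cancel_left[where w = "(\<a> Q X P)\<^sup>\<dagger>"])
  show "unitary (Q \<otimes> (X \<otimes> P)) ((Q \<otimes> X) \<otimes> P) ((\<a> Q X P)\<^sup>\<dagger>)"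
    using o by (simp add: unitary_dagger Assoc_unitary)
  show "(\<a> Q X P)\<^sup>\<dagger> \<cdot> \<sigma> (X \<otimes> P) Q \<cdot> (\<a> X P Q)\<^sup>\<dagger> = (\<a> Q X P)\<^sup>\<dagger> \<cdot> left_swap X Q P \<cdot> (\<one> X \<odot> \<sigma> P Q)"
    using o by (simp add: hexagon_dagger left_swap_def comp_assoc)
qed (use o in simp_all)

text \<open>Only the brackets behind the moved factor change, so two pentagons and naturality
  suffice. This is the case of \<open>unmerge_assoc\<close> in which the middle list supplies the
  first variable.\<close>

lemma left_swap_assoc_left:
  assumes o: "Y \<in> Obj C" "P \<in> Obj C" "Q \<in> Obj C" "R \<in> Obj C"
  shows "\<a> P (Y \<otimes> Q) R \<cdot> (left_swap Y P Q \<odot> \<one> R) \<cdot> (\<a> Y (P \<otimes> Q) R)\<^sup>\<dagger> =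
    (\<one> P \<odot> (\<a> Y Q R)\<^sup>\<dagger>) \<cdot> left_swap Y P (Q \<otimes> R) \<cdot> (\<one> Y \<odot> \<a> P Q R)"
proof -
  have p: "(\<one> P \<odot> (\<a> Y Q R)\<^sup>\<dagger>) \<cdot> \<a> P Y (Q \<otimes> R) = \<a> P (Y \<otimes> Q) R \<cdot> (\<a> P Y Q \<odot> \<one> R) \<cdot> (\<a> (P \<otimes> Y) Q R)\<^sup>\<dagger>"
  proof -
    have "(\<one> P \<odot> (\<a> Y Q R)\<^sup>\<dagger>) \<cdot> \<a> P Y (Q \<otimes> R) =
      (\<one> P \<odot> (\<a> Y Q R)\<^sup>\<dagger>) \<cdot> (\<a> P Y (Q \<otimes> R) \<cdot> \<a> (P \<otimes> Y) Q R) \<cdot> (\<a> (P \<otimes> Y) Q R)\<^sup>\<dagger>"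
      using o by (simp add: comp_assoc)
    also have "\<dots> = ((\<one> P \<odot> (\<a> Y Q R)\<^sup>\<dagger>) \<cdot> (\<one> P \<odot> \<a> Y Q R)) \<cdot> \<a> P (Y \<otimes> Q) R \<cdot> (\<a> P Y Q \<odot> \<one> R) \<cdot> (\<a> (P \<otimes> Y) Q R)\<^sup>\<dagger>"
      using o by (simp add: comp_assoc pentagon)
    also have "\<dots> = \<a> P (Y \<otimes> Q) R \<cdot> (\<a> P Y Q \<odot> \<one> R) \<cdot> (\<a> (P \<otimes> Y) Q R)\<^sup>\<dagger>"
      using o by (simp add: interchange)
    finally show ?thesis .
  qed
  have q: "((\<a> Y P Q)\<^sup>\<dagger> \<odot> \<one> R) \<cdot> (\<a> Y (P \<otimes> Q) R)\<^sup>\<dagger> =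
     (\<a> (Y \<otimes> P) Q R)\<^sup>\<dagger> \<cdot> (\<a> Y P (Q \<otimes> R))\<^sup>\<dagger> \<cdot> (\<one> Y \<odot> \<a> P Q R)"
  proof -
    have "(\<a> (Y \<otimes> P) Q R)\<^sup>\<dagger> \<cdot> (\<a> Y P (Q \<otimes> R))\<^sup>\<dagger> \<cdot> (\<one> Y \<odot> \<a> P Q R) =
       ((\<a> (Y \<otimes> P) Q R)\<^sup>\<dagger> \<cdot> (\<a> Y P (Q \<otimes> R))\<^sup>\<dagger>) \<cdot> (\<one> Y \<odot> \<a> P Q R)"
      using o by (simp add: comp_assoc)
    also have "\<dots> = ((\<a> Y P Q)\<^sup>\<dagger> \<odot> \<one> R) \<cdot> (\<a> Y (P \<otimes> Q) R)\<^sup>\<dagger> \<cdot> (\<one> Y \<odot> (\<a> P Q R)\<^sup>\<dagger>) \<cdot> (\<one> Y \<odot> \<a> P Q R)"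
      unfolding pentagon_dagger[OF o] using o by (simp add: comp_assoc)
    also have "\<dots> = ((\<a> Y P Q)\<^sup>\<dagger> \<odot> \<one> R) \<cdot> (\<a> Y (P \<otimes> Q) R)\<^sup>\<dagger>"
      using o by (simp add: interchange)
    finally show ?thesis by simp
  qed
  have n: "(\<a> (P \<otimes> Y) Q R)\<^sup>\<dagger> \<cdot> (\<sigma> Y P \<odot> \<one> (Q \<otimes> R)) = ((\<sigma> Y P \<odot> \<one> Q) \<odot> \<one> R) \<cdot> (\<a> (Y \<otimes> P) Q R)\<^sup>\<dagger>"
    using o assoc_dagger_nat[of "\<sigma> Y P" "\<one> Q" "\<one> R" "P \<otimes> Y" Q R] by simp
  have "\<a> P (Y \<otimes> Q) R \<cdot> (left_swap Y P Q \<odot> \<one> R) \<cdot> (\<a> Y (P \<otimes> Q) R)\<^sup>\<dagger> =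
    \<a> P (Y \<otimes> Q) R \<cdot> ((\<a> P Y Q \<odot> \<one> R) \<cdot> ((\<sigma> Y P \<odot> \<one> Q) \<odot> \<one> R) \<cdot> ((\<a> Y P Q)\<^sup>\<dagger> \<odot> \<one> R)) \<cdot> (\<a> Y (P \<otimes> Q) R)\<^sup>\<dagger>"
    unfolding left_swap_def using o by (simp add: interchange)
  also have "\<dots> = \<a> P (Y \<otimes> Q) R \<cdot> (\<a> P Y Q \<odot> \<one> R) \<cdot> ((\<sigma> Y P \<odot> \<one> Q) \<odot> \<one> R) \<cdot>
     (\<a> (Y \<otimes> P) Q R)\<^sup>\<dagger> \<cdot> (\<a> Y P (Q \<otimes> R))\<^sup>\<dagger> \<cdot> (\<one> Y \<odot> \<a> P Q R)"
    using o by (simp add: comp_assoc q)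
  also have "\<dots> = (\<a> P (Y \<otimes> Q) R \<cdot> (\<a> P Y Q \<odot> \<one> R) \<cdot> (\<a> (P \<otimes> Y) Q R)\<^sup>\<dagger>) \<cdot> (\<sigma> Y P \<odot> \<one> (Q \<otimes> R)) \<cdot>
      (\<a> Y P (Q \<otimes> R))\<^sup>\<dagger> \<cdot> (\<one> Y \<odot> \<a> P Q R)"
    using o comp_reassoc[OF n, of "(\<a> Y P (Q \<otimes> R))\<^sup>\<dagger> \<cdot> (\<one> Y \<odot> \<a> P Q R)"] by (simp add: comp_assoc)
  also have "\<dots> = (\<one> P \<odot> (\<a> Y Q R)\<^sup>\<dagger>) \<cdot> left_swap Y P (Q \<otimes> R) \<cdot> (\<one> Y \<odot> \<a> P Q R)"
    unfolding p[symmetric] left_swap_def using o by (simp add: comp_assoc)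
  finally show ?thesis .
qed

text \<open>Here the hexagon enters, as moving \<open>Z\<close> past \<open>P \<otimes> Q\<close>
  means moving it past \<open>P\<close> and then past \<open>Q\<close>. This is the case of
  \<open>unmerge_assoc\<close> in which the last list supplies the first variable.\<close>

lemma left_swap_assoc_right:
  assumes o: "Z \<in> Obj C" "P \<in> Obj C" "Q \<in> Obj C" "R \<in> Obj C"
  shows "\<a> P Q (Z \<otimes> R) \<cdot> left_swap Z (P \<otimes> Q) R =
    (\<one> P \<odot> left_swap Z Q R) \<cdot> left_swap Z P (Q \<otimes> R) \<cdot> (\<one> Z \<odot> \<a> P Q R)"
proof (rule unitary_cancel_right[where w = "\<a> Z (P \<otimes> Q) R"])
  show "unitary ((Z \<otimes> (P \<otimes> Q)) \<otimes> R) (Z \<otimes> ((P \<otimes> Q) \<otimes> R)) (\<a> Z (P \<otimes> Q) R)"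
    using o by (simp add: Assoc_unitary)
  have n: "(\<a> P Z (Q \<otimes> R)) \<cdot> (\<sigma> Z P \<odot> \<one> (Q \<otimes> R)) \<cdot> \<a> (Z \<otimes> P) Q R =
     (\<one> P \<odot> \<a> Z Q R) \<cdot> \<a> P (Z \<otimes> Q) R \<cdot> ((\<a> P Z Q \<cdot> (\<sigma> Z P \<odot> \<one> Q)) \<odot> \<one> R)"
  proof -
    have e: "\<a> (P \<otimes> Z) Q R \<cdot> ((\<sigma> Z P \<odot> \<one> Q) \<odot> \<one> R) = (\<sigma> Z P \<odot> \<one> (Q \<otimes> R)) \<cdot> \<a> (Z \<otimes> P) Q R"
      using o assoc_nat[of "\<sigma> Z P" "\<one> Q" "\<one> R" "P \<otimes> Z" Q R] by simp
    have "(\<a> P Z (Q \<otimes> R)) \<cdot> (\<sigma> Z P \<odot> \<one> (Q \<otimes> R)) \<cdot> \<a> (Z \<otimes> P) Q R =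
       (\<a> P Z (Q \<otimes> R) \<cdot> \<a> (P \<otimes> Z) Q R) \<cdot> ((\<sigma> Z P \<odot> \<one> Q) \<odot> \<one> R)"
      using o by (simp add: comp_assoc e)
    also have "\<dots> = (\<one> P \<odot> \<a> Z Q R) \<cdot> \<a> P (Z \<otimes> Q) R \<cdot> ((\<a> P Z Q \<cdot> (\<sigma> Z P \<odot> \<one> Q)) \<odot> \<one> R)"
      unfolding pentagon[OF o(2,1,3,4)] using o by (simp add: comp_assoc interchange)
    finally show ?thesis .
  qed
  have h: "(\<one> P \<odot> \<sigma> Z Q) \<cdot> \<a> P Z Q \<cdot> (\<sigma> Z P \<odot> \<one> Q) \<cdot> (\<a> Z P Q)\<^sup>\<dagger> = \<a> P Q Z \<cdot> \<sigma> Z (P \<otimes> Q)"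
    using arg_cong[OF hexagon[OF o(1,2,3)], of "\<lambda>f. f \<cdot> (\<a> Z P Q)\<^sup>\<dagger>"] o by (simp add: comp_assoc)
  have p: "(\<a> Z P (Q \<otimes> R))\<^sup>\<dagger> \<cdot> (\<one> Z \<odot> \<a> P Q R) \<cdot> \<a> Z (P \<otimes> Q) R =
     \<a> (Z \<otimes> P) Q R \<cdot> ((\<a> Z P Q)\<^sup>\<dagger> \<odot> \<one> R)"
  proof -
    have "(\<a> Z P (Q \<otimes> R))\<^sup>\<dagger> \<cdot> (\<one> Z \<odot> \<a> P Q R) \<cdot> \<a> Z (P \<otimes> Q) R =
      (\<a> Z P (Q \<otimes> R))\<^sup>\<dagger> \<cdot> ((\<one> Z \<odot> \<a> P Q R) \<cdot> \<a> Z (P \<otimes> Q) R \<cdot> (\<a> Z P Q \<odot> \<one> R)) \<cdot> ((\<a> Z P Q)\<^sup>\<dagger> \<odot> \<one> R)"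
      using o by (simp add: comp_assoc interchange)
    also have "\<dots> = \<a> (Z \<otimes> P) Q R \<cdot> ((\<a> Z P Q)\<^sup>\<dagger> \<odot> \<one> R)"
      unfolding pentagon[OF o, symmetric] using o by (simp add: comp_assoc)
    finally show ?thesis .
  qed
  have m: "\<a> P (Q \<otimes> Z) R \<cdot> ((\<one> P \<odot> \<sigma> Z Q) \<odot> \<one> R) = (\<one> P \<odot> (\<sigma> Z Q \<odot> \<one> R)) \<cdot> \<a> P (Z \<otimes> Q) R"
    using o assoc_nat[of "\<one> P" "\<sigma> Z Q" "\<one> R" P "Q \<otimes> Z" R] by simp
  have "((\<one> P \<odot> left_swap Z Q R) \<cdot> left_swap Z P (Q \<otimes> R) \<cdot> (\<one> Z \<odot> \<a> P Q R)) \<cdot> \<a> Z (P \<otimes> Q) R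
    = (\<one> P \<odot> left_swap Z Q R) \<cdot> \<a> P Z (Q \<otimes> R) \<cdot> (\<sigma> Z P \<odot> \<one> (Q \<otimes> R)) \<cdot>
       ((\<a> Z P (Q \<otimes> R))\<^sup>\<dagger> \<cdot> (\<one> Z \<odot> \<a> P Q R) \<cdot> \<a> Z (P \<otimes> Q) R)"
    unfolding left_swap_def[of Z P] using o by (simp add: comp_assoc)
  also have "\<dots> = (\<one> P \<odot> left_swap Z Q R) \<cdot> (\<a> P Z (Q \<otimes> R) \<cdot> (\<sigma> Z P \<odot> \<one> (Q \<otimes> R)) \<cdot> \<a> (Z \<otimes> P) Q R) \<cdot> ((\<a> Z P Q)\<^sup>\<dagger> \<odot> \<one> R)"
    unfolding p using o by (simp add: comp_assoc)
  also have "\<dots> = ((\<one> P \<odot> left_swap Z Q R) \<cdot> (\<one> P \<odot> \<a> Z Q R)) \<cdot> \<a> P (Z \<otimes> Q) R \<cdot>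
       ((\<a> P Z Q \<cdot> (\<sigma> Z P \<odot> \<one> Q)) \<odot> \<one> R) \<cdot> ((\<a> Z P Q)\<^sup>\<dagger> \<odot> \<one> R)"
    unfolding n using o by (simp add: comp_assoc)
  also have "\<dots> = (\<one> P \<odot> (\<a> Q Z R \<cdot> (\<sigma> Z Q \<odot> \<one> R))) \<cdot> \<a> P (Z \<otimes> Q) R \<cdot>
       ((\<a> P Z Q \<cdot> (\<sigma> Z P \<odot> \<one> Q) \<cdot> (\<a> Z P Q)\<^sup>\<dagger>) \<odot> \<one> R)"
    unfolding left_swap_def using o by (simp add: comp_assoc interchange)
  also have "\<dots> = (\<one> P \<odot> \<a> Q Z R) \<cdot> ((\<one> P \<odot> (\<sigma> Z Q \<odot> \<one> R)) \<cdot> \<a> P (Z \<otimes> Q) R) \<cdot>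
       ((\<a> P Z Q \<cdot> (\<sigma> Z P \<odot> \<one> Q) \<cdot> (\<a> Z P Q)\<^sup>\<dagger>) \<odot> \<one> R)"
    using o by (simp add: interchange flip: comp_assoc)
  also have "\<dots> = (\<one> P \<odot> \<a> Q Z R) \<cdot> \<a> P (Q \<otimes> Z) R \<cdot>
       (((\<one> P \<odot> \<sigma> Z Q) \<cdot> \<a> P Z Q \<cdot> (\<sigma> Z P \<odot> \<one> Q) \<cdot> (\<a> Z P Q)\<^sup>\<dagger>) \<odot> \<one> R)"
    unfolding m[symmetric] using o by (simp add: comp_assoc interchange)
  also have "\<dots> = ((\<one> P \<odot> \<a> Q Z R) \<cdot> \<a> P (Q \<otimes> Z) R \<cdot> (\<a> P Q Z \<odot> \<one> R)) \<cdot> (\<sigma> Z (P \<otimes> Q) \<odot> \<one> R)"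
    unfolding h using o by (simp add: comp_assoc interchange)
  also have "\<dots> = (\<a> P Q (Z \<otimes> R) \<cdot> left_swap Z (P \<otimes> Q) R) \<cdot> \<a> Z (P \<otimes> Q) R"
    unfolding pentagon[OF o(2,3,1,4), symmetric] left_swap_def using o by (simp add: comp_assoc)
  finally show "(\<a> P Q (Z \<otimes> R) \<cdot> left_swap Z (P \<otimes> Q) R) \<cdot> \<a> Z (P \<otimes> Q) R =
    ((\<one> P \<odot> left_swap Z Q R) \<cdot> left_swap Z P (Q \<otimes> R) \<cdot> (\<one> Z \<odot> \<a> P Q R)) \<cdot> \<a> Z (P \<otimes> Q) R" by simp
qed (use o in simp_all)

section \<open>Contexts, their objects and their canonical splittings\<close>

fun ctx_ob :: "(nat \<times> 'o) list \<Rightarrow> 'o" where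
  "ctx_ob [] = \<I>"
| "ctx_ob (x # xs) = snd x \<otimes> ctx_ob xs"

definition valid_ctx :: "(nat \<times> 'o) list \<Rightarrow> bool" where
  "valid_ctx xs \<longleftrightarrow> snd ` set xs \<subseteq> Obj C"

lemma valid_ctx_simps [simp]: "valid_ctx []" "valid_ctx (x # xs) \<longleftrightarrow> snd x \<in> Obj C \<and> valid_ctx xs" "valid_ctx (merge xs ys) \<longleftrightarrow> valid_ctx xs \<and> valid_ctx ys"
  by (auto simp: valid_ctx_def)

lemma ctx_ob_Obj [simp]: "valid_ctx xs \<Longrightarrow> ctx_ob xs \<in> Obj C"
  by (induction xs) auto

text \<open>The canonical isomorphism that splits a sorted list of variables into its two parts. In the case of
  \<open>fst x = fst y\<close>, which the results on the symmetry exclude, the order is arbitrary.\<close>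

fun unmerge :: "(nat \<times> 'o) list \<Rightarrow> (nat \<times> 'o) list \<Rightarrow> 'm" where
  "unmerge [] ys = (\<l> (ctx_ob ys))\<^sup>\<dagger>"
| "unmerge (x # xs) [] = (\<r> (ctx_ob (x # xs)))\<^sup>\<dagger>"
| "unmerge (x # xs) (y # ys) =
     (if fst x < fst y
      then (\<a> (snd x) (ctx_ob xs) (ctx_ob (y # ys)))\<^sup>\<dagger> \<cdot> (\<one> (snd x) \<odot> unmerge xs (y # ys))
      else left_swap (snd y) (ctx_ob (x # xs)) (ctx_ob ys) \<cdot> (\<one> (snd y) \<odot> unmerge (x # xs) ys))"

text \<open>For empty \<open>xs\<close> the definition yields a left unitor instead, which at
  \<open>\<I>\<close> agrees with the right one.\<close>

lemma unmerge_Nil: "unmerge xs [] = (\<r> (ctx_ob xs))\<^sup>\<dagger>"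
  by (cases xs) (simp_all add: lunit_unit)

lemma unmerge_unitary:
  "valid_ctx xs \<Longrightarrow> valid_ctx ys \<Longrightarrow> unitary (ctx_ob (merge xs ys)) (ctx_ob xs \<otimes> ctx_ob ys) (unmerge xs ys)"
proof (induction xs ys rule: unmerge.induct)
  case (1 ys)
  then show ?case by (simp add: unitary_dagger Lunit_unitary)
next
  case (2 x xs)
  then show ?case using unitary_dagger[OF Runit_unitary[of "ctx_ob (x # xs)"]] by simp
next
  case (3 x xs y ys)
  show ?case
  proof (cases "fst x < fst y")
    case True
    with 3 show ?thesis
      by (auto intro!: unitary_Comp[OF unitary_TensorA[OF unitary_Id] unitary_dagger[OF Assoc_unitary]])
  next
    case False
    with 3 show ?thesis
      by (auto intro!: unitary_Comp[OF unitary_TensorA[OF unitary_Id] left_swap_unitary])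
  qed
qed

lemma unmerge_typing [simp]:
  assumes "valid_ctx xs" "valid_ctx ys"
  shows "unmerge xs ys \<in> Arr C" "Dom C (unmerge xs ys) = ctx_ob (merge xs ys)"
    "Cod C (unmerge xs ys) = ctx_ob xs \<otimes> ctx_ob ys"
  using unitaryD[OF unmerge_unitary[OF assms]] by simp_all

text \<open>Disjointness is essential: with a name in common, the two splittings would take its two
  occurrences in opposite orders.\<close>

lemma unmerge_sym:
  "valid_ctx xs \<Longrightarrow> valid_ctx ys \<Longrightarrow> fst ` set xs \<inter> fst ` set ys = {} \<Longrightarrow>
   \<sigma> (ctx_ob xs) (ctx_ob ys) \<cdot> unmerge xs ys = unmerge ys xs"
proof (induction xs ys rule: unmerge.induct)
  case (1 ys)
  have "(\<l> (ctx_ob ys) \<cdot> \<sigma> (ctx_ob ys) \<I>)\<^sup>\<dagger> = (\<r> (ctx_ob ys))\<^sup>\<dagger>" using 1 by (simp add: lunit_sym)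
  then show ?case using 1 by (simp add: dagger_Comp unmerge_Nil)
next
  case (2 x xs)
  have "(\<r> (ctx_ob (x # xs)) \<cdot> \<sigma> \<I> (ctx_ob (x # xs)))\<^sup>\<dagger> = (\<l> (ctx_ob (x # xs)))\<^sup>\<dagger>" using 2 by (simp add: runit_sym)
  then show ?case using 2 by (simp add: dagger_Comp unmerge_Nil)
next
  case (3 x xs y ys)
  let ?X = "snd x" and ?Y = "snd y" and ?P = "ctx_ob xs" and ?Q = "ctx_ob ys"
  show ?case
  proof (cases "fst x < fst y")
    case True
    have IH: "\<sigma> ?P (?Y \<otimes> ?Q) \<cdot> unmerge xs (y # ys) = unmerge (y # ys) xs"
      using 3 True by simp
    have "\<sigma> (?X \<otimes> ?P) (?Y \<otimes> ?Q) \<cdot> (\<a> ?X ?P (?Y \<otimes> ?Q))\<^sup>\<dagger> \<cdot> (\<one> ?X \<odot> unmerge xs (y # ys))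
      = left_swap ?X (?Y \<otimes> ?Q) ?P \<cdot> (\<one> ?X \<odot> (\<sigma> ?P (?Y \<otimes> ?Q) \<cdot> unmerge xs (y # ys)))"
      using 3(3,4) comp_reassoc[OF left_swap_sym[of ?X ?P "?Y \<otimes> ?Q"], of "\<one> ?X \<odot> unmerge xs (y # ys)"]
      by (simp add: comp_assoc interchange)
    then show ?thesis using True 3(3,4) unfolding IH by simp
  next
    \<comment> \<open>The mirrored equation is proved first, because
      \<open>unmerge (y # ys) (x # xs)\<close> starts with an associator and
      \<open>left_swap_sym\<close> applies to it. Involutivity of the symmetry then turns it
      around.\<close>
    case False
    have lt: "fst y < fst x" using False 3(5) by (metis IntI emptyE image_eqI linorder_neqE_nat list.set_intros(1))
    have IH: "\<sigma> (?X \<otimes> ?P) ?Q \<cdot> unmerge (x # xs) ys = unmerge ys (x # xs)"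
      using 3 False by simp
    have "\<sigma> (?Y \<otimes> ?Q) (?X \<otimes> ?P) \<cdot> (\<a> ?Y ?Q (?X \<otimes> ?P))\<^sup>\<dagger> \<cdot> (\<one> ?Y \<odot> (\<sigma> (?X \<otimes> ?P) ?Q \<cdot> unmerge (x # xs) ys))
      = left_swap ?Y (?X \<otimes> ?P) ?Q \<cdot> (\<one> ?Y \<odot> (\<sigma> ?Q (?X \<otimes> ?P) \<cdot> \<sigma> (?X \<otimes> ?P) ?Q \<cdot> unmerge (x # xs) ys))"
      using 3(3,4) comp_reassoc[OF left_swap_sym[of ?Y ?Q "?X \<otimes> ?P"], of "\<one> ?Y \<odot> (\<sigma> (?X \<otimes> ?P) ?Q \<cdot> unmerge (x # xs) ys)"]
      by (simp add: comp_assoc interchange)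
    moreover have "\<sigma> ?Q (?X \<otimes> ?P) \<cdot> \<sigma> (?X \<otimes> ?P) ?Q \<cdot> unmerge (x # xs) ys = unmerge (x # xs) ys"
      using 3(3,4) by (simp add: Sym_Sym flip: comp_assoc)
    ultimately have e: "\<sigma> (?Y \<otimes> ?Q) (?X \<otimes> ?P) \<cdot> unmerge (y # ys) (x # xs) = unmerge (x # xs) (y # ys)"
      using False lt 3(3,4) unfolding IH by simp
    have "\<sigma> (?X \<otimes> ?P) (?Y \<otimes> ?Q) \<cdot> unmerge (x # xs) (y # ys) =
        (\<sigma> (?X \<otimes> ?P) (?Y \<otimes> ?Q) \<cdot> \<sigma> (?Y \<otimes> ?Q) (?X \<otimes> ?P)) \<cdot> unmerge (y # ys) (x # xs)"
      unfolding e[symmetric] using 3(3,4) by (simp add: comp_assoc del: unmerge.simps)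
    also have "\<dots> = unmerge (y # ys) (x # xs)"
      using 3(3-5) merge_comm[of "x # xs" "y # ys"] by (simp add: Sym_Sym del: unmerge.simps merge.simps)
    finally show ?thesis by simp
  qed
qed

text \<open>The coherence theorem behind the calculus of elements. The induction removes whichever
  variable comes first in the merged list, and the list that owns it decides which law is used: the
  pentagon for \<open>xs\<close>, \<open>left_swap_assoc_left\<close> for \<open>ys\<close>,
  \<open>left_swap_assoc_right\<close> for \<open>zs\<close>. Empty lists are settled by the three
  unit laws for tensor products.\<close>

lemma unmerge_assoc:
  "valid_ctx xs \<Longrightarrow> valid_ctx ys \<Longrightarrow> valid_ctx zs \<Longrightarrow>
   \<a> (ctx_ob xs) (ctx_ob ys) (ctx_ob zs) \<cdot> (unmerge xs ys \<odot> \<one> (ctx_ob zs)) \<cdot> unmerge (merge xs ys) zs =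
   (\<one> (ctx_ob xs) \<odot> unmerge ys zs) \<cdot> unmerge xs (merge ys zs)"
proof (induction "length xs + length ys + length zs" arbitrary: xs ys zs rule: less_induct)
  case less
  let ?X = "ctx_ob xs" and ?Y = "ctx_ob ys" and ?Z = "ctx_ob zs"
  have o: "?X \<in> Obj C" "?Y \<in> Obj C" "?Z \<in> Obj C" using less.prems by auto
  note ok = less.prems
  consider "xs = []" | "ys = []" | "zs = []"
    | (ne) x xs' y ys' z zs' where "xs = x # xs'" "ys = y # ys'" "zs = z # zs'"
    by (metis list.exhaust)
  then show ?case
  proof cases
    case 1
    have "(\<l> (?Y \<otimes> ?Z) \<cdot> \<a> \<I> ?Y ?Z)\<^sup>\<dagger> = (\<l> ?Y)\<^sup>\<dagger> \<odot> \<one> ?Z" using o by (simp add: lunit_tensor)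
    then have "(\<l> ?Y)\<^sup>\<dagger> \<odot> \<one> ?Z = (\<a> \<I> ?Y ?Z)\<^sup>\<dagger> \<cdot> (\<l> (?Y \<otimes> ?Z))\<^sup>\<dagger>" using o by (simp add: dagger_Comp)
    then show ?thesis using 1 ok o by (simp add: comp_assoc lunit_dagger_nat)
  next
    case 2
    have "((\<one> ?X \<odot> \<l> ?Z) \<cdot> \<a> ?X \<I> ?Z)\<^sup>\<dagger> = (\<r> ?X)\<^sup>\<dagger> \<odot> \<one> ?Z" using o by (simp add: triangle)
    then have "(\<r> ?X)\<^sup>\<dagger> \<odot> \<one> ?Z = (\<a> ?X \<I> ?Z)\<^sup>\<dagger> \<cdot> (\<one> ?X \<odot> (\<l> ?Z)\<^sup>\<dagger>)" using o by (simp add: dagger_Comp)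
    then show ?thesis using 2 ok o by (simp add: comp_assoc unmerge_Nil)
  next
    case 3
    have "((\<one> ?X \<odot> \<r> ?Y) \<cdot> \<a> ?X ?Y \<I>)\<^sup>\<dagger> = (\<r> (?X \<otimes> ?Y))\<^sup>\<dagger>" using o by (simp add: runit_tensor)
    then have e: "(\<r> (?X \<otimes> ?Y))\<^sup>\<dagger> = (\<a> ?X ?Y \<I>)\<^sup>\<dagger> \<cdot> (\<one> ?X \<odot> (\<r> ?Y)\<^sup>\<dagger>)" using o by (simp add: dagger_Comp)
    have "(unmerge xs ys \<odot> \<one> \<I>) \<cdot> (\<r> (ctx_ob (merge xs ys)))\<^sup>\<dagger> = (\<r> (?X \<otimes> ?Y))\<^sup>\<dagger> \<cdot> unmerge xs ys"
      using ok by (simp add: runit_dagger_nat)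
    then show ?thesis using 3 ok o by (simp add: comp_assoc unmerge_Nil e)
  next
    case ne
    let ?x = "snd x" and ?y = "snd y" and ?z = "snd z" and ?P = "ctx_ob xs'" and ?Q = "ctx_ob ys'" and ?R = "ctx_ob zs'"
    have o': "?x \<in> Obj C" "?y \<in> Obj C" "?z \<in> Obj C" "?P \<in> Obj C" "?Q \<in> Obj C" "?R \<in> Obj C"
      "valid_ctx xs'" "valid_ctx ys'" "valid_ctx zs'"
      using ok ne by auto
    have X: "?X = ?x \<otimes> ?P" and Y: "?Y = ?y \<otimes> ?Q" and Z: "?Z = ?z \<otimes> ?R" using ne by simp_all
    \<comment> \<open>The owner of the first variable of the triple merge, with ties going to the
      later list as in \<open>merge\<close>.\<close>
    consider (x) "fst x < fst y" "fst x < fst z" | (y) "\<not> fst x < fst y" "fst y < fst z"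
      | (z) "\<not> fst x < fst z" "\<not> fst y < fst z"
      by linarith
    then show ?thesis
    proof cases
      case x
      let ?xy = "merge xs' ys" and ?yz = "merge ys zs"
      have m: "merge xs ys = x # ?xy" using ne x by simp
      have u1: "unmerge xs ys = (\<a> ?x ?P ?Y)\<^sup>\<dagger> \<cdot> (\<one> ?x \<odot> unmerge xs' ys)" using ne x by simp
      have u2: "unmerge (x # ?xy) zs = (\<a> ?x (ctx_ob ?xy) ?Z)\<^sup>\<dagger> \<cdot> (\<one> ?x \<odot> unmerge ?xy zs)" using ne x by simp
      have u3: "unmerge xs ?yz = (\<a> ?x ?P (ctx_ob ?yz))\<^sup>\<dagger> \<cdot> (\<one> ?x \<odot> unmerge xs' ?yz)"
        using ne x by simp
      have n: "((\<one> ?x \<odot> unmerge xs' ys) \<odot> \<one> ?Z) \<cdot> (\<a> ?x (ctx_ob ?xy) ?Z)\<^sup>\<dagger> =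
          (\<a> ?x (?P \<otimes> ?Y) ?Z)\<^sup>\<dagger> \<cdot> (\<one> ?x \<odot> (unmerge xs' ys \<odot> \<one> ?Z))"
        using o o' ok by (simp add: assoc_dagger_nat)
      have "\<a> ?P ?Y ?Z \<cdot> (unmerge xs' ys \<odot> \<one> ?Z) \<cdot> unmerge ?xy zs = (\<one> ?P \<odot> unmerge ys zs) \<cdot> unmerge xs' ?yz"
        using less.hyps[of xs' ys zs] ne(1) ok(2,3) o' by simp
      from arg_cong[OF this, of "\<lambda>f. (\<a> ?P ?Y ?Z)\<^sup>\<dagger> \<cdot> f"]
      have IH: "(unmerge xs' ys \<odot> \<one> ?Z) \<cdot> unmerge ?xy zs = (\<a> ?P ?Y ?Z)\<^sup>\<dagger> \<cdot> (\<one> ?P \<odot> unmerge ys zs) \<cdot> unmerge xs' ?yz"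
        using o o' ok by simp
      have "(unmerge xs ys \<odot> \<one> ?Z) \<cdot> unmerge (merge xs ys) zs
          = ((\<a> ?x ?P ?Y)\<^sup>\<dagger> \<odot> \<one> ?Z) \<cdot> (((\<one> ?x \<odot> unmerge xs' ys) \<odot> \<one> ?Z) \<cdot> (\<a> ?x (ctx_ob ?xy) ?Z)\<^sup>\<dagger>) \<cdot> (\<one> ?x \<odot> unmerge ?xy zs)"
        unfolding m u1 u2 using o o' ok by (simp add: comp_assoc interchange flip: comp_assoc)
      also have "\<dots> = ((\<a> ?x ?P ?Y)\<^sup>\<dagger> \<odot> \<one> ?Z) \<cdot> (\<a> ?x (?P \<otimes> ?Y) ?Z)\<^sup>\<dagger> \<cdot> (\<one> ?x \<odot> ((unmerge xs' ys \<odot> \<one> ?Z) \<cdot> unmerge ?xy zs))"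
        unfolding n using o o' ok by (simp add: comp_assoc interchange)
      also have "\<dots> = (((\<a> ?x ?P ?Y)\<^sup>\<dagger> \<odot> \<one> ?Z) \<cdot> (\<a> ?x (?P \<otimes> ?Y) ?Z)\<^sup>\<dagger> \<cdot> (\<one> ?x \<odot> (\<a> ?P ?Y ?Z)\<^sup>\<dagger>)) \<cdot>
          (\<one> ?x \<odot> ((\<one> ?P \<odot> unmerge ys zs) \<cdot> unmerge xs' ?yz))"
        unfolding IH using o o' ok by (simp add: comp_assoc interchange)
      also have "\<dots> = (\<a> (?x \<otimes> ?P) ?Y ?Z)\<^sup>\<dagger> \<cdot> ((\<a> ?x ?P (?Y \<otimes> ?Z))\<^sup>\<dagger> \<cdot> (\<one> ?x \<odot> (\<one> ?P \<odot> unmerge ys zs))) \<cdot> (\<one> ?x \<odot> unmerge xs' ?yz)"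
        unfolding pentagon_dagger[OF o'(1,4) o(2,3), symmetric] using o o' ok by (simp add: comp_assoc interchange)
      also have "\<dots> = (\<a> (?x \<otimes> ?P) ?Y ?Z)\<^sup>\<dagger> \<cdot> (\<one> ?X \<odot> unmerge ys zs) \<cdot> unmerge xs ?yz"
        unfolding u3 X using o o' ok by (simp add: assoc_dagger_nat comp_assoc)
      finally show ?thesis unfolding X using o o' ok X by simp
    next
      case y
      let ?xy = "merge xs ys'" and ?yz = "merge ys' zs"
      have m: "merge xs ys = y # ?xy" "merge ys zs = y # ?yz" using ne y by simp_all
      have u1: "unmerge xs ys = left_swap ?y ?X ?Q \<cdot> (\<one> ?y \<odot> unmerge xs ys')" using ne y by simp
      have u2: "unmerge (y # ?xy) zs = (\<a> ?y (ctx_ob ?xy) ?Z)\<^sup>\<dagger> \<cdot> (\<one> ?y \<odot> unmerge ?xy zs)" using ne y by simp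
      have u3: "unmerge xs (y # ?yz) = left_swap ?y ?X (ctx_ob ?yz) \<cdot> (\<one> ?y \<odot> unmerge xs ?yz)"
        using ne y by simp
      have u4: "unmerge ys zs = (\<a> ?y ?Q ?Z)\<^sup>\<dagger> \<cdot> (\<one> ?y \<odot> unmerge ys' zs)" using ne y by simp
      have n: "((\<one> ?y \<odot> unmerge xs ys') \<odot> \<one> ?Z) \<cdot> (\<a> ?y (ctx_ob ?xy) ?Z)\<^sup>\<dagger> =
          (\<a> ?y (?X \<otimes> ?Q) ?Z)\<^sup>\<dagger> \<cdot> (\<one> ?y \<odot> (unmerge xs ys' \<odot> \<one> ?Z))"
        using o o' ok by (simp add: assoc_dagger_nat)
      have IH: "\<a> ?X ?Q ?Z \<cdot> (unmerge xs ys' \<odot> \<one> ?Z) \<cdot> unmerge ?xy zs = (\<one> ?X \<odot> unmerge ys' zs) \<cdot> unmerge xs ?yz"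
        using less.hyps[of xs ys' zs] ne(2) ok(1,3) o' by simp
      have "\<a> ?X ?Y ?Z \<cdot> (unmerge xs ys \<odot> \<one> ?Z) \<cdot> unmerge (merge xs ys) zs
          = \<a> ?X ?Y ?Z \<cdot> (left_swap ?y ?X ?Q \<odot> \<one> ?Z) \<cdot> (((\<one> ?y \<odot> unmerge xs ys') \<odot> \<one> ?Z) \<cdot> (\<a> ?y (ctx_ob ?xy) ?Z)\<^sup>\<dagger>) \<cdot> (\<one> ?y \<odot> unmerge ?xy zs)"
        unfolding m u1 u2 using o o' ok Y by (simp add: comp_assoc interchange flip: comp_assoc)
      also have "\<dots> = (\<a> ?X (?y \<otimes> ?Q) ?Z \<cdot> (left_swap ?y ?X ?Q \<odot> \<one> ?Z) \<cdot> (\<a> ?y (?X \<otimes> ?Q) ?Z)\<^sup>\<dagger>) \<cdot> (\<one> ?y \<odot> ((unmerge xs ys' \<odot> \<one> ?Z) \<cdot> unmerge ?xy zs))"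
        unfolding n Y using o o' ok Y by (simp add: comp_assoc interchange)
      also have "\<dots> = (\<one> ?X \<odot> (\<a> ?y ?Q ?Z)\<^sup>\<dagger>) \<cdot> left_swap ?y ?X (?Q \<otimes> ?Z) \<cdot> (\<one> ?y \<odot> (\<a> ?X ?Q ?Z \<cdot> (unmerge xs ys' \<odot> \<one> ?Z) \<cdot> unmerge ?xy zs))"
        using o o' ok by (simp add: left_swap_assoc_left comp_assoc interchange)
      also have "\<dots> = (\<one> ?X \<odot> (\<a> ?y ?Q ?Z)\<^sup>\<dagger>) \<cdot> (left_swap ?y ?X (?Q \<otimes> ?Z) \<cdot> (\<one> ?y \<odot> (\<one> ?X \<odot> unmerge ys' zs))) \<cdot> (\<one> ?y \<odot> unmerge xs ?yz)"
        unfolding IH using o o' ok by (simp add: comp_assoc interchange)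
      also have "\<dots> = ((\<one> ?X \<odot> (\<a> ?y ?Q ?Z)\<^sup>\<dagger>) \<cdot> (\<one> ?X \<odot> (\<one> ?y \<odot> unmerge ys' zs))) \<cdot> unmerge xs (y # ?yz)"
        unfolding u3 using o o' ok by (simp add: comp_assoc left_swap_nat)
      also have "\<dots> = (\<one> ?X \<odot> unmerge ys zs) \<cdot> unmerge xs (merge ys zs)"
        unfolding m u4 using o o' ok by (simp add: interchange)
      finally show ?thesis .
    next
      case z
      let ?xy = "merge xs ys" and ?yz = "merge ys zs'"
      have m: "merge ys zs = z # ?yz" using ne z by simp
      have u1: "unmerge ?xy zs = left_swap ?z (ctx_ob ?xy) ?R \<cdot> (\<one> ?z \<odot> unmerge ?xy zs')"
        using ne z by simp
      have u2: "unmerge ys zs = left_swap ?z ?Y ?R \<cdot> (\<one> ?z \<odot> unmerge ys zs')" using ne z by simp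
      have u3: "unmerge xs (z # ?yz) = left_swap ?z ?X (ctx_ob ?yz) \<cdot> (\<one> ?z \<odot> unmerge xs ?yz)"
        using ne z by simp
      have n: "(unmerge xs ys \<odot> \<one> ?Z) \<cdot> left_swap ?z (ctx_ob ?xy) ?R = left_swap ?z (?X \<otimes> ?Y) ?R \<cdot> (\<one> ?z \<odot> (unmerge xs ys \<odot> \<one> ?R))"
        using o o' ok Z by (simp add: left_swap_nat)
      have IH: "\<a> ?X ?Y ?R \<cdot> (unmerge xs ys \<odot> \<one> ?R) \<cdot> unmerge ?xy zs' = (\<one> ?X \<odot> unmerge ys zs') \<cdot> unmerge xs ?yz"
        using less.hyps[of xs ys zs'] ne(3) ok(1,2) o' by simp
      have "\<a> ?X ?Y ?Z \<cdot> (unmerge xs ys \<odot> \<one> ?Z) \<cdot> unmerge ?xy zs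
          = \<a> ?X ?Y ?Z \<cdot> ((unmerge xs ys \<odot> \<one> ?Z) \<cdot> left_swap ?z (ctx_ob ?xy) ?R) \<cdot> (\<one> ?z \<odot> unmerge ?xy zs')"
        unfolding u1 using o o' ok Z by (simp add: comp_assoc)
      also have "\<dots> = (\<a> ?X ?Y (?z \<otimes> ?R) \<cdot> left_swap ?z (?X \<otimes> ?Y) ?R) \<cdot> (\<one> ?z \<odot> ((unmerge xs ys \<odot> \<one> ?R) \<cdot> unmerge ?xy zs'))"
        unfolding n unfolding Z using o o' ok by (simp add: comp_assoc interchange)
      also have "\<dots> = (\<one> ?X \<odot> left_swap ?z ?Y ?R) \<cdot> left_swap ?z ?X (?Y \<otimes> ?R) \<cdot> (\<one> ?z \<odot> (\<a> ?X ?Y ?R \<cdot> (unmerge xs ys \<odot> \<one> ?R) \<cdot> unmerge ?xy zs'))"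
        using o o' ok by (simp add: left_swap_assoc_right comp_assoc interchange)
      also have "\<dots> = (\<one> ?X \<odot> left_swap ?z ?Y ?R) \<cdot> (left_swap ?z ?X (?Y \<otimes> ?R) \<cdot> (\<one> ?z \<odot> (\<one> ?X \<odot> unmerge ys zs'))) \<cdot> (\<one> ?z \<odot> unmerge xs ?yz)"
        unfolding IH using o o' ok by (simp add: comp_assoc interchange)
      also have "\<dots> = ((\<one> ?X \<odot> left_swap ?z ?Y ?R) \<cdot> (\<one> ?X \<odot> (\<one> ?z \<odot> unmerge ys zs'))) \<cdot> unmerge xs (z # ?yz)"
        unfolding u3 using o o' ok by (simp add: comp_assoc left_swap_nat)
      also have "\<dots> = (\<one> ?X \<odot> unmerge ys zs) \<cdot> unmerge xs (merge ys zs)"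
        unfolding m u2 using o o' ok by (simp add: interchange)
      finally show ?thesis .
    qed
  qed
qed

section \<open>Elements, and how structure maps act on them\<close>

definition valid :: "('o, 'm) elem \<Rightarrow> bool" where
  "valid x \<longleftrightarrow> valid_ctx (ctx x) \<and> val x \<in> Arr C \<and> Dom C (val x) = ctx_ob (ctx x) \<and> Cod C (val x) = cod x"

definition app :: "'m \<Rightarrow> ('o, 'm) elem \<Rightarrow> ('o, 'm) elem"  (infixr "\<rhd>" 80) where
  "f \<rhd> x = Elem (ctx x) (f \<cdot> val x) (Cod C f)"

definition pair :: "('o, 'm) elem \<Rightarrow> ('o, 'm) elem \<Rightarrow> ('o, 'm) elem"  ("\<langle>_,/ _\<rangle>") where
  "\<langle>x, y\<rangle> = Elem (merge (ctx x) (ctx y)) ((val x \<odot> val y) \<cdot> unmerge (ctx x) (ctx y)) (cod x \<otimes> cod y)"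

definition un :: "('o, 'm) elem" where
  "un = Elem [] (\<one> \<I>) \<I>"

text \<open>The unitor is the identity of \<open>A\<close> up to typing: the context object of a
  single variable is \<open>A \<otimes> \<I>\<close>.\<close>

definition var :: "nat \<Rightarrow> 'o \<Rightarrow> ('o, 'm) elem" where
  "var i A = Elem [(i, A)] (\<r> A) A"

text \<open>A scalar is an element of \<open>\<I>\<close> and may contain variables itself, as in
  \<open>tr A \<rhd> \<langle>x, y\<rangle>\<close>. Collecting all scalars in front is the normal
  form in which contracted wires are compared.\<close>

definition scale :: "('o, 'm) elem \<Rightarrow> ('o, 'm) elem \<Rightarrow> ('o, 'm) elem"  (infixr "\<bullet>" 85) where
  "s \<bullet> x = \<l> (cod x) \<rhd> \<langle>s, x\<rangle>"

lemma cod_simps [simp]: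
  "cod (f \<rhd> x) = Cod C f" "cod \<langle>x, y\<rangle> = cod x \<otimes> cod y" "cod un = \<I>" "cod (var i A) = A"
  by (simp_all add: app_def pair_def un_def var_def)

lemma names_simps [simp]:
  "names (f \<rhd> x) = names x" "names \<langle>x, y\<rangle> = names x \<union> names y" "names un = {}" "names (var i A) = {i}"
  "names (s \<bullet> x) = names s \<union> names x"
  by (auto simp: app_def pair_def un_def var_def names_def scale_def)

lemma valid_cod [simp]: "valid x \<Longrightarrow> cod x \<in> Obj C"
  unfolding valid_def using Cod_Obj by metis

lemma valid_simps [simp]:
  "valid x \<Longrightarrow> f \<in> Arr C \<Longrightarrow> Dom C f = cod x \<Longrightarrow> valid (f \<rhd> x)"
  "valid x \<Longrightarrow> valid y \<Longrightarrow> valid \<langle>x, y\<rangle>"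
  "valid un" "A \<in> Obj C \<Longrightarrow> valid (var i A)"
  by (simp_all add: valid_def app_def pair_def un_def var_def)

lemma valid_scale [simp]:
  "valid x \<Longrightarrow> cod (s \<bullet> x) = cod x"
  "valid s \<Longrightarrow> valid x \<Longrightarrow> cod s = \<I> \<Longrightarrow> valid (s \<bullet> x)"
  by (simp_all add: scale_def)

lemma elem_eqI:
  "ctx x = ctx y \<Longrightarrow> val x = val y \<Longrightarrow> cod x = cod y \<Longrightarrow> x = y"
  by (cases x; cases y) simp

lemma app_Comp [simp]:
  "valid x \<Longrightarrow> f \<in> Arr C \<Longrightarrow> g \<in> Arr C \<Longrightarrow> Dom C g = Cod C f \<Longrightarrow> Dom C f = cod x \<Longrightarrow> (g \<cdot> f) \<rhd> x = g \<rhd> f \<rhd> x"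
  by (simp add: app_def valid_def comp_assoc)

lemma app_Id [simp]: "valid x \<Longrightarrow> cod x = A \<Longrightarrow> \<one> A \<rhd> x = x"
  by (rule elem_eqI) (auto simp: app_def valid_def)

lemma app_tensor [simp]:
  assumes "valid x" "valid y" "f \<in> Arr C" "g \<in> Arr C" "Dom C f = cod x" "Dom C g = cod y"
  shows "(f \<odot> g) \<rhd> \<langle>x, y\<rangle> = \<langle>f \<rhd> x, g \<rhd> y\<rangle>"
  using assms comp_reassoc[OF interchange[of "val x" f "val y" g], of "unmerge (ctx x) (ctx y)"]
  by (intro elem_eqI) (auto simp: app_def pair_def valid_def comp_assoc)

text \<open>Naturality moves the values past the associator and leaves \<open>unmerge_assoc\<close>
  for the contexts. No condition on names arises, because nothing is exchanged.\<close>

lemma app_Assoc [simp]: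
  assumes "valid x" "valid y" "valid z" "cod x = A" "cod y = B" "cod z = D"
  shows "\<a> A B D \<rhd> \<langle>\<langle>x, y\<rangle>, z\<rangle> = \<langle>x, \<langle>y, z\<rangle>\<rangle>"
proof (rule elem_eqI)
  let ?x = "val x" and ?y = "val y" and ?z = "val z" and ?X = "ctx x" and ?Y = "ctx y" and ?Z = "ctx z"
  have w: "valid_ctx ?X" "valid_ctx ?Y" "valid_ctx ?Z" "?x \<in> Arr C" "?y \<in> Arr C" "?z \<in> Arr C" "Dom C ?x = ctx_ob ?X" "Dom C ?y = ctx_ob ?Y"
    "Dom C ?z = ctx_ob ?Z" "Cod C ?x = A" "Cod C ?y = B" "Cod C ?z = D"
    using assms by (auto simp: valid_def)
  then have o: "A \<in> Obj C" "B \<in> Obj C" "D \<in> Obj C" by auto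
  have "\<a> A B D \<cdot> (((?x \<odot> ?y) \<cdot> unmerge ?X ?Y) \<odot> ?z) \<cdot> unmerge (merge ?X ?Y) ?Z
    = \<a> A B D \<cdot> (((?x \<odot> ?y) \<odot> ?z) \<cdot> (unmerge ?X ?Y \<odot> \<one> (ctx_ob ?Z))) \<cdot> unmerge (merge ?X ?Y) ?Z"
    using w by (simp add: interchange)
  also have "\<dots> = (\<a> A B D \<cdot> ((?x \<odot> ?y) \<odot> ?z)) \<cdot> (unmerge ?X ?Y \<odot> \<one> (ctx_ob ?Z)) \<cdot> unmerge (merge ?X ?Y) ?Z"
    using w o by (simp add: comp_assoc)
  also have "\<dots> = (?x \<odot> (?y \<odot> ?z)) \<cdot> \<a> (ctx_ob ?X) (ctx_ob ?Y) (ctx_ob ?Z) \<cdot> (unmerge ?X ?Y \<odot> \<one> (ctx_ob ?Z)) \<cdot> unmerge (merge ?X ?Y) ?Z"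
    using w o by (simp add: assoc_nat comp_assoc)
  also have "\<dots> = ((?x \<odot> (?y \<odot> ?z)) \<cdot> (\<one> (ctx_ob ?X) \<odot> unmerge ?Y ?Z)) \<cdot> unmerge ?X (merge ?Y ?Z)"
    using w o by (simp add: unmerge_assoc comp_assoc)
  also have "\<dots> = (?x \<odot> ((?y \<odot> ?z) \<cdot> unmerge ?Y ?Z)) \<cdot> unmerge ?X (merge ?Y ?Z)"
    using w by (simp add: interchange)
  finally show "val (\<a> A B D \<rhd> \<langle>\<langle>x, y\<rangle>, z\<rangle>) = val \<langle>x, \<langle>y, z\<rangle>\<rangle>"
    by (simp add: app_def pair_def)
qed (use assms in \<open>auto simp: app_def pair_def merge_assoc\<close>)

lemma app_Assoc_dagger [simp]:
  assumes "valid x" "valid y" "valid z" "cod x = A" "cod y = B" "cod z = D"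
  shows "(\<a> A B D)\<^sup>\<dagger> \<rhd> \<langle>x, \<langle>y, z\<rangle>\<rangle> = \<langle>\<langle>x, y\<rangle>, z\<rangle>"
proof -
  have o: "A \<in> Obj C" "B \<in> Obj C" "D \<in> Obj C" using assms by auto
  have "(\<a> A B D)\<^sup>\<dagger> \<rhd> \<langle>x, \<langle>y, z\<rangle>\<rangle> = ((\<a> A B D)\<^sup>\<dagger> \<cdot> \<a> A B D) \<rhd> \<langle>\<langle>x, y\<rangle>, z\<rangle>"
    using assms o by (simp del: Assoc_typing(4))
  then show ?thesis using assms o by simp
qed

lemma app_Sym [simp]:
  assumes "valid x" "valid y" "cod x = A" "cod y = B" "disjnt (names x) (names y)"
  shows "\<sigma> A B \<rhd> \<langle>x, y\<rangle> = \<langle>y, x\<rangle>"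
proof (rule elem_eqI)
  have w: "valid_ctx (ctx x)" "valid_ctx (ctx y)" "val x \<in> Arr C" "val y \<in> Arr C" "Dom C (val x) = ctx_ob (ctx x)"
    "Dom C (val y) = ctx_ob (ctx y)" "Cod C (val x) = A" "Cod C (val y) = B"
    using assms by (auto simp: valid_def)
  then have o: "A \<in> Obj C" "B \<in> Obj C" by auto
  show "ctx (\<sigma> A B \<rhd> \<langle>x, y\<rangle>) = ctx \<langle>y, x\<rangle>"
    using assms(5) merge_comm[of "ctx x" "ctx y"] by (simp add: app_def pair_def disjnt_def names_def)
  have "\<sigma> A B \<cdot> (val x \<odot> val y) \<cdot> unmerge (ctx x) (ctx y) =
      (val y \<odot> val x) \<cdot> \<sigma> (ctx_ob (ctx x)) (ctx_ob (ctx y)) \<cdot> unmerge (ctx x) (ctx y)"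
    using w o comp_reassoc[OF sym_nat[of "val x" "val y"], of A B "unmerge (ctx x) (ctx y)"]
    by (simp add: comp_assoc)
  then show "val (\<sigma> A B \<rhd> \<langle>x, y\<rangle>) = val \<langle>y, x\<rangle>"
    using assms(5) w by (simp add: app_def pair_def unmerge_sym disjnt_def names_def)
qed (use assms in \<open>auto simp: app_def pair_def\<close>)

lemma app_Lunit [simp]:
  "valid s \<Longrightarrow> valid x \<Longrightarrow> cod s = \<I> \<Longrightarrow> cod x = A \<Longrightarrow> \<l> A \<rhd> \<langle>s, x\<rangle> = s \<bullet> x"
  by (simp add: scale_def)

lemma un_scale [simp]:
  assumes "valid x"
  shows "un \<bullet> x = x"
proof (rule elem_eqI)
  have w: "valid_ctx (ctx x)" "val x \<in> Arr C" "Dom C (val x) = ctx_ob (ctx x)" "Cod C (val x) = cod x"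
    using assms by (auto simp: valid_def)
  have "\<l> (cod x) \<cdot> (\<one> \<I> \<odot> val x) \<cdot> (\<l> (ctx_ob (ctx x)))\<^sup>\<dagger> = val x"
    using w comp_reassoc[OF lunit_nat[of "val x"], of "cod x" "(\<l> (ctx_ob (ctx x)))\<^sup>\<dagger>"] assms
    by (simp add: comp_assoc)
  then show "val (un \<bullet> x) = val x" by (simp add: scale_def app_def pair_def un_def)
qed (use assms in \<open>auto simp: scale_def app_def pair_def un_def\<close>)

lemma app_Lunit_dagger [simp]:
  assumes "valid x" "cod x = A"
  shows "(\<l> A)\<^sup>\<dagger> \<rhd> x = \<langle>un, x\<rangle>"
proof -
  have "(\<l> A)\<^sup>\<dagger> \<rhd> x = ((\<l> A)\<^sup>\<dagger> \<cdot> \<l> A) \<rhd> \<langle>un, x\<rangle>"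
    using assms by (auto simp del: Lunit_typing(4))
  then show ?thesis using assms by auto
qed

text \<open>\<open>\<r>\<close> is \<open>\<l>\<close> after a symmetry, whence the condition on
  names.\<close>

lemma app_Runit [simp]:
  assumes "valid s" "valid x" "cod s = \<I>" "cod x = A" "disjnt (names s) (names x)"
  shows "\<r> A \<rhd> \<langle>x, s\<rangle> = s \<bullet> x"
proof -
  have "A \<in> Obj C" using assms by auto
  then have "\<r> A \<rhd> \<langle>x, s\<rangle> = (\<l> A \<cdot> \<sigma> A \<I>) \<rhd> \<langle>x, s\<rangle>" by (simp add: lunit_sym)
  also have "\<dots> = s \<bullet> x" using assms \<open>A \<in> Obj C\<close> by (simp add: disjnt_commute)
  finally show ?thesis .
qed

lemma app_Runit_dagger [simp]:
  assumes "valid x" "cod x = A"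
  shows "(\<r> A)\<^sup>\<dagger> \<rhd> x = \<langle>x, un\<rangle>"
proof -
  have "(\<r> A)\<^sup>\<dagger> \<rhd> x = ((\<r> A)\<^sup>\<dagger> \<cdot> \<r> A) \<rhd> \<langle>x, un\<rangle>"
    using assms by (auto simp del: Runit_typing(4))
  then show ?thesis using assms by auto
qed

text \<open>Compatibility with scalars is naturality of \<open>\<l>\<close>.\<close>

lemma app_scale [simp]:
  assumes "valid s" "valid x" "cod s = \<I>" "f \<in> Arr C" "Dom C f = cod x"
  shows "f \<rhd> (s \<bullet> x) = s \<bullet> (f \<rhd> x)"
proof -
  have "f \<rhd> (s \<bullet> x) = (f \<cdot> \<l> (Dom C f)) \<rhd> \<langle>s, x\<rangle>" using assms by (simp add: scale_def del: app_Lunit)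
  also have "\<dots> = (\<l> (Cod C f) \<cdot> (\<one> \<I> \<odot> f)) \<rhd> \<langle>s, x\<rangle>" using assms by (simp add: lunit_nat)
  also have "\<dots> = s \<bullet> (f \<rhd> x)" using assms by simp
  finally show ?thesis .
qed

lemma pair_scale_left [simp]:
  assumes "valid s" "valid x" "valid y" "cod s = \<I>"
  shows "\<langle>s \<bullet> x, y\<rangle> = s \<bullet> \<langle>x, y\<rangle>"
proof -
  have "\<langle>s \<bullet> x, y\<rangle> = (\<l> (cod x) \<odot> \<one> (cod y)) \<rhd> \<langle>\<langle>s, x\<rangle>, y\<rangle>" using assms by simp
  also have "\<dots> = (\<l> (cod x \<otimes> cod y) \<cdot> \<a> \<I> (cod x) (cod y)) \<rhd> \<langle>\<langle>s, x\<rangle>, y\<rangle>"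
    using assms by (simp add: lunit_tensor del: app_tensor app_Comp)
  also have "\<dots> = s \<bullet> \<langle>x, y\<rangle>" using assms by simp
  finally show ?thesis .
qed

text \<open>The scalar has to pass \<open>x\<close>: the triangle trades \<open>\<l>\<close> on
  \<open>y\<close> for \<open>\<r>\<close> on \<open>x\<close>.\<close>

lemma pair_scale_right [simp]:
  assumes "valid s" "valid x" "valid y" "cod s = \<I>" "disjnt (names s) (names x)"
  shows "\<langle>x, s \<bullet> y\<rangle> = s \<bullet> \<langle>x, y\<rangle>"
proof -
  have "s \<bullet> \<langle>x, y\<rangle> = \<langle>\<r> (cod x) \<rhd> \<langle>x, s\<rangle>, y\<rangle>" using assms by simp
  also have "\<dots> = (\<r> (cod x) \<odot> \<one> (cod y)) \<rhd> \<langle>\<langle>x, s\<rangle>, y\<rangle>" using assms(1-4) by (simp del: app_Runit)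
  also have "\<dots> = ((\<one> (cod x) \<odot> \<l> (cod y)) \<cdot> \<a> (cod x) \<I> (cod y)) \<rhd> \<langle>\<langle>x, s\<rangle>, y\<rangle>"
    using assms(1-3) by (simp add: triangle del: app_tensor app_Comp)
  also have "\<dots> = \<langle>x, s \<bullet> y\<rangle>" using assms(1-4) by simp
  finally show ?thesis by simp
qed

lemma scale_assoc [simp]:
  assumes "valid s" "valid t" "valid x" "cod s = \<I>" "cod t = \<I>"
  shows "(s \<bullet> t) \<bullet> x = s \<bullet> t \<bullet> x"
  using assms by (simp add: scale_def[of "s \<bullet> t"] del: app_Lunit)  simp

text \<open>The two unitors of \<open>\<I>\<close> coincide; one reads a pair of scalars as the
  first acting on the second, the other as the second acting on the first.\<close>

lemma scale_commute:
  assumes "valid s" "valid t" "cod s = \<I>" "cod t = \<I>" "disjnt (names s) (names t)"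
  shows "s \<bullet> t = t \<bullet> s"
proof -
  have "s \<bullet> t = \<l> \<I> \<rhd> \<langle>s, t\<rangle>" using assms by simp
  also have "\<dots> = t \<bullet> s" unfolding lunit_unit using assms by (simp add: disjnt_commute)
  finally show ?thesis .
qed

lemma scale_left_commute:
  assumes "valid s" "valid t" "valid x" "cod s = \<I>" "cod t = \<I>" "disjnt (names s) (names t)"
  shows "s \<bullet> t \<bullet> x = t \<bullet> s \<bullet> x"
  using assms scale_assoc[of s t x] scale_assoc[of t s x] scale_commute[of s t] by simp

lemma scale_un [simp]: "valid s \<Longrightarrow> cod s = \<I> \<Longrightarrow> s \<bullet> un = s"
  using scale_commute[of s un] by simp

section \<open>Free elements, whose values determine a morphism, and extensionality\<close>

definition free :: "('o, 'm) elem \<Rightarrow> bool" where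
  "free x \<longleftrightarrow> valid x \<and> unitary (ctx_ob (ctx x)) (cod x) (val x)"

lemma free_un: "free un"
  by (simp add: free_def un_def valid_def unitary_Id)

lemma free_var: "A \<in> Obj C \<Longrightarrow> free (var i A)"
  using Runit_unitary[of A] by (simp add: free_def) (simp add: var_def)

lemma free_pair:
  assumes "free x" "free y"
  shows "free \<langle>x, y\<rangle>"
proof -
  have "valid x" "valid y" using assms by (auto simp: free_def)
  moreover have "unitary (ctx_ob (merge (ctx x) (ctx y))) (cod x \<otimes> cod y) ((val x \<odot> val y) \<cdot> unmerge (ctx x) (ctx y))"
    using assms by (intro unitary_Comp[OF unmerge_unitary unitary_TensorA]) (auto simp: free_def valid_def)
  ultimately show ?thesis by (simp add: free_def) (simp add: pair_def)
qed

lemma free_ext: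
  assumes "free x" "f \<in> Arr C" "g \<in> Arr C" "Dom C f = cod x" "Dom C g = cod x" "f \<rhd> x = g \<rhd> x"
  shows "f = g"
  using assms unitary_cancel_right[of "ctx_ob (ctx x)" "cod x" "val x" f g] by (simp add: free_def app_def)

text \<open>Both orientations are recorded, so that the simplifier finds whichever one it needs
  without commuting \<open>disjnt\<close>.\<close>

abbreviation (input) apart :: "nat set \<Rightarrow> nat set \<Rightarrow> bool" where
  "apart X Y \<equiv> disjnt X Y \<and> disjnt Y X"

lemma arrow_ext_un:
  "f \<in> Arr C \<Longrightarrow> g \<in> Arr C \<Longrightarrow> Dom C f = \<I> \<Longrightarrow> Dom C g = \<I> \<Longrightarrow> f \<rhd> un = g \<rhd> un \<Longrightarrow> f = g"
  using free_ext[OF free_un] by simp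

lemma arrow_ext:
  assumes "f \<in> Arr C" "g \<in> Arr C" "Dom C f = A" "Dom C g = A"
    and "\<And>x. valid x \<Longrightarrow> cod x = A \<Longrightarrow> f \<rhd> x = g \<rhd> x"
  shows "f = g"
proof -
  have "A \<in> Obj C" using assms by auto
  then show ?thesis using assms free_var[of A 0] by (intro free_ext[of "var 0 A" f g]) simp_all
qed

text \<open>One pair of distinct variables is enough. The premise still speaks of arbitrary elements
  with disjoint names, which spares its users concrete names.\<close>

lemma TensorO_ext:
  assumes "A \<in> Obj C" "B \<in> Obj C" "f \<in> Arr C" "g \<in> Arr C" "Dom C f = A \<otimes> B" "Dom C g = A \<otimes> B"
    and "\<And>x y. valid x \<Longrightarrow> valid y \<Longrightarrow> cod x = A \<Longrightarrow> cod y = B \<Longrightarrow> apart (names x) (names y) \<Longrightarrow>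
      f \<rhd> \<langle>x, y\<rangle> = g \<rhd> \<langle>x, y\<rangle>"
  shows "f = g"
  using assms by (intro free_ext[of "\<langle>var 0 A, var 1 B\<rangle>" f g] free_pair free_var)
    (simp_all add: disjnt_def)

lemma TensorO_ext3:
  assumes "A \<in> Obj C" "B \<in> Obj C" "D \<in> Obj C" "f \<in> Arr C" "g \<in> Arr C"
    "Dom C f = (A \<otimes> B) \<otimes> D" "Dom C g = (A \<otimes> B) \<otimes> D"
    and "\<And>x y z. valid x \<Longrightarrow> valid y \<Longrightarrow> valid z \<Longrightarrow> cod x = A \<Longrightarrow> cod y = B \<Longrightarrow> cod z = D \<Longrightarrow>
      apart (names x) (names y) \<Longrightarrow> apart (names x) (names z) \<Longrightarrow> apart (names y) (names z) \<Longrightarrow>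
      f \<rhd> \<langle>\<langle>x, y\<rangle>, z\<rangle> = g \<rhd> \<langle>\<langle>x, y\<rangle>, z\<rangle>"
  shows "f = g"
  using assms by (intro free_ext[of "\<langle>\<langle>var 0 A, var 1 B\<rangle>, var 2 D\<rangle>" f g] free_pair free_var)
    (simp_all add: disjnt_def)

lemma TensorO_ext4:
  assumes "A \<in> Obj C" "B \<in> Obj C" "D \<in> Obj C" "E \<in> Obj C" "f \<in> Arr C" "g \<in> Arr C"
    "Dom C f = (A \<otimes> B) \<otimes> (D \<otimes> E)" "Dom C g = (A \<otimes> B) \<otimes> (D \<otimes> E)"
    and "\<And>x y z w. valid x \<Longrightarrow> valid y \<Longrightarrow> valid z \<Longrightarrow> valid w \<Longrightarrow> cod x = A \<Longrightarrow> cod y = B \<Longrightarrow> cod z = D \<Longrightarrow> cod w = E \<Longrightarrow>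
      apart (names x) (names y) \<Longrightarrow> apart (names x) (names z) \<Longrightarrow> apart (names x) (names w) \<Longrightarrow>
      apart (names y) (names z) \<Longrightarrow> apart (names y) (names w) \<Longrightarrow> apart (names z) (names w) \<Longrightarrow>
      f \<rhd> \<langle>\<langle>x, y\<rangle>, \<langle>z, w\<rangle>\<rangle> = g \<rhd> \<langle>\<langle>x, y\<rangle>, \<langle>z, w\<rangle>\<rangle>"
  shows "f = g"
  using assms by (intro free_ext[of "\<langle>\<langle>var 0 A, var 1 B\<rangle>, \<langle>var 2 D, var 3 E\<rangle>\<rangle>" f g] free_pair free_var)
    (simp_all add: disjnt_def)

text \<open>\<open>Q\<close> is linear if it post-composes its argument with a fixed morphism, after pairing it with a fixed
  element whose variables are \<open>N\<close>. Such a function is determined by its values at pairs, as in Sweedler notation: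
  an equation about \<open>\<eta> A \<rhd> un\<close> or a comultiplication may be checked as if that element were a pair.\<close>

definition linear :: "'o \<Rightarrow> 'o \<Rightarrow> nat set \<Rightarrow> (('o, 'm) elem \<Rightarrow> ('o, 'm) elem) \<Rightarrow> bool" where
  "linear A B N Q \<longleftrightarrow> A \<in> Obj C \<and> (\<exists>F w. valid w \<and> names w = N \<and> F \<in> Arr C \<and> Dom C F = A \<otimes> cod w \<and> Cod C F = B \<and>
     (\<forall>t. valid t \<longrightarrow> cod t = A \<longrightarrow> apart (names t) N \<longrightarrow> Q t = F \<rhd> \<langle>t, w\<rangle>))"

lemma linearI:
  assumes "A \<in> Obj C" "valid w" "names w = N" "F \<in> Arr C" "Dom C F = A \<otimes> cod w" "Cod C F = B"
    and "\<And>t. valid t \<Longrightarrow> cod t = A \<Longrightarrow> apart (names t) N \<Longrightarrow> Q t = F \<rhd> \<langle>t, w\<rangle>"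
  shows "linear A B N Q"
  using assms unfolding linear_def by blast

lemma linearE:
  assumes "linear A B N Q"
  obtains F w where "A \<in> Obj C" "B \<in> Obj C" "valid w" "names w = N" "F \<in> Arr C" "Dom C F = A \<otimes> cod w" "Cod C F = B"
    "\<And>t. valid t \<Longrightarrow> cod t = A \<Longrightarrow> apart (names t) N \<Longrightarrow> Q t = F \<rhd> \<langle>t, w\<rangle>"
  using assms unfolding linear_def by (metis Cod_Obj)

lemma linear_id: "A \<in> Obj C \<Longrightarrow> linear A A {} (\<lambda>t. t)"
  by (rule linearI[where w = un and F = "\<r> A"]) simp_all

lemma linear_app:
  assumes "linear A B N Q" "f \<in> Arr C" "Dom C f = B"
  shows "linear A (Cod C f) N (\<lambda>t. f \<rhd> Q t)"
  using assms(1)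
proof (rule linearE)
  fix F w
  assume "A \<in> Obj C" "B \<in> Obj C" "valid w" "names w = N" "F \<in> Arr C" "Dom C F = A \<otimes> cod w" "Cod C F = B"
    "\<And>t. valid t \<Longrightarrow> cod t = A \<Longrightarrow> apart (names t) N \<Longrightarrow> Q t = F \<rhd> \<langle>t, w\<rangle>"
  then show ?thesis using assms by (intro linearI[where w = w and F = "f \<cdot> F"]) simp_all
qed

lemma linear_pair_left:
  assumes "linear A B N Q" "valid y"
  shows "linear A (B \<otimes> cod y) (N \<union> names y) (\<lambda>t. \<langle>Q t, y\<rangle>)"
  using assms(1)
proof (rule linearE)
  fix F w
  assume "A \<in> Obj C" "B \<in> Obj C" "valid w" "names w = N" "F \<in> Arr C" "Dom C F = A \<otimes> cod w" "Cod C F = B"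
    "\<And>t. valid t \<Longrightarrow> cod t = A \<Longrightarrow> apart (names t) N \<Longrightarrow> Q t = F \<rhd> \<langle>t, w\<rangle>"
  then show ?thesis using assms
    by (intro linearI[where w = "\<langle>w, y\<rangle>" and F = "(F \<odot> \<one> (cod y)) \<cdot> (\<a> A (cod w) (cod y))\<^sup>\<dagger>"]) simp_all
qed

lemma linear_pair_right:
  assumes "linear A B N Q" "valid y" "apart (names y) N"
  shows "linear A (cod y \<otimes> B) (N \<union> names y) (\<lambda>t. \<langle>y, Q t\<rangle>)"
  using assms(1)
proof (rule linearE)
  fix F w
  assume *: "A \<in> Obj C" "B \<in> Obj C" "valid w" "names w = N" "F \<in> Arr C" "Dom C F = A \<otimes> cod w" "Cod C F = B"
    "\<And>t. valid t \<Longrightarrow> cod t = A \<Longrightarrow> apart (names t) N \<Longrightarrow> Q t = F \<rhd> \<langle>t, w\<rangle>"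
  then have "apart (names y) (names w)" using assms(3) by simp
  with * show ?thesis using assms(2)
    by (intro linearI[where w = "\<langle>w, y\<rangle>" and F = "\<sigma> B (cod y) \<cdot> (F \<odot> \<one> (cod y)) \<cdot> (\<a> A (cod w) (cod y))\<^sup>\<dagger>"]) simp_all
qed

lemma linear_scale_left:
  assumes "linear A B N Q" "B = \<I>" "valid y"
  shows "linear A (cod y) (N \<union> names y) (\<lambda>t. Q t \<bullet> y)"
  unfolding scale_def using linear_app[OF linear_pair_left[OF assms(1,3)], of "\<l> (cod y)"] assms by simp

lemma linear_scale_right:
  assumes "linear A B N Q" "valid s" "cod s = \<I>" "apart (names s) N"
  shows "linear A B (N \<union> names s) (\<lambda>t. s \<bullet> Q t)"
  using assms(1)
proof (rule linearE)
  fix F w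
  assume *: "A \<in> Obj C" "B \<in> Obj C" "valid w" "names w = N" "F \<in> Arr C" "Dom C F = A \<otimes> cod w" "Cod C F = B"
    "\<And>t. valid t \<Longrightarrow> cod t = A \<Longrightarrow> apart (names t) N \<Longrightarrow> Q t = F \<rhd> \<langle>t, w\<rangle>"
  then have "apart (names s) (names w)" using assms(4) by simp
  with * show ?thesis using assms(2,3)
    by (intro linearI[where w = "\<langle>w, s\<rangle>" and F = "\<l> B \<cdot> \<sigma> B \<I> \<cdot> (F \<odot> \<one> \<I>) \<cdot> (\<a> A (cod w) \<I>)\<^sup>\<dagger>"]) simp_all
qed

text \<open>These rules follow the syntax: they cover every expression built by application, pairing
  and scaling in which the argument occurs exactly once.\<close>

lemmas linear_intros = linear_id linear_app linear_pair_left linear_pair_right linear_scale_left linear_scale_right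

lemma finite_names: "finite (names x)"
  by (simp add: names_def)

text \<open>The element \<open>t\<close>, for instance a cup, need not be a pair. But both functions
  are post-compositions with fixed morphisms \<open>F\<close> and \<open>G\<close>, and such
  morphisms are already compared at a pair of fresh variables.\<close>

lemma linear_eq_on_pairs:
  assumes lin: "linear (A \<otimes> B) D N Q" "linear (A \<otimes> B) D' N' Q'"
    and AB: "A \<in> Obj C" "B \<in> Obj C"
    and t: "valid t" "cod t = A \<otimes> B" "apart (names t) N" "apart (names t) N'"
    and eq: "\<And>x y. \<lbrakk>valid x; valid y; cod x = A; cod y = B; apart (names x) (names y);
      apart (names x) N; apart (names x) N'; apart (names y) N; apart (names y) N'\<rbrakk> \<Longrightarrow> Q \<langle>x, y\<rangle> = Q' \<langle>x, y\<rangle>"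
  shows "Q t = Q' t"
proof -
  from lin(1) obtain F w where F: "valid w" "names w = N" "F \<in> Arr C" "Dom C F = (A \<otimes> B) \<otimes> cod w" "Cod C F = D"
    "\<And>t. valid t \<Longrightarrow> cod t = A \<otimes> B \<Longrightarrow> apart (names t) N \<Longrightarrow> Q t = F \<rhd> \<langle>t, w\<rangle>" by (rule linearE) blast
  from lin(2) obtain G v where G: "valid v" "names v = N'" "G \<in> Arr C" "Dom C G = (A \<otimes> B) \<otimes> cod v" "Cod C G = D'"
    "\<And>t. valid t \<Longrightarrow> cod t = A \<otimes> B \<Longrightarrow> apart (names t) N' \<Longrightarrow> Q' t = G \<rhd> \<langle>t, v\<rangle>" by (rule linearE) blast
  \<comment> \<open>Two names above all those in use are chosen, so that the new variables come last
    in both contexts.\<close>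
  have "finite (N \<union> N')" using F(2) G(2) finite_names by blast
  then obtain i where i: "\<forall>n \<in> N \<union> N'. n < i" using finite_nat_set_iff_bounded by auto
  then have fr: "apart {i} N" "apart {i} N'" "apart {Suc i} N" "apart {Suc i} N'"
    unfolding disjnt_def by (auto dest: Suc_lessD)
  let ?p = "\<langle>var i A, var (Suc i) B\<rangle>"
  have cp: "ctx ?p = [(i, A), (Suc i, B)]" by (simp add: pair_def var_def)
  have e: "F \<rhd> \<langle>?p, w\<rangle> = G \<rhd> \<langle>?p, v\<rangle>"
    using eq[of "var i A" "var (Suc i) B"] F(6)[of ?p] G(6)[of ?p] fr AB by (simp add: disjnt_def)
  \<comment> \<open>Equal elements have equal contexts. Since the fresh variables are appended at
    the end, cancelling them shows that \<open>w\<close> and \<open>v\<close> have the same list of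
    variables.\<close>
  have "merge (ctx ?p) (ctx w) = merge (ctx ?p) (ctx v)"
    using arg_cong[OF e, of ctx] by (simp add: app_def pair_def)
  moreover have "merge (ctx ?p) (ctx w) = ctx w @ [(i, A), (Suc i, B)]" unfolding cp
    by (rule merge_above) (use i F(2) in \<open>auto simp: names_def\<close>)
  moreover have "merge (ctx ?p) (ctx v) = ctx v @ [(i, A), (Suc i, B)]" unfolding cp
    by (rule merge_above) (use i G(2) in \<open>auto simp: names_def\<close>)
  ultimately have c: "ctx v = ctx w" by simp
  let ?P = "ctx_ob (ctx w)"
  \<comment> \<open>The generic element of the common context. Both \<open>w\<close> and
    \<open>v\<close> are images of it, and it is free, so the equation becomes one between morphisms
    that can be applied to \<open>t\<close> as well.\<close>
  let ?\<theta> = "Elem (ctx w) (\<one> ?P) ?P"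
  have okw: "valid_ctx (ctx w)" "?P \<in> Obj C" using F(1) by (auto simp: valid_def)
  have th: "free ?\<theta>" "valid ?\<theta>" "cod ?\<theta> = ?P" "names ?\<theta> = N"
    using okw F(2) by (simp_all add: free_def valid_def unitary_Id names_def)
  have vw: "val w \<in> Arr C" "Dom C (val w) = ?P" "Cod C (val w) = cod w"
    "val v \<in> Arr C" "Dom C (val v) = ?P" "Cod C (val v) = cod v"
    using F(1) G(1) c by (auto simp: valid_def)
  have wv: "val w \<rhd> ?\<theta> = w" "val v \<rhd> ?\<theta> = v"
    using vw okw c by (auto intro!: elem_eqI simp: app_def)
  let ?F = "F \<cdot> (\<one> (A \<otimes> B) \<odot> val w)" and ?G = "G \<cdot> (\<one> (A \<otimes> B) \<odot> val v)"
  have "?F = ?G"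
  proof (rule free_ext)
    show "free \<langle>?p, ?\<theta>\<rangle>" using AB th by (intro free_pair free_var) simp_all
    show "?F \<rhd> \<langle>?p, ?\<theta>\<rangle> = ?G \<rhd> \<langle>?p, ?\<theta>\<rangle>" using AB vw F(3,4) G(3,4) th(2,3) e by (simp add: wv)
  qed (use AB F G vw th in simp_all)
  have "Q t = ?F \<rhd> \<langle>t, ?\<theta>\<rangle>" using F t th vw AB by (simp add: wv)
  also have "\<dots> = Q' t" unfolding \<open>?F = ?G\<close> using G t th vw AB by (simp add: wv)
  finally show ?thesis .
qed

section \<open>Exchanging and contracting the inner two of four factors; dual pairs\<close>

lemma mid_swap_typing [simp]:
  assumes "A \<in> Obj C" "B \<in> Obj C" "D \<in> Obj C" "E \<in> Obj C"
  shows "mid_swap A B D E \<in> Arr C" "Dom C (mid_swap A B D E) = (A \<otimes> B) \<otimes> (D \<otimes> E)"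
    "Cod C (mid_swap A B D E) = (A \<otimes> D) \<otimes> (B \<otimes> E)"
  using assms by (simp_all add: mid_swap_def)

lemma app_mid_swap [simp]:
  assumes "valid x" "valid y" "valid z" "valid w" "cod x = A" "cod y = B" "cod z = D" "cod w = E" "disjnt (names y) (names z)"
  shows "mid_swap A B D E \<rhd> \<langle>\<langle>x, y\<rangle>, \<langle>z, w\<rangle>\<rangle> = \<langle>\<langle>x, z\<rangle>, \<langle>y, w\<rangle>\<rangle>"
proof -
  have "A \<in> Obj C" "B \<in> Obj C" "D \<in> Obj C" "E \<in> Obj C" using assms by auto
  then show ?thesis using assms by (simp add: mid_swap_def)
qed

lemma dagger_mid_swap [simp]:
  assumes "A \<in> Obj C" "B \<in> Obj C" "D \<in> Obj C" "E \<in> Obj C"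
  shows "(mid_swap A B D E)\<^sup>\<dagger> = mid_swap A D B E"
  using assms by (simp add: mid_swap_def dagger_Comp comp_assoc)

lemma mid_cap_typing [simp]:
  assumes "P \<in> Obj C" "Q \<in> Obj C" "R \<in> Obj C" "S \<in> Obj C" "e \<in> Arr C" "Dom C e = Q \<otimes> R" "Cod C e = \<I>"
  shows "mid_cap P Q R S e \<in> Arr C" "Dom C (mid_cap P Q R S e) = (P \<otimes> Q) \<otimes> (R \<otimes> S)"
    "Cod C (mid_cap P Q R S e) = P \<otimes> S"
  using assms by (simp_all add: mid_cap_def)

lemma app_mid_cap [simp]:
  assumes "valid p" "valid q" "valid r" "valid s" "cod p = P" "cod q = Q" "cod r = R" "cod s = S"
    "e \<in> Arr C" "Dom C e = Q \<otimes> R" "Cod C e = \<I>" "disjnt (names q) (names p)" "disjnt (names r) (names p)"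
  shows "mid_cap P Q R S e \<rhd> \<langle>\<langle>p, q\<rangle>, \<langle>r, s\<rangle>\<rangle> = (e \<rhd> \<langle>q, r\<rangle>) \<bullet> \<langle>p, s\<rangle>"
proof -
  have "P \<in> Obj C" "Q \<in> Obj C" "R \<in> Obj C" "S \<in> Obj C" using assms by auto
  then show ?thesis using assms by (simp add: mid_cap_def)
qed

text \<open>The inserted cup \<open>e\<^sup>\<dagger> \<rhd> un\<close> is left unexpanded, so that
  \<open>linear_eq_on_pairs\<close> can put a pair in its place.\<close>

lemma app_mid_cap_dagger [simp]:
  assumes "valid p" "valid s" "cod p = P" "cod s = S" "Q \<in> Obj C" "R \<in> Obj C"
    "e \<in> Arr C" "Dom C e = Q \<otimes> R" "Cod C e = \<I>"
  shows "(mid_cap P Q R S e)\<^sup>\<dagger> \<rhd> \<langle>p, s\<rangle> = (\<a> P Q (R \<otimes> S))\<^sup>\<dagger> \<rhd> \<langle>p, \<a> Q R S \<rhd> \<langle>e\<^sup>\<dagger> \<rhd> un, s\<rangle>\<rangle>"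
proof -
  have "P \<in> Obj C" "S \<in> Obj C" using assms by auto
  then show ?thesis using assms by (simp add: mid_cap_def dagger_Comp comp_assoc)
qed

text \<open>For a pairing \<open>p\<close> of \<open>A'\<close> with \<open>A\<close>, an element of \<open>A' \<otimes> B\<close> acts as a function from \<open>A\<close> to \<open>B\<close>.\<close>

definition evaluation :: "'o \<Rightarrow> 'o \<Rightarrow> 'm \<Rightarrow> 'o \<Rightarrow> 'm" where
  "evaluation A' A p B = \<l> B \<cdot> (p \<odot> \<one> B) \<cdot> (\<a> A' A B)\<^sup>\<dagger> \<cdot> (\<one> A' \<odot> \<sigma> B A) \<cdot> \<a> A' B A"

text \<open>The transpose of \<open>evaluation\<close>: the leg in \<open>A\<close> is contracted
  with an argument from \<open>A'\<close> and the leg in \<open>A'\<close> is the result.\<close>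

definition coevaluation :: "'o \<Rightarrow> 'o \<Rightarrow> 'm \<Rightarrow> 'm" where
  "coevaluation A' A p = \<r> A' \<cdot> (\<one> A' \<odot> (p \<cdot> \<sigma> A A')) \<cdot> \<a> A' A A'"

lemma evaluation_typing [simp]:
  assumes "A' \<in> Obj C" "A \<in> Obj C" "B \<in> Obj C" "p \<in> Arr C" "Dom C p = A' \<otimes> A" "Cod C p = \<I>"
  shows "evaluation A' A p B \<in> Arr C" "Dom C (evaluation A' A p B) = (A' \<otimes> B) \<otimes> A"
    "Cod C (evaluation A' A p B) = B"
  using assms by (simp_all add: evaluation_def)

lemma coevaluation_typing [simp]:
  assumes "A' \<in> Obj C" "A \<in> Obj C" "p \<in> Arr C" "Dom C p = A' \<otimes> A" "Cod C p = \<I>"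
  shows "coevaluation A' A p \<in> Arr C" "Dom C (coevaluation A' A p) = (A' \<otimes> A) \<otimes> A'"
    "Cod C (coevaluation A' A p) = A'"
  using assms by (simp_all add: coevaluation_def)

lemma app_evaluation [simp]:
  assumes "valid a" "valid b" "valid y" "cod a = A'" "cod b = B" "cod y = A" "p \<in> Arr C" "Dom C p = A' \<otimes> A" "Cod C p = \<I>"
    "disjnt (names b) (names y)"
  shows "evaluation A' A p B \<rhd> \<langle>\<langle>a, b\<rangle>, y\<rangle> = (p \<rhd> \<langle>a, y\<rangle>) \<bullet> b"
proof -
  have "A' \<in> Obj C" "B \<in> Obj C" "A \<in> Obj C" using assms by auto
  then show ?thesis using assms by (simp add: evaluation_def)
qed

lemma app_coevaluation [simp]:
  assumes "valid a" "valid b" "valid x" "cod a = A'" "cod b = A" "cod x = A'" "p \<in> Arr C" "Dom C p = A' \<otimes> A" "Cod C p = \<I>"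
    "disjnt (names x) (names a)" "disjnt (names b) (names a)" "disjnt (names b) (names x)"
  shows "coevaluation A' A p \<rhd> \<langle>\<langle>a, b\<rangle>, x\<rangle> = (p \<rhd> \<langle>x, b\<rangle>) \<bullet> a"
proof -
  have "A' \<in> Obj C" "A \<in> Obj C" using assms by auto
  then show ?thesis using assms by (simp add: coevaluation_def)
qed

text \<open>The cup is taken to be \<open>p\<^sup>\<dagger>\<close>, and the two conditions are the
  snake equations at elements: the cup represents the identity on either side. Instances are
  \<open>tr A\<close>, the nested pairing of
  \<open>B\<^sup>\<star> \<otimes> A\<^sup>\<star>\<close> with \<open>A \<otimes> B\<close>, and
  the form of a normalisable algebra.\<close>

definition dual_pair :: "'o \<Rightarrow> 'o \<Rightarrow> 'm \<Rightarrow> bool" where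
  "dual_pair A' A p \<longleftrightarrow> A' \<in> Obj C \<and> A \<in> Obj C \<and> p \<in> hom C (A' \<otimes> A) \<I> \<and>
     (\<forall>y. valid y \<longrightarrow> cod y = A \<longrightarrow> evaluation A' A p A \<rhd> \<langle>p\<^sup>\<dagger> \<rhd> un, y\<rangle> = y) \<and>
     (\<forall>x. valid x \<longrightarrow> cod x = A' \<longrightarrow> coevaluation A' A p \<rhd> \<langle>p\<^sup>\<dagger> \<rhd> un, x\<rangle> = x)"

lemma dual_pairD:
  assumes "dual_pair A' A p"
  shows "A' \<in> Obj C" "A \<in> Obj C" "p \<in> Arr C" "Dom C p = A' \<otimes> A" "Cod C p = \<I>"
    "valid y \<Longrightarrow> cod y = A \<Longrightarrow> evaluation A' A p A \<rhd> \<langle>p\<^sup>\<dagger> \<rhd> un, y\<rangle> = y"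
    "valid x \<Longrightarrow> cod x = A' \<Longrightarrow> coevaluation A' A p \<rhd> \<langle>p\<^sup>\<dagger> \<rhd> un, x\<rangle> = x"
  using assms by (auto simp: dual_pair_def)

text \<open>The second snake equation recovers \<open>x\<close> from the cup; once the cup is
  expanded as a pair, \<open>x\<close> enters only through its pairings.\<close>

lemma dual_pair_nondegenerate:
  assumes p: "dual_pair A' A p" and x: "valid x" "valid x'" "cod x = A'" "cod x' = A'"
    and eq: "\<And>y. valid y \<Longrightarrow> cod y = A \<Longrightarrow> apart (names y) (names x) \<Longrightarrow> apart (names y) (names x') \<Longrightarrow>
      p \<rhd> \<langle>x, y\<rangle> = p \<rhd> \<langle>x', y\<rangle>"
  shows "x = x'"
proof -
  note [simp] = dual_pairD(1-5)[OF p]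
  have "coevaluation A' A p \<rhd> \<langle>p\<^sup>\<dagger> \<rhd> un, x\<rangle> = coevaluation A' A p \<rhd> \<langle>p\<^sup>\<dagger> \<rhd> un, x'\<rangle>"
    by (rule linear_eq_on_pairs[where t = "p\<^sup>\<dagger> \<rhd> un" and Q = "\<lambda>t. coevaluation A' A p \<rhd> \<langle>t, x\<rangle>"
          and Q' = "\<lambda>t. coevaluation A' A p \<rhd> \<langle>t, x'\<rangle>" and A = A' and B = A],
        (rule linear_intros | use x eq in simp)+)
  then show ?thesis using x p by (simp add: dual_pairD)
qed

text \<open>The morphism \<open>?W\<close> rebuilds an element of \<open>A' \<otimes> B\<close> from
  the function that it represents: the function is applied to the second leg of the cup, and the
  first leg is kept.\<close>

lemma evaluation_nondegenerate:
  assumes p: "dual_pair A' A p" and B: "B \<in> Obj C"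
    and x: "valid T" "valid T'" "cod T = A' \<otimes> B" "cod T' = A' \<otimes> B"
    and eq: "\<And>y. valid y \<Longrightarrow> cod y = A \<Longrightarrow> apart (names y) (names T) \<Longrightarrow> apart (names y) (names T') \<Longrightarrow>
      evaluation A' A p B \<rhd> \<langle>T, y\<rangle> = evaluation A' A p B \<rhd> \<langle>T', y\<rangle>"
  shows "T = T'"
proof -
  note [simp] = dual_pairD(1-5)[OF p] B
  let ?W = "(\<one> A' \<odot> (evaluation A' A p B \<cdot> \<sigma> A (A' \<otimes> B))) \<cdot> \<a> A' A (A' \<otimes> B)"
  have W: "?W \<rhd> \<langle>p\<^sup>\<dagger> \<rhd> un, T\<rangle> = T" if T: "valid T" "cod T = A' \<otimes> B" for T
  proof (rule linear_eq_on_pairs[where t = T and Q = "\<lambda>T. ?W \<rhd> \<langle>p\<^sup>\<dagger> \<rhd> un, T\<rangle>" and Q' = "\<lambda>T. T" and A = A' and B = B])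
    fix x b
    assume *: "valid x" "valid b" "cod x = A'" "cod b = B" "apart (names x) (names b)"
    have "?W \<rhd> \<langle>p\<^sup>\<dagger> \<rhd> un, \<langle>x, b\<rangle>\<rangle> = \<langle>coevaluation A' A p \<rhd> \<langle>p\<^sup>\<dagger> \<rhd> un, x\<rangle>, b\<rangle>"
      by (rule linear_eq_on_pairs[where t = "p\<^sup>\<dagger> \<rhd> un" and Q = "\<lambda>t. ?W \<rhd> \<langle>t, \<langle>x, b\<rangle>\<rangle>"
          and Q' = "\<lambda>t. \<langle>coevaluation A' A p \<rhd> \<langle>t, x\<rangle>, b\<rangle>" and A = A' and B = A],
        (rule linear_intros | use * in simp)+)
    then show "?W \<rhd> \<langle>p\<^sup>\<dagger> \<rhd> un, \<langle>x, b\<rangle>\<rangle> = \<langle>x, b\<rangle>" using * p by (simp add: dual_pairD)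
  qed ((rule linear_intros | use T in simp)+)
  have "?W \<rhd> \<langle>p\<^sup>\<dagger> \<rhd> un, T\<rangle> = ?W \<rhd> \<langle>p\<^sup>\<dagger> \<rhd> un, T'\<rangle>"
    by (rule linear_eq_on_pairs[where t = "p\<^sup>\<dagger> \<rhd> un" and Q = "\<lambda>t. ?W \<rhd> \<langle>t, T\<rangle>"
          and Q' = "\<lambda>t. ?W \<rhd> \<langle>t, T'\<rangle>" and A = A' and B = A],
        (rule linear_intros | use x eq in simp)+)
  then show ?thesis using W x by metis
qed

lemma dual_pair_arrow_ext:
  assumes p: "dual_pair A' A p" and f: "f \<in> Arr C" "g \<in> Arr C" "Dom C f = X" "Dom C g = X" "Cod C f = A'" "Cod C g = A'"
    and eq: "\<And>x y. valid x \<Longrightarrow> valid y \<Longrightarrow> cod x = X \<Longrightarrow> cod y = A \<Longrightarrow> apart (names x) (names y) \<Longrightarrow>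
      p \<rhd> \<langle>f \<rhd> x, y\<rangle> = p \<rhd> \<langle>g \<rhd> x, y\<rangle>"
  shows "f = g"
proof (rule arrow_ext[where A = X])
  fix x assume "valid x" "cod x = X"
  with f show "f \<rhd> x = g \<rhd> x"
    by - (rule dual_pair_nondegenerate[OF p], simp_all add: eq)
qed (use f in simp_all)

lemma evaluation_arrow_ext:
  assumes p: "dual_pair A' A p" and f: "f \<in> Arr C" "g \<in> Arr C" "Dom C f = X" "Dom C g = X"
      "B \<in> Obj C" "Cod C f = A' \<otimes> B" "Cod C g = A' \<otimes> B"
    and eq: "\<And>x y. valid x \<Longrightarrow> valid y \<Longrightarrow> cod x = X \<Longrightarrow> cod y = A \<Longrightarrow> apart (names x) (names y) \<Longrightarrow>
      evaluation A' A p B \<rhd> \<langle>f \<rhd> x, y\<rangle> = evaluation A' A p B \<rhd> \<langle>g \<rhd> x, y\<rangle>"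
  shows "f = g"
proof (rule arrow_ext[where A = X])
  fix x assume "valid x" "cod x = X"
  with f show "f \<rhd> x = g \<rhd> x"
    by - (rule evaluation_nondegenerate[OF p], simp_all, rule eq, simp_all)
qed (use f in simp_all)

text \<open>Uniqueness of duals, with unitarity supplied by the dagger. The map \<open>c\<close>
  carries one cup to the other; the dagger of this fact says that \<open>c\<^sup>\<dagger>\<close>
  respects the pairings in the opposite direction, so that both composites are identities by
  nondegeneracy.\<close>

lemma dual_pair_comparison:
  assumes p: "dual_pair A' A p" and q: "dual_pair A'' A q" and c: "c \<in> Arr C" "Dom C c = A'" "Cod C c = A''"
    and eq: "\<And>x y. valid x \<Longrightarrow> valid y \<Longrightarrow> cod x = A' \<Longrightarrow> cod y = A \<Longrightarrow> apart (names x) (names y) \<Longrightarrow>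
      q \<rhd> \<langle>c \<rhd> x, y\<rangle> = p \<rhd> \<langle>x, y\<rangle>"
  shows "unitary A' A'' c"
proof -
  note [simp] = dual_pairD(1-5)[OF p] dual_pairD(1-5)[OF q] c
  \<comment> \<open>Both sides represent the identity function of \<open>A\<close>.\<close>
  have "(c \<odot> \<one> A) \<cdot> p\<^sup>\<dagger> = q\<^sup>\<dagger>"
  proof (rule arrow_ext_un)
    have "evaluation A'' A q A \<rhd> \<langle>(c \<odot> \<one> A) \<rhd> p\<^sup>\<dagger> \<rhd> un, y\<rangle> = evaluation A' A p A \<rhd> \<langle>p\<^sup>\<dagger> \<rhd> un, y\<rangle>"
      if "valid y" "cod y = A" for y
      by (rule linear_eq_on_pairs[where t = "p\<^sup>\<dagger> \<rhd> un" and Q = "\<lambda>t. evaluation A'' A q A \<rhd> \<langle>(c \<odot> \<one> A) \<rhd> t, y\<rangle>"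
          and Q' = "\<lambda>t. evaluation A' A p A \<rhd> \<langle>t, y\<rangle>" and A = A' and B = A],
        (rule linear_intros | use that in \<open>simp add: eq\<close>)+)
    then have e: "evaluation A'' A q A \<rhd> \<langle>(c \<odot> \<one> A) \<rhd> p\<^sup>\<dagger> \<rhd> un, y\<rangle> = evaluation A'' A q A \<rhd> \<langle>q\<^sup>\<dagger> \<rhd> un, y\<rangle>"
      if "valid y" "cod y = A" for y
      using that p q by (simp only: dual_pairD)
    have "(c \<odot> \<one> A) \<rhd> p\<^sup>\<dagger> \<rhd> un = q\<^sup>\<dagger> \<rhd> un"
      by (rule evaluation_nondegenerate[OF q dual_pairD(2)[OF p]]) (simp_all add: e)
    then show "((c \<odot> \<one> A) \<cdot> p\<^sup>\<dagger>) \<rhd> un = q\<^sup>\<dagger> \<rhd> un" by simp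
  qed simp_all
  from arg_cong[OF this, of "\<lambda>f. f\<^sup>\<dagger>"] have pc: "p \<cdot> (c\<^sup>\<dagger> \<odot> \<one> A) = q" by (simp add: dagger_Comp)
  have c': "p \<rhd> \<langle>c\<^sup>\<dagger> \<rhd> x, y\<rangle> = q \<rhd> \<langle>x, y\<rangle>" if "valid x" "valid y" "cod x = A''" "cod y = A" for x y
    unfolding pc[symmetric] using that by simp
  show ?thesis
  proof (rule unitaryI)
    show "c\<^sup>\<dagger> \<cdot> c = \<one> A'"
      by (rule dual_pair_arrow_ext[OF p, where X = A']) (simp_all add: c' eq)
    show "c \<cdot> c\<^sup>\<dagger> = \<one> A''"
      by (rule dual_pair_arrow_ext[OF q, where X = A'']) (simp_all add: c' eq)
  qed simp_all
qed

lemma TensorO_ext_right: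
  assumes "A \<in> Obj C" "B \<in> Obj C" "D \<in> Obj C" "f \<in> Arr C" "g \<in> Arr C"
    "Dom C f = A \<otimes> (B \<otimes> D)" "Dom C g = A \<otimes> (B \<otimes> D)"
    and "\<And>x y z. valid x \<Longrightarrow> valid y \<Longrightarrow> valid z \<Longrightarrow> cod x = A \<Longrightarrow> cod y = B \<Longrightarrow> cod z = D \<Longrightarrow>
      apart (names x) (names y) \<Longrightarrow> apart (names x) (names z) \<Longrightarrow> apart (names y) (names z) \<Longrightarrow>
      f \<rhd> \<langle>x, \<langle>y, z\<rangle>\<rangle> = g \<rhd> \<langle>x, \<langle>y, z\<rangle>\<rangle>"
  shows "f = g"
  using assms by (intro free_ext[of "\<langle>var 0 A, \<langle>var 1 B, var 2 D\<rangle>\<rangle>" f g] free_pair free_var)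
    (simp_all add: disjnt_def)

text \<open>For an action of \<open>P\<close> on \<open>A\<close> and one of \<open>Q\<close> on
  \<open>B\<close>, this is the factorwise action of \<open>P \<otimes> Q\<close> on
  \<open>A \<otimes> B\<close>.\<close>

definition par :: "'o \<Rightarrow> 'o \<Rightarrow> 'm \<Rightarrow> 'o \<Rightarrow> 'o \<Rightarrow> 'm \<Rightarrow> 'm" where
  "par P A e Q B e' = (e \<odot> e') \<cdot> mid_swap P Q A B"

lemma par_typing [simp]:
  assumes "P \<in> Obj C" "A \<in> Obj C" "Q \<in> Obj C" "B \<in> Obj C" "e \<in> Arr C" "e' \<in> Arr C"
    "Dom C e = P \<otimes> A" "Dom C e' = Q \<otimes> B"
  shows "par P A e Q B e' \<in> Arr C" "Dom C (par P A e Q B e') = (P \<otimes> Q) \<otimes> (A \<otimes> B)"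
    "Cod C (par P A e Q B e') = Cod C e \<otimes> Cod C e'"
  using assms by (simp_all add: par_def)

lemma app_par [simp]:
  assumes "valid S" "valid R" "valid y" "valid w" "cod S = P" "cod R = Q" "cod y = A" "cod w = B" "e \<in> Arr C" "e' \<in> Arr C"
    "Dom C e = P \<otimes> A" "Dom C e' = Q \<otimes> B" "disjnt (names R) (names y)"
  shows "par P A e Q B e' \<rhd> \<langle>\<langle>S, R\<rangle>, \<langle>y, w\<rangle>\<rangle> = \<langle>e \<rhd> \<langle>S, y\<rangle>, e' \<rhd> \<langle>R, w\<rangle>\<rangle>"
proof -
  have "P \<in> Obj C" "A \<in> Obj C" "Q \<in> Obj C" "B \<in> Obj C" using assms by auto
  then show ?thesis using assms by (simp add: par_def)
qed

lemma app_left_swap [simp]: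
  assumes "valid y" "valid p" "valid q" "cod y = Y" "cod p = P" "cod q = Q" "disjnt (names y) (names p)"
  shows "left_swap Y P Q \<rhd> \<langle>y, \<langle>p, q\<rangle>\<rangle> = \<langle>p, \<langle>y, q\<rangle>\<rangle>"
proof -
  have "Y \<in> Obj C" "P \<in> Obj C" "Q \<in> Obj C" using assms by auto
  then show ?thesis using assms by (simp add: left_swap_def)
qed

end


section \<open>Dagger Frobenius algebras\<close>

context dagger_symmetric_monoidal_category
begin

lemma dagger_frobeniusD:
  assumes "dagger_frobenius_algebra M"
  shows "Car M \<in> Obj C" "Mult M \<in> Arr C" "Dom C (Mult M) = Car M \<otimes> Car M" "Cod C (Mult M) = Car M"
    "Unt M \<in> Arr C" "Dom C (Unt M) = \<I>" "Cod C (Unt M) = Car M"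
  using assms by (auto simp: dagger_frobenius_algebra_def frobenius_algebra_def monoid_structure_def)

lemma dagger_frobenius_eqs:
  assumes "dagger_frobenius_algebra M"
  shows "Mult M \<cdot> (Mult M \<odot> \<one> (Car M)) = Mult M \<cdot> (\<one> (Car M) \<odot> Mult M) \<cdot> \<a> (Car M) (Car M) (Car M)"
    "Mult M \<cdot> (Unt M \<odot> \<one> (Car M)) = \<l> (Car M)" "Mult M \<cdot> (\<one> (Car M) \<odot> Unt M) = \<r> (Car M)"
    "\<l> (Car M) \<cdot> ((Unt M)\<^sup>\<dagger> \<odot> \<one> (Car M)) \<cdot> (Mult M)\<^sup>\<dagger> = \<one> (Car M)"
    "\<r> (Car M) \<cdot> (\<one> (Car M) \<odot> (Unt M)\<^sup>\<dagger>) \<cdot> (Mult M)\<^sup>\<dagger> = \<one> (Car M)"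
    "(\<one> (Car M) \<odot> Mult M) \<cdot> \<a> (Car M) (Car M) (Car M) \<cdot> ((Mult M)\<^sup>\<dagger> \<odot> \<one> (Car M)) = (Mult M)\<^sup>\<dagger> \<cdot> Mult M"
    "(Mult M \<odot> \<one> (Car M)) \<cdot> (\<a> (Car M) (Car M) (Car M))\<^sup>\<dagger> \<cdot> (\<one> (Car M) \<odot> (Mult M)\<^sup>\<dagger>) = (Mult M)\<^sup>\<dagger> \<cdot> Mult M"
  using assms by (auto simp: dagger_frobenius_algebra_def frobenius_algebra_def monoid_structure_def comonoid_structure_def)

text \<open>The comonoid laws and the other Frobenius equation are the daggers of the laws that are
  assumed.\<close>

lemma dagger_frobeniusI:
  fixes A m u
  assumes [simp]: "A \<in> Obj C" "m \<in> Arr C" "Dom C m = A \<otimes> A" "Cod C m = A" "u \<in> Arr C" "Dom C u = \<I>" "Cod C u = A"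
    and as: "m \<cdot> (m \<odot> \<one> A) = m \<cdot> (\<one> A \<odot> m) \<cdot> \<a> A A A"
    and ul: "m \<cdot> (u \<odot> \<one> A) = \<l> A" and ur: "m \<cdot> (\<one> A \<odot> u) = \<r> A"
    and fr: "(\<one> A \<odot> m) \<cdot> \<a> A A A \<cdot> (m\<^sup>\<dagger> \<odot> \<one> A) = m\<^sup>\<dagger> \<cdot> m"
  shows "dagger_frobenius_algebra \<lparr>Car = A, Mult = m, Unt = u\<rparr>"
proof -
  have 1: "(m\<^sup>\<dagger> \<odot> \<one> A) \<cdot> m\<^sup>\<dagger> = (\<a> A A A)\<^sup>\<dagger> \<cdot> (\<one> A \<odot> m\<^sup>\<dagger>) \<cdot> m\<^sup>\<dagger>"
    using arg_cong[OF as, of "\<lambda>f. f\<^sup>\<dagger>"] by (simp add: dagger_Comp comp_assoc)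
  have 2: "(u\<^sup>\<dagger> \<odot> \<one> A) \<cdot> m\<^sup>\<dagger> = (\<l> A)\<^sup>\<dagger>" "(\<one> A \<odot> u\<^sup>\<dagger>) \<cdot> m\<^sup>\<dagger> = (\<r> A)\<^sup>\<dagger>"
    using arg_cong[OF ul, of "\<lambda>f. f\<^sup>\<dagger>"] arg_cong[OF ur, of "\<lambda>f. f\<^sup>\<dagger>"] by (simp_all add: dagger_Comp)
  have 3: "(m \<odot> \<one> A) \<cdot> (\<a> A A A)\<^sup>\<dagger> \<cdot> (\<one> A \<odot> m\<^sup>\<dagger>) = m\<^sup>\<dagger> \<cdot> m"
    using arg_cong[OF fr, of "\<lambda>f. f\<^sup>\<dagger>"] by (simp add: dagger_Comp comp_assoc)
  show ?thesis
    by (simp add: dagger_frobenius_algebra_def frobenius_algebra_def monoid_structure_def comonoid_structure_def hom_def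
        as ul ur fr 1 2 3)
qed

lemma mult_assoc:
  assumes M: "dagger_frobenius_algebra M" and xyz: "valid x" "valid y" "valid z" "cod x = Car M" "cod y = Car M" "cod z = Car M"
  shows "Mult M \<rhd> \<langle>Mult M \<rhd> \<langle>x, y\<rangle>, z\<rangle> = Mult M \<rhd> \<langle>x, Mult M \<rhd> \<langle>y, z\<rangle>\<rangle>"
  using arg_cong[OF dagger_frobenius_eqs(1)[OF M], of "\<lambda>f. f \<rhd> \<langle>\<langle>x, y\<rangle>, z\<rangle>"] xyz dagger_frobeniusD[OF M] by simp

lemma mult_unit:
  assumes M: "dagger_frobenius_algebra M" and x: "valid x" "cod x = Car M"
  shows "Mult M \<rhd> \<langle>Unt M \<rhd> un, x\<rangle> = x" "Mult M \<rhd> \<langle>x, Unt M \<rhd> un\<rangle> = x"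
  using arg_cong[OF dagger_frobenius_eqs(2)[OF M], of "\<lambda>f. f \<rhd> \<langle>un, x\<rangle>"] arg_cong[OF dagger_frobenius_eqs(3)[OF M], of "\<lambda>f. f \<rhd> \<langle>x, un\<rangle>"] x dagger_frobeniusD[OF M]
  by simp_all

lemma mult_counit:
  assumes M: "dagger_frobenius_algebra M" and x: "valid x" "cod x = Car M"
  shows "\<l> (Car M) \<rhd> ((Unt M)\<^sup>\<dagger> \<odot> \<one> (Car M)) \<rhd> (Mult M)\<^sup>\<dagger> \<rhd> x = x"
    "\<r> (Car M) \<rhd> (\<one> (Car M) \<odot> (Unt M)\<^sup>\<dagger>) \<rhd> (Mult M)\<^sup>\<dagger> \<rhd> x = x"
  using arg_cong[OF dagger_frobenius_eqs(4)[OF M], of "\<lambda>f. f \<rhd> x"] arg_cong[OF dagger_frobenius_eqs(5)[OF M], of "\<lambda>f. f \<rhd> x"] x dagger_frobeniusD[OF M]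
  by simp_all

lemma mult_frobenius:
  assumes M: "dagger_frobenius_algebra M" and xy: "valid x" "cod x = Car M" "valid y" "cod y = Car M"
  shows "(\<one> (Car M) \<odot> Mult M) \<rhd> \<a> (Car M) (Car M) (Car M) \<rhd> \<langle>(Mult M)\<^sup>\<dagger> \<rhd> x, y\<rangle> = (Mult M)\<^sup>\<dagger> \<rhd> Mult M \<rhd> \<langle>x, y\<rangle>"
    "(Mult M \<odot> \<one> (Car M)) \<rhd> (\<a> (Car M) (Car M) (Car M))\<^sup>\<dagger> \<rhd> \<langle>x, (Mult M)\<^sup>\<dagger> \<rhd> y\<rangle> = (Mult M)\<^sup>\<dagger> \<rhd> Mult M \<rhd> \<langle>x, y\<rangle>"
  using arg_cong[OF dagger_frobenius_eqs(6)[OF M], of "\<lambda>f. f \<rhd> \<langle>x, y\<rangle>"] arg_cong[OF dagger_frobenius_eqs(7)[OF M], of "\<lambda>f. f \<rhd> \<langle>x, y\<rangle>"] xy dagger_frobeniusD[OF M]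
  by simp_all

section \<open>Tensor products of Frobenius algebras and of central positive definite maps\<close>

lemma tensor_algebra_simps [simp]:
  "Car (tensor_algebra M N) = Car M \<otimes> Car N"
  "Mult (tensor_algebra M N) = (Mult M \<odot> Mult N) \<cdot> mid_swap (Car M) (Car N) (Car M) (Car N)"
  "Unt (tensor_algebra M N) = (Unt M \<odot> Unt N) \<cdot> (\<l> \<I>)\<^sup>\<dagger>"
  by (simp_all add: tensor_algebra_def)

lemma unit_algebra_simps [simp]:
  "Car unit_algebra = \<I>" "Mult unit_algebra = \<l> \<I>" "Unt unit_algebra = \<one> \<I>"
  by (simp_all add: unit_algebra_def)

lemma dagger_frobenius_unit: "dagger_frobenius_algebra unit_algebra"
  unfolding unit_algebra_def
proof (rule dagger_frobeniusI)
  show "\<l> \<I> \<cdot> (\<l> \<I> \<odot> \<one> \<I>) = \<l> \<I> \<cdot> (\<one> \<I> \<odot> \<l> \<I>) \<cdot> \<a> \<I> \<I> \<I>"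
    by (rule free_ext[of "\<langle>\<langle>un, un\<rangle>, un\<rangle>"], intro free_pair free_un) simp_all
  show "(\<one> \<I> \<odot> \<l> \<I>) \<cdot> \<a> \<I> \<I> \<I> \<cdot> ((\<l> \<I>)\<^sup>\<dagger> \<odot> \<one> \<I>) = (\<l> \<I>)\<^sup>\<dagger> \<cdot> \<l> \<I>"
    by (rule free_ext[of "\<langle>un, un\<rangle>"], intro free_pair free_un) (simp_all del: Lunit_typing(4))
qed (simp_all add: lunit_unit)

lemma dagger_frobenius_tensor:
  assumes M: "dagger_frobenius_algebra M" and N: "dagger_frobenius_algebra N"
  shows "dagger_frobenius_algebra (tensor_algebra M N)"
  unfolding tensor_algebra_def
proof (rule dagger_frobeniusI)
  note [simp] = dagger_frobeniusD[OF M] dagger_frobeniusD[OF N]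
  let ?A = "Car M" and ?B = "Car N" and ?m = "Mult M" and ?n = "Mult N"
  let ?s = "mid_swap ?A ?B ?A ?B"
  let ?\<mu> = "(?m \<odot> ?n) \<cdot> ?s" and ?u = "(Unt M \<odot> Unt N) \<cdot> (\<l> \<I>)\<^sup>\<dagger>" and ?X = "?A \<otimes> ?B"
  let ?x = "\<langle>var 0 ?A, var 1 ?B\<rangle>" and ?y = "\<langle>var 2 ?A, var 3 ?B\<rangle>" and ?z = "\<langle>var 4 ?A, var 5 ?B\<rangle>"
  show "?\<mu> \<cdot> (?\<mu> \<odot> \<one> ?X) = ?\<mu> \<cdot> (\<one> ?X \<odot> ?\<mu>) \<cdot> \<a> ?X ?X ?X"
  proof (rule free_ext)
    show "free \<langle>\<langle>?x, ?y\<rangle>, ?z\<rangle>" by (intro free_pair free_var) simp_all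
    show "(?\<mu> \<cdot> (?\<mu> \<odot> \<one> ?X)) \<rhd> \<langle>\<langle>?x, ?y\<rangle>, ?z\<rangle> = (?\<mu> \<cdot> (\<one> ?X \<odot> ?\<mu>) \<cdot> \<a> ?X ?X ?X) \<rhd> \<langle>\<langle>?x, ?y\<rangle>, ?z\<rangle>"
      by (simp add: disjnt_def mult_assoc[OF M] mult_assoc[OF N])
  qed simp_all
  show "?\<mu> \<cdot> (?u \<odot> \<one> ?X) = \<l> ?X"
  proof (rule free_ext)
    show "free \<langle>un, ?x\<rangle>" by (intro free_pair free_var free_un) simp_all
    show "(?\<mu> \<cdot> (?u \<odot> \<one> ?X)) \<rhd> \<langle>un, ?x\<rangle> = \<l> ?X \<rhd> \<langle>un, ?x\<rangle>"
      by (simp add: mult_unit[OF M] mult_unit[OF N])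
  qed simp_all
  show "?\<mu> \<cdot> (\<one> ?X \<odot> ?u) = \<r> ?X"
  proof (rule free_ext)
    show "free \<langle>?x, un\<rangle>" by (intro free_pair free_var free_un) simp_all
    show "(?\<mu> \<cdot> (\<one> ?X \<odot> ?u)) \<rhd> \<langle>?x, un\<rangle> = \<r> ?X \<rhd> \<langle>?x, un\<rangle>"
      by (simp add: mult_unit[OF M] mult_unit[OF N])
  qed simp_all
  \<comment> \<open>Comultiplied elements are not pairs, so the Frobenius equation is not evaluated
    directly. Permuting wires turns the composite into the tensor product of those for
    \<open>M\<close> and \<open>N\<close>, to which their own Frobenius equations apply.\<close>
  let ?t = "mid_swap ?A ?A ?B ?B" and ?F = "\<lambda>A m. (\<one> A \<odot> m) \<cdot> \<a> A A A"
  have 1: "?F ?X ?\<mu> \<cdot> (?t \<odot> \<one> ?X) = ?t \<cdot> (?F ?A ?m \<odot> ?F ?B ?n) \<cdot> mid_swap (?A \<otimes> ?A) (?B \<otimes> ?B) ?A ?B"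
  proof (rule free_ext)
    let ?v = "\<langle>\<langle>\<langle>var 0 ?A, var 1 ?A\<rangle>, \<langle>var 2 ?B, var 3 ?B\<rangle>\<rangle>, ?z\<rangle>"
    show "free ?v" by (intro free_pair free_var) simp_all
    show "(?F ?X ?\<mu> \<cdot> (?t \<odot> \<one> ?X)) \<rhd> ?v =
      (?t \<cdot> (?F ?A ?m \<odot> ?F ?B ?n) \<cdot> mid_swap (?A \<otimes> ?A) (?B \<otimes> ?B) ?A ?B) \<rhd> ?v" by (simp add: disjnt_def)
  qed simp_all
  have 2: "mid_swap (?A \<otimes> ?A) (?B \<otimes> ?B) ?A ?B \<cdot> ((?m\<^sup>\<dagger> \<odot> ?n\<^sup>\<dagger>) \<odot> \<one> ?X) = ((?m\<^sup>\<dagger> \<odot> \<one> ?A) \<odot> (?n\<^sup>\<dagger> \<odot> \<one> ?B)) \<cdot> ?s"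
    by (rule TensorO_ext4[of ?A ?B ?A ?B]) simp_all
  have "(\<one> ?X \<odot> ?\<mu>) \<cdot> \<a> ?X ?X ?X \<cdot> (?\<mu>\<^sup>\<dagger> \<odot> \<one> ?X) =
     (?F ?X ?\<mu> \<cdot> (?t \<odot> \<one> ?X)) \<cdot> ((?m\<^sup>\<dagger> \<odot> ?n\<^sup>\<dagger>) \<odot> \<one> ?X)"
    by (simp add: dagger_Comp comp_assoc interchange)
  also have "\<dots> = ?t \<cdot> (?F ?A ?m \<odot> ?F ?B ?n) \<cdot> ((?m\<^sup>\<dagger> \<odot> \<one> ?A) \<odot> (?n\<^sup>\<dagger> \<odot> \<one> ?B)) \<cdot> ?s"
    unfolding 1 2[symmetric] by (simp add: comp_assoc)
  also have "\<dots> = ?t \<cdot> ((?F ?A ?m \<odot> ?F ?B ?n) \<cdot> ((?m\<^sup>\<dagger> \<odot> \<one> ?A) \<odot> (?n\<^sup>\<dagger> \<odot> \<one> ?B))) \<cdot> ?s"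
    by (simp add: comp_assoc)
  also have "(?F ?A ?m \<odot> ?F ?B ?n) \<cdot> ((?m\<^sup>\<dagger> \<odot> \<one> ?A) \<odot> (?n\<^sup>\<dagger> \<odot> \<one> ?B)) = (?m\<^sup>\<dagger> \<cdot> ?m) \<odot> (?n\<^sup>\<dagger> \<cdot> ?n)"
    using dagger_frobenius_eqs(6)[OF M] dagger_frobenius_eqs(6)[OF N] by (simp add: interchange comp_assoc)
  also have "?t \<cdot> ((?m\<^sup>\<dagger> \<cdot> ?m) \<odot> (?n\<^sup>\<dagger> \<cdot> ?n)) \<cdot> ?s = ?\<mu>\<^sup>\<dagger> \<cdot> ?\<mu>"
    by (simp add: dagger_Comp comp_assoc) (simp add: interchange flip: comp_assoc)
  finally show "(\<one> ?X \<odot> ?\<mu>) \<cdot> \<a> ?X ?X ?X \<cdot> (?\<mu>\<^sup>\<dagger> \<odot> \<one> ?X) = ?\<mu>\<^sup>\<dagger> \<cdot> ?\<mu>" .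
qed (use dagger_frobeniusD[OF M] dagger_frobeniusD[OF N] in simp_all)

lemma app_central:
  assumes z: "central M z" and M: "dagger_frobenius_algebra M" and x: "valid x" "valid y" "cod x = Car M" "cod y = Car M"
  shows "Mult M \<rhd> \<langle>z \<rhd> x, y\<rangle> = z \<rhd> Mult M \<rhd> \<langle>x, y\<rangle>" "Mult M \<rhd> \<langle>x, z \<rhd> y\<rangle> = z \<rhd> Mult M \<rhd> \<langle>x, y\<rangle>"
proof -
  have [simp]: "z \<in> Arr C" "Dom C z = Car M" "Cod C z = Car M" using z by (auto simp: central_def)
  have "Mult M \<cdot> (z \<odot> \<one> (Car M)) = z \<cdot> Mult M" "Mult M \<cdot> (\<one> (Car M) \<odot> z) = z \<cdot> Mult M"
    using z by (auto simp: central_def)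
  from arg_cong[OF this(1), of "\<lambda>f. f \<rhd> \<langle>x, y\<rangle>"] arg_cong[OF this(2), of "\<lambda>f. f \<rhd> \<langle>x, y\<rangle>"]
  show "Mult M \<rhd> \<langle>z \<rhd> x, y\<rangle> = z \<rhd> Mult M \<rhd> \<langle>x, y\<rangle>" "Mult M \<rhd> \<langle>x, z \<rhd> y\<rangle> = z \<rhd> Mult M \<rhd> \<langle>x, y\<rangle>"
    using x dagger_frobeniusD[OF M] by simp_all
qed

lemma positive_definiteD:
  assumes "positive_definite A z"
  shows "z \<in> Arr C" "Dom C z = A" "Cod C z = A" "z\<^sup>\<dagger> = z"
proof -
  from assms obtain B h where h: "h \<in> hom C A B" "z = h\<^sup>\<dagger> \<cdot> h" unfolding positive_definite_def positive_def by blast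
  have "h \<in> Arr C" "Dom C h = A" "Cod C h = B" using h(1) by auto
  then show "z \<in> Arr C" "Dom C z = A" "Cod C z = A" "z\<^sup>\<dagger> = z" unfolding h(2) by (simp_all add: dagger_Comp)
qed

lemma positive_definite_Id: "A \<in> Obj C \<Longrightarrow> positive_definite A (\<one> A)"
  unfolding positive_definite_def positive_def isomorphism_def
  by (intro conjI bexI[of _ A] bexI[of _ "\<one> A"]) (simp_all add: hom_def)

lemma positive_definite_TensorA:
  assumes "positive_definite A z" "positive_definite B w"
  shows "positive_definite (A \<otimes> B) (z \<odot> w)"
proof -
  from assms obtain X h Y k where h: "h \<in> hom C A X" "z = h\<^sup>\<dagger> \<cdot> h" and k: "k \<in> hom C B Y" "w = k\<^sup>\<dagger> \<cdot> k"
    unfolding positive_definite_def positive_def by blast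
  have hk: "h \<in> Arr C" "Dom C h = A" "Cod C h = X" "k \<in> Arr C" "Dom C k = B" "Cod C k = Y" using h(1) k(1) by auto
  from assms obtain z' w' where z': "z' \<in> hom C A A" "z' \<cdot> z = \<one> A" "z \<cdot> z' = \<one> A"
    and w': "w' \<in> hom C B B" "w' \<cdot> w = \<one> B" "w \<cdot> w' = \<one> B"
    unfolding positive_definite_def isomorphism_def by blast
  have zw: "z' \<in> Arr C" "Dom C z' = A" "Cod C z' = A" "w' \<in> Arr C" "Dom C w' = B" "Cod C w' = B" using z'(1) w'(1) by auto
  note t = positive_definiteD[OF assms(1)] positive_definiteD[OF assms(2)]
  have [simp]: "A \<in> Obj C" "B \<in> Obj C" "X \<in> Obj C" "Y \<in> Obj C" using hk by auto
  have "z \<odot> w = (h \<odot> k)\<^sup>\<dagger> \<cdot> (h \<odot> k)" unfolding h(2) k(2) using hk by (simp add: interchange)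
  then have "positive (A \<otimes> B) (z \<odot> w)" unfolding positive_def
    using hk by (intro bexI[of _ "X \<otimes> Y"] bexI[of _ "h \<odot> k"]) (simp_all add: hom_def)
  moreover have "isomorphism (A \<otimes> B) (A \<otimes> B) (z \<odot> w)" unfolding isomorphism_def
    using t zw z' w' by (intro conjI bexI[of _ "z' \<odot> w'"]) (simp_all add: hom_def interchange)
  ultimately show ?thesis by (simp add: positive_definite_def)
qed

lemma central_TensorA:
  assumes M: "dagger_frobenius_algebra M" and N: "dagger_frobenius_algebra N" and z: "central M z" and w: "central N w"
  shows "central (tensor_algebra M N) (z \<odot> w)"
proof -
  note [simp] = dagger_frobeniusD[OF M] dagger_frobeniusD[OF N] app_central[OF z M] app_central[OF w N]
  have [simp]: "z \<in> Arr C" "Dom C z = Car M" "Cod C z = Car M" "w \<in> Arr C" "Dom C w = Car N" "Cod C w = Car N"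
    using z w by (auto simp: central_def)
  show ?thesis unfolding central_def
    by (intro conjI; (rule TensorO_ext4[of "Car M" "Car N" "Car M" "Car N"])?) (simp_all add: hom_def)
qed

text \<open>If \<open>s = h\<^sup>\<dagger> \<cdot> h\<close>, then the multiple of the identity is
  the square of \<open>h \<odot> \<one> X\<close> up to a unitor. Normalisers of pants algebras have
  this form.\<close>

lemma positive_definite_scalar:
  assumes "positive_definite \<I> s" and X [simp]: "X \<in> Obj C"
  shows "positive_definite X (\<l> X \<cdot> (s \<odot> \<one> X) \<cdot> (\<l> X)\<^sup>\<dagger>)"
proof -
  let ?f = "\<lambda>s. \<l> X \<cdot> (s \<odot> \<one> X) \<cdot> (\<l> X)\<^sup>\<dagger>"
  obtain B h where h: "h \<in> hom C \<I> B" "s = h\<^sup>\<dagger> \<cdot> h" using assms unfolding positive_definite_def positive_def by blast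
  have [simp]: "B \<in> Obj C" using hom_Obj[OF h(1)] by simp
  have [simp]: "h \<in> Arr C" "Dom C h = \<I>" "Cod C h = B" using h(1) by auto
  have "?f s = ((h \<odot> \<one> X) \<cdot> (\<l> X)\<^sup>\<dagger>)\<^sup>\<dagger> \<cdot> ((h \<odot> \<one> X) \<cdot> (\<l> X)\<^sup>\<dagger>)"
    unfolding h(2) by (simp add: dagger_Comp comp_assoc) (simp add: interchange flip: comp_assoc)
  then have "positive X (?f s)" unfolding positive_def
    by (intro bexI[of _ "B \<otimes> X"] bexI[of _ "(h \<odot> \<one> X) \<cdot> (\<l> X)\<^sup>\<dagger>"]) (simp_all add: hom_def)
  moreover
  obtain s' where s': "s' \<in> hom C \<I> \<I>" "s' \<cdot> s = \<one> \<I>" "s \<cdot> s' = \<one> \<I>"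
    using assms unfolding positive_definite_def isomorphism_def by blast
  have [simp]: "s' \<in> Arr C" "Dom C s' = \<I>" "Cod C s' = \<I>" using s'(1) by auto
  note [simp] = positive_definiteD(1-3)[OF assms(1)]
  have "?f a \<cdot> ?f b = \<one> X" if "a \<cdot> b = \<one> \<I>" "a \<in> Arr C" "b \<in> Arr C" "Dom C a = \<I>" "Cod C a = \<I>" "Dom C b = \<I>" "Cod C b = \<I>" for a b
  proof -
    have "?f a \<cdot> ?f b = \<l> X \<cdot> ((a \<odot> \<one> X) \<cdot> (b \<odot> \<one> X)) \<cdot> (\<l> X)\<^sup>\<dagger>" using that by (simp add: comp_assoc)
    then show ?thesis using that by (simp add: interchange)
  qed
  with s' have "isomorphism X X (?f s)" unfolding isomorphism_def
    by (intro conjI bexI[of _ "?f s'"]) (simp_all add: hom_def)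
  ultimately show ?thesis by (simp add: positive_definite_def)
qed

lemma app_scalar:
  assumes "s \<in> Arr C" "Dom C s = \<I>" "Cod C s = \<I>" "valid x" "cod x = \<I>"
  shows "s \<rhd> x = x \<bullet> (s \<rhd> un)"
proof -
  have "s \<rhd> x = s \<rhd> (x \<bullet> un)" using assms by simp
  also have "\<dots> = x \<bullet> (s \<rhd> un)" using assms by (simp del: scale_un)
  finally show ?thesis .
qed

end


section \<open>Conjugation and doubling\<close>

context dagger_compact_category
begin

notation app  (infixr "\<rhd>" 80) and pair  ("\<langle>_,/ _\<rangle>") and scale  (infixr "\<bullet>" 85)

lemma Dual_Obj [simp]: "A \<in> Obj V \<Longrightarrow> A\<^sup>\<star> \<in> Obj V"
  by (rule Dual_in_Obj)

lemma Eta_typing [simp]: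
  assumes "A \<in> Obj V"
  shows "\<eta> A \<in> Arr V" "Dom V (\<eta> A) = \<I>" "Cod V (\<eta> A) = A\<^sup>\<star> \<otimes> A"
  using Eta_in_hom[OF assms] by auto

lemma Eps_typing [simp]:
  assumes "A \<in> Obj V"
  shows "\<epsilon> A \<in> Arr V" "Dom V (\<epsilon> A) = A \<otimes> A\<^sup>\<star>" "Cod V (\<epsilon> A) = \<I>"
  using Eps_in_hom[OF assms] by auto

abbreviation tr :: "'o \<Rightarrow> 'm" where
  "tr A \<equiv> (\<eta> A)\<^sup>\<dagger>"

abbreviation D :: "'o \<Rightarrow> 'o" where
  "D A \<equiv> A\<^sup>\<star> \<otimes> A"

text \<open>Every counit is rewritten to \<open>tr\<close>, so that a single pairing of
  \<open>A\<^sup>\<star>\<close> with \<open>A\<close> remains.\<close>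

lemma app_Eps [simp]:
  assumes "valid x" "valid y" "cod y = A" "cod x = A\<^sup>\<star>" "disjnt (names y) (names x)"
  shows "\<epsilon> A \<rhd> \<langle>y, x\<rangle> = tr A \<rhd> \<langle>x, y\<rangle>"
proof -
  have "A \<in> Obj V" using assms by auto
  then show ?thesis using assms by (simp add: Eps_eq)
qed

text \<open>These are the axioms \<open>snake\<close> and \<open>snake_Dual\<close>: expanding the
  cup as a pair turns \<open>\<epsilon>\<close> into contractions by \<open>tr\<close>.\<close>

lemma dual_pair_Dual:
  assumes A: "A \<in> Obj V"
  shows "dual_pair (A\<^sup>\<star>) A (tr A)"
  unfolding dual_pair_def
proof (intro conjI allI impI)
  note [simp] = A
  show "tr A \<in> hom V (A\<^sup>\<star> \<otimes> A) \<I>" by (simp add: hom_def)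
  fix y assume y: "valid y" "cod y = A"
  have "y = \<l> A \<rhd> (\<epsilon> A \<odot> \<one> A) \<rhd> (\<a> A (A\<^sup>\<star>) A)\<^sup>\<dagger> \<rhd> \<langle>y, \<eta> A \<rhd> un\<rangle>"
    using arg_cong[OF snake[OF A], of "\<lambda>f. f \<rhd> y"] y by simp
  also have "\<dots> = evaluation (A\<^sup>\<star>) A (tr A) A \<rhd> \<langle>\<eta> A \<rhd> un, y\<rangle>"
    by (rule linear_eq_on_pairs[where t = "\<eta> A \<rhd> un" and A = "A\<^sup>\<star>" and B = A
          and Q = "\<lambda>t. \<l> A \<rhd> (\<epsilon> A \<odot> \<one> A) \<rhd> (\<a> A (A\<^sup>\<star>) A)\<^sup>\<dagger> \<rhd> \<langle>y, t\<rangle>"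
          and Q' = "\<lambda>t. evaluation (A\<^sup>\<star>) A (tr A) A \<rhd> \<langle>t, y\<rangle>"],
        (rule linear_intros | use y in simp)+)
  finally show "evaluation (A\<^sup>\<star>) A (tr A) A \<rhd> \<langle>(tr A)\<^sup>\<dagger> \<rhd> un, y\<rangle> = y" by simp
next
  note [simp] = A
  fix x assume x: "valid x" "cod x = A\<^sup>\<star>"
  have "x = \<r> (A\<^sup>\<star>) \<rhd> (\<one> (A\<^sup>\<star>) \<odot> \<epsilon> A) \<rhd> \<a> (A\<^sup>\<star>) A (A\<^sup>\<star>) \<rhd> \<langle>\<eta> A \<rhd> un, x\<rangle>"
    using arg_cong[OF snake_Dual[OF A], of "\<lambda>f. f \<rhd> x"] x by simp
  also have "\<dots> = coevaluation (A\<^sup>\<star>) A (tr A) \<rhd> \<langle>\<eta> A \<rhd> un, x\<rangle>"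
    by (rule linear_eq_on_pairs[where t = "\<eta> A \<rhd> un" and A = "A\<^sup>\<star>" and B = A
          and Q = "\<lambda>t. \<r> (A\<^sup>\<star>) \<rhd> (\<one> (A\<^sup>\<star>) \<odot> \<epsilon> A) \<rhd> \<a> (A\<^sup>\<star>) A (A\<^sup>\<star>) \<rhd> \<langle>t, x\<rangle>"
          and Q' = "\<lambda>t. coevaluation (A\<^sup>\<star>) A (tr A) \<rhd> \<langle>t, x\<rangle>"],
        (rule linear_intros | use x in simp)+)
  finally show "coevaluation (A\<^sup>\<star>) A (tr A) \<rhd> \<langle>(tr A)\<^sup>\<dagger> \<rhd> un, x\<rangle> = x" by simp
qed (use A in simp_all)

abbreviation ev :: "'o \<Rightarrow> 'm" where
  "ev A \<equiv> evaluation (A\<^sup>\<star>) A (tr A) A"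

lemma ev_Eta [simp]:
  "A \<in> Obj V \<Longrightarrow> valid y \<Longrightarrow> cod y = A \<Longrightarrow> ev A \<rhd> \<langle>\<eta> A \<rhd> un, y\<rangle> = y"
  using dual_pairD(6)[OF dual_pair_Dual] by simp

lemma coev_Eta [simp]:
  "A \<in> Obj V \<Longrightarrow> valid x \<Longrightarrow> cod x = A\<^sup>\<star> \<Longrightarrow> coevaluation (A\<^sup>\<star>) A (tr A) \<rhd> \<langle>\<eta> A \<rhd> un, x\<rangle> = x"
  using dual_pairD(7)[OF dual_pair_Dual] by simp

section \<open>Conjugation of morphisms\<close>

lemma conj_typing [simp]:
  assumes "f \<in> Arr V"
  shows "conj_arr f \<in> Arr V" "Dom V (conj_arr f) = (Dom V f)\<^sup>\<star>" "Cod V (conj_arr f) = (Cod V f)\<^sup>\<star>"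
  using assms by (simp_all add: conj_arr_def dual_arr_def Let_def)

text \<open>Conjugation is thereby an adjoint for the pairing \<open>tr\<close>, and its
  functoriality follows by nondegeneracy without diagrams.\<close>

lemma tr_conj:
  assumes f: "f \<in> Arr V" "Dom V f = A" "Cod V f = B"
    and xy: "valid x" "valid y" "cod x = A\<^sup>\<star>" "cod y = B" "apart (names x) (names y)"
  shows "tr B \<rhd> \<langle>conj_arr f \<rhd> x, y\<rangle> = tr A \<rhd> \<langle>x, f\<^sup>\<dagger> \<rhd> y\<rangle>"
proof -
  have o [simp]: "A \<in> Obj V" "B \<in> Obj V" using f by auto
  let ?Q = "\<lambda>t. tr B \<rhd> \<langle>\<r> (B\<^sup>\<star>) \<rhd> (\<one> (B\<^sup>\<star>) \<odot> \<epsilon> A) \<rhd> \<a> (B\<^sup>\<star>) A (A\<^sup>\<star>) \<rhd> \<langle>(\<one> (B\<^sup>\<star>) \<odot> f\<^sup>\<dagger>) \<rhd> t, x\<rangle>, y\<rangle>"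
  let ?R = "\<lambda>t. tr A \<rhd> \<langle>x, f\<^sup>\<dagger> \<rhd> ev B \<rhd> \<langle>t, y\<rangle>\<rangle>"
  have "tr B \<rhd> \<langle>conj_arr f \<rhd> x, y\<rangle> = ?Q (\<eta> B \<rhd> un)"
    using f xy by (simp add: conj_arr_def dual_arr_def Let_def)
  also have "\<dots> = ?R (\<eta> B \<rhd> un)"
    by (rule linear_eq_on_pairs[where t = "\<eta> B \<rhd> un" and A = "B\<^sup>\<star>" and B = B and Q = ?Q and Q' = ?R],
        (rule linear_intros | use f xy in \<open>simp add: scale_commute\<close>)+)
  finally show ?thesis using xy f by simp
qed

lemma conj_Id [simp]:
  assumes "A \<in> Obj V"
  shows "conj_arr (\<one> A) = \<one> (A\<^sup>\<star>)"
  by (rule dual_pair_arrow_ext[OF dual_pair_Dual[OF assms], where X = "A\<^sup>\<star>"])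
    (use assms in \<open>simp_all add: tr_conj\<close>)

lemma conj_Comp:
  assumes "f \<in> Arr V" "g \<in> Arr V" "Dom V g = Cod V f"
  shows "conj_arr (g \<cdot> f) = conj_arr g \<cdot> conj_arr f"
proof -
  have o: "Dom V f \<in> Obj V" "Cod V f \<in> Obj V" "Cod V g \<in> Obj V" using assms by auto
  show ?thesis
    by (rule dual_pair_arrow_ext[OF dual_pair_Dual[OF o(3)], where X = "(Dom V f)\<^sup>\<star>"])
      (use assms o in \<open>simp_all add: tr_conj dagger_Comp\<close>)
qed

text \<open>Sliding along a cup: both sides of the first equation represent the function
  \<open>f\<^sup>\<dagger>\<close>. The dagger of that equation determines
  \<open>(conj_arr f)\<^sup>\<dagger>\<close> by its pairings, and \<open>tr_conj\<close> recognises
  them.\<close>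

lemma conj_dagger:
  assumes f: "f \<in> Arr V"
  shows "(conj_arr f)\<^sup>\<dagger> = conj_arr (f\<^sup>\<dagger>)"
proof -
  let ?A = "Dom V f" and ?B = "Cod V f"
  have o [simp]: "?A \<in> Obj V" "?B \<in> Obj V" using f by auto
  have "(conj_arr f \<odot> \<one> ?A) \<cdot> \<eta> ?A = (\<one> (?B\<^sup>\<star>) \<odot> f\<^sup>\<dagger>) \<cdot> \<eta> ?B"
  proof (rule arrow_ext_un)
    have e: "evaluation (?B\<^sup>\<star>) ?B (tr ?B) ?A \<rhd> \<langle>(conj_arr f \<odot> \<one> ?A) \<rhd> \<eta> ?A \<rhd> un, y\<rangle> =
      evaluation (?B\<^sup>\<star>) ?B (tr ?B) ?A \<rhd> \<langle>(\<one> (?B\<^sup>\<star>) \<odot> f\<^sup>\<dagger>) \<rhd> \<eta> ?B \<rhd> un, y\<rangle>" if y: "valid y" "cod y = ?B" for y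
    proof -
      have "evaluation (?B\<^sup>\<star>) ?B (tr ?B) ?A \<rhd> \<langle>(conj_arr f \<odot> \<one> ?A) \<rhd> \<eta> ?A \<rhd> un, y\<rangle> = ev ?A \<rhd> \<langle>\<eta> ?A \<rhd> un, f\<^sup>\<dagger> \<rhd> y\<rangle>"
        by (rule linear_eq_on_pairs[where t = "\<eta> ?A \<rhd> un" and A = "?A\<^sup>\<star>" and B = ?A
              and Q = "\<lambda>t. evaluation (?B\<^sup>\<star>) ?B (tr ?B) ?A \<rhd> \<langle>(conj_arr f \<odot> \<one> ?A) \<rhd> t, y\<rangle>"
              and Q' = "\<lambda>t. ev ?A \<rhd> \<langle>t, f\<^sup>\<dagger> \<rhd> y\<rangle>"],
            (rule linear_intros | use f y in \<open>simp add: tr_conj\<close>)+)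
      also have "\<dots> = f\<^sup>\<dagger> \<rhd> ev ?B \<rhd> \<langle>\<eta> ?B \<rhd> un, y\<rangle>" using f y by simp
      also have "\<dots> = evaluation (?B\<^sup>\<star>) ?B (tr ?B) ?A \<rhd> \<langle>(\<one> (?B\<^sup>\<star>) \<odot> f\<^sup>\<dagger>) \<rhd> \<eta> ?B \<rhd> un, y\<rangle>"
        by (rule linear_eq_on_pairs[where t = "\<eta> ?B \<rhd> un" and A = "?B\<^sup>\<star>" and B = ?B
              and Q = "\<lambda>t. f\<^sup>\<dagger> \<rhd> ev ?B \<rhd> \<langle>t, y\<rangle>"
              and Q' = "\<lambda>t. evaluation (?B\<^sup>\<star>) ?B (tr ?B) ?A \<rhd> \<langle>(\<one> (?B\<^sup>\<star>) \<odot> f\<^sup>\<dagger>) \<rhd> t, y\<rangle>"],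
            (rule linear_intros | use f y in simp)+)
      finally show ?thesis .
    qed
    have "(conj_arr f \<odot> \<one> ?A) \<rhd> \<eta> ?A \<rhd> un = (\<one> (?B\<^sup>\<star>) \<odot> f\<^sup>\<dagger>) \<rhd> \<eta> ?B \<rhd> un"
      by (rule evaluation_nondegenerate[OF dual_pair_Dual[of ?B], of ?A]) (use f e in simp_all)
    then show "((conj_arr f \<odot> \<one> ?A) \<cdot> \<eta> ?A) \<rhd> un = ((\<one> (?B\<^sup>\<star>) \<odot> f\<^sup>\<dagger>) \<cdot> \<eta> ?B) \<rhd> un" using f by simp
  qed (use f in simp_all)
  from arg_cong[OF this, of "\<lambda>f. f\<^sup>\<dagger>"]
  have *: "tr ?A \<cdot> ((conj_arr f)\<^sup>\<dagger> \<odot> \<one> ?A) = tr ?B \<cdot> (\<one> (?B\<^sup>\<star>) \<odot> f)" using f by (simp add: dagger_Comp)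
  show ?thesis
  proof (rule dual_pair_arrow_ext[OF dual_pair_Dual[of ?A], where X = "?B\<^sup>\<star>"])
    fix x y assume xy: "valid x" "valid y" "cod x = ?B\<^sup>\<star>" "cod y = ?A" "apart (names x) (names y)"
    have "tr ?A \<rhd> \<langle>(conj_arr f)\<^sup>\<dagger> \<rhd> x, y\<rangle> = (tr ?A \<cdot> ((conj_arr f)\<^sup>\<dagger> \<odot> \<one> ?A)) \<rhd> \<langle>x, y\<rangle>" using f xy by simp
    also have "\<dots> = tr ?A \<rhd> \<langle>conj_arr (f\<^sup>\<dagger>) \<rhd> x, y\<rangle>" unfolding * using f xy by (simp add: tr_conj)
    finally show "tr ?A \<rhd> \<langle>(conj_arr f)\<^sup>\<dagger> \<rhd> x, y\<rangle> = tr ?A \<rhd> \<langle>conj_arr (f\<^sup>\<dagger>) \<rhd> x, y\<rangle>" .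
  qed (use f in simp_all)
qed

section \<open>The doubling functor and its effect on operators\<close>

definition double :: "'m \<Rightarrow> 'm" where
  "double f = conj_arr f \<odot> f"

lemma double_typing [simp]:
  assumes "f \<in> Arr V"
  shows "double f \<in> Arr V" "Dom V (double f) = D (Dom V f)" "Cod V (double f) = D (Cod V f)"
  using assms by (simp_all add: double_def)

lemma double_Id [simp]: "A \<in> Obj V \<Longrightarrow> double (\<one> A) = \<one> (D A)"
  by (simp add: double_def)

lemma double_Comp:
  "f \<in> Arr V \<Longrightarrow> g \<in> Arr V \<Longrightarrow> Dom V g = Cod V f \<Longrightarrow> double (g \<cdot> f) = double g \<cdot> double f"
  by (simp add: double_def conj_Comp interchange)

lemma double_dagger: "f \<in> Arr V \<Longrightarrow> (double f)\<^sup>\<dagger> = double (f\<^sup>\<dagger>)"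
  by (simp add: double_def conj_dagger)

lemma double_unitary:
  assumes "unitary A B f" shows "unitary (D A) (D B) (double f)"
proof -
  note f = unitaryD[OF assms]
  then have "A \<in> Obj V" "B \<in> Obj V" by auto
  then show ?thesis using f by (intro unitaryI) (simp_all add: double_dagger flip: double_Comp)
qed

text \<open>Regarding elements of \<open>D A\<close> as operators, doubling is conjugation: the
  operator \<open>T\<close> becomes \<open>f T f\<^sup>\<dagger>\<close>.\<close>

lemma ev_double [simp]:
  assumes f: "f \<in> Arr V" "Dom V f = A" "Cod V f = B"
    and Ty: "valid T" "valid y" "cod T = D A" "cod y = B" "apart (names T) (names y)"
  shows "ev B \<rhd> \<langle>double f \<rhd> T, y\<rangle> = f \<rhd> ev A \<rhd> \<langle>T, f\<^sup>\<dagger> \<rhd> y\<rangle>"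
proof -
  have o [simp]: "A \<in> Obj V" "B \<in> Obj V" using f by auto
  show ?thesis
    by (rule linear_eq_on_pairs[where t = T and A = "A\<^sup>\<star>" and B = A
          and Q = "\<lambda>T. ev B \<rhd> \<langle>double f \<rhd> T, y\<rangle>" and Q' = "\<lambda>T. f \<rhd> ev A \<rhd> \<langle>T, f\<^sup>\<dagger> \<rhd> y\<rangle>"],
        (rule linear_intros | use f Ty in \<open>simp add: tr_conj double_def\<close>)+)
qed

section \<open>Duals of tensor products\<close>

definition tensor_tr :: "'o \<Rightarrow> 'o \<Rightarrow> 'm" where
  "tensor_tr A B = tr B \<cdot> mid_cap (B\<^sup>\<star>) (A\<^sup>\<star>) A B (tr A)"

lemma tensor_tr_typing [simp]:
  assumes "A \<in> Obj V" "B \<in> Obj V"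
  shows "tensor_tr A B \<in> Arr V" "Dom V (tensor_tr A B) = (B\<^sup>\<star> \<otimes> A\<^sup>\<star>) \<otimes> (A \<otimes> B)" "Cod V (tensor_tr A B) = \<I>"
  using assms by (simp_all add: tensor_tr_def)

lemma app_tensor_tr [simp]:
  assumes "valid x" "valid x'" "valid y" "valid y'" "cod x = A\<^sup>\<star>" "cod x' = B\<^sup>\<star>" "cod y = A" "cod y' = B"
    "disjnt (names x) (names x')" "disjnt (names y) (names x')"
  shows "tensor_tr A B \<rhd> \<langle>\<langle>x', x\<rangle>, \<langle>y, y'\<rangle>\<rangle> = (tr A \<rhd> \<langle>x, y\<rangle>) \<bullet> (tr B \<rhd> \<langle>x', y'\<rangle>)"
proof -
  have o: "A \<in> Obj V" "B \<in> Obj V" using assms by auto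
  then show ?thesis using assms by (simp add: tensor_tr_def)
qed

lemma tensor_eta_eq:
  "A \<in> Obj V \<Longrightarrow> B \<in> Obj V \<Longrightarrow> tensor_eta A B = (tensor_tr A B)\<^sup>\<dagger>"
  by (simp add: tensor_eta_def tensor_tr_def dagger_Comp)

text \<open>The cup is nested: that of \<open>A\<close> sits between the legs of that of
  \<open>B\<close>. Fact \<open>1\<close> straightens the inner cup while the outer one is replaced
  by a pair, and fact \<open>2\<close> then straightens the outer one.\<close>

lemma dual_pair_tensor:
  assumes o [simp]: "A \<in> Obj V" "B \<in> Obj V"
  shows "dual_pair (B\<^sup>\<star> \<otimes> A\<^sup>\<star>) (A \<otimes> B) (tensor_tr A B)"
  unfolding dual_pair_def
proof (intro conjI allI impI)
  let ?p = "tensor_tr A B" and ?m = "mid_cap (B\<^sup>\<star>) (A\<^sup>\<star>) A B (tr A)"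
  let ?E = "evaluation (B\<^sup>\<star> \<otimes> A\<^sup>\<star>) (A \<otimes> B) ?p (A \<otimes> B)" and ?E' = "coevaluation (B\<^sup>\<star> \<otimes> A\<^sup>\<star>) (A \<otimes> B) ?p"
  show "?p \<in> hom V ((B\<^sup>\<star> \<otimes> A\<^sup>\<star>) \<otimes> (A \<otimes> B)) \<I>" by (simp add: hom_def)
  have pd: "?p\<^sup>\<dagger> \<rhd> un = ?m\<^sup>\<dagger> \<rhd> \<eta> B \<rhd> un" by (simp add: tensor_tr_def dagger_Comp del: app_mid_cap_dagger)
  let ?c = "\<lambda>A. coevaluation (A\<^sup>\<star>) A (tr A)"
  let ?i = "\<lambda>x t f. (\<a> (B\<^sup>\<star>) (A\<^sup>\<star>) (A \<otimes> B))\<^sup>\<dagger> \<rhd> \<langle>x, \<a> (A\<^sup>\<star>) A B \<rhd> \<langle>t, f\<rangle>\<rangle>"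
  {
    fix y assume y: "valid y" "cod y = A \<otimes> B"
    have 1: "?E \<rhd> \<langle>?m\<^sup>\<dagger> \<rhd> \<langle>x, f\<rangle>, \<langle>a, b\<rangle>\<rangle> = \<langle>a, ev B \<rhd> \<langle>\<langle>x, f\<rangle>, b\<rangle>\<rangle>"
      if *: "valid a" "valid b" "cod a = A" "cod b = B" "apart (names a) (names b)"
        "valid x" "valid f" "cod x = B\<^sup>\<star>" "cod f = B" "apart (names x) (names f)"
        "apart (names x) (names a)" "apart (names x) (names b)" "apart (names f) (names a)" "apart (names f) (names b)"
      for a b x f
    proof -
      have "?E \<rhd> \<langle>?i x (\<eta> A \<rhd> un) f, \<langle>a, b\<rangle>\<rangle> = \<langle>ev A \<rhd> \<langle>\<eta> A \<rhd> un, a\<rangle>, ev B \<rhd> \<langle>\<langle>x, f\<rangle>, b\<rangle>\<rangle>"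
        by (rule linear_eq_on_pairs[where t = "\<eta> A \<rhd> un" and A = "A\<^sup>\<star>" and B = A
              and Q = "\<lambda>t. ?E \<rhd> \<langle>?i x t f, \<langle>a, b\<rangle>\<rangle>" and Q' = "\<lambda>t. \<langle>ev A \<rhd> \<langle>t, a\<rangle>, ev B \<rhd> \<langle>\<langle>x, f\<rangle>, b\<rangle>\<rangle>"],
            (rule linear_intros | use * in \<open>simp add: scale_left_commute\<close>)+)
      then show ?thesis using * by simp
    qed
    have 2: "?E \<rhd> \<langle>?m\<^sup>\<dagger> \<rhd> \<eta> B \<rhd> un, \<langle>a, b\<rangle>\<rangle> = \<langle>a, b\<rangle>"
      if *: "valid a" "valid b" "cod a = A" "cod b = B" "apart (names a) (names b)" for a b
    proof -
      have "?E \<rhd> \<langle>?m\<^sup>\<dagger> \<rhd> \<eta> B \<rhd> un, \<langle>a, b\<rangle>\<rangle> = \<langle>a, ev B \<rhd> \<langle>\<eta> B \<rhd> un, b\<rangle>\<rangle>"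
        by (rule linear_eq_on_pairs[where t = "\<eta> B \<rhd> un" and A = "B\<^sup>\<star>" and B = B and Q = "\<lambda>t. ?E \<rhd> \<langle>?m\<^sup>\<dagger> \<rhd> t, \<langle>a, b\<rangle>\<rangle>"
            and Q' = "\<lambda>t. \<langle>a, ev B \<rhd> \<langle>t, b\<rangle>\<rangle>"], (rule linear_intros | rule 1 | use * in simp)+)
      then show ?thesis using * by simp
    qed
    have "?E \<rhd> \<langle>?m\<^sup>\<dagger> \<rhd> \<eta> B \<rhd> un, y\<rangle> = y"
      by (rule linear_eq_on_pairs[where t = y and A = A and B = B and Q = "\<lambda>y. ?E \<rhd> \<langle>?m\<^sup>\<dagger> \<rhd> \<eta> B \<rhd> un, y\<rangle>" and Q' = "\<lambda>y. y"],
        (rule linear_intros | rule 2 | use y in \<open>simp del: app_mid_cap_dagger\<close>)+)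
    then show "?E \<rhd> \<langle>?p\<^sup>\<dagger> \<rhd> un, y\<rangle> = y" unfolding pd .
  next
    fix y assume y: "valid y" "cod y = B\<^sup>\<star> \<otimes> A\<^sup>\<star>"
    have 1: "?E' \<rhd> \<langle>?m\<^sup>\<dagger> \<rhd> \<langle>x, f\<rangle>, \<langle>b, a\<rangle>\<rangle> = \<langle>?c B \<rhd> \<langle>\<langle>x, f\<rangle>, b\<rangle>, a\<rangle>"
      if *: "valid a" "valid b" "cod a = A\<^sup>\<star>" "cod b = B\<^sup>\<star>" "apart (names a) (names b)"
        "valid x" "valid f" "cod x = B\<^sup>\<star>" "cod f = B" "apart (names x) (names f)"
        "apart (names x) (names a)" "apart (names x) (names b)" "apart (names f) (names a)" "apart (names f) (names b)"
      for a b x f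
    proof -
      have "?E' \<rhd> \<langle>?i x (\<eta> A \<rhd> un) f, \<langle>b, a\<rangle>\<rangle> = \<langle>?c B \<rhd> \<langle>\<langle>x, f\<rangle>, b\<rangle>, ?c A \<rhd> \<langle>\<eta> A \<rhd> un, a\<rangle>\<rangle>"
        by (rule linear_eq_on_pairs[where t = "\<eta> A \<rhd> un" and A = "A\<^sup>\<star>" and B = A
              and Q = "\<lambda>t. ?E' \<rhd> \<langle>?i x t f, \<langle>b, a\<rangle>\<rangle>" and Q' = "\<lambda>t. \<langle>?c B \<rhd> \<langle>\<langle>x, f\<rangle>, b\<rangle>, ?c A \<rhd> \<langle>t, a\<rangle>\<rangle>"],
            (rule linear_intros | use * in \<open>simp add: scale_left_commute\<close>)+)
      then show ?thesis using * by simp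
    qed
    have 2: "?E' \<rhd> \<langle>?m\<^sup>\<dagger> \<rhd> \<eta> B \<rhd> un, \<langle>b, a\<rangle>\<rangle> = \<langle>b, a\<rangle>"
      if *: "valid b" "valid a" "cod b = B\<^sup>\<star>" "cod a = A\<^sup>\<star>" "apart (names b) (names a)" for a b
    proof -
      have "?E' \<rhd> \<langle>?m\<^sup>\<dagger> \<rhd> \<eta> B \<rhd> un, \<langle>b, a\<rangle>\<rangle> = \<langle>?c B \<rhd> \<langle>\<eta> B \<rhd> un, b\<rangle>, a\<rangle>"
        by (rule linear_eq_on_pairs[where t = "\<eta> B \<rhd> un" and A = "B\<^sup>\<star>" and B = B and Q = "\<lambda>t. ?E' \<rhd> \<langle>?m\<^sup>\<dagger> \<rhd> t, \<langle>b, a\<rangle>\<rangle>"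
            and Q' = "\<lambda>t. \<langle>?c B \<rhd> \<langle>t, b\<rangle>, a\<rangle>"], (rule linear_intros | rule 1 | use * in simp)+)
      then show ?thesis using * by simp
    qed
    have "?E' \<rhd> \<langle>?m\<^sup>\<dagger> \<rhd> \<eta> B \<rhd> un, y\<rangle> = y"
      by (rule linear_eq_on_pairs[where t = y and A = "B\<^sup>\<star>" and B = "A\<^sup>\<star>" and Q = "\<lambda>y. ?E' \<rhd> \<langle>?m\<^sup>\<dagger> \<rhd> \<eta> B \<rhd> un, y\<rangle>" and Q' = "\<lambda>y. y"],
        (rule linear_intros | rule 2 | use y in \<open>simp del: app_mid_cap_dagger\<close>)+)
    then show "?E' \<rhd> \<langle>?p\<^sup>\<dagger> \<rhd> un, y\<rangle> = y" unfolding pd .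
  }
qed simp_all

lemma dual_tensor_typing [simp]:
  assumes "A \<in> Obj V" "B \<in> Obj V"
  shows "dual_tensor A B \<in> Arr V" "Dom V (dual_tensor A B) = (A \<otimes> B)\<^sup>\<star>" "Cod V (dual_tensor A B) = B\<^sup>\<star> \<otimes> A\<^sup>\<star>"
  using assms by (simp_all add: dual_tensor_def tensor_eta_eq)

text \<open>In \<open>dual_tensor\<close> the composite cup meets the chosen counit, and the snake
  equation of the nested pairing removes that cup. Hence \<open>dual_tensor\<close> is the
  comparison of two duals of \<open>A \<otimes> B\<close>.\<close>

lemma tensor_tr_dual_tensor:
  assumes o [simp]: "A \<in> Obj V" "B \<in> Obj V"
    and xy: "valid x" "valid y" "cod x = (A \<otimes> B)\<^sup>\<star>" "cod y = A \<otimes> B" "apart (names x) (names y)"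
  shows "tensor_tr A B \<rhd> \<langle>dual_tensor A B \<rhd> x, y\<rangle> = tr (A \<otimes> B) \<rhd> \<langle>x, y\<rangle>"
proof -
  let ?p = "tensor_tr A B" and ?D = "B\<^sup>\<star> \<otimes> A\<^sup>\<star>"
  let ?Q = "\<lambda>t. ?p \<rhd> \<langle>\<r> ?D \<rhd> (\<one> ?D \<odot> \<epsilon> (A \<otimes> B)) \<rhd> \<a> ?D (A \<otimes> B) ((A \<otimes> B)\<^sup>\<star>) \<rhd> \<langle>t, x\<rangle>, y\<rangle>"
  let ?R = "\<lambda>t. tr (A \<otimes> B) \<rhd> \<langle>x, evaluation ?D (A \<otimes> B) ?p (A \<otimes> B) \<rhd> \<langle>t, y\<rangle>\<rangle>"
  have "?p \<rhd> \<langle>dual_tensor A B \<rhd> x, y\<rangle> = ?Q (?p\<^sup>\<dagger> \<rhd> un)"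
    using xy by (simp add: dual_tensor_def tensor_eta_eq)
  also have "\<dots> = ?R (?p\<^sup>\<dagger> \<rhd> un)"
    by (rule linear_eq_on_pairs[where t = "?p\<^sup>\<dagger> \<rhd> un" and A = ?D and B = "A \<otimes> B" and Q = ?Q and Q' = ?R],
        (rule linear_intros | use xy in \<open>simp add: scale_commute\<close>)+)
  also have "\<dots> = tr (A \<otimes> B) \<rhd> \<langle>x, y\<rangle>"
    using dual_pairD(6)[OF dual_pair_tensor[OF o], of y] xy by simp
  finally show ?thesis .
qed

lemma dual_tensor_unitary:
  assumes "A \<in> Obj V" "B \<in> Obj V"
  shows "unitary ((A \<otimes> B)\<^sup>\<star>) (B\<^sup>\<star> \<otimes> A\<^sup>\<star>) (dual_tensor A B)"
  by (rule dual_pair_comparison[OF dual_pair_Dual dual_pair_tensor])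
    (use assms in \<open>simp_all add: tensor_tr_dual_tensor\<close>)

text \<open>The part of \<open>double_tensor\<close> that follows \<open>dual_tensor\<close>, a mere
  permutation of four factors.\<close>

definition double_shuffle :: "'o \<Rightarrow> 'o \<Rightarrow> 'm" where
  "double_shuffle A C =
     \<a> (D A) (C\<^sup>\<star>) C \<cdot> (\<sigma> (C\<^sup>\<star>) (D A) \<odot> \<one> C) \<cdot> (\<a> (C\<^sup>\<star>) (D A) C)\<^sup>\<dagger>
       \<cdot> (\<one> (C\<^sup>\<star>) \<odot> (\<a> (A\<^sup>\<star>) A C)\<^sup>\<dagger>) \<cdot> \<a> (C\<^sup>\<star>) (A\<^sup>\<star>) (A \<otimes> C)"

lemma double_shuffle_typing [simp]:
  assumes "A \<in> Obj V" "B \<in> Obj V"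
  shows "double_shuffle A B \<in> Arr V" "Dom V (double_shuffle A B) = (B\<^sup>\<star> \<otimes> A\<^sup>\<star>) \<otimes> (A \<otimes> B)"
    "Cod V (double_shuffle A B) = D A \<otimes> D B"
  using assms by (simp_all add: double_shuffle_def)

lemma app_double_shuffle [simp]:
  assumes "valid x" "valid x'" "valid y" "valid y'" "cod x = A\<^sup>\<star>" "cod x' = B\<^sup>\<star>" "cod y = A" "cod y' = B"
    "disjnt (names x') (names x)" "disjnt (names x') (names y)"
  shows "double_shuffle A B \<rhd> \<langle>\<langle>x', x\<rangle>, \<langle>y, y'\<rangle>\<rangle> = \<langle>\<langle>x, y\<rangle>, \<langle>x', y'\<rangle>\<rangle>"
proof -
  have "A \<in> Obj V" "B \<in> Obj V" using assms by auto
  then show ?thesis using assms by (simp add: double_shuffle_def)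
qed

lemma double_shuffle_unitary:
  assumes o [simp]: "A \<in> Obj V" "B \<in> Obj V"
  shows "unitary ((B\<^sup>\<star> \<otimes> A\<^sup>\<star>) \<otimes> (A \<otimes> B)) (D A \<otimes> D B) (double_shuffle A B)"
proof -
  have d: "(double_shuffle A B)\<^sup>\<dagger> \<rhd> \<langle>\<langle>x, y\<rangle>, \<langle>x', y'\<rangle>\<rangle> = \<langle>\<langle>x', x\<rangle>, \<langle>y, y'\<rangle>\<rangle>"
    if "valid x" "valid x'" "valid y" "valid y'" "cod x = A\<^sup>\<star>" "cod x' = B\<^sup>\<star>" "cod y = A" "cod y' = B"
      "disjnt (names x) (names x')" "disjnt (names y) (names x')" for x x' y y'
    using that by (simp add: double_shuffle_def dagger_Comp)
  show ?thesis
  proof (rule unitaryI)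
    show "(double_shuffle A B)\<^sup>\<dagger> \<cdot> double_shuffle A B = \<one> ((B\<^sup>\<star> \<otimes> A\<^sup>\<star>) \<otimes> (A \<otimes> B))"
      by (rule TensorO_ext4[of "B\<^sup>\<star>" "A\<^sup>\<star>" A B]) (simp_all add: d)
    show "double_shuffle A B \<cdot> (double_shuffle A B)\<^sup>\<dagger> = \<one> (D A \<otimes> D B)"
      by (rule TensorO_ext4[of "A\<^sup>\<star>" A "B\<^sup>\<star>" B]) (simp_all add: d)
  qed simp_all
qed

lemma double_tensor_eq:
  "A \<in> Obj V \<Longrightarrow> B \<in> Obj V \<Longrightarrow> double_tensor A B = double_shuffle A B \<cdot> (dual_tensor A B \<odot> \<one> (A \<otimes> B))"
  by (simp add: double_tensor_def double_shuffle_def comp_assoc)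

lemma double_tensor_unitary:
  assumes "A \<in> Obj V" "B \<in> Obj V"
  shows "unitary (D (A \<otimes> B)) (D A \<otimes> D B) (double_tensor A B)"
  unfolding double_tensor_eq[OF assms] using assms
  by (intro unitary_Comp[OF unitary_TensorA[OF dual_tensor_unitary unitary_Id] double_shuffle_unitary]) simp_all

lemma double_tensor_typing [simp]:
  assumes "A \<in> Obj V" "B \<in> Obj V"
  shows "double_tensor A B \<in> Arr V" "Dom V (double_tensor A B) = D (A \<otimes> B)"
    "Cod V (double_tensor A B) = D A \<otimes> D B"
    "(double_tensor A B)\<^sup>\<dagger> \<cdot> double_tensor A B = \<one> (D (A \<otimes> B))"
    "double_tensor A B \<cdot> (double_tensor A B)\<^sup>\<dagger> = \<one> (D A \<otimes> D B)"
  using unitaryD[OF double_tensor_unitary[OF assms]] by simp_all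

abbreviation ev2 :: "'o \<Rightarrow> 'o \<Rightarrow> 'm" where
  "ev2 A B \<equiv> par (D A) A (ev A) (D B) B (ev B)"

text \<open>The property that characterises \<open>double_tensor\<close>: operators on
  \<open>A \<otimes> B\<close>, viewed in \<open>D A \<otimes> D B\<close>, act factor by factor as
  before.\<close>

lemma ev_double_tensor [simp]:
  assumes o [simp]: "A \<in> Obj V" "B \<in> Obj V"
    and Ts: "valid T" "valid s" "cod T = D (A \<otimes> B)" "cod s = A \<otimes> B" "apart (names T) (names s)"
  shows "ev2 A B \<rhd> \<langle>double_tensor A B \<rhd> T, s\<rangle> = ev (A \<otimes> B) \<rhd> \<langle>T, s\<rangle>"
proof -
  let ?d = "dual_tensor A B \<odot> \<one> (A \<otimes> B)"
  \<comment> \<open>The legs of \<open>T\<close> are treated separately: the first has already been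
    moved to \<open>B\<^sup>\<star> \<otimes> A\<^sup>\<star>\<close>, and the second,
    \<open>z\<close>, is an arbitrary element of \<open>A \<otimes> B\<close>.\<close>
  have 1: "ev2 A B \<rhd> \<langle>double_shuffle A B \<rhd> \<langle>x, z\<rangle>, s\<rangle> = (tensor_tr A B \<rhd> \<langle>x, s\<rangle>) \<bullet> z"
    if x: "valid x" "valid z" "valid s" "cod x = B\<^sup>\<star> \<otimes> A\<^sup>\<star>" "cod z = A \<otimes> B" "cod s = A \<otimes> B"
      "apart (names x) (names z)" "apart (names x) (names s)" "apart (names z) (names s)" for x z s
  proof -
    let ?F = "(ev2 A B \<cdot> (double_shuffle A B \<odot> \<one> (A \<otimes> B)))"
    let ?G = "\<l> (A \<otimes> B) \<cdot> (tensor_tr A B \<odot> \<one> (A \<otimes> B)) \<cdot> (\<a> (B\<^sup>\<star> \<otimes> A\<^sup>\<star>) (A \<otimes> B) (A \<otimes> B))\<^sup>\<dagger> \<cdot>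
       (\<one> (B\<^sup>\<star> \<otimes> A\<^sup>\<star>) \<odot> \<sigma> (A \<otimes> B) (A \<otimes> B)) \<cdot> \<a> (B\<^sup>\<star> \<otimes> A\<^sup>\<star>) (A \<otimes> B) (A \<otimes> B)"
    have "?F = ?G"
    proof (rule free_ext)
      let ?v = "\<langle>\<langle>\<langle>var 0 (B\<^sup>\<star>), var 1 (A\<^sup>\<star>)\<rangle>, \<langle>var 2 A, var 3 B\<rangle>\<rangle>, \<langle>var 4 A, var 5 B\<rangle>\<rangle>"
      show "free ?v" by (intro free_pair free_var) simp_all
      show "?F \<rhd> ?v = ?G \<rhd> ?v" by (simp add: disjnt_def scale_commute)
    qed simp_all
    then have "?F \<rhd> \<langle>\<langle>x, z\<rangle>, s\<rangle> = ?G \<rhd> \<langle>\<langle>x, z\<rangle>, s\<rangle>" by (simp only:)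
    then show ?thesis using x by simp
  qed
  show ?thesis
    by (rule linear_eq_on_pairs[where t = T and A = "(A \<otimes> B)\<^sup>\<star>" and B = "A \<otimes> B"
          and Q = "\<lambda>T. ev2 A B \<rhd> \<langle>double_tensor A B \<rhd> T, s\<rangle>" and Q' = "\<lambda>T. ev (A \<otimes> B) \<rhd> \<langle>T, s\<rangle>"],
        (rule linear_intros | use Ts in \<open>simp add: double_tensor_eq 1 tensor_tr_dual_tensor\<close>)+)
qed

text \<open>\<open>P\<close> is identified along \<open>d\<close> with the algebra \<open>D A\<close> of operators on \<open>A\<close>, and \<open>e\<close> is the action of \<open>P\<close> on \<open>A\<close>. As the
  action is faithful, coherence of \<open>double_tensor\<close> reduces to the action of tensor products of operators.\<close>

definition model :: "'o \<Rightarrow> 'o \<Rightarrow> 'm \<Rightarrow> 'm \<Rightarrow> bool" where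
  "model P A e d \<longleftrightarrow> A \<in> Obj V \<and> P \<in> Obj V \<and> e \<in> Arr V \<and> Dom V e = P \<otimes> A \<and> Cod V e = A \<and> unitary (D A) P d \<and>
     (\<forall>T y. valid T \<longrightarrow> valid y \<longrightarrow> cod T = D A \<longrightarrow> cod y = A \<longrightarrow> apart (names T) (names y) \<longrightarrow>
       e \<rhd> \<langle>d \<rhd> T, y\<rangle> = ev A \<rhd> \<langle>T, y\<rangle>)"

lemma modelD:
  assumes "model P A e d"
  shows "A \<in> Obj V" "P \<in> Obj V" "e \<in> Arr V" "Dom V e = P \<otimes> A" "Cod V e = A" "unitary (D A) P d"
    "d \<in> Arr V" "Dom V d = D A" "Cod V d = P"
    "valid T \<Longrightarrow> valid y \<Longrightarrow> cod T = D A \<Longrightarrow> cod y = A \<Longrightarrow> apart (names T) (names y) \<Longrightarrow>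
       e \<rhd> \<langle>d \<rhd> T, y\<rangle> = ev A \<rhd> \<langle>T, y\<rangle>"
  using assms by (auto simp: model_def dest: unitaryD)

lemma model_Id: "A \<in> Obj V \<Longrightarrow> model (D A) A (ev A) (\<one> (D A))"
  by (simp add: model_def unitary_Id)

text \<open>Pulled back along \<open>d \<odot> d'\<close>, the factorwise action becomes
  \<open>ev2 A B\<close>, to which \<open>ev_double_tensor\<close> applies.\<close>

lemma model_tensor:
  assumes d: "model P A e d" and d': "model Q B e' d'"
  shows "model (P \<otimes> Q) (A \<otimes> B) (par P A e Q B e') ((d \<odot> d') \<cdot> double_tensor A B)"
proof -
  note [simp] = modelD(1-5,7-9)[OF d] modelD(1-5,7-9)[OF d']
  let ?p = "par P A e Q B e'"
  have p: "?p \<cdot> ((d \<odot> d') \<odot> \<one> (A \<otimes> B)) = ev2 A B"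
    by (rule TensorO_ext4[of "D A" "D B" A B]) (simp_all add: modelD(10)[OF d] modelD(10)[OF d'])
  have "unitary (D (A \<otimes> B)) (P \<otimes> Q) ((d \<odot> d') \<cdot> double_tensor A B)"
    by (intro unitary_Comp[OF double_tensor_unitary unitary_TensorA] modelD(6)[OF d] modelD(6)[OF d']) simp_all
  moreover have "?p \<rhd> \<langle>(d \<odot> d') \<rhd> double_tensor A B \<rhd> T, y\<rangle> = ev (A \<otimes> B) \<rhd> \<langle>T, y\<rangle>"
    if "valid T" "valid y" "cod T = D (A \<otimes> B)" "cod y = A \<otimes> B" "apart (names T) (names y)" for T y
  proof -
    have "?p \<rhd> \<langle>(d \<odot> d') \<rhd> double_tensor A B \<rhd> T, y\<rangle> = (?p \<cdot> ((d \<odot> d') \<odot> \<one> (A \<otimes> B))) \<rhd> \<langle>double_tensor A B \<rhd> T, y\<rangle>"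
      using that by simp
    also have "\<dots> = ev (A \<otimes> B) \<rhd> \<langle>T, y\<rangle>" unfolding p using that by simp
    finally show ?thesis .
  qed
  ultimately show ?thesis by (simp add: model_def)
qed

text \<open>The unitary \<open>d\<close> transports the claim to \<open>D A\<close>, whose action on
  \<open>A\<close> is faithful by nondegeneracy.\<close>

lemma model_ext:
  assumes m: "model P A e d" and f: "f \<in> Arr V" "g \<in> Arr V" "Dom V f = X" "Dom V g = X" "Cod V f = P" "Cod V g = P"
    and eq: "e \<cdot> (f \<odot> \<one> A) = e \<cdot> (g \<odot> \<one> A)"
  shows "f = g"
proof -
  have X [simp]: "X \<in> Obj V" using f(1,3) by auto
  note [simp] = modelD(1-5,7-9)[OF m] f
  have inv [simp]: "d \<rhd> d\<^sup>\<dagger> \<rhd> U = U" if "valid U" "cod U = P" for U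
    using that unitaryD(5)[OF modelD(6)[OF m]] app_Comp[of U "d\<^sup>\<dagger>" d] by simp
  have e: "ev A \<rhd> \<langle>d\<^sup>\<dagger> \<rhd> U, y\<rangle> = e \<rhd> \<langle>U, y\<rangle>"
    if "valid U" "valid y" "cod U = P" "cod y = A" "apart (names U) (names y)" for U y
    using that modelD(10)[OF m, of "d\<^sup>\<dagger> \<rhd> U" y] by simp
  have "d\<^sup>\<dagger> \<cdot> f = d\<^sup>\<dagger> \<cdot> g"
  proof (rule evaluation_arrow_ext[OF dual_pair_Dual[of A], where X = X and B = A])
    fix x y assume xy: "valid x" "valid y" "cod x = X" "cod y = A" "apart (names x) (names y)"
    have "(e \<cdot> (f \<odot> \<one> A)) \<rhd> \<langle>x, y\<rangle> = (e \<cdot> (g \<odot> \<one> A)) \<rhd> \<langle>x, y\<rangle>" unfolding eq ..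
    with xy have "e \<rhd> \<langle>f \<rhd> x, y\<rangle> = e \<rhd> \<langle>g \<rhd> x, y\<rangle>" by simp
    with xy show "ev A \<rhd> \<langle>(d\<^sup>\<dagger> \<cdot> f) \<rhd> x, y\<rangle> = ev A \<rhd> \<langle>(d\<^sup>\<dagger> \<cdot> g) \<rhd> x, y\<rangle>" by (simp add: e)
  qed simp_all
  then show ?thesis
    by (rule unitary_cancel_left[OF unitary_dagger[OF modelD(6)[OF m]], rotated 4]) simp_all
qed

lemma model_ext_elem:
  assumes m: "model P A e d" and f: "f \<in> Arr V" "g \<in> Arr V" "Dom V f = X" "Dom V g = X" "Cod V f = P" "Cod V g = P"
    and eq: "\<And>x y. valid x \<Longrightarrow> valid y \<Longrightarrow> cod x = X \<Longrightarrow> cod y = A \<Longrightarrow> apart (names x) (names y) \<Longrightarrow>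
      e \<rhd> \<langle>f \<rhd> x, y\<rangle> = e \<rhd> \<langle>g \<rhd> x, y\<rangle>"
  shows "f = g"
proof (rule model_ext[OF m f])
  have "X \<in> Obj V" using f(1,3) by auto
  then show "e \<cdot> (f \<odot> \<one> A) = e \<cdot> (g \<odot> \<one> A)"
    using f modelD(1-4)[OF m] by (intro TensorO_ext[of X A]) (simp_all add: eq)
qed

section \<open>Naturality and coherence of \<open>double_tensor\<close>, tested on actions\<close>

lemma double_tensor_natural:
  assumes f: "f \<in> Arr V" "g \<in> Arr V" and c: "Cod V f = B" "Cod V g = B'"
  shows "double_tensor B B' \<cdot> double (f \<odot> g) = (double f \<odot> double g) \<cdot> double_tensor (Dom V f) (Dom V g)"
proof -
  let ?A = "Dom V f" and ?A' = "Dom V g"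
  have o [simp]: "?A \<in> Obj V" "?A' \<in> Obj V" "B \<in> Obj V" "B' \<in> Obj V" using f c by auto
  note [simp] = f c
  have e: "ev2 B B' \<cdot> ((double f \<odot> double g) \<odot> \<one> (B \<otimes> B')) = (f \<odot> g) \<cdot> ev2 ?A ?A' \<cdot> (\<one> (D ?A \<otimes> D ?A') \<odot> (f\<^sup>\<dagger> \<odot> g\<^sup>\<dagger>))"
    by (rule TensorO_ext4[of "D ?A" "D ?A'" B B']) simp_all
  show ?thesis
  proof (rule model_ext_elem[OF model_tensor[OF model_Id[of B] model_Id[of B']], where X = "D (?A \<otimes> ?A')"])
    fix T y assume *: "valid T" "valid y" "cod T = D (?A \<otimes> ?A')" "cod y = B \<otimes> B'" "apart (names T) (names y)"
    have "ev2 B B' \<rhd> \<langle>((double f \<odot> double g) \<cdot> double_tensor ?A ?A') \<rhd> T, y\<rangle> =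
      (ev2 B B' \<cdot> ((double f \<odot> double g) \<odot> \<one> (B \<otimes> B'))) \<rhd> \<langle>double_tensor ?A ?A' \<rhd> T, y\<rangle>" using * by simp
    also have "\<dots> = ev2 B B' \<rhd> \<langle>(double_tensor B B' \<cdot> double (f \<odot> g)) \<rhd> T, y\<rangle>" unfolding e using * by simp
    finally show "ev2 B B' \<rhd> \<langle>(double_tensor B B' \<cdot> double (f \<odot> g)) \<rhd> T, y\<rangle> =
      ev2 B B' \<rhd> \<langle>((double f \<odot> double g) \<cdot> double_tensor ?A ?A') \<rhd> T, y\<rangle>" by simp
  qed simp_all
qed

text \<open>The test takes place on \<open>A \<otimes> (B \<otimes> E)\<close>: fact
  \<open>*\<close> says that threefold actions respect associators, and \<open>ev_double\<close>
  absorbs the doubled associator.\<close>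

lemma double_tensor_Assoc:
  assumes o [simp]: "A \<in> Obj V" "B \<in> Obj V" "E \<in> Obj V"
  shows "\<a> (D A) (D B) (D E) \<cdot> (double_tensor A B \<odot> \<one> (D E)) \<cdot> double_tensor (A \<otimes> B) E =
    (\<one> (D A) \<odot> double_tensor B E) \<cdot> double_tensor A (B \<otimes> E) \<cdot> double (\<a> A B E)"
proof -
  have mBE: "model (D B \<otimes> D E) (B \<otimes> E) (ev2 B E) (double_tensor B E)"
    using model_tensor[OF model_Id[OF o(2)] model_Id[OF o(3)]] by simp
  have mAB: "model (D A \<otimes> D B) (A \<otimes> B) (ev2 A B) (double_tensor A B)"
    using model_tensor[OF model_Id[OF o(1)] model_Id[OF o(2)]] by simp
  note m = model_tensor[OF model_Id[OF o(1)] mBE] and m' = model_tensor[OF mAB model_Id[OF o(3)]]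
  let ?e = "par (D A) A (ev A) (D B \<otimes> D E) (B \<otimes> E) (ev2 B E)"
  let ?e' = "par (D A \<otimes> D B) (A \<otimes> B) (ev2 A B) (D E) E (ev E)"
  have *: "?e \<cdot> (\<a> (D A) (D B) (D E) \<odot> \<a> A B E) = \<a> A B E \<cdot> ?e'"
  proof (rule free_ext)
    let ?v = "\<langle>\<langle>\<langle>var 0 (D A), var 1 (D B)\<rangle>, var 2 (D E)\<rangle>, \<langle>\<langle>var 3 A, var 4 B\<rangle>, var 5 E\<rangle>\<rangle>"
    show "free ?v" by (intro free_pair free_var) simp_all
    show "(?e \<cdot> (\<a> (D A) (D B) (D E) \<odot> \<a> A B E)) \<rhd> ?v = (\<a> A B E \<cdot> ?e') \<rhd> ?v" by (simp add: disjnt_def)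
  qed simp_all
  have e: "?e \<rhd> \<langle>\<a> (D A) (D B) (D E) \<rhd> U, y\<rangle> = \<a> A B E \<rhd> ?e' \<rhd> \<langle>U, (\<a> A B E)\<^sup>\<dagger> \<rhd> y\<rangle>"
    if "valid U" "valid y" "cod U = (D A \<otimes> D B) \<otimes> D E" "cod y = A \<otimes> B \<otimes> E" "apart (names U) (names y)" for U y
  proof -
    have y: "\<a> A B E \<rhd> (\<a> A B E)\<^sup>\<dagger> \<rhd> y = y" using that app_Comp[of y "(\<a> A B E)\<^sup>\<dagger>" "\<a> A B E"] by simp
    have "(?e \<cdot> (\<a> (D A) (D B) (D E) \<odot> \<a> A B E)) \<rhd> \<langle>U, (\<a> A B E)\<^sup>\<dagger> \<rhd> y\<rangle> = (\<a> A B E \<cdot> ?e') \<rhd> \<langle>U, (\<a> A B E)\<^sup>\<dagger> \<rhd> y\<rangle>"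
      unfolding * ..
    then show ?thesis using that by (simp add: y)
  qed
  show ?thesis
  proof (rule model_ext_elem[OF m, where X = "D ((A \<otimes> B) \<otimes> E)"])
    fix T y assume *: "valid T" "valid y" "cod T = D ((A \<otimes> B) \<otimes> E)" "cod y = A \<otimes> B \<otimes> E" "apart (names T) (names y)"
    then show "?e \<rhd> \<langle>(\<a> (D A) (D B) (D E) \<cdot> (double_tensor A B \<odot> \<one> (D E)) \<cdot> double_tensor (A \<otimes> B) E) \<rhd> T, y\<rangle> =
      ?e \<rhd> \<langle>((\<one> (D A) \<odot> double_tensor B E) \<cdot> double_tensor A (B \<otimes> E) \<cdot> double (\<a> A B E)) \<rhd> T, y\<rangle>"
      using modelD(10)[OF m, of "double (\<a> A B E) \<rhd> T" y] modelD(10)[OF m', of T "(\<a> A B E)\<^sup>\<dagger> \<rhd> y"]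
      by (simp add: e)
  qed simp_all
qed

lemma double_tensor_Sym:
  assumes o [simp]: "A \<in> Obj V" "B \<in> Obj V"
  shows "double_tensor B A \<cdot> double (\<sigma> A B) = \<sigma> (D A) (D B) \<cdot> double_tensor A B"
proof -
  have e: "ev2 B A \<cdot> (\<sigma> (D A) (D B) \<odot> \<one> (B \<otimes> A)) = \<sigma> A B \<cdot> ev2 A B \<cdot> (\<one> (D A \<otimes> D B) \<odot> \<sigma> B A)"
    by (rule TensorO_ext4[of "D A" "D B" B A]) simp_all
  show ?thesis
  proof (rule model_ext_elem[OF model_tensor[OF model_Id[of B] model_Id[of A]], where X = "D (A \<otimes> B)"])
    fix T y assume *: "valid T" "valid y" "cod T = D (A \<otimes> B)" "cod y = B \<otimes> A" "apart (names T) (names y)"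
    have "ev2 B A \<rhd> \<langle>(\<sigma> (D A) (D B) \<cdot> double_tensor A B) \<rhd> T, y\<rangle> =
      (ev2 B A \<cdot> (\<sigma> (D A) (D B) \<odot> \<one> (B \<otimes> A))) \<rhd> \<langle>double_tensor A B \<rhd> T, y\<rangle>" using * by simp
    also have "\<dots> = ev2 B A \<rhd> \<langle>(double_tensor B A \<cdot> double (\<sigma> A B)) \<rhd> T, y\<rangle>" unfolding e using * by simp
    finally show "ev2 B A \<rhd> \<langle>(double_tensor B A \<cdot> double (\<sigma> A B)) \<rhd> T, y\<rangle> =
      ev2 B A \<rhd> \<langle>(\<sigma> (D A) (D B) \<cdot> double_tensor A B) \<rhd> T, y\<rangle>" by simp
  qed simp_all
qed

text \<open>The second leg of \<open>S\<close> is a scalar here, so applying \<open>S\<close> to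
  \<open>un\<close> merely multiplies the pairing of the first leg with \<open>un\<close> by
  it.\<close>

lemma ev_un:
  assumes S: "valid S" "cod S = D \<I>"
  shows "ev \<I> \<rhd> \<langle>S, un\<rangle> = tr \<I> \<rhd> S"
proof -
  have *: "(tr \<I> \<rhd> \<langle>x, un\<rangle>) \<bullet> s = tr \<I> \<rhd> \<langle>x, s\<rangle>"
    if "valid x" "valid s" "cod x = \<I>\<^sup>\<star>" "cod s = \<I>" "apart (names x) (names s)" for x s
  proof -
    have "tr \<I> \<rhd> \<langle>x, s\<rangle> = tr \<I> \<rhd> \<langle>x, s \<bullet> un\<rangle>" using that by simp
    also have "\<dots> = s \<bullet> (tr \<I> \<rhd> \<langle>x, un\<rangle>)" using that by (simp del: scale_un)
    also have "\<dots> = (tr \<I> \<rhd> \<langle>x, un\<rangle>) \<bullet> s" using that by (simp add: scale_commute)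
    finally show ?thesis by simp
  qed
  show ?thesis
    by (rule linear_eq_on_pairs[where t = S and A = "\<I>\<^sup>\<star>" and B = \<I> and Q = "\<lambda>S. ev \<I> \<rhd> \<langle>S, un\<rangle>" and Q' = "\<lambda>S. tr \<I> \<rhd> S"],
      (rule linear_intros | use S in \<open>simp add: *\<close>)+)
qed

lemma double_tensor_Lunit:
  assumes o [simp]: "A \<in> Obj V"
  shows "\<l> (D A) \<cdot> (tr \<I> \<odot> \<one> (D A)) \<cdot> double_tensor \<I> A = double (\<l> A)"
proof -
  have e: "ev A \<cdot> ((\<l> (D A) \<cdot> (tr \<I> \<odot> \<one> (D A))) \<odot> \<one> A) = \<l> A \<cdot> ev2 \<I> A \<cdot> (\<one> (D \<I> \<otimes> D A) \<odot> (\<l> A)\<^sup>\<dagger>)"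
    by (rule TensorO_ext3[of "D \<I>" "D A" A]) (simp_all add: ev_un)
  show ?thesis
  proof (rule model_ext_elem[OF model_Id[OF o], where X = "D (\<I> \<otimes> A)"])
    fix T y assume *: "valid T" "valid y" "cod T = D (\<I> \<otimes> A)" "cod y = A" "apart (names T) (names y)"
    have "ev A \<rhd> \<langle>(\<l> (D A) \<cdot> (tr \<I> \<odot> \<one> (D A)) \<cdot> double_tensor \<I> A) \<rhd> T, y\<rangle> =
      (ev A \<cdot> ((\<l> (D A) \<cdot> (tr \<I> \<odot> \<one> (D A))) \<odot> \<one> A)) \<rhd> \<langle>double_tensor \<I> A \<rhd> T, y\<rangle>" using * by simp
    also have "\<dots> = ev A \<rhd> \<langle>double (\<l> A) \<rhd> T, y\<rangle>" unfolding e using * by (simp flip: app_Lunit_dagger)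
    finally show "ev A \<rhd> \<langle>(\<l> (D A) \<cdot> (tr \<I> \<odot> \<one> (D A)) \<cdot> double_tensor \<I> A) \<rhd> T, y\<rangle> = ev A \<rhd> \<langle>double (\<l> A) \<rhd> T, y\<rangle>" .
  qed simp_all
qed

text \<open>Obtained from the left unit law by the symmetry.\<close>

lemma double_tensor_Runit:
  assumes o [simp]: "A \<in> Obj V"
  shows "\<r> (D A) \<cdot> (\<one> (D A) \<odot> tr \<I>) \<cdot> double_tensor A \<I> = double (\<r> A)"
proof -
  have "double (\<r> A) = double (\<l> A) \<cdot> double (\<sigma> A \<I>)" by (simp add: lunit_sym flip: double_Comp)
  also have "\<dots> = \<l> (D A) \<cdot> (tr \<I> \<odot> \<one> (D A)) \<cdot> (double_tensor \<I> A \<cdot> double (\<sigma> A \<I>))"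
    by (simp add: comp_assoc flip: double_tensor_Lunit)
  also have "\<dots> = (\<l> (D A) \<cdot> (tr \<I> \<odot> \<one> (D A)) \<cdot> \<sigma> (D A) (D \<I>)) \<cdot> double_tensor A \<I>"
    by (simp add: double_tensor_Sym comp_assoc)
  also have "\<l> (D A) \<cdot> (tr \<I> \<odot> \<one> (D A)) \<cdot> \<sigma> (D A) (D \<I>) = \<r> (D A) \<cdot> (\<one> (D A) \<odot> tr \<I>)"
    by (rule TensorO_ext[of "D A" "D \<I>"]) simp_all
  finally show ?thesis by (simp add: comp_assoc)
qed

text \<open>Multiplicativity of the trace: behind the shuffle of factors, the nested pairing is a
  product of two traces.\<close>

lemma tr_tensor:
  assumes o [simp]: "A \<in> Obj V" "B \<in> Obj V"
  shows "\<l> \<I> \<cdot> (tr A \<odot> tr B) \<cdot> double_tensor A B = tr (A \<otimes> B)"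
proof -
  have *: "\<l> \<I> \<cdot> (tr A \<odot> tr B) \<cdot> double_shuffle A B = tensor_tr A B"
    by (rule TensorO_ext4[of "B\<^sup>\<star>" "A\<^sup>\<star>" A B]) simp_all
  have "\<l> \<I> \<cdot> (tr A \<odot> tr B) \<cdot> double_tensor A B = tensor_tr A B \<cdot> (dual_tensor A B \<odot> \<one> (A \<otimes> B))"
    by (simp add: double_tensor_eq comp_assoc flip: *)
  also have "\<dots> = tr (A \<otimes> B)"
    by (rule TensorO_ext[of "(A \<otimes> B)\<^sup>\<star>" "A \<otimes> B"]) (simp_all add: tensor_tr_dual_tensor)
  finally show ?thesis .
qed

end


section \<open>Completely positive maps and CPM[V]\<close>

context dagger_compact_category
begin

text \<open>The trace over \<open>X\<close> of operators on \<open>X \<otimes> B\<close>. Written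
  with \<open>double_tensor\<close>, it inherits the coherence laws of doubling.\<close>

definition partial_tr :: "'o \<Rightarrow> 'o \<Rightarrow> 'm" where
  "partial_tr X B = \<l> (D B) \<cdot> (tr X \<odot> \<one> (D B)) \<cdot> double_tensor X B"

lemma partial_tr_typing [simp]:
  assumes "X \<in> Obj V" "B \<in> Obj V"
  shows "partial_tr X B \<in> Arr V" "Dom V (partial_tr X B) = D (X \<otimes> B)" "Cod V (partial_tr X B) = D B"
  using assms by (simp_all add: partial_tr_def)

text \<open>The literal form of complete positivity is translated here: contracting the inner wires
  is the shuffle followed by the trace over \<open>X\<close>.\<close>

lemma mid_cap_double:
  assumes [simp]: "X \<in> Obj V" "B \<in> Obj V" "g \<in> Arr V" "Cod V g = X \<otimes> B"
  shows "mid_cap (B\<^sup>\<star>) (X\<^sup>\<star>) X B (tr X) \<cdot> ((dual_tensor X B \<cdot> conj_arr g) \<odot> g) = partial_tr X B \<cdot> double g"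
proof -
  have "mid_cap (B\<^sup>\<star>) (X\<^sup>\<star>) X B (tr X) = \<l> (D B) \<cdot> (tr X \<odot> \<one> (D B)) \<cdot> double_shuffle X B"
    by (rule TensorO_ext4[of "B\<^sup>\<star>" "X\<^sup>\<star>" X B]) simp_all
  then show ?thesis by (simp add: partial_tr_def double_tensor_eq double_def comp_assoc interchange)
qed

lemma completely_positive_iff:
  assumes "B \<in> Obj V"
  shows "completely_positive A B f \<longleftrightarrow> f \<in> hom V (D A) (D B) \<and>
     (\<exists>X \<in> Obj V. \<exists>g \<in> hom V A (X \<otimes> B). f = partial_tr X B \<cdot> double g)"
  unfolding completely_positive_def using mid_cap_double assms
  by (metis (no_types, lifting) homD(1) homD(3))

lemma completely_positiveD:
  assumes "completely_positive A B f"
  shows "f \<in> Arr V" "Dom V f = D A" "Cod V f = D B"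
  using assms by (auto simp: completely_positive_def hom_def)

lemma completely_positiveI:
  "X \<in> Obj V \<Longrightarrow> B \<in> Obj V \<Longrightarrow> g \<in> Arr V \<Longrightarrow> Dom V g = A \<Longrightarrow> Cod V g = X \<otimes> B \<Longrightarrow> f = partial_tr X B \<cdot> double g \<Longrightarrow>
   completely_positive A B f"
  unfolding completely_positive_iff by (auto simp: hom_def)

lemma completely_positiveE:
  assumes "completely_positive A B f" "B \<in> Obj V"
  obtains X g where "X \<in> Obj V" "g \<in> Arr V" "Dom V g = A" "Cod V g = X \<otimes> B" "f = partial_tr X B \<cdot> double g"
  using assms unfolding completely_positive_iff[OF assms(2)] by (auto simp: hom_def)

lemma partial_tr_natural:
  assumes [simp]: "X \<in> Obj V" "g \<in> Arr V"
  shows "partial_tr X (Cod V g) \<cdot> double (\<one> X \<odot> g) = double g \<cdot> partial_tr X (Dom V g)"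
proof -
  have "partial_tr X (Cod V g) \<cdot> double (\<one> X \<odot> g) =
     (\<l> (D (Cod V g)) \<cdot> (tr X \<odot> double g)) \<cdot> double_tensor X (Dom V g)"
    by (simp add: partial_tr_def comp_assoc double_tensor_natural) (simp add: interchange flip: comp_assoc)
  also have "\<l> (D (Cod V g)) \<cdot> (tr X \<odot> double g) = double g \<cdot> \<l> (D (Dom V g)) \<cdot> (tr X \<odot> \<one> (D (Dom V g)))"
    by (rule TensorO_ext[of "D X" "D (Dom V g)"]) simp_all
  finally show ?thesis by (simp add: partial_tr_def comp_assoc)
qed

text \<open>Fubini for traces, from associativity of \<open>double_tensor\<close> and
  multiplicativity of \<open>tr\<close>.\<close>

lemma partial_tr_partial_tr:
  assumes o [simp]: "X \<in> Obj V" "Y \<in> Obj V" "B \<in> Obj V"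
  shows "partial_tr Y B \<cdot> partial_tr X (Y \<otimes> B) = partial_tr (X \<otimes> Y) B \<cdot> double ((\<a> X Y B)\<^sup>\<dagger>)"
proof -
  let ?d = "(\<one> (D X) \<odot> double_tensor Y B) \<cdot> double_tensor X (Y \<otimes> B)"
  let ?F = "\<l> (D B) \<cdot> (tr Y \<odot> \<one> (D B)) \<cdot> \<l> (D Y \<otimes> D B) \<cdot> (tr X \<odot> \<one> (D Y \<otimes> D B))"
  let ?G = "\<l> (D B) \<cdot> ((\<l> \<I> \<cdot> (tr X \<odot> tr Y)) \<odot> \<one> (D B))"
  have 1: "double_tensor Y B \<cdot> \<l> (D (Y \<otimes> B)) \<cdot> (tr X \<odot> \<one> (D (Y \<otimes> B))) =
      \<l> (D Y \<otimes> D B) \<cdot> (tr X \<odot> \<one> (D Y \<otimes> D B)) \<cdot> (\<one> (D X) \<odot> double_tensor Y B)"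
    by (rule TensorO_ext[of "D X" "D (Y \<otimes> B)"]) simp_all
  have "partial_tr Y B \<cdot> partial_tr X (Y \<otimes> B) = \<l> (D B) \<cdot> (tr Y \<odot> \<one> (D B)) \<cdot>
      (double_tensor Y B \<cdot> \<l> (D (Y \<otimes> B)) \<cdot> (tr X \<odot> \<one> (D (Y \<otimes> B)))) \<cdot> double_tensor X (Y \<otimes> B)"
    by (simp add: partial_tr_def comp_assoc)
  also have "\<dots> = ?F \<cdot> ?d" unfolding 1 by (simp add: comp_assoc)
  also have "?F = ?G \<cdot> (\<a> (D X) (D Y) (D B))\<^sup>\<dagger>"
    by (rule TensorO_ext_right[of "D X" "D Y" "D B"]) simp_all
  also have "(?G \<cdot> (\<a> (D X) (D Y) (D B))\<^sup>\<dagger>) \<cdot> ?d =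
      (?G \<cdot> (\<a> (D X) (D Y) (D B))\<^sup>\<dagger>) \<cdot> (?d \<cdot> double (\<a> X Y B)) \<cdot> double ((\<a> X Y B)\<^sup>\<dagger>)"
    by (simp add: comp_assoc flip: double_Comp)
  also have "?d \<cdot> double (\<a> X Y B) = \<a> (D X) (D Y) (D B) \<cdot> (double_tensor X Y \<odot> \<one> (D B)) \<cdot> double_tensor (X \<otimes> Y) B"
    unfolding double_tensor_Assoc[OF o] by (simp add: comp_assoc)
  also have "(?G \<cdot> (\<a> (D X) (D Y) (D B))\<^sup>\<dagger>) \<cdot> (\<a> (D X) (D Y) (D B) \<cdot> (double_tensor X Y \<odot> \<one> (D B)) \<cdot> double_tensor (X \<otimes> Y) B) \<cdot>
      double ((\<a> X Y B)\<^sup>\<dagger>) = ?G \<cdot> (double_tensor X Y \<odot> \<one> (D B)) \<cdot> double_tensor (X \<otimes> Y) B \<cdot> double ((\<a> X Y B)\<^sup>\<dagger>)"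
    by (simp add: comp_assoc)
  also have "\<dots> = partial_tr (X \<otimes> Y) B \<cdot> double ((\<a> X Y B)\<^sup>\<dagger>)"
    by (simp add: partial_tr_def comp_assoc interchange flip: tr_tensor) (simp add: interchange flip: comp_assoc)
  finally show ?thesis .
qed

lemma cp_double: "f \<in> Arr V \<Longrightarrow> Dom V f = A \<Longrightarrow> Cod V f = B \<Longrightarrow> completely_positive A B (double f)"
  by (rule completely_positiveI[where X = \<I> and g = "(\<l> B)\<^sup>\<dagger> \<cdot> f"])
    (auto simp: partial_tr_def double_tensor_Lunit simp flip: double_Comp)

lemma cp_Id: "A \<in> Obj V \<Longrightarrow> completely_positive A A (\<one> (D A))"
  using cp_double[of "\<one> A" A A] by simp

lemma cp_partial_tr:
  assumes "X \<in> Obj V" "B \<in> Obj V"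
  shows "completely_positive (X \<otimes> B) B (partial_tr X B)"
  by (rule completely_positiveI[where X = X and g = "\<one> (X \<otimes> B)"]) (use assms in simp_all)

text \<open>The morphism \<open>k\<close> slides past the partial trace over \<open>X\<close>, after
  which both environments are traced out together as \<open>X \<otimes> Y\<close>.\<close>

lemma cp_Comp:
  assumes f: "completely_positive A B f" and g: "completely_positive B E g"
    and o [simp]: "B \<in> Obj V" "E \<in> Obj V"
  shows "completely_positive A E (g \<cdot> f)"
proof -
  obtain X h where h [simp]: "X \<in> Obj V" "h \<in> Arr V" "Dom V h = A" "Cod V h = X \<otimes> B" and f': "f = partial_tr X B \<cdot> double h"
    using f by (rule completely_positiveE) simp
  obtain Y k where k [simp]: "Y \<in> Obj V" "k \<in> Arr V" "Dom V k = B" "Cod V k = Y \<otimes> E" and g': "g = partial_tr Y E \<cdot> double k"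
    using g by (rule completely_positiveE) simp
  have "g \<cdot> f = partial_tr Y E \<cdot> (double k \<cdot> partial_tr X B) \<cdot> double h" unfolding f' g' by (simp add: comp_assoc)
  also have "double k \<cdot> partial_tr X B = partial_tr X (Y \<otimes> E) \<cdot> double (\<one> X \<odot> k)" using partial_tr_natural[of X k] by simp
  also have "partial_tr Y E \<cdot> (partial_tr X (Y \<otimes> E) \<cdot> double (\<one> X \<odot> k)) \<cdot> double h =
     (partial_tr Y E \<cdot> partial_tr X (Y \<otimes> E)) \<cdot> double ((\<one> X \<odot> k) \<cdot> h)" by (simp add: comp_assoc double_Comp)
  also have "\<dots> = partial_tr (X \<otimes> Y) E \<cdot> double ((\<a> X Y E)\<^sup>\<dagger> \<cdot> (\<one> X \<odot> k) \<cdot> h)"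
    unfolding partial_tr_partial_tr[OF h(1) k(1) o(2)] by (simp add: comp_assoc double_Comp)
  finally show ?thesis
    by (intro completely_positiveI[where X = "X \<otimes> Y" and g = "(\<a> X Y E)\<^sup>\<dagger> \<cdot> (\<one> X \<odot> k) \<cdot> h"]) simp_all
qed

section \<open>Tensor products of completely positive maps\<close>

lemma double_tensor_mid_swap:
  assumes o [simp]: "X \<in> Obj V" "B \<in> Obj V" "Y \<in> Obj V" "E \<in> Obj V"
  shows "mid_swap (D X) (D B) (D Y) (D E) \<cdot> (double_tensor X B \<odot> double_tensor Y E) \<cdot> double_tensor (X \<otimes> B) (Y \<otimes> E) =
    (double_tensor X Y \<odot> double_tensor B E) \<cdot> double_tensor (X \<otimes> Y) (B \<otimes> E) \<cdot> double (mid_swap X B Y E)"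
proof -
  have m2: "model (D A \<otimes> D B) (A \<otimes> B) (ev2 A B) (double_tensor A B)" if "A \<in> Obj V" "B \<in> Obj V" for A B
    using model_tensor[OF model_Id[of A] model_Id[of B]] that by simp
  note m = model_tensor[OF m2[OF o(1,3)] m2[OF o(2,4)]] and m' = model_tensor[OF m2[OF o(1,2)] m2[OF o(3,4)]]
  let ?e = "par (D X \<otimes> D Y) (X \<otimes> Y) (ev2 X Y) (D B \<otimes> D E) (B \<otimes> E) (ev2 B E)"
  let ?e' = "par (D X \<otimes> D B) (X \<otimes> B) (ev2 X B) (D Y \<otimes> D E) (Y \<otimes> E) (ev2 Y E)"
  let ?m = "mid_swap (D X) (D B) (D Y) (D E)" and ?A = "(X \<otimes> B) \<otimes> (Y \<otimes> E)" and ?B = "(X \<otimes> Y) \<otimes> (B \<otimes> E)"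
  let ?U = "(D X \<otimes> D B) \<otimes> (D Y \<otimes> D E)"
  have e: "?e \<cdot> (?m \<odot> \<one> ?B) = mid_swap X B Y E \<cdot> ?e' \<cdot> (\<one> ?U \<odot> mid_swap X Y B E)"
  proof (rule free_ext)
    let ?v = "\<langle>\<langle>\<langle>var 0 (D X), var 1 (D B)\<rangle>, \<langle>var 2 (D Y), var 3 (D E)\<rangle>\<rangle>, \<langle>\<langle>var 4 X, var 5 Y\<rangle>, \<langle>var 6 B, var 7 E\<rangle>\<rangle>\<rangle>"
    show "free ?v" by (intro free_pair free_var) simp_all
    show "(?e \<cdot> (?m \<odot> \<one> ?B)) \<rhd> ?v = (mid_swap X B Y E \<cdot> ?e' \<cdot> (\<one> ?U \<odot> mid_swap X Y B E)) \<rhd> ?v" by (simp add: disjnt_def)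
  qed simp_all
  let ?l = "?m \<cdot> (double_tensor X B \<odot> double_tensor Y E) \<cdot> double_tensor (X \<otimes> B) (Y \<otimes> E)"
  let ?r = "(double_tensor X Y \<odot> double_tensor B E) \<cdot> double_tensor (X \<otimes> Y) (B \<otimes> E) \<cdot> double (mid_swap X B Y E)"
  show ?thesis
  proof (rule model_ext_elem[OF m, where X = "D ?A"])
    fix T y assume *: "valid T" "valid y" "cod T = D ?A" "cod y = ?B" "apart (names T) (names y)"
    have "?e \<rhd> \<langle>?l \<rhd> T, y\<rangle> =
       (?e \<cdot> (?m \<odot> \<one> ?B)) \<rhd> \<langle>(double_tensor X B \<odot> double_tensor Y E) \<rhd> double_tensor (X \<otimes> B) (Y \<otimes> E) \<rhd> T, y\<rangle>"
      using * by simp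
    also have "\<dots> = mid_swap X B Y E \<rhd> ev ?A \<rhd> \<langle>T, mid_swap X Y B E \<rhd> y\<rangle>"
      unfolding e using * modelD(10)[OF m', of T "mid_swap X Y B E \<rhd> y"] by simp
    also have "\<dots> = ?e \<rhd> \<langle>?r \<rhd> T, y\<rangle>" using * modelD(10)[OF m, of "double (mid_swap X B Y E) \<rhd> T" y] by simp
    finally show "?e \<rhd> \<langle>?l \<rhd> T, y\<rangle> = ?e \<rhd> \<langle>?r \<rhd> T, y\<rangle>" .
  qed simp_all
qed

definition cpm_tensor :: "'o \<Rightarrow> 'o \<Rightarrow> 'o \<Rightarrow> 'o \<Rightarrow> 'm \<Rightarrow> 'm \<Rightarrow> 'm" where
  "cpm_tensor A A' B B' f g = (double_tensor B B')\<^sup>\<dagger> \<cdot> (f \<odot> g) \<cdot> double_tensor A A'"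

text \<open>Two environments may be traced out as one, once \<open>mid_swap\<close> has brought
  \<open>X\<close> next to \<open>Y\<close>.\<close>

lemma partial_tr_tensor:
  assumes o [simp]: "X \<in> Obj V" "B \<in> Obj V" "Y \<in> Obj V" "E \<in> Obj V"
  shows "cpm_tensor (X \<otimes> B) (Y \<otimes> E) B E (partial_tr X B) (partial_tr Y E) = partial_tr (X \<otimes> Y) (B \<otimes> E) \<cdot> double (mid_swap X B Y E)"
proof -
  let ?H = "(\<l> (D B) \<cdot> (tr X \<odot> \<one> (D B))) \<odot> (\<l> (D E) \<cdot> (tr Y \<odot> \<one> (D E)))"
  let ?G = "\<l> (D B \<otimes> D E) \<cdot> ((\<l> \<I> \<cdot> (tr X \<odot> tr Y)) \<odot> \<one> (D B \<otimes> D E))"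
  let ?d = "(double_tensor X B \<odot> double_tensor Y E) \<cdot> double_tensor (X \<otimes> B) (Y \<otimes> E)"
  let ?m = "mid_swap (D X) (D B) (D Y) (D E)"
  have 1: "?H = ?G \<cdot> ?m"
    by (rule TensorO_ext4[of "D X" "D B" "D Y" "D E"]) (simp_all add: scale_left_commute)
  have 2: "double_tensor B E \<cdot> \<l> (D (B \<otimes> E)) \<cdot> (tr (X \<otimes> Y) \<odot> \<one> (D (B \<otimes> E))) = ?G \<cdot> (double_tensor X Y \<odot> double_tensor B E)"
    by (rule TensorO_ext[of "D (X \<otimes> Y)" "D (B \<otimes> E)"]) (simp_all flip: tr_tensor)
  have "cpm_tensor (X \<otimes> B) (Y \<otimes> E) B E (partial_tr X B) (partial_tr Y E) = (double_tensor B E)\<^sup>\<dagger> \<cdot> ?H \<cdot> ?d"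
    by (simp add: cpm_tensor_def partial_tr_def comp_assoc) (simp add: interchange comp_assoc flip: comp_assoc)
  also have "\<dots> = (double_tensor B E)\<^sup>\<dagger> \<cdot> ?G \<cdot> (?m \<cdot> ?d)" unfolding 1 by (simp add: comp_assoc)
  also have "\<dots> = (double_tensor B E)\<^sup>\<dagger> \<cdot> (?G \<cdot> (double_tensor X Y \<odot> double_tensor B E)) \<cdot> double_tensor (X \<otimes> Y) (B \<otimes> E) \<cdot> double (mid_swap X B Y E)"
    unfolding double_tensor_mid_swap[OF o] by (simp add: comp_assoc)
  also have "\<dots> = ((double_tensor B E)\<^sup>\<dagger> \<cdot> double_tensor B E) \<cdot> \<l> (D (B \<otimes> E)) \<cdot> (tr (X \<otimes> Y) \<odot> \<one> (D (B \<otimes> E))) \<cdot>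
      double_tensor (X \<otimes> Y) (B \<otimes> E) \<cdot> double (mid_swap X B Y E)"
    unfolding 2[symmetric] by (simp add: comp_assoc del: double_tensor_typing(4))
  also have "\<dots> = partial_tr (X \<otimes> Y) (B \<otimes> E) \<cdot> double (mid_swap X B Y E)"
    by (simp add: partial_tr_def comp_assoc)
  finally show ?thesis .
qed

lemma cpm_tensor_typing [simp]:
  assumes "f \<in> Arr V" "g \<in> Arr V" "Dom V f = D A" "Dom V g = D A'" "Cod V f = D B" "Cod V g = D B'"
    "A \<in> Obj V" "A' \<in> Obj V" "B \<in> Obj V" "B' \<in> Obj V"
  shows "cpm_tensor A A' B B' f g \<in> Arr V" "Dom V (cpm_tensor A A' B B' f g) = D (A \<otimes> A')"
    "Cod V (cpm_tensor A A' B B' f g) = D (B \<otimes> B')"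
  using assms by (simp_all add: cpm_tensor_def)

lemma double_tensor_cancel [simp]:
  assumes "A \<in> Obj V" "B \<in> Obj V" "f \<in> Arr V"
  shows "Cod V f = D A \<otimes> D B \<Longrightarrow> double_tensor A B \<cdot> (double_tensor A B)\<^sup>\<dagger> \<cdot> f = f"
    and "Cod V f = D (A \<otimes> B) \<Longrightarrow> (double_tensor A B)\<^sup>\<dagger> \<cdot> double_tensor A B \<cdot> f = f"
  using assms by (simp_all flip: comp_assoc)

lemma cpm_tensor_Comp:
  assumes "f \<in> Arr V" "g \<in> Arr V" "f' \<in> Arr V" "g' \<in> Arr V" "Dom V f = D A" "Dom V f' = D A'" "Cod V f = D B" "Cod V f' = D B'"
    "Dom V g = D B" "Dom V g' = D B'" "Cod V g = D E" "Cod V g' = D E'"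
    "A \<in> Obj V" "A' \<in> Obj V" "B \<in> Obj V" "B' \<in> Obj V" "E \<in> Obj V" "E' \<in> Obj V"
  shows "cpm_tensor A A' E E' (g \<cdot> f) (g' \<cdot> f') = cpm_tensor B B' E E' g g' \<cdot> cpm_tensor A A' B B' f f'"
  using assms by (simp add: cpm_tensor_def comp_assoc) (simp add: interchange flip: comp_assoc)

lemma cpm_tensor_double:
  assumes "f \<in> Arr V" "g \<in> Arr V" "Dom V f = A" "Dom V g = A'" "Cod V f = B" "Cod V g = B'"
  shows "cpm_tensor A A' B B' (double f) (double g) = double (f \<odot> g)"
proof -
  have "A \<in> Obj V" "A' \<in> Obj V" "B \<in> Obj V" "B' \<in> Obj V" using assms by auto
  then show ?thesis using assms double_tensor_natural[of f g B B', symmetric]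
    by (simp add: cpm_tensor_def)
qed

lemma cp_tensor:
  assumes f: "completely_positive A B f" and g: "completely_positive A' B' g"
    and o [simp]: "A \<in> Obj V" "A' \<in> Obj V" "B \<in> Obj V" "B' \<in> Obj V"
  shows "completely_positive (A \<otimes> A') (B \<otimes> B') (cpm_tensor A A' B B' f g)"
proof -
  obtain X h where h [simp]: "X \<in> Obj V" "h \<in> Arr V" "Dom V h = A" "Cod V h = X \<otimes> B" and f': "f = partial_tr X B \<cdot> double h"
    using f by (rule completely_positiveE) simp
  obtain Y k where k [simp]: "Y \<in> Obj V" "k \<in> Arr V" "Dom V k = A'" "Cod V k = Y \<otimes> B'" and g': "g = partial_tr Y B' \<cdot> double k"
    using g by (rule completely_positiveE) simp
  have "cpm_tensor A A' B B' f g = cpm_tensor (X \<otimes> B) (Y \<otimes> B') B B' (partial_tr X B) (partial_tr Y B') \<cdot>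
     cpm_tensor A A' (X \<otimes> B) (Y \<otimes> B') (double h) (double k)"
    unfolding f' g' by (rule cpm_tensor_Comp) simp_all
  also have "\<dots> = partial_tr (X \<otimes> Y) (B \<otimes> B') \<cdot> double (mid_swap X B Y B' \<cdot> (h \<odot> k))"
    by (simp add: partial_tr_tensor cpm_tensor_double double_Comp comp_assoc)
  finally show ?thesis
    by (intro completely_positiveI[where X = "X \<otimes> Y" and g = "mid_swap X B Y B' \<cdot> (h \<odot> k)"]) simp_all
qed

text \<open>The partial trace over \<open>Y\<close> of an operator on \<open>Y \<otimes> S\<close>, applied to an element of \<open>S\<close> and with the
  two legs of \<open>\<eta> Y\<close> as an argument.\<close>

definition contract :: "'o \<Rightarrow> 'o \<Rightarrow> 'm" where
  "contract Y S = \<l> S \<cdot> (tr Y \<odot> \<one> S) \<cdot> (\<a> (Y\<^sup>\<star>) Y S)\<^sup>\<dagger> \<cdot>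
     (\<one> (Y\<^sup>\<star>) \<odot> (ev (Y \<otimes> S) \<cdot> left_swap Y (D (Y \<otimes> S)) S)) \<cdot> \<a> (Y\<^sup>\<star>) Y (D (Y \<otimes> S) \<otimes> S)"

lemma contract_typing [simp]:
  assumes "Y \<in> Obj V" "S \<in> Obj V"
  shows "contract Y S \<in> Arr V" "Dom V (contract Y S) = D Y \<otimes> (D (Y \<otimes> S) \<otimes> S)" "Cod V (contract Y S) = S"
  using assms by (simp_all add: contract_def)

lemma app_contract:
  assumes "valid e'" "valid e" "valid W" "valid s" "cod e' = Y\<^sup>\<star>" "cod e = Y" "cod W = D (Y \<otimes> S)" "cod s = S"
    "disjnt (names e) (names W)"
  shows "contract Y S \<rhd> \<langle>\<langle>e', e\<rangle>, \<langle>W, s\<rangle>\<rangle> =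
    \<l> S \<rhd> (tr Y \<odot> \<one> S) \<rhd> (\<a> (Y\<^sup>\<star>) Y S)\<^sup>\<dagger> \<rhd> \<langle>e', ev (Y \<otimes> S) \<rhd> \<langle>W, \<langle>e, s\<rangle>\<rangle>\<rangle>"
proof -
  have "Y \<in> Obj V" "S \<in> Obj V" using assms by auto
  then show ?thesis using assms by (simp add: contract_def)
qed

text \<open>The cup of \<open>Y\<close> plays the role of a sum over a basis: its second leg is fed
  into the operator and its first leg is paired with the result. Facts \<open>1\<close> to
  \<open>3\<close> prove this on \<open>D Y \<otimes> D S\<close>, first for both legs of the
  \<open>D Y\<close> factor given, then for a pair, then for any element;
  \<open>double_tensor\<close> transports it to \<open>D (Y \<otimes> S)\<close>.\<close>

lemma ev_partial_tr:
  assumes o [simp]: "Y \<in> Obj V" "S \<in> Obj V"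
    and Ws: "valid W" "valid s" "cod W = D (Y \<otimes> S)" "cod s = S" "apart (names W) (names s)"
  shows "ev S \<rhd> \<langle>partial_tr Y S \<rhd> W, s\<rangle> = contract Y S \<rhd> \<langle>\<eta> Y \<rhd> un, \<langle>W, s\<rangle>\<rangle>"
proof -
  let ?c = "coevaluation (Y\<^sup>\<star>) Y (tr Y)"
  let ?q = "\<lambda>t U. \<l> S \<rhd> (tr Y \<odot> \<one> S) \<rhd> (\<a> (Y\<^sup>\<star>) Y S)\<^sup>\<dagger> \<rhd> (\<one> (Y\<^sup>\<star>) \<odot> (ev2 Y S \<cdot> left_swap Y (D Y \<otimes> D S) S)) \<rhd>
      \<a> (Y\<^sup>\<star>) Y ((D Y \<otimes> D S) \<otimes> S) \<rhd> \<langle>t, \<langle>U, s\<rangle>\<rangle>"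
  have 1: "?q (\<eta> Y \<rhd> un) \<langle>\<langle>u', u\<rangle>, R\<rangle> = (tr Y \<rhd> \<langle>u', u\<rangle>) \<bullet> (ev S \<rhd> \<langle>R, s\<rangle>)"
    if *: "valid u'" "valid u" "valid R" "cod u' = Y\<^sup>\<star>" "cod u = Y" "cod R = D S" "apart (names u') (names u)"
      "apart (names u') (names R)" "apart (names u) (names R)"
      "apart (names u') (names s)" "apart (names u) (names s)" "apart (names R) (names s)" for u' u R
  proof -
    have "?q (\<eta> Y \<rhd> un) \<langle>\<langle>u', u\<rangle>, R\<rangle> = (tr Y \<rhd> \<langle>?c \<rhd> \<langle>\<eta> Y \<rhd> un, u'\<rangle>, u\<rangle>) \<bullet> (ev S \<rhd> \<langle>R, s\<rangle>)"
      by (rule linear_eq_on_pairs[where t = "\<eta> Y \<rhd> un" and A = "Y\<^sup>\<star>" and B = Y and Q = "\<lambda>t. ?q t \<langle>\<langle>u', u\<rangle>, R\<rangle>"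
            and Q' = "\<lambda>t. (tr Y \<rhd> \<langle>?c \<rhd> \<langle>t, u'\<rangle>, u\<rangle>) \<bullet> (ev S \<rhd> \<langle>R, s\<rangle>)"],
          (rule linear_intros | use * Ws in simp)+)
    then show ?thesis using * by simp
  qed
  have 2: "?q (\<eta> Y \<rhd> un) \<langle>T, R\<rangle> = (tr Y \<rhd> T) \<bullet> (ev S \<rhd> \<langle>R, s\<rangle>)"
    if *: "valid T" "valid R" "cod T = D Y" "cod R = D S" "apart (names T) (names R)"
      "apart (names T) (names s)" "apart (names R) (names s)" for T R
    by (rule linear_eq_on_pairs[where t = T and A = "Y\<^sup>\<star>" and B = Y and Q = "\<lambda>T. ?q (\<eta> Y \<rhd> un) \<langle>T, R\<rangle>"
          and Q' = "\<lambda>T. (tr Y \<rhd> T) \<bullet> (ev S \<rhd> \<langle>R, s\<rangle>)"],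
        (rule linear_intros | rule 1 | use * Ws in simp)+)
  have 3: "?q (\<eta> Y \<rhd> un) U = ev S \<rhd> \<langle>\<l> (D S) \<rhd> (tr Y \<odot> \<one> (D S)) \<rhd> U, s\<rangle>"
    if *: "valid U" "cod U = D Y \<otimes> D S" "apart (names U) (names s)" for U
  proof (rule linear_eq_on_pairs[where t = U and A = "D Y" and B = "D S" and Q = "\<lambda>U. ?q (\<eta> Y \<rhd> un) U"
          and Q' = "\<lambda>U. ev S \<rhd> \<langle>\<l> (D S) \<rhd> (tr Y \<odot> \<one> (D S)) \<rhd> U, s\<rangle>"])
    show "?q (\<eta> Y \<rhd> un) \<langle>T, R\<rangle> = ev S \<rhd> \<langle>\<l> (D S) \<rhd> (tr Y \<odot> \<one> (D S)) \<rhd> \<langle>T, R\<rangle>, s\<rangle>"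
      if "valid T" "valid R" "cod T = D Y" "cod R = D S" "apart (names T) (names R)"
        "apart (names T) ({} \<union> names s \<union> names (\<eta> Y \<rhd> un))" "apart (names T) ({} \<union> names s)"
        "apart (names R) ({} \<union> names s \<union> names (\<eta> Y \<rhd> un))" "apart (names R) ({} \<union> names s)" for T R
      using that Ws by (subst 2) simp_all
  qed ((rule linear_intros | use * Ws in simp)+)
  have "ev S \<rhd> \<langle>partial_tr Y S \<rhd> W, s\<rangle> = ?q (\<eta> Y \<rhd> un) (double_tensor Y S \<rhd> W)"
    using 3[of "double_tensor Y S \<rhd> W"] Ws by (simp add: partial_tr_def)
  also have "\<dots> = contract Y S \<rhd> \<langle>\<eta> Y \<rhd> un, \<langle>W, s\<rangle>\<rangle>"
    by (rule linear_eq_on_pairs[where t = "\<eta> Y \<rhd> un" and A = "Y\<^sup>\<star>" and B = Y and Q = "\<lambda>t. ?q t (double_tensor Y S \<rhd> W)"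
          and Q' = "\<lambda>t. contract Y S \<rhd> \<langle>t, \<langle>W, s\<rangle>\<rangle>"],
        (rule linear_intros | use Ws in \<open>simp add: app_contract\<close>)+)
  finally show ?thesis .
qed

section \<open>Adjoints of partial traces and of completely positive maps\<close>

lemma ev_double_tensor_dagger [simp]:
  assumes "A \<in> Obj V" "B \<in> Obj V" "valid U" "valid s" "cod U = D A \<otimes> D B" "cod s = A \<otimes> B" "apart (names U) (names s)"
  shows "ev (A \<otimes> B) \<rhd> \<langle>(double_tensor A B)\<^sup>\<dagger> \<rhd> U, s\<rangle> = ev2 A B \<rhd> \<langle>U, s\<rangle>"
proof -
  have "double_tensor A B \<rhd> (double_tensor A B)\<^sup>\<dagger> \<rhd> U = U"
    using assms app_Comp[of U "(double_tensor A B)\<^sup>\<dagger>" "double_tensor A B"] by simp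
  then show ?thesis using ev_double_tensor[of A B "(double_tensor A B)\<^sup>\<dagger> \<rhd> U" s] assms by simp
qed

text \<open>The adjoint sends \<open>T\<close> to \<open>\<one> \<otimes> T\<close> on
  \<open>X \<otimes> B\<close>. Creating a cup of \<open>X\<close> next to \<open>B\<close> and
  tracing out its leg in \<open>X\<^sup>\<star>\<close> has the same effect, which exhibits the
  adjoint as a dilation.\<close>

lemma partial_tr_dagger:
  assumes o [simp]: "X \<in> Obj V" "B \<in> Obj V"
  shows "(partial_tr X B)\<^sup>\<dagger> = partial_tr (X\<^sup>\<star>) (X \<otimes> B) \<cdot> double (\<a> (X\<^sup>\<star>) X B \<cdot> (\<eta> X \<odot> \<one> B) \<cdot> (\<l> B)\<^sup>\<dagger>)"
proof -
  let ?Y = "X\<^sup>\<star>" and ?S = "X \<otimes> B" and ?h = "\<a> (X\<^sup>\<star>) X B \<cdot> (\<eta> X \<odot> \<one> B) \<cdot> (\<l> B)\<^sup>\<dagger>"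
  show ?thesis
  proof (rule model_ext[OF model_Id[of ?S], where X = "D B"])
    show "ev ?S \<cdot> ((partial_tr X B)\<^sup>\<dagger> \<odot> \<one> ?S) = ev ?S \<cdot> ((partial_tr ?Y ?S \<cdot> double ?h) \<odot> \<one> ?S)"
    proof (rule TensorO_ext_right[of "D B" X B])
      fix T x b assume *: "valid T" "valid x" "valid b" "cod T = D B" "cod x = X" "cod b = B"
        "apart (names T) (names x)" "apart (names T) (names b)" "apart (names x) (names b)"
      let ?z = "ev B \<rhd> \<langle>T, b\<rangle>" and ?s = "\<langle>x, b\<rangle>" and ?W = "double ?h \<rhd> T"
      have L: "(ev ?S \<cdot> ((partial_tr X B)\<^sup>\<dagger> \<odot> \<one> ?S)) \<rhd> \<langle>T, ?s\<rangle> = \<langle>x, ?z\<rangle>"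
        using * by (simp add: partial_tr_def dagger_Comp)
      let ?k = "\<lambda>e' r. \<l> ?S \<rhd> (tr ?Y \<odot> \<one> ?S) \<rhd> (\<a> (?Y\<^sup>\<star>) ?Y ?S)\<^sup>\<dagger> \<rhd> \<langle>e', \<a> ?Y X B \<rhd> \<langle>r, ?z\<rangle>\<rangle>"
      \<comment> \<open>Two cups are present, that of \<open>?Y\<close> from the partial trace and
        that of \<open>X\<close> from \<open>?h\<close>. They form a zigzag, which
        \<open>ev ?Y\<close> and \<open>ev X\<close> straighten in turn.\<close>
      have 1: "(tr X \<rhd> \<langle>e, x\<rangle>) \<bullet> ?k e' (\<eta> X \<rhd> un) = \<langle>ev X \<rhd> \<langle>(ev ?Y \<odot> \<one> X) \<rhd> (\<a> (D ?Y) ?Y X)\<^sup>\<dagger> \<rhd> \<langle>\<langle>e', e\<rangle>, \<eta> X \<rhd> un\<rangle>, x\<rangle>, ?z\<rangle>"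
        if e: "valid e'" "valid e" "cod e' = ?Y\<^sup>\<star>" "cod e = ?Y" "apart (names e') (names e)"
          "apart (names e') (names x)" "apart (names e) (names x)" "apart (names e') (names T)" "apart (names e) (names T)"
          "apart (names e') (names b)" "apart (names e) (names b)" for e' e
        by (rule linear_eq_on_pairs[where t = "\<eta> X \<rhd> un" and A = ?Y and B = X and Q = "\<lambda>r. (tr X \<rhd> \<langle>e, x\<rangle>) \<bullet> ?k e' r"
            and Q' = "\<lambda>r. \<langle>ev X \<rhd> \<langle>(ev ?Y \<odot> \<one> X) \<rhd> (\<a> (D ?Y) ?Y X)\<^sup>\<dagger> \<rhd> \<langle>\<langle>e', e\<rangle>, r\<rangle>, x\<rangle>, ?z\<rangle>"],
            (rule linear_intros | use * e in \<open>simp add: scale_left_commute\<close>)+)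
      have 2: "contract ?Y ?S \<rhd> \<langle>\<langle>e', e\<rangle>, \<langle>?W, ?s\<rangle>\<rangle> = (tr X \<rhd> \<langle>e, x\<rangle>) \<bullet> ?k e' (\<eta> X \<rhd> un)"
        if e: "valid e'" "valid e" "cod e' = ?Y\<^sup>\<star>" "cod e = ?Y" "apart (names e') (names e)"
          "apart (names e') (names x)" "apart (names e) (names x)" "apart (names e') (names T)" "apart (names e) (names T)"
          "apart (names e') (names b)" "apart (names e) (names b)" for e' e
        using * e by (simp add: app_contract dagger_Comp)
      have "contract ?Y ?S \<rhd> \<langle>\<eta> ?Y \<rhd> un, \<langle>?W, ?s\<rangle>\<rangle> = \<langle>ev X \<rhd> \<langle>(ev ?Y \<odot> \<one> X) \<rhd> (\<a> (D ?Y) ?Y X)\<^sup>\<dagger> \<rhd> \<langle>\<eta> ?Y \<rhd> un, \<eta> X \<rhd> un\<rangle>, x\<rangle>, ?z\<rangle>"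
        by (rule linear_eq_on_pairs[where t = "\<eta> ?Y \<rhd> un" and A = "?Y\<^sup>\<star>" and B = ?Y and Q = "\<lambda>t. contract ?Y ?S \<rhd> \<langle>t, \<langle>?W, ?s\<rangle>\<rangle>"
            and Q' = "\<lambda>t. \<langle>ev X \<rhd> \<langle>(ev ?Y \<odot> \<one> X) \<rhd> (\<a> (D ?Y) ?Y X)\<^sup>\<dagger> \<rhd> \<langle>t, \<eta> X \<rhd> un\<rangle>, x\<rangle>, ?z\<rangle>"],
            (rule linear_intros | use * 1 2 in simp)+)
      also have "(ev ?Y \<odot> \<one> X) \<rhd> (\<a> (D ?Y) ?Y X)\<^sup>\<dagger> \<rhd> \<langle>\<eta> ?Y \<rhd> un, \<eta> X \<rhd> un\<rangle> = \<eta> X \<rhd> un"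
        by (rule linear_eq_on_pairs[where t = "\<eta> X \<rhd> un" and A = ?Y and B = X
            and Q = "\<lambda>r. (ev ?Y \<odot> \<one> X) \<rhd> (\<a> (D ?Y) ?Y X)\<^sup>\<dagger> \<rhd> \<langle>\<eta> ?Y \<rhd> un, r\<rangle>" and Q' = "\<lambda>r. r"],
            (rule linear_intros | simp)+)
      finally have "ev ?S \<rhd> \<langle>partial_tr ?Y ?S \<rhd> ?W, ?s\<rangle> = \<langle>x, ?z\<rangle>" using * by (simp add: ev_partial_tr)
      then show "(ev ?S \<cdot> ((partial_tr X B)\<^sup>\<dagger> \<odot> \<one> ?S)) \<rhd> \<langle>T, ?s\<rangle> = (ev ?S \<cdot> ((partial_tr ?Y ?S \<cdot> double ?h) \<odot> \<one> ?S)) \<rhd> \<langle>T, ?s\<rangle>"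
        unfolding L using * by simp
    qed simp_all
  qed simp_all
qed

text \<open>The dagger of a dilation is a double after the adjoint of a partial trace, and that
  adjoint is itself completely positive.\<close>

lemma cp_dagger:
  assumes f: "completely_positive A B f" and o [simp]: "A \<in> Obj V" "B \<in> Obj V"
  shows "completely_positive B A (f\<^sup>\<dagger>)"
proof -
  obtain X g where g [simp]: "X \<in> Obj V" "g \<in> Arr V" "Dom V g = A" "Cod V g = X \<otimes> B" and f': "f = partial_tr X B \<cdot> double g"
    using f by (rule completely_positiveE) simp
  let ?h = "\<a> (X\<^sup>\<star>) X B \<cdot> (\<eta> X \<odot> \<one> B) \<cdot> (\<l> B)\<^sup>\<dagger>"
  have "f\<^sup>\<dagger> = double (g\<^sup>\<dagger>) \<cdot> partial_tr (X\<^sup>\<star>) (X \<otimes> B) \<cdot> double ?h"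
    unfolding f' by (simp add: dagger_Comp double_dagger partial_tr_dagger)
  moreover have "completely_positive B A (double (g\<^sup>\<dagger>) \<cdot> partial_tr (X\<^sup>\<star>) (X \<otimes> B) \<cdot> double ?h)"
    by (intro cp_Comp[of _ "X \<otimes> B"] cp_Comp[of _ "X\<^sup>\<star> \<otimes> (X \<otimes> B)"] cp_double cp_partial_tr) simp_all
  ultimately show ?thesis by simp
qed

section \<open>CPM[V] as a dagger symmetric monoidal category\<close>

lemma CPM_simps [simp]:
  "Obj CPM = Obj V" "Dom CPM = src" "Cod CPM = tgt" "\<one>\<^bsub>CPM\<^esub> A = Arrow A (\<one> (D A)) A"
  "g \<cdot>\<^bsub>CPM\<^esub> f = Arrow (src f) (mor g \<cdot> mor f) (tgt g)" "f\<^sup>\<dagger>\<^bsub>CPM\<^esub> = Arrow (tgt f) ((mor f)\<^sup>\<dagger>) (src f)"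
  "A \<otimes>\<^bsub>CPM\<^esub> B = A \<otimes> B" "\<I>\<^bsub>CPM\<^esub> = \<I>"
  "f \<odot>\<^bsub>CPM\<^esub> g = Arrow (src f \<otimes> src g) (cpm_tensor (src f) (src g) (tgt f) (tgt g) (mor f) (mor g)) (tgt f \<otimes> tgt g)"
  "\<a>\<^bsub>CPM\<^esub> A B E = pure_arrow (\<a> A B E)" "\<l>\<^bsub>CPM\<^esub> A = pure_arrow (\<l> A)" "\<r>\<^bsub>CPM\<^esub> A = pure_arrow (\<r> A)"
  "\<sigma>\<^bsub>CPM\<^esub> A B = pure_arrow (\<sigma> A B)"
  by (simp_all add: CPM_def cpm_tensor_def)

lemma pure_arrow_eq: "pure_arrow f = Arrow (Dom V f) (double f) (Cod V f)"
  by (simp add: pure_arrow_def double_def)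

lemma CPM_hom_iff:
  "x \<in> hom CPM A B \<longleftrightarrow> A \<in> Obj V \<and> B \<in> Obj V \<and> (\<exists>f. x = Arrow A f B \<and> completely_positive A B f)"
  by (auto simp: CPM_def hom_def)

lemma CPM_homE:
  assumes "x \<in> hom CPM A B"
  obtains f where "x = Arrow A f B" "A \<in> Obj V" "B \<in> Obj V" "completely_positive A B f" "f \<in> Arr V"
    "Dom V f = D A" "Cod V f = D B"
  using assms completely_positiveD unfolding CPM_hom_iff by blast

lemma CPM_category: "category CPM"
proof
  fix f assume "f \<in> Arr CPM"
  then show "Dom CPM f \<in> Obj CPM" "Cod CPM f \<in> Obj CPM" by (auto simp: CPM_def)
next
  fix A assume "A \<in> Obj CPM"
  then show "\<one>\<^bsub>CPM\<^esub> A \<in> hom CPM A A" by (simp add: CPM_hom_iff cp_Id)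
next
  fix f g A B E assume "f \<in> hom CPM A B" "g \<in> hom CPM B E"
  then show "g \<cdot>\<^bsub>CPM\<^esub> f \<in> hom CPM A E" by (auto simp: CPM_hom_iff intro: cp_Comp)
next
  fix f A B assume f: "f \<in> hom CPM A B"
  then show "\<one>\<^bsub>CPM\<^esub> B \<cdot>\<^bsub>CPM\<^esub> f = f" "f \<cdot>\<^bsub>CPM\<^esub> \<one>\<^bsub>CPM\<^esub> A = f" by (auto elim!: CPM_homE)
next
  fix f g h A B E F assume "f \<in> hom CPM A B" "g \<in> hom CPM B E" "h \<in> hom CPM E F"
  then show "(h \<cdot>\<^bsub>CPM\<^esub> g) \<cdot>\<^bsub>CPM\<^esub> f = h \<cdot>\<^bsub>CPM\<^esub> g \<cdot>\<^bsub>CPM\<^esub> f"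
    by (auto elim!: CPM_homE simp: comp_assoc)
qed

lemma CPM_dagger_category: "dagger_category CPM"
proof (intro dagger_category.intro CPM_category dagger_category_axioms.intro)
  fix f A B assume "f \<in> hom CPM A B"
  then show "f\<^sup>\<dagger>\<^bsub>CPM\<^esub> \<in> hom CPM B A" by (auto simp: CPM_hom_iff intro: cp_dagger)
next
  fix A assume "A \<in> Obj CPM"
  then show "(\<one>\<^bsub>CPM\<^esub> A)\<^sup>\<dagger>\<^bsub>CPM\<^esub> = \<one>\<^bsub>CPM\<^esub> A" by simp
next
  fix f g A B E assume "f \<in> hom CPM A B" "g \<in> hom CPM B E"
  then show "(g \<cdot>\<^bsub>CPM\<^esub> f)\<^sup>\<dagger>\<^bsub>CPM\<^esub> = f\<^sup>\<dagger>\<^bsub>CPM\<^esub> \<cdot>\<^bsub>CPM\<^esub> g\<^sup>\<dagger>\<^bsub>CPM\<^esub>" by (auto elim!: CPM_homE simp: dagger_Comp)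
next
  fix f A B assume "f \<in> hom CPM A B"
  then show "(f\<^sup>\<dagger>\<^bsub>CPM\<^esub>)\<^sup>\<dagger>\<^bsub>CPM\<^esub> = f" by (auto elim!: CPM_homE)
qed

lemma pure_Comp:
  "f \<in> Arr V \<Longrightarrow> g \<in> Arr V \<Longrightarrow> Dom V g = Cod V f \<Longrightarrow> pure_arrow g \<cdot>\<^bsub>CPM\<^esub> pure_arrow f = pure_arrow (g \<cdot> f)"
  by (simp add: pure_arrow_eq double_Comp)

lemma pure_Id: "A \<in> Obj V \<Longrightarrow> \<one>\<^bsub>CPM\<^esub> A = pure_arrow (\<one> A)"
  by (simp add: pure_arrow_eq)

lemma pure_tensor: "f \<in> Arr V \<Longrightarrow> g \<in> Arr V \<Longrightarrow> pure_arrow f \<odot>\<^bsub>CPM\<^esub> pure_arrow g = pure_arrow (f \<odot> g)"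
  by (simp add: pure_arrow_eq cpm_tensor_double)

lemma CPM_unitary_iff:
  assumes "A \<in> Obj V" "B \<in> Obj V"
  shows "dagger_category.unitary CPM A B (Arrow A f B) \<longleftrightarrow> completely_positive A B f \<and> unitary (D A) (D B) f"
  using assms unfolding dagger_category.unitary_def[OF CPM_dagger_category] unitary_def CPM_hom_iff
  by (auto simp: hom_def completely_positiveD)

lemma CPM_pure_unitary:
  assumes "unitary A B f"
  shows "dagger_category.unitary CPM A B (pure_arrow f)"
proof -
  note f = unitaryD[OF assms]
  then have "A \<in> Obj V" "B \<in> Obj V" by auto
  then show ?thesis using f assms by (simp add: pure_arrow_eq CPM_unitary_iff cp_double double_unitary)
qed

text \<open>Naturality is needed for all completely positive maps, not only for pure ones. Composing
  with the unitary \<open>?w\<close> collects the occurrences of \<open>double_tensor\<close> at one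
  end and leaves naturality of the associator of \<open>V\<close>.\<close>

lemma cpm_tensor_Assoc:
  assumes [simp]: "f \<in> Arr V" "g \<in> Arr V" "h \<in> Arr V" "Dom V f = D A" "Dom V g = D B" "Dom V h = D E"
    "Cod V f = D A'" "Cod V g = D B'" "Cod V h = D E'"
    and o [simp]: "A \<in> Obj V" "B \<in> Obj V" "E \<in> Obj V" "A' \<in> Obj V" "B' \<in> Obj V" "E' \<in> Obj V"
  shows "double (\<a> A' B' E') \<cdot> cpm_tensor (A \<otimes> B) E (A' \<otimes> B') E' (cpm_tensor A B A' B' f g) h =
    cpm_tensor A (B \<otimes> E) A' (B' \<otimes> E') f (cpm_tensor B E B' E' g h) \<cdot> double (\<a> A B E)"
proof (rule unitary_cancel_left)
  let ?w = "\<lambda>A B E. (\<one> (D A) \<odot> double_tensor B E) \<cdot> double_tensor A (B \<otimes> E)"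
  show "unitary (D (A' \<otimes> B' \<otimes> E')) (D A' \<otimes> D B' \<otimes> D E') (?w A' B' E')"
    by (intro unitary_Comp[OF double_tensor_unitary unitary_TensorA[OF unitary_Id double_tensor_unitary]]) simp_all
  have 1: "?w A B E \<cdot> double (\<a> A B E) = \<a> (D A) (D B) (D E) \<cdot> (double_tensor A B \<odot> \<one> (D E)) \<cdot> double_tensor (A \<otimes> B) E"
    if "A \<in> Obj V" "B \<in> Obj V" "E \<in> Obj V" for A B E
    using that by (simp add: double_tensor_Assoc comp_assoc)
  have 2: "(double_tensor A' B' \<odot> \<one> (D E')) \<cdot> (cpm_tensor A B A' B' f g \<odot> h) = ((f \<odot> g) \<odot> h) \<cdot> (double_tensor A B \<odot> \<one> (D E))"
    by (simp add: cpm_tensor_def interchange)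
  have 3: "(\<one> (D A') \<odot> double_tensor B' E') \<cdot> (f \<odot> cpm_tensor B E B' E' g h) = (f \<odot> (g \<odot> h)) \<cdot> (\<one> (D A) \<odot> double_tensor B E)"
    by (simp add: cpm_tensor_def interchange)
  have "?w A' B' E' \<cdot> double (\<a> A' B' E') \<cdot> cpm_tensor (A \<otimes> B) E (A' \<otimes> B') E' (cpm_tensor A B A' B' f g) h =
     (\<a> (D A') (D B') (D E') \<cdot> (double_tensor A' B' \<odot> \<one> (D E')) \<cdot> double_tensor (A' \<otimes> B') E') \<cdot>
       cpm_tensor (A \<otimes> B) E (A' \<otimes> B') E' (cpm_tensor A B A' B' f g) h"
    using 1[of A' B' E'] by (simp flip: comp_assoc)
  also have "\<dots> = \<a> (D A') (D B') (D E') \<cdot> ((f \<odot> g) \<odot> h) \<cdot> (double_tensor A B \<odot> \<one> (D E)) \<cdot> double_tensor (A \<otimes> B) E"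
    using comp_reassoc[OF 2, of "double_tensor (A \<otimes> B) E"] by (simp add: cpm_tensor_def[of "A \<otimes> B"] comp_assoc)
  also have "\<dots> = (f \<odot> (g \<odot> h)) \<cdot> \<a> (D A) (D B) (D E) \<cdot> (double_tensor A B \<odot> \<one> (D E)) \<cdot> double_tensor (A \<otimes> B) E"
    using comp_reassoc[OF assoc_nat[of f g h], of "D A'" "D B'" "D E'"] by (simp add: comp_assoc)
  also have "\<dots> = (f \<odot> (g \<odot> h)) \<cdot> ?w A B E \<cdot> double (\<a> A B E)" using 1[of A B E] by simp
  also have "\<dots> = ?w A' B' E' \<cdot> cpm_tensor A (B \<otimes> E) A' (B' \<otimes> E') f (cpm_tensor B E B' E' g h) \<cdot> double (\<a> A B E)"
    using comp_reassoc[OF 3, of "double_tensor A (B \<otimes> E) \<cdot> double (\<a> A B E)"] by (simp add: cpm_tensor_def[of A "B \<otimes> E"] comp_assoc)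
  finally show "?w A' B' E' \<cdot> double (\<a> A' B' E') \<cdot> cpm_tensor (A \<otimes> B) E (A' \<otimes> B') E' (cpm_tensor A B A' B' f g) h =
     ?w A' B' E' \<cdot> cpm_tensor A (B \<otimes> E) A' (B' \<otimes> E') f (cpm_tensor B E B' E' g h) \<cdot> double (\<a> A B E)" .
qed simp_all

lemma cpm_tensor_Lunit:
  assumes [simp]: "f \<in> Arr V" "Dom V f = D A" "Cod V f = D B" "A \<in> Obj V" "B \<in> Obj V"
  shows "double (\<l> B) \<cdot> cpm_tensor \<I> A \<I> B (\<one> (D \<I>)) f = f \<cdot> double (\<l> A)"
proof -
  have 1: "\<l> (D B) \<cdot> (tr \<I> \<odot> \<one> (D B)) \<cdot> (\<one> (D \<I>) \<odot> f) = f \<cdot> \<l> (D A) \<cdot> (tr \<I> \<odot> \<one> (D A))"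
    by (rule TensorO_ext[of "D \<I>" "D A"]) simp_all
  have "double (\<l> B) \<cdot> cpm_tensor \<I> A \<I> B (\<one> (D \<I>)) f = (\<l> (D B) \<cdot> (tr \<I> \<odot> \<one> (D B)) \<cdot> (\<one> (D \<I>) \<odot> f)) \<cdot> double_tensor \<I> A"
    by (simp add: cpm_tensor_def comp_assoc flip: double_tensor_Lunit)
  also have "\<dots> = f \<cdot> double (\<l> A)" unfolding 1 by (simp add: comp_assoc flip: double_tensor_Lunit)
  finally show ?thesis .
qed

lemma cpm_tensor_Runit:
  assumes [simp]: "f \<in> Arr V" "Dom V f = D A" "Cod V f = D B" "A \<in> Obj V" "B \<in> Obj V"
  shows "double (\<r> B) \<cdot> cpm_tensor A \<I> B \<I> f (\<one> (D \<I>)) = f \<cdot> double (\<r> A)"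
proof -
  have 1: "\<r> (D B) \<cdot> (\<one> (D B) \<odot> tr \<I>) \<cdot> (f \<odot> \<one> (D \<I>)) = f \<cdot> \<r> (D A) \<cdot> (\<one> (D A) \<odot> tr \<I>)"
    by (rule TensorO_ext[of "D A" "D \<I>"]) simp_all
  have "double (\<r> B) \<cdot> cpm_tensor A \<I> B \<I> f (\<one> (D \<I>)) = (\<r> (D B) \<cdot> (\<one> (D B) \<odot> tr \<I>) \<cdot> (f \<odot> \<one> (D \<I>))) \<cdot> double_tensor A \<I>"
    by (simp add: cpm_tensor_def comp_assoc flip: double_tensor_Runit)
  also have "\<dots> = f \<cdot> double (\<r> A)" unfolding 1 by (simp add: comp_assoc flip: double_tensor_Runit)
  finally show ?thesis .
qed

lemma cpm_tensor_Sym: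
  assumes [simp]: "f \<in> Arr V" "g \<in> Arr V" "Dom V f = D A" "Dom V g = D B" "Cod V f = D A'" "Cod V g = D B'"
    "A \<in> Obj V" "B \<in> Obj V" "A' \<in> Obj V" "B' \<in> Obj V"
  shows "double (\<sigma> A' B') \<cdot> cpm_tensor A B A' B' f g = cpm_tensor B A B' A' g f \<cdot> double (\<sigma> A B)"
proof (rule unitary_cancel_left[OF double_tensor_unitary])
  have "double_tensor B' A' \<cdot> double (\<sigma> A' B') \<cdot> cpm_tensor A B A' B' f g = (double_tensor B' A' \<cdot> double (\<sigma> A' B')) \<cdot> cpm_tensor A B A' B' f g"
    by (simp add: comp_assoc)
  also have "\<dots> = (\<sigma> (D A') (D B') \<cdot> (f \<odot> g)) \<cdot> double_tensor A B"
    unfolding double_tensor_Sym[OF \<open>A' \<in> Obj V\<close> \<open>B' \<in> Obj V\<close>] by (simp add: comp_assoc cpm_tensor_def)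
  also have "\<dots> = (g \<odot> f) \<cdot> (double_tensor B A \<cdot> double (\<sigma> A B))" by (simp add: sym_nat comp_assoc double_tensor_Sym)
  also have "\<dots> = double_tensor B' A' \<cdot> cpm_tensor B A B' A' g f \<cdot> double (\<sigma> A B)" by (simp add: comp_assoc cpm_tensor_def)
  finally show "double_tensor B' A' \<cdot> double (\<sigma> A' B') \<cdot> cpm_tensor A B A' B' f g = double_tensor B' A' \<cdot> cpm_tensor B A B' A' g f \<cdot> double (\<sigma> A B)" .
qed simp_all

text \<open>The coherence equations involve only pure arrows and are images of those of
  \<open>V\<close> under \<open>pure_arrow\<close>; naturality concerns all arrows and comes from
  the lemmas on \<open>cpm_tensor\<close>.\<close>

lemma CPM_dagger_symmetric_monoidal_category: "dagger_symmetric_monoidal_category CPM"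
proof (intro dagger_symmetric_monoidal_category.intro CPM_dagger_category dagger_symmetric_monoidal_category_axioms.intro,
    unfold CPM_simps(1))
  fix A B assume "A \<in> Obj V" "B \<in> Obj V"
  then show "A \<otimes>\<^bsub>CPM\<^esub> B \<in> Obj V" "\<one>\<^bsub>CPM\<^esub> A \<odot>\<^bsub>CPM\<^esub> \<one>\<^bsub>CPM\<^esub> B = \<one>\<^bsub>CPM\<^esub> (A \<otimes>\<^bsub>CPM\<^esub> B)"
    by (simp_all add: cpm_tensor_def)
next
  show "\<I>\<^bsub>CPM\<^esub> \<in> Obj V" by simp
next
  fix f g A B A' B' assume *: "f \<in> hom CPM A B" "g \<in> hom CPM A' B'"
  from * show "f \<odot>\<^bsub>CPM\<^esub> g \<in> hom CPM (A \<otimes>\<^bsub>CPM\<^esub> A') (B \<otimes>\<^bsub>CPM\<^esub> B')"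
    by (auto simp: CPM_hom_iff cp_tensor)
  from * show "(f \<odot>\<^bsub>CPM\<^esub> g)\<^sup>\<dagger>\<^bsub>CPM\<^esub> = f\<^sup>\<dagger>\<^bsub>CPM\<^esub> \<odot>\<^bsub>CPM\<^esub> g\<^sup>\<dagger>\<^bsub>CPM\<^esub>"
    by (auto elim!: CPM_homE simp: cpm_tensor_def dagger_Comp comp_assoc)
  from * show "\<sigma>\<^bsub>CPM\<^esub> B B' \<cdot>\<^bsub>CPM\<^esub> f \<odot>\<^bsub>CPM\<^esub> g = g \<odot>\<^bsub>CPM\<^esub> f \<cdot>\<^bsub>CPM\<^esub> \<sigma>\<^bsub>CPM\<^esub> A A'"
    by (auto elim!: CPM_homE simp: pure_arrow_eq cpm_tensor_Sym)
next
  fix f g f' g' A B E A' B' E'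
  assume "f \<in> hom CPM A B" "g \<in> hom CPM B E" "f' \<in> hom CPM A' B'" "g' \<in> hom CPM B' E'"
  then show "(g \<cdot>\<^bsub>CPM\<^esub> f) \<odot>\<^bsub>CPM\<^esub> (g' \<cdot>\<^bsub>CPM\<^esub> f') = (g \<odot>\<^bsub>CPM\<^esub> g') \<cdot>\<^bsub>CPM\<^esub> (f \<odot>\<^bsub>CPM\<^esub> f')"
    by (auto elim!: CPM_homE simp: cpm_tensor_Comp)
next
  fix A B E assume o: "A \<in> Obj V" "B \<in> Obj V" "E \<in> Obj V"
  show "dagger_category.unitary CPM ((A \<otimes>\<^bsub>CPM\<^esub> B) \<otimes>\<^bsub>CPM\<^esub> E) (A \<otimes>\<^bsub>CPM\<^esub> B \<otimes>\<^bsub>CPM\<^esub> E) (\<a>\<^bsub>CPM\<^esub> A B E)"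
    using o by (simp add: CPM_pure_unitary Assoc_unitary)
  show "\<a>\<^bsub>CPM\<^esub> B E A \<cdot>\<^bsub>CPM\<^esub> \<sigma>\<^bsub>CPM\<^esub> A (B \<otimes>\<^bsub>CPM\<^esub> E) \<cdot>\<^bsub>CPM\<^esub> \<a>\<^bsub>CPM\<^esub> A B E =
     (\<one>\<^bsub>CPM\<^esub> B \<odot>\<^bsub>CPM\<^esub> \<sigma>\<^bsub>CPM\<^esub> A E) \<cdot>\<^bsub>CPM\<^esub> \<a>\<^bsub>CPM\<^esub> B A E \<cdot>\<^bsub>CPM\<^esub> (\<sigma>\<^bsub>CPM\<^esub> A B \<odot>\<^bsub>CPM\<^esub> \<one>\<^bsub>CPM\<^esub> E)"
    using o by (simp only: CPM_simps(7,10-) pure_Id pure_tensor pure_Comp hexagon Assoc_typing Sym_typing Id_typing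
        Comp_typing TensorA_typing TensorO_Obj)
next
  fix A assume o: "A \<in> Obj V"
  show "dagger_category.unitary CPM (\<I>\<^bsub>CPM\<^esub> \<otimes>\<^bsub>CPM\<^esub> A) A (\<l>\<^bsub>CPM\<^esub> A)"
    "dagger_category.unitary CPM (A \<otimes>\<^bsub>CPM\<^esub> \<I>\<^bsub>CPM\<^esub>) A (\<r>\<^bsub>CPM\<^esub> A)"
    using o by (simp_all add: CPM_pure_unitary Lunit_unitary Runit_unitary)
next
  fix A B assume o: "A \<in> Obj V" "B \<in> Obj V"
  show "dagger_category.unitary CPM (A \<otimes>\<^bsub>CPM\<^esub> B) (B \<otimes>\<^bsub>CPM\<^esub> A) (\<sigma>\<^bsub>CPM\<^esub> A B)"
    using o by (simp add: CPM_pure_unitary Sym_unitary)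
  show "(\<one>\<^bsub>CPM\<^esub> A \<odot>\<^bsub>CPM\<^esub> \<l>\<^bsub>CPM\<^esub> B) \<cdot>\<^bsub>CPM\<^esub> \<a>\<^bsub>CPM\<^esub> A \<I>\<^bsub>CPM\<^esub> B = \<r>\<^bsub>CPM\<^esub> A \<odot>\<^bsub>CPM\<^esub> \<one>\<^bsub>CPM\<^esub> B"
    using o by (simp only: CPM_simps(7,8,10-) pure_Id pure_tensor pure_Comp triangle Assoc_typing Lunit_typing Runit_typing Id_typing
        Comp_typing TensorA_typing TensorO_Obj TUnit_Obj)
  show "\<sigma>\<^bsub>CPM\<^esub> B A \<cdot>\<^bsub>CPM\<^esub> \<sigma>\<^bsub>CPM\<^esub> A B = \<one>\<^bsub>CPM\<^esub> (A \<otimes>\<^bsub>CPM\<^esub> B)"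
    using o by (simp only: CPM_simps(7,10-) pure_Id pure_Comp Sym_Sym Sym_typing TensorO_Obj)
next
  fix f g h A A' B B' E E' assume "f \<in> hom CPM A A'" "g \<in> hom CPM B B'" "h \<in> hom CPM E E'"
  then show "\<a>\<^bsub>CPM\<^esub> A' B' E' \<cdot>\<^bsub>CPM\<^esub> (f \<odot>\<^bsub>CPM\<^esub> g) \<odot>\<^bsub>CPM\<^esub> h = f \<odot>\<^bsub>CPM\<^esub> (g \<odot>\<^bsub>CPM\<^esub> h) \<cdot>\<^bsub>CPM\<^esub> \<a>\<^bsub>CPM\<^esub> A B E"
    by (auto elim!: CPM_homE simp: pure_arrow_eq cpm_tensor_Assoc)
next
  fix f A B assume "f \<in> hom CPM A B"
  then show "\<l>\<^bsub>CPM\<^esub> B \<cdot>\<^bsub>CPM\<^esub> \<one>\<^bsub>CPM\<^esub> \<I>\<^bsub>CPM\<^esub> \<odot>\<^bsub>CPM\<^esub> f = f \<cdot>\<^bsub>CPM\<^esub> \<l>\<^bsub>CPM\<^esub> A"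
    "\<r>\<^bsub>CPM\<^esub> B \<cdot>\<^bsub>CPM\<^esub> f \<odot>\<^bsub>CPM\<^esub> \<one>\<^bsub>CPM\<^esub> \<I>\<^bsub>CPM\<^esub> = f \<cdot>\<^bsub>CPM\<^esub> \<r>\<^bsub>CPM\<^esub> A"
    by (auto elim!: CPM_homE simp: pure_arrow_eq cpm_tensor_Lunit cpm_tensor_Runit)
next
  fix A B E F assume o: "A \<in> Obj V" "B \<in> Obj V" "E \<in> Obj V" "F \<in> Obj V"
  show "\<a>\<^bsub>CPM\<^esub> A B (E \<otimes>\<^bsub>CPM\<^esub> F) \<cdot>\<^bsub>CPM\<^esub> \<a>\<^bsub>CPM\<^esub> (A \<otimes>\<^bsub>CPM\<^esub> B) E F =
     (\<one>\<^bsub>CPM\<^esub> A \<odot>\<^bsub>CPM\<^esub> \<a>\<^bsub>CPM\<^esub> B E F) \<cdot>\<^bsub>CPM\<^esub> \<a>\<^bsub>CPM\<^esub> A (B \<otimes>\<^bsub>CPM\<^esub> E) F \<cdot>\<^bsub>CPM\<^esub> (\<a>\<^bsub>CPM\<^esub> A B E \<odot>\<^bsub>CPM\<^esub> \<one>\<^bsub>CPM\<^esub> F)"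
    using o by (simp only: CPM_simps(7,10-) pure_Id pure_tensor pure_Comp pentagon Assoc_typing Id_typing
        Comp_typing TensorA_typing TensorO_Obj)
qed

end


section \<open>Actions of algebras\<close>

context dagger_compact_category
begin

text \<open>Represents right multiplication by the argument as an operator. The product
  \<open>m\<close> is left arbitrary, so that the opposite product gives left
  multiplication.\<close>

definition right_mult :: "'o \<Rightarrow> 'm \<Rightarrow> 'm" where
  "right_mult A m = (\<one> (A\<^sup>\<star>) \<odot> m) \<cdot> \<a> (A\<^sup>\<star>) A A \<cdot> (\<eta> A \<odot> \<one> A) \<cdot> (\<l> A)\<^sup>\<dagger>"

lemma right_mult_typing [simp]:
  assumes "A \<in> Obj V" "m \<in> Arr V" "Dom V m = A \<otimes> A" "Cod V m = A"
  shows "right_mult A m \<in> Arr V" "Dom V (right_mult A m) = A" "Cod V (right_mult A m) = D A"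
  using assms by (simp_all add: right_mult_def)

lemma action_eq: "action M = right_mult (Car M) (Mult M)"
  by (simp add: action_def right_mult_def Let_def)

lemma ev_right_mult [simp]:
  assumes m [simp]: "A \<in> Obj V" "m \<in> Arr V" "Dom V m = A \<otimes> A" "Cod V m = A"
    and xy: "valid x" "valid y" "cod x = A" "cod y = A" "apart (names x) (names y)"
  shows "ev A \<rhd> \<langle>right_mult A m \<rhd> x, y\<rangle> = m \<rhd> \<langle>y, x\<rangle>"
proof -
  let ?Q = "\<lambda>t. ev A \<rhd> \<langle>(\<one> (A\<^sup>\<star>) \<odot> m) \<rhd> \<a> (A\<^sup>\<star>) A A \<rhd> \<langle>t, x\<rangle>, y\<rangle>" and ?R = "\<lambda>t. m \<rhd> \<langle>ev A \<rhd> \<langle>t, y\<rangle>, x\<rangle>"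
  have "ev A \<rhd> \<langle>right_mult A m \<rhd> x, y\<rangle> = ?Q (\<eta> A \<rhd> un)" using xy by (simp add: right_mult_def)
  also have "\<dots> = ?R (\<eta> A \<rhd> un)"
    by (rule linear_eq_on_pairs[where t = "\<eta> A \<rhd> un" and A = "A\<^sup>\<star>" and B = A and Q = ?Q and Q' = ?R],
        (rule linear_intros | use xy in simp)+)
  finally show ?thesis using xy by simp
qed

text \<open>\<open>trace_mult\<close> is the trace of left multiplication, hence the opposite
  product, whereas \<open>action\<close> is right multiplication. That their traces agree is shown
  only in \<open>trace_mult_action\<close>.\<close>

lemma trace_mult_eq:
  assumes m [simp]: "Car M \<in> Obj V" "Mult M \<in> Arr V" "Dom V (Mult M) = Car M \<otimes> Car M" "Cod V (Mult M) = Car M"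
  shows "trace_mult M = tr (Car M) \<cdot> right_mult (Car M) (Mult M \<cdot> \<sigma> (Car M) (Car M))"
proof (rule arrow_ext[where A = "Car M"])
  let ?A = "Car M" and ?m = "Mult M"
  fix x assume x: "valid x" "cod x = ?A"
  let ?Q = "\<lambda>t. \<epsilon> ?A \<rhd> (?m \<odot> \<one> (?A\<^sup>\<star>)) \<rhd> (\<a> ?A ?A (?A\<^sup>\<star>))\<^sup>\<dagger> \<rhd> \<langle>x, \<sigma> (?A\<^sup>\<star>) ?A \<rhd> t\<rangle>"
  let ?R = "\<lambda>t. tr ?A \<rhd> (\<one> (?A\<^sup>\<star>) \<odot> (?m \<cdot> \<sigma> ?A ?A)) \<rhd> \<a> (?A\<^sup>\<star>) ?A ?A \<rhd> \<langle>t, x\<rangle>"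
  have "?Q (\<eta> ?A \<rhd> un) = ?R (\<eta> ?A \<rhd> un)"
    by (rule linear_eq_on_pairs[where t = "\<eta> ?A \<rhd> un" and A = "?A\<^sup>\<star>" and B = ?A and Q = ?Q and Q' = ?R],
        (rule linear_intros | use x in simp)+)
  then show "trace_mult M \<rhd> x = (tr ?A \<cdot> right_mult ?A (?m \<cdot> \<sigma> ?A ?A)) \<rhd> x"
    using x by (simp add: trace_mult_def right_mult_def Let_def)
qed (simp_all add: trace_mult_def Let_def)

lemma right_mult_tensor:
  assumes [simp]: "A \<in> Obj V" "m \<in> Arr V" "Dom V m = A \<otimes> A" "Cod V m = A"
    "B \<in> Obj V" "n \<in> Arr V" "Dom V n = B \<otimes> B" "Cod V n = B"
  shows "right_mult (A \<otimes> B) ((m \<odot> n) \<cdot> mid_swap A B A B) = (double_tensor A B)\<^sup>\<dagger> \<cdot> (right_mult A m \<odot> right_mult B n)"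
proof (rule model_ext[OF model_Id[of "A \<otimes> B"], where X = "A \<otimes> B"])
  let ?l = "right_mult (A \<otimes> B) ((m \<odot> n) \<cdot> mid_swap A B A B)" and ?r = "(double_tensor A B)\<^sup>\<dagger> \<cdot> (right_mult A m \<odot> right_mult B n)"
  show "ev (A \<otimes> B) \<cdot> (?l \<odot> \<one> (A \<otimes> B)) = ev (A \<otimes> B) \<cdot> (?r \<odot> \<one> (A \<otimes> B))"
    by (rule TensorO_ext4[of A B A B]) simp_all
qed simp_all

lemma tr_double_tensor_dagger:
  assumes [simp]: "A \<in> Obj V" "B \<in> Obj V"
  shows "tr (A \<otimes> B) \<cdot> (double_tensor A B)\<^sup>\<dagger> = \<l> \<I> \<cdot> (tr A \<odot> tr B)"
  by (simp add: comp_assoc flip: tr_tensor)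

lemma trace_mult_tensor:
  assumes M: "dagger_frobenius_algebra M" and N: "dagger_frobenius_algebra N"
  shows "trace_mult (tensor_algebra M N) = \<l> \<I> \<cdot> (trace_mult M \<odot> trace_mult N)"
proof -
  note [simp] = dagger_frobeniusD[OF M] dagger_frobeniusD[OF N]
  let ?A = "Car M" and ?B = "Car N" and ?m = "Mult M" and ?n = "Mult N"
  have "((?m \<odot> ?n) \<cdot> mid_swap ?A ?B ?A ?B) \<cdot> \<sigma> (?A \<otimes> ?B) (?A \<otimes> ?B) = ((?m \<cdot> \<sigma> ?A ?A) \<odot> (?n \<cdot> \<sigma> ?B ?B)) \<cdot> mid_swap ?A ?B ?A ?B"
    by (rule TensorO_ext4[of ?A ?B ?A ?B]) simp_all
  then have "trace_mult (tensor_algebra M N) = (tr (?A \<otimes> ?B) \<cdot> (double_tensor ?A ?B)\<^sup>\<dagger>) \<cdot>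
      (right_mult ?A (?m \<cdot> \<sigma> ?A ?A) \<odot> right_mult ?B (?n \<cdot> \<sigma> ?B ?B))"
    by (simp add: trace_mult_eq right_mult_tensor comp_assoc)
  also have "\<dots> = \<l> \<I> \<cdot> (trace_mult M \<odot> trace_mult N)"
    unfolding tr_double_tensor_dagger[OF dagger_frobeniusD(1)[OF M] dagger_frobeniusD(1)[OF N]] by (simp add: trace_mult_eq comp_assoc interchange)
  finally show ?thesis .
qed

lemma trace_mult_typing [simp]:
  assumes M: "dagger_frobenius_algebra M"
  shows "trace_mult M \<in> Arr V" "Dom V (trace_mult M) = Car M" "Cod V (trace_mult M) = \<I>"
  using dagger_frobeniusD[OF M] by (simp_all add: trace_mult_eq)

text \<open>Since \<open>trace_mult\<close> is multiplicative, the tensor product of two normalisers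
  is a normaliser.\<close>

lemma normalisable_tensor:
  assumes M: "dagger_frobenius_algebra M" "normalisable M" and N: "dagger_frobenius_algebra N" "normalisable N"
  shows "normalisable (tensor_algebra M N)"
proof -
  note [simp] = dagger_frobeniusD[OF M(1)] dagger_frobeniusD[OF N(1)] trace_mult_typing[OF M(1)] trace_mult_typing[OF N(1)]
  obtain z w where z: "central M z" "positive_definite (Car M) z" "trace_mult M \<cdot> z \<cdot> z = (Unt M)\<^sup>\<dagger>"
    and w: "central N w" "positive_definite (Car N) w" "trace_mult N \<cdot> w \<cdot> w = (Unt N)\<^sup>\<dagger>"
    using M N unfolding normalisable_def normaliser_def by blast
  note [simp] = positive_definiteD(1-3)[OF z(2)] positive_definiteD(1-3)[OF w(2)]
  have "trace_mult (tensor_algebra M N) \<cdot> (z \<odot> w) \<cdot> (z \<odot> w) = (Unt (tensor_algebra M N))\<^sup>\<dagger>"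
    using z(3) w(3) by (simp add: trace_mult_tensor[OF M(1) N(1)] comp_assoc interchange dagger_Comp)
  then show ?thesis unfolding normalisable_def normaliser_def
    using central_TensorA[OF M(1) N(1) z(1) w(1)] positive_definite_TensorA[OF z(2) w(2)] by auto
qed

text \<open>By \<open>ev_un\<close>, an operator on \<open>\<I>\<close> is multiplication by its
  trace, and the cup represents the identity.\<close>

lemma tr_unit_unitary: "unitary (D \<I>) \<I> (tr \<I>)"
proof (rule unitaryI)
  have 1: "tr \<I> \<rhd> \<eta> \<I> \<rhd> un = un" using ev_un[of "\<eta> \<I> \<rhd> un"] by simp
  show "tr \<I> \<cdot> (tr \<I>)\<^sup>\<dagger> = \<one> \<I>" by (rule arrow_ext_un) (simp_all add: 1)
  show "(tr \<I>)\<^sup>\<dagger> \<cdot> tr \<I> = \<one> (D \<I>)"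
  proof (rule model_ext[OF model_Id[of \<I>], where X = "D \<I>"])
    show "ev \<I> \<cdot> (((tr \<I>)\<^sup>\<dagger> \<cdot> tr \<I>) \<odot> \<one> \<I>) = ev \<I> \<cdot> (\<one> (D \<I>) \<odot> \<one> \<I>)"
    proof (rule free_ext[of "\<langle>var 0 (D \<I>), un\<rangle>"])
      let ?s = "tr \<I> \<rhd> var 0 (D \<I>)"
      have "\<eta> \<I> \<rhd> ?s = \<eta> \<I> \<rhd> (?s \<bullet> un)" by simp
      also have "\<dots> = ?s \<bullet> (\<eta> \<I> \<rhd> un)" by (simp del: scale_un)
      finally show "(ev \<I> \<cdot> (((tr \<I>)\<^sup>\<dagger> \<cdot> tr \<I>) \<odot> \<one> \<I>)) \<rhd> \<langle>var 0 (D \<I>), un\<rangle> = (ev \<I> \<cdot> (\<one> (D \<I>) \<odot> \<one> \<I>)) \<rhd> \<langle>var 0 (D \<I>), un\<rangle>"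
        by (simp add: ev_un 1)
    qed (intro free_pair free_var free_un, simp_all)
  qed simp_all
qed simp_all

lemma normalisable_unit: "normalisable unit_algebra"
proof -
  \<comment> \<open>Multiplication by the unit is the identity operator, which is represented by the
    cup.\<close>
  have *: "right_mult \<I> (\<l> \<I> \<cdot> \<sigma> \<I> \<I>) \<rhd> un = \<eta> \<I> \<rhd> un"
    by (rule evaluation_nondegenerate[OF dual_pair_Dual[of \<I>], of \<I>]) simp_all
  have "tr \<I> \<cdot> right_mult \<I> (\<l> \<I> \<cdot> \<sigma> \<I> \<I>) = \<one> \<I>"
    by (rule arrow_ext_un) (simp_all add: * flip: ev_un)
  then have "trace_mult unit_algebra \<cdot> \<one> \<I> \<cdot> \<one> \<I> = (Unt unit_algebra)\<^sup>\<dagger>"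
    by (simp add: trace_mult_eq)
  moreover have "central unit_algebra (\<one> \<I>)" by (simp add: central_def hom_def)
  ultimately show ?thesis unfolding normalisable_def normaliser_def
    using positive_definite_Id[of \<I>] by (intro exI[of _ "\<one> \<I>"]) simp
qed

section \<open>The pants product as composition of operators\<close>

definition pants_mult :: "'o \<Rightarrow> 'm" where
  "pants_mult A = mid_cap (A\<^sup>\<star>) A (A\<^sup>\<star>) A (\<epsilon> A)"

lemma pants_mult_typing [simp]:
  assumes "A \<in> Obj V"
  shows "pants_mult A \<in> Arr V" "Dom V (pants_mult A) = D A \<otimes> D A" "Cod V (pants_mult A) = D A"
  using assms by (simp_all add: pants_mult_def)

lemma app_pants_mult [simp]:
  assumes "valid x" "valid y" "valid z" "valid w" "cod x = A\<^sup>\<star>" "cod y = A" "cod z = A\<^sup>\<star>" "cod w = A"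
    "disjnt (names y) (names x)" "disjnt (names z) (names x)" "disjnt (names y) (names z)"
  shows "pants_mult A \<rhd> \<langle>\<langle>x, y\<rangle>, \<langle>z, w\<rangle>\<rangle> = (tr A \<rhd> \<langle>z, y\<rangle>) \<bullet> \<langle>x, w\<rangle>"
proof -
  have "A \<in> Obj V" using assms by auto
  then show ?thesis using assms by (simp add: pants_mult_def)
qed

text \<open>The product of \<open>S\<close> and \<open>T\<close> performs \<open>S\<close> first.
  This is the origin of the reversed products in \<open>trace_mult_commute\<close>.\<close>

lemma ev_pants_mult [simp]:
  assumes A [simp]: "A \<in> Obj V" and STy: "valid S" "valid T" "valid y" "cod S = D A" "cod T = D A" "cod y = A"
    "apart (names S) (names T)" "apart (names S) (names y)" "apart (names T) (names y)"
  shows "ev A \<rhd> \<langle>pants_mult A \<rhd> \<langle>S, T\<rangle>, y\<rangle> = ev A \<rhd> \<langle>T, ev A \<rhd> \<langle>S, y\<rangle>\<rangle>"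
proof -
  have "ev A \<cdot> (pants_mult A \<odot> \<one> A) = ev A \<cdot> (\<one> (D A) \<odot> ev A) \<cdot> \<a> (D A) (D A) A \<cdot> (\<sigma> (D A) (D A) \<odot> \<one> A)"
  proof (rule free_ext)
    let ?v = "\<langle>\<langle>\<langle>var 0 (A\<^sup>\<star>), var 1 A\<rangle>, \<langle>var 2 (A\<^sup>\<star>), var 3 A\<rangle>\<rangle>, var 4 A\<rangle>"
    show "free ?v" by (intro free_pair free_var) simp_all
    show "(ev A \<cdot> (pants_mult A \<odot> \<one> A)) \<rhd> ?v = (ev A \<cdot> (\<one> (D A) \<odot> ev A) \<cdot> \<a> (D A) (D A) A \<cdot> (\<sigma> (D A) (D A) \<odot> \<one> A)) \<rhd> ?v"
      by (simp add: disjnt_def scale_left_commute)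
  qed simp_all
  from arg_cong[OF this, of "\<lambda>f. f \<rhd> \<langle>\<langle>S, T\<rangle>, y\<rangle>"] show ?thesis using STy by simp
qed

text \<open>Cyclicity of the trace: at pairs, both sides are the same product of two
  scalars.\<close>

lemma tr_pants_mult_commute:
  assumes [simp]: "A \<in> Obj V"
  shows "tr A \<cdot> pants_mult A \<cdot> \<sigma> (D A) (D A) = tr A \<cdot> pants_mult A"
  by (rule TensorO_ext4[of "A\<^sup>\<star>" A "A\<^sup>\<star>" A]) (simp_all add: scale_commute)

section \<open>The Frobenius form and the traces of multiplications\<close>

abbreviation form :: "('o, 'm) algebra_data \<Rightarrow> 'm" where
  "form M \<equiv> (Unt M)\<^sup>\<dagger> \<cdot> Mult M"

abbreviation coform :: "('o, 'm) algebra_data \<Rightarrow> ('o, 'm) elem" where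
  "coform M \<equiv> (Mult M)\<^sup>\<dagger> \<rhd> Unt M \<rhd> un"

text \<open>By the Frobenius equation, multiplying \<open>x\<close> into a leg of the comultiplied
  unit gives the comultiplication of \<open>x\<close>; the counit law finishes.\<close>

lemma form_snake:
  assumes M: "dagger_frobenius_algebra M" and x: "valid x" "cod x = Car M"
  shows "\<l> (Car M) \<rhd> (form M \<odot> \<one> (Car M)) \<rhd> (\<a> (Car M) (Car M) (Car M))\<^sup>\<dagger> \<rhd> \<langle>x, coform M\<rangle> = x"
    "\<r> (Car M) \<rhd> (\<one> (Car M) \<odot> form M) \<rhd> \<a> (Car M) (Car M) (Car M) \<rhd> \<langle>coform M, x\<rangle> = x"
proof -
  note [simp] = dagger_frobeniusD[OF M] mult_unit[OF M] mult_frobenius[OF M] mult_counit[OF M]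
  have 1: "form M \<odot> \<one> (Car M) = ((Unt M)\<^sup>\<dagger> \<odot> \<one> (Car M)) \<cdot> (Mult M \<odot> \<one> (Car M))"
    "\<one> (Car M) \<odot> form M = (\<one> (Car M) \<odot> (Unt M)\<^sup>\<dagger>) \<cdot> (\<one> (Car M) \<odot> Mult M)"
    by (simp_all add: interchange)
  show "\<l> (Car M) \<rhd> (form M \<odot> \<one> (Car M)) \<rhd> (\<a> (Car M) (Car M) (Car M))\<^sup>\<dagger> \<rhd> \<langle>x, coform M\<rangle> = x"
    "\<r> (Car M) \<rhd> (\<one> (Car M) \<odot> form M) \<rhd> \<a> (Car M) (Car M) (Car M) \<rhd> \<langle>coform M, x\<rangle> = x"
    unfolding 1 using x by simp_all
qed

text \<open>A trace can be computed with the Frobenius form and its cup instead of \<open>tr\<close>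
  and \<open>\<eta>\<close>; two versions are needed because the form is not yet known to be
  symmetric. The auxiliary diagrams \<open>?E\<close> and \<open>?E'\<close> contain both cups:
  straightening that of the form leaves the ordinary trace, and straightening \<open>\<eta>\<close>
  leaves the formula with the form.\<close>

lemma tr_right_mult_form:
  assumes M: "dagger_frobenius_algebra M" and F [simp]: "F \<in> Arr V" "Dom V F = Car M \<otimes> Car M" "Cod V F = Car M"
    and x: "valid x" "cod x = Car M"
  shows "tr (Car M) \<rhd> right_mult (Car M) F \<rhd> x =
      form M \<rhd> (\<one> (Car M) \<odot> F) \<rhd> \<a> (Car M) (Car M) (Car M) \<rhd> \<langle>\<sigma> (Car M) (Car M) \<rhd> coform M, x\<rangle>"
    "tr (Car M) \<rhd> right_mult (Car M) F \<rhd> x =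
      form M \<rhd> (F \<odot> \<one> (Car M)) \<rhd> \<sigma> (Car M) (Car M \<otimes> Car M) \<rhd> \<a> (Car M) (Car M) (Car M) \<rhd> \<langle>coform M, x\<rangle>"
proof -
  note [simp] = dagger_frobeniusD[OF M] form_snake[OF M]
  let ?A = "Car M" and ?c = "coform M"
  let ?L = "form M"
  let ?f = "\<lambda>t. (\<one> (?A\<^sup>\<star>) \<odot> F) \<rhd> \<a> (?A\<^sup>\<star>) ?A ?A \<rhd> \<langle>t, x\<rangle>"
  let ?E = "\<lambda>t s. \<l> \<I> \<rhd> (tr ?A \<odot> (?L \<cdot> \<sigma> ?A ?A)) \<rhd> mid_swap (?A\<^sup>\<star>) ?A ?A ?A \<rhd> \<langle>?f t, s\<rangle>"
  let ?E' = "\<lambda>t s. \<l> \<I> \<rhd> (tr ?A \<odot> ?L) \<rhd> mid_swap (?A\<^sup>\<star>) ?A ?A ?A \<rhd> \<langle>?f t, \<sigma> ?A ?A \<rhd> s\<rangle>"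
  have t: "tr ?A \<rhd> right_mult ?A F \<rhd> x = tr ?A \<rhd> ?f (\<eta> ?A \<rhd> un)" using x by (simp add: right_mult_def)
  have 1: "?E \<langle>e', e\<rangle> ?c = tr ?A \<rhd> ?f \<langle>e', e\<rangle>" "?E' \<langle>e', e\<rangle> ?c = tr ?A \<rhd> ?f \<langle>e', e\<rangle>"
    if *: "valid e'" "valid e" "cod e' = ?A\<^sup>\<star>" "cod e = ?A" "apart (names e') (names e)" "apart (names e') (names x)"
      "apart (names e) (names x)" for e' e
  proof -
    have "?E \<langle>e', e\<rangle> ?c = tr ?A \<rhd> \<langle>e', \<r> ?A \<rhd> (\<one> ?A \<odot> ?L) \<rhd> \<a> ?A ?A ?A \<rhd> \<langle>?c, F \<rhd> \<langle>e, x\<rangle>\<rangle>\<rangle>"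
      by (rule linear_eq_on_pairs[where t = ?c and A = ?A and B = ?A and Q = "\<lambda>s. ?E \<langle>e', e\<rangle> s"
            and Q' = "\<lambda>s. tr ?A \<rhd> \<langle>e', \<r> ?A \<rhd> (\<one> ?A \<odot> ?L) \<rhd> \<a> ?A ?A ?A \<rhd> \<langle>s, F \<rhd> \<langle>e, x\<rangle>\<rangle>\<rangle>"],
          (rule linear_intros | use * x in \<open>simp add: scale_commute\<close>)+)
    moreover have "?E' \<langle>e', e\<rangle> ?c = tr ?A \<rhd> \<langle>e', \<l> ?A \<rhd> (?L \<odot> \<one> ?A) \<rhd> (\<a> ?A ?A ?A)\<^sup>\<dagger> \<rhd> \<langle>F \<rhd> \<langle>e, x\<rangle>, ?c\<rangle>\<rangle>"
      by (rule linear_eq_on_pairs[where t = ?c and A = ?A and B = ?A and Q = "\<lambda>s. ?E' \<langle>e', e\<rangle> s"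
            and Q' = "\<lambda>s. tr ?A \<rhd> \<langle>e', \<l> ?A \<rhd> (?L \<odot> \<one> ?A) \<rhd> (\<a> ?A ?A ?A)\<^sup>\<dagger> \<rhd> \<langle>F \<rhd> \<langle>e, x\<rangle>, s\<rangle>\<rangle>"],
          (rule linear_intros | use * x in \<open>simp add: scale_commute\<close>)+)
    ultimately show "?E \<langle>e', e\<rangle> ?c = tr ?A \<rhd> ?f \<langle>e', e\<rangle>" "?E' \<langle>e', e\<rangle> ?c = tr ?A \<rhd> ?f \<langle>e', e\<rangle>"
      using * x by (simp_all only:) simp_all
  qed
  have 2: "?E (\<eta> ?A \<rhd> un) ?c = tr ?A \<rhd> ?f (\<eta> ?A \<rhd> un)"
    by (rule linear_eq_on_pairs[where t = "\<eta> ?A \<rhd> un" and A = "?A\<^sup>\<star>" and B = ?A and Q = "\<lambda>t. ?E t ?c" and Q' = "\<lambda>t. tr ?A \<rhd> ?f t"],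
        (rule linear_intros | rule 1 | use x in simp)+)
  have b2: "?E' (\<eta> ?A \<rhd> un) ?c = tr ?A \<rhd> ?f (\<eta> ?A \<rhd> un)"
    by (rule linear_eq_on_pairs[where t = "\<eta> ?A \<rhd> un" and A = "?A\<^sup>\<star>" and B = ?A and Q = "\<lambda>t. ?E' t ?c" and Q' = "\<lambda>t. tr ?A \<rhd> ?f t"],
        (rule linear_intros | rule 1 | use x in simp)+)
  let ?G = "\<lambda>s. ?L \<rhd> (\<one> ?A \<odot> F) \<rhd> \<a> ?A ?A ?A \<rhd> \<langle>\<sigma> ?A ?A \<rhd> s, x\<rangle>"
  let ?G' = "\<lambda>s. ?L \<rhd> (F \<odot> \<one> ?A) \<rhd> \<sigma> ?A (?A \<otimes> ?A) \<rhd> \<a> ?A ?A ?A \<rhd> \<langle>s, x\<rangle>"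
  have 3: "?E (\<eta> ?A \<rhd> un) \<langle>c, d\<rangle> = ?G \<langle>c, d\<rangle>" "?E' (\<eta> ?A \<rhd> un) \<langle>c, d\<rangle> = ?G' \<langle>c, d\<rangle>"
    if *: "valid c" "valid d" "cod c = ?A" "cod d = ?A" "apart (names c) (names d)" "apart (names c) (names x)"
      "apart (names d) (names x)" for c d
  proof -
    have "?E (\<eta> ?A \<rhd> un) \<langle>c, d\<rangle> = ?L \<rhd> \<langle>d, F \<rhd> \<langle>ev ?A \<rhd> \<langle>\<eta> ?A \<rhd> un, c\<rangle>, x\<rangle>\<rangle>"
      by (rule linear_eq_on_pairs[where t = "\<eta> ?A \<rhd> un" and A = "?A\<^sup>\<star>" and B = ?A and Q = "\<lambda>t. ?E t \<langle>c, d\<rangle>"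
            and Q' = "\<lambda>t. ?L \<rhd> \<langle>d, F \<rhd> \<langle>ev ?A \<rhd> \<langle>t, c\<rangle>, x\<rangle>\<rangle>"],
          (rule linear_intros | use * x in simp)+)
    moreover have "?E' (\<eta> ?A \<rhd> un) \<langle>c, d\<rangle> = ?L \<rhd> \<langle>F \<rhd> \<langle>ev ?A \<rhd> \<langle>\<eta> ?A \<rhd> un, d\<rangle>, x\<rangle>, c\<rangle>"
      by (rule linear_eq_on_pairs[where t = "\<eta> ?A \<rhd> un" and A = "?A\<^sup>\<star>" and B = ?A and Q = "\<lambda>t. ?E' t \<langle>c, d\<rangle>"
            and Q' = "\<lambda>t. ?L \<rhd> \<langle>F \<rhd> \<langle>ev ?A \<rhd> \<langle>t, d\<rangle>, x\<rangle>, c\<rangle>"],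
          (rule linear_intros | use * x in simp)+)
    ultimately show "?E (\<eta> ?A \<rhd> un) \<langle>c, d\<rangle> = ?G \<langle>c, d\<rangle>" "?E' (\<eta> ?A \<rhd> un) \<langle>c, d\<rangle> = ?G' \<langle>c, d\<rangle>"
      using * x by (simp_all only:) simp_all
  qed
  have 4: "?E (\<eta> ?A \<rhd> un) ?c = ?G ?c"
    by (rule linear_eq_on_pairs[where t = ?c and A = ?A and B = ?A and Q = "\<lambda>s. ?E (\<eta> ?A \<rhd> un) s" and Q' = ?G],
        (rule linear_intros | rule 3 | use x in simp)+)
  have b4: "?E' (\<eta> ?A \<rhd> un) ?c = ?G' ?c"
    by (rule linear_eq_on_pairs[where t = ?c and A = ?A and B = ?A and Q = "\<lambda>s. ?E' (\<eta> ?A \<rhd> un) s" and Q' = ?G'],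
        (rule linear_intros | rule 3 | use x in simp)+)
  show "tr ?A \<rhd> right_mult ?A F \<rhd> x = ?G ?c" unfolding t 2[symmetric] 4 ..
  show "tr ?A \<rhd> right_mult ?A F \<rhd> x = ?G' ?c" unfolding t b2[symmetric] b4 ..
qed

text \<open>With \<open>c \<otimes> d\<close> for the cup of the form, the trace of left
  multiplication is the counit of \<open>d (x c)\<close> and that of right multiplication the counit
  of \<open>(d x) c\<close>. Associativity identifies them, without any symmetry of the
  form.\<close>

lemma trace_mult_action:
  assumes M: "dagger_frobenius_algebra M"
  shows "trace_mult M = tr (Car M) \<cdot> action M"
proof (rule arrow_ext[where A = "Car M"])
  note [simp] = dagger_frobeniusD[OF M]
  let ?A = "Car M" and ?m = "Mult M" and ?c = "coform M"
  fix x assume x: "valid x" "cod x = ?A"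
  let ?Q = "\<lambda>s. form M \<rhd> (\<one> ?A \<odot> (?m \<cdot> \<sigma> ?A ?A)) \<rhd> \<a> ?A ?A ?A \<rhd> \<langle>\<sigma> ?A ?A \<rhd> s, x\<rangle>"
  let ?R = "\<lambda>s. form M \<rhd> (?m \<odot> \<one> ?A) \<rhd> \<sigma> ?A (?A \<otimes> ?A) \<rhd> \<a> ?A ?A ?A \<rhd> \<langle>s, x\<rangle>"
  have "?Q ?c = ?R ?c"
    by (rule linear_eq_on_pairs[where t = ?c and A = ?A and B = ?A and Q = ?Q and Q' = ?R],
        (rule linear_intros | use x in \<open>simp add: mult_assoc[OF M]\<close>)+)
  then show "trace_mult M \<rhd> x = (tr ?A \<cdot> action M) \<rhd> x"
    using tr_right_mult_form(1)[OF M, of "?m \<cdot> \<sigma> ?A ?A" x] tr_right_mult_form(2)[OF M, of ?m x] x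
    by (simp add: trace_mult_eq action_eq)
qed (use dagger_frobeniusD[OF M] trace_mult_typing[OF M] in \<open>simp_all add: action_eq\<close>)

text \<open>\<open>?g\<close> represents the algebra by left multiplications, turning products into
  composites, and the trace of operators is cyclic.\<close>

lemma trace_mult_commute:
  assumes M: "dagger_frobenius_algebra M" and xy: "valid x" "valid y" "cod x = Car M" "cod y = Car M" "apart (names x) (names y)"
  shows "trace_mult M \<rhd> Mult M \<rhd> \<langle>x, y\<rangle> = trace_mult M \<rhd> Mult M \<rhd> \<langle>y, x\<rangle>"
proof -
  note [simp] = dagger_frobeniusD[OF M]
  let ?A = "Car M" and ?m = "Mult M"
  let ?g = "right_mult ?A (?m \<cdot> \<sigma> ?A ?A)"
  have hom: "?g \<rhd> ?m \<rhd> \<langle>a, b\<rangle> = pants_mult ?A \<rhd> \<langle>?g \<rhd> b, ?g \<rhd> a\<rangle>"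
    if "valid a" "valid b" "cod a = ?A" "cod b = ?A" "apart (names a) (names b)" for a b
    by (rule evaluation_nondegenerate[OF dual_pair_Dual[of ?A], of ?A]) (use that in \<open>simp_all add: mult_assoc[OF M]\<close>)
  have "tr ?A \<rhd> pants_mult ?A \<rhd> \<langle>?g \<rhd> y, ?g \<rhd> x\<rangle> = (tr ?A \<cdot> pants_mult ?A \<cdot> \<sigma> (D ?A) (D ?A)) \<rhd> \<langle>?g \<rhd> x, ?g \<rhd> y\<rangle>"
    using xy by simp
  also have "\<dots> = tr ?A \<rhd> pants_mult ?A \<rhd> \<langle>?g \<rhd> x, ?g \<rhd> y\<rangle>"
    unfolding tr_pants_mult_commute[OF dagger_frobeniusD(1)[OF M]] using xy by simp
  finally show ?thesis using hom[of x y] hom[of y x] xy by (simp add: trace_mult_eq)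
qed

text \<open>The counit is \<open>trace_mult\<close> after \<open>z \<cdot> z\<close>. Centrality
  attaches the two copies of \<open>z\<close> to one factor, the trace allows the exchange, and
  centrality detaches them again.\<close>

lemma form_commute:
  assumes M: "dagger_frobenius_algebra M" "normalisable M"
    and xy: "valid x" "valid y" "cod x = Car M" "cod y = Car M" "apart (names x) (names y)"
  shows "form M \<rhd> \<langle>x, y\<rangle> = form M \<rhd> \<langle>y, x\<rangle>"
proof -
  note [simp] = dagger_frobeniusD[OF M(1)] trace_mult_typing[OF M(1)]
  obtain z where z: "central M z" "positive_definite (Car M) z" "trace_mult M \<cdot> z \<cdot> z = (Unt M)\<^sup>\<dagger>"
    using M unfolding normalisable_def normaliser_def by blast
  note [simp] = positive_definiteD(1-3)[OF z(2)]
  have u: "(Unt M)\<^sup>\<dagger> \<rhd> a = trace_mult M \<rhd> z \<rhd> z \<rhd> a" if "valid a" "cod a = Car M" for a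
    unfolding z(3)[symmetric] using that by simp
  have "trace_mult M \<rhd> z \<rhd> z \<rhd> Mult M \<rhd> \<langle>x, y\<rangle> = trace_mult M \<rhd> Mult M \<rhd> \<langle>z \<rhd> z \<rhd> x, y\<rangle>"
    using xy by (simp add: app_central[OF z(1) M(1)])
  also have "\<dots> = trace_mult M \<rhd> Mult M \<rhd> \<langle>y, z \<rhd> z \<rhd> x\<rangle>"
    using xy by (intro trace_mult_commute[OF M(1)]) simp_all
  also have "\<dots> = trace_mult M \<rhd> z \<rhd> z \<rhd> Mult M \<rhd> \<langle>y, x\<rangle>"
    using xy by (simp add: app_central[OF z(1) M(1)])
  finally show ?thesis using xy by (simp add: u)
qed

text \<open>The algebra is its own dual. Symmetry of the form reconciles the order of arguments in
  \<open>dual_pair\<close> with that in \<open>form_snake\<close>.\<close>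

lemma dual_pair_form:
  assumes M: "dagger_frobenius_algebra M" "normalisable M"
  shows "dual_pair (Car M) (Car M) (form M)"
  unfolding dual_pair_def
proof (intro conjI allI impI)
  note [simp] = dagger_frobeniusD[OF M(1)]
  let ?A = "Car M" and ?c = "coform M"
  have c: "(form M)\<^sup>\<dagger> \<rhd> un = ?c" by (simp add: dagger_Comp)
  have comm: "(Unt M)\<^sup>\<dagger> \<rhd> Mult M \<rhd> \<langle>x, y\<rangle> = (Unt M)\<^sup>\<dagger> \<rhd> Mult M \<rhd> \<langle>y, x\<rangle>"
    if "valid x" "valid y" "cod x = ?A" "cod y = ?A" "apart (names x) (names y)" for x y
    using form_commute[OF M that] that by simp
  show "form M \<in> hom V (?A \<otimes> ?A) \<I>" by (simp add: hom_def)
  fix y assume y: "valid y" "cod y = ?A"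
  let ?Q = "\<lambda>t. evaluation ?A ?A (form M) ?A \<rhd> \<langle>t, y\<rangle>" and ?R = "\<lambda>t. \<l> ?A \<rhd> (form M \<odot> \<one> ?A) \<rhd> (\<a> ?A ?A ?A)\<^sup>\<dagger> \<rhd> \<langle>y, t\<rangle>"
  have 1: "?Q \<langle>c, d\<rangle> = ?R \<langle>c, d\<rangle>" if "valid c" "valid d" "cod c = ?A" "cod d = ?A" "apart (names c) (names d)"
    "apart (names c) (names y)" "apart (names d) (names y)" for c d
    using that y comm[of c y] by simp
  have "?Q ?c = ?R ?c"
    by (rule linear_eq_on_pairs[where t = ?c and A = ?A and B = ?A and Q = ?Q and Q' = ?R],
        (rule linear_intros | rule 1 | use y in simp)+)
  then show "evaluation ?A ?A (form M) ?A \<rhd> \<langle>(form M)\<^sup>\<dagger> \<rhd> un, y\<rangle> = y"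
    unfolding c using form_snake(1)[OF M(1) y] by simp
  let ?Q' = "\<lambda>t. coevaluation ?A ?A (form M) \<rhd> \<langle>t, y\<rangle>" and ?R' = "\<lambda>t. \<r> ?A \<rhd> (\<one> ?A \<odot> form M) \<rhd> \<a> ?A ?A ?A \<rhd> \<langle>t, y\<rangle>"
  have 2: "?Q' \<langle>c, d\<rangle> = ?R' \<langle>c, d\<rangle>" if "valid c" "valid d" "cod c = ?A" "cod d = ?A" "apart (names c) (names d)"
    "apart (names c) (names y)" "apart (names d) (names y)" for c d
    using that y comm[of d y] by simp
  have "?Q' ?c = ?R' ?c"
    by (rule linear_eq_on_pairs[where t = ?c and A = ?A and B = ?A and Q = ?Q' and Q' = ?R'],
        (rule linear_intros | rule 2 | use y in simp)+)
  then show "coevaluation ?A ?A (form M) \<rhd> \<langle>(form M)\<^sup>\<dagger> \<rhd> un, y\<rangle> = y"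
    unfolding c using form_snake(2)[OF M(1) y] by simp
qed (use dagger_frobeniusD[OF M(1)] in simp_all)

text \<open>With \<open>c \<otimes> d\<close> for the comultiplication of \<open>t\<close>, this is
  the invariance \<open>c y \<otimes> d = c \<otimes> y d\<close>. Pairing the first leg with
  \<open>w\<close> under the form yields \<open>(y w) t\<close> on one side and
  \<open>y (w t)\<close> on the other; the symmetry of the form is used on both sides.\<close>

lemma casimir:
  assumes M: "dagger_frobenius_algebra M" "normalisable M"
    and ty: "valid t" "valid y" "cod t = Car M" "cod y = Car M" "apart (names t) (names y)"
  shows "(Mult M \<odot> \<one> (Car M)) \<rhd> (\<a> (Car M) (Car M) (Car M))\<^sup>\<dagger> \<rhd> (\<one> (Car M) \<odot> \<sigma> (Car M) (Car M)) \<rhd>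
      \<a> (Car M) (Car M) (Car M) \<rhd> \<langle>(Mult M)\<^sup>\<dagger> \<rhd> t, y\<rangle> =
    (\<one> (Car M) \<odot> (Mult M \<cdot> \<sigma> (Car M) (Car M))) \<rhd> \<a> (Car M) (Car M) (Car M) \<rhd> \<langle>(Mult M)\<^sup>\<dagger> \<rhd> t, y\<rangle>"
proof (rule evaluation_nondegenerate[OF dual_pair_form[OF M] dagger_frobeniusD(1)[OF M(1)]])
  note [simp] = dagger_frobeniusD[OF M(1)]
  let ?A = "Car M" and ?m = "Mult M" and ?a = "\<a> (Car M) (Car M) (Car M)"
  let ?Z = "\<lambda>s. (?m \<odot> \<one> ?A) \<rhd> ?a\<^sup>\<dagger> \<rhd> (\<one> ?A \<odot> \<sigma> ?A ?A) \<rhd> ?a \<rhd> \<langle>s, y\<rangle>"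
  let ?Y = "\<lambda>s. (\<one> ?A \<odot> (?m \<cdot> \<sigma> ?A ?A)) \<rhd> ?a \<rhd> \<langle>s, y\<rangle>"
  show "valid (?Z (?m\<^sup>\<dagger> \<rhd> t))" "valid (?Y (?m\<^sup>\<dagger> \<rhd> t))" "cod (?Z (?m\<^sup>\<dagger> \<rhd> t)) = ?A \<otimes> ?A" "cod (?Y (?m\<^sup>\<dagger> \<rhd> t)) = ?A \<otimes> ?A"
    using ty by simp_all
  fix w assume "valid w" "cod w = ?A" "apart (names w) (names (?Z (?m\<^sup>\<dagger> \<rhd> t)))"
  then have w: "valid w" "cod w = ?A" "apart (names w) (names t)" "apart (names w) (names y)" by simp_all
  let ?E = "evaluation ?A ?A (form M) ?A"
  let ?k = "\<lambda>w s. \<l> ?A \<rhd> (form M \<odot> \<one> ?A) \<rhd> ?a\<^sup>\<dagger> \<rhd> \<langle>w, s\<rangle>"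
  have k: "?k w (?m\<^sup>\<dagger> \<rhd> t) = ?m \<rhd> \<langle>w, t\<rangle>" if "valid w" "cod w = ?A" for w
  proof -
    have "form M \<odot> \<one> ?A = ((Unt M)\<^sup>\<dagger> \<odot> \<one> ?A) \<cdot> (?m \<odot> \<one> ?A)" by (simp add: interchange)
    then show ?thesis using that ty by (simp add: mult_frobenius[OF M(1)] mult_counit[OF M(1)])
  qed
  have comm: "(Unt M)\<^sup>\<dagger> \<rhd> Mult M \<rhd> \<langle>x, y\<rangle> = (Unt M)\<^sup>\<dagger> \<rhd> Mult M \<rhd> \<langle>y, x\<rangle>"
    if "valid x" "valid y" "cod x = ?A" "cod y = ?A" "apart (names x) (names y)" for x y
    using form_commute[OF M that] that by simp
  have 1: "?E \<rhd> \<langle>?Z \<langle>c, d\<rangle>, w\<rangle> = ?k (?m \<rhd> \<langle>y, w\<rangle>) \<langle>c, d\<rangle>" "?E \<rhd> \<langle>?Y \<langle>c, d\<rangle>, w\<rangle> = ?m \<rhd> \<langle>y, ?k w \<langle>c, d\<rangle>\<rangle>"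
    if "valid c" "valid d" "cod c = ?A" "cod d = ?A" "apart (names c) (names d)"
    "apart (names c) (names y)" "apart (names d) (names y)" "apart (names c) (names w)" "apart (names d) (names w)" for c d
    using that ty w comm[of c "?m \<rhd> \<langle>y, w\<rangle>"] comm[of c w] by (simp_all add: mult_assoc[OF M(1)])
  have "?E \<rhd> \<langle>?Z (?m\<^sup>\<dagger> \<rhd> t), w\<rangle> = ?k (?m \<rhd> \<langle>y, w\<rangle>) (?m\<^sup>\<dagger> \<rhd> t)"
    by (rule linear_eq_on_pairs[where t = "?m\<^sup>\<dagger> \<rhd> t" and A = ?A and B = ?A and Q = "\<lambda>s. ?E \<rhd> \<langle>?Z s, w\<rangle>" and Q' = "?k (?m \<rhd> \<langle>y, w\<rangle>)"],
        (rule linear_intros | rule 1 | use ty w in simp)+)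
  also have "\<dots> = ?m \<rhd> \<langle>y, ?k w (?m\<^sup>\<dagger> \<rhd> t)\<rangle>" using ty w by (simp only: k valid_simps cod_simps dagger_frobeniusD[OF M(1)]) (simp add: mult_assoc[OF M(1)])
  also have "\<dots> = ?E \<rhd> \<langle>?Y (?m\<^sup>\<dagger> \<rhd> t), w\<rangle>"
    by (rule linear_eq_on_pairs[where t = "?m\<^sup>\<dagger> \<rhd> t" and A = ?A and B = ?A and Q = "\<lambda>s. ?m \<rhd> \<langle>y, ?k w s\<rangle>" and Q' = "\<lambda>s. ?E \<rhd> \<langle>?Y s, w\<rangle>"],
        (rule linear_intros | rule 1[symmetric] | use ty w in simp)+)
  finally show "?E \<rhd> \<langle>?Z (?m\<^sup>\<dagger> \<rhd> t), w\<rangle> = ?E \<rhd> \<langle>?Y (?m\<^sup>\<dagger> \<rhd> t), w\<rangle>" .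
qed

section \<open>Composites of action and coaction\<close>

lemma action_typing [simp]:
  assumes M: "dagger_frobenius_algebra M"
  shows "action M \<in> Arr V" "Dom V (action M) = Car M" "Cod V (action M) = D (Car M)"
  using dagger_frobeniusD[OF M] by (simp_all add: action_eq)

lemma coaction_eq:
  assumes M: "dagger_frobenius_algebra M"
  shows "coaction M = (action M)\<^sup>\<dagger>"
  using dagger_frobeniusD[OF M] by (simp add: action_def coaction_def Let_def dagger_Comp comp_assoc)

lemma app_coaction:
  assumes M: "dagger_frobenius_algebra M" and x: "valid x" "valid t" "cod x = (Car M)\<^sup>\<star>" "cod t = Car M"
  shows "coaction M \<rhd> \<langle>x, t\<rangle> = \<l> (Car M) \<rhd> (tr (Car M) \<odot> \<one> (Car M)) \<rhd> (\<a> ((Car M)\<^sup>\<star>) (Car M) (Car M))\<^sup>\<dagger> \<rhd> \<langle>x, (Mult M)\<^sup>\<dagger> \<rhd> t\<rangle>"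
  using dagger_frobeniusD[OF M] x by (simp add: coaction_def Let_def)

text \<open>The dilation makes identities morphisms of CP*[V]. Acting on \<open>y\<close>, the left
  side multiplies the second leg of the comultiplied \<open>t\<close> by \<open>y\<close>;
  \<open>casimir\<close> moves \<open>y\<close> to the first leg, which is where the partial trace
  has it.\<close>

lemma action_coaction:
  assumes M: "dagger_frobenius_algebra M" "normalisable M"
  shows "action M \<cdot> coaction M = partial_tr (Car M) (Car M) \<cdot> double ((Mult M)\<^sup>\<dagger>)"
proof (rule model_ext[OF model_Id[of "Car M"], where X = "D (Car M)"])
  note [simp] = dagger_frobeniusD[OF M(1)] action_typing[OF M(1)] coaction_eq[OF M(1)]
  let ?A = "Car M" and ?m = "Mult M" and ?a = "\<a> (Car M) (Car M) (Car M)"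
  show "ev ?A \<cdot> ((action M \<cdot> coaction M) \<odot> \<one> ?A) = ev ?A \<cdot> ((partial_tr ?A ?A \<cdot> double (?m\<^sup>\<dagger>)) \<odot> \<one> ?A)"
  proof (rule TensorO_ext3[of "?A\<^sup>\<star>" ?A ?A])
    fix t' t y assume ty: "valid t'" "valid t" "valid y" "cod t' = ?A\<^sup>\<star>" "cod t = ?A" "cod y = ?A"
      "apart (names t') (names t)" "apart (names t') (names y)" "apart (names t) (names y)"
    let ?s = "?m\<^sup>\<dagger> \<rhd> t" and ?T = "\<langle>t', t\<rangle>" and ?W = "double (?m\<^sup>\<dagger>) \<rhd> \<langle>t', t\<rangle>"
    let ?K = "\<lambda>x s. \<l> ?A \<rhd> (tr ?A \<odot> \<one> ?A) \<rhd> (\<a> (?A\<^sup>\<star>) ?A ?A)\<^sup>\<dagger> \<rhd> \<langle>x, s\<rangle>"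
    let ?Z = "\<lambda>s. (?m \<odot> \<one> ?A) \<rhd> ?a\<^sup>\<dagger> \<rhd> (\<one> ?A \<odot> \<sigma> ?A ?A) \<rhd> ?a \<rhd> \<langle>s, y\<rangle>"
    let ?Y = "\<lambda>s. (\<one> ?A \<odot> (?m \<cdot> \<sigma> ?A ?A)) \<rhd> ?a \<rhd> \<langle>s, y\<rangle>"
    have "ev ?A \<rhd> \<langle>action M \<rhd> coaction M \<rhd> ?T, y\<rangle> = ?m \<rhd> \<langle>y, coaction M \<rhd> ?T\<rangle>"
      using ty by (simp add: action_eq)
    also have "\<dots> = ?m \<rhd> \<langle>y, ?K t' ?s\<rangle>" using ty app_coaction[OF M(1), of t' t] by simp
    also have "\<dots> = ?K t' (?Y ?s)"
      by (rule linear_eq_on_pairs[where t = ?s and A = ?A and B = ?A and Q = "\<lambda>s. ?m \<rhd> \<langle>y, ?K t' s\<rangle>" and Q' = "\<lambda>s. ?K t' (?Y s)"],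
          (rule linear_intros | use ty in simp)+)
    also have "\<dots> = ?K t' (?Z ?s)" using casimir[OF M, of t y] ty by simp
    also have "\<dots> = contract ?A ?A \<rhd> \<langle>\<eta> ?A \<rhd> un, \<langle>?W, y\<rangle>\<rangle>"
    proof -
      let ?q = "\<lambda>e' e s. (tr ?A \<rhd> \<langle>t', ?m \<rhd> \<langle>e, y\<rangle>\<rangle>) \<bullet> ?K e' s"
      let ?r = "\<lambda>t s. ?K t' ((?m \<odot> \<one> ?A) \<rhd> ?a\<^sup>\<dagger> \<rhd> (\<one> ?A \<odot> \<sigma> ?A ?A) \<rhd> ?a \<rhd> \<langle>(ev ?A \<odot> \<one> ?A) \<rhd> (\<a> (D ?A) ?A ?A)\<^sup>\<dagger> \<rhd> \<langle>t, s\<rangle>, y\<rangle>)"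
      have 1: "contract ?A ?A \<rhd> \<langle>\<langle>e', e\<rangle>, \<langle>?W, y\<rangle>\<rangle> = ?r \<langle>e', e\<rangle> ?s"
        if e: "valid e'" "valid e" "cod e' = ?A\<^sup>\<star>" "cod e = ?A" "apart (names e') (names e)" "apart (names e') (names t)"
          "apart (names e') (names t')" "apart (names e') (names y)" "apart (names e) (names t)" "apart (names e) (names t')" "apart (names e) (names y)" for e' e
      proof -
        have "contract ?A ?A \<rhd> \<langle>\<langle>e', e\<rangle>, \<langle>?W, y\<rangle>\<rangle> = ?q e' e ?s" using e ty by (simp add: app_contract)
        also have "\<dots> = ?r \<langle>e', e\<rangle> ?s"
          by (rule linear_eq_on_pairs[where t = ?s and A = ?A and B = ?A and Q = "?q e' e" and Q' = "?r \<langle>e', e\<rangle>"],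
              (rule linear_intros | use ty e in \<open>simp add: scale_left_commute\<close>)+)
        finally show ?thesis .
      qed
      have "contract ?A ?A \<rhd> \<langle>\<eta> ?A \<rhd> un, \<langle>?W, y\<rangle>\<rangle> = ?r (\<eta> ?A \<rhd> un) ?s"
        by (rule linear_eq_on_pairs[where t = "\<eta> ?A \<rhd> un" and A = "?A\<^sup>\<star>" and B = ?A and Q = "\<lambda>t. contract ?A ?A \<rhd> \<langle>t, \<langle>?W, y\<rangle>\<rangle>" and Q' = "\<lambda>t. ?r t ?s"],
            (rule linear_intros | rule 1 | use ty in simp)+)
      also have "(ev ?A \<odot> \<one> ?A) \<rhd> (\<a> (D ?A) ?A ?A)\<^sup>\<dagger> \<rhd> \<langle>\<eta> ?A \<rhd> un, ?s\<rangle> = ?s"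
        by (rule linear_eq_on_pairs[where t = ?s and A = ?A and B = ?A and Q = "\<lambda>s. (ev ?A \<odot> \<one> ?A) \<rhd> (\<a> (D ?A) ?A ?A)\<^sup>\<dagger> \<rhd> \<langle>\<eta> ?A \<rhd> un, s\<rangle>" and Q' = "\<lambda>s. s"],
            (rule linear_intros | use ty in simp)+)
      finally show ?thesis by simp
    qed
    also have "\<dots> = ev ?A \<rhd> \<langle>partial_tr ?A ?A \<rhd> ?W, y\<rangle>" using ty by (subst ev_partial_tr) simp_all
    finally show "(ev ?A \<cdot> ((action M \<cdot> coaction M) \<odot> \<one> ?A)) \<rhd> \<langle>?T, y\<rangle> = (ev ?A \<cdot> ((partial_tr ?A ?A \<cdot> double (?m\<^sup>\<dagger>)) \<odot> \<one> ?A)) \<rhd> \<langle>?T, y\<rangle>"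
      using ty by simp
  qed simp_all
qed (use dagger_frobeniusD[OF M(1)] action_typing[OF M(1)] coaction_eq[OF M(1)] in simp_all)

text \<open>The Frobenius equation merges the product in the action with the coproduct in the
  coaction. What remains is the trace of the action on one leg of the comultiplication, and this
  trace is \<open>trace_mult\<close>.\<close>

lemma coaction_action:
  assumes M: "dagger_frobenius_algebra M"
  shows "coaction M \<cdot> action M = \<l> (Car M) \<cdot> (trace_mult M \<odot> \<one> (Car M)) \<cdot> (Mult M)\<^sup>\<dagger>"
proof (rule arrow_ext[where A = "Car M"])
  note [simp] = dagger_frobeniusD[OF M] action_typing[OF M]
  let ?A = "Car M" and ?m = "Mult M" and ?a = "\<a> (Car M) (Car M) (Car M)"
  fix x assume x: "valid x" "cod x = ?A"
  let ?K = "\<lambda>s. \<l> ?A \<rhd> (tr ?A \<odot> \<one> ?A) \<rhd> (\<a> (?A\<^sup>\<star>) ?A ?A)\<^sup>\<dagger> \<rhd> s"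
  let ?q = "\<lambda>t. ?K ((\<one> (?A\<^sup>\<star>) \<odot> ?m\<^sup>\<dagger>) \<rhd> (\<one> (?A\<^sup>\<star>) \<odot> ?m) \<rhd> \<a> (?A\<^sup>\<star>) ?A ?A \<rhd> \<langle>t, x\<rangle>)"
  let ?r = "\<lambda>t s. \<l> ?A \<rhd> ((tr ?A \<cdot> (\<one> (?A\<^sup>\<star>) \<odot> ?m) \<cdot> \<a> (?A\<^sup>\<star>) ?A ?A) \<odot> \<one> ?A) \<rhd> (\<a> (D ?A) ?A ?A)\<^sup>\<dagger> \<rhd> \<langle>t, s\<rangle>"
  have 1: "?q \<langle>e', e\<rangle> = ?r \<langle>e', e\<rangle> (?m\<^sup>\<dagger> \<rhd> x)"
    if e: "valid e'" "valid e" "cod e' = ?A\<^sup>\<star>" "cod e = ?A" "apart (names e') (names e)" "apart (names e') (names x)" "apart (names e) (names x)" for e' e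
  proof -
    let ?q' = "\<lambda>s. ?K \<langle>e', (?m \<odot> \<one> ?A) \<rhd> ?a\<^sup>\<dagger> \<rhd> \<langle>e, s\<rangle>\<rangle>"
    have "?q \<langle>e', e\<rangle> = ?q' (?m\<^sup>\<dagger> \<rhd> x)" using e x by (simp add: mult_frobenius[OF M])
    also have "\<dots> = ?r \<langle>e', e\<rangle> (?m\<^sup>\<dagger> \<rhd> x)"
      by (rule linear_eq_on_pairs[where t = "?m\<^sup>\<dagger> \<rhd> x" and A = ?A and B = ?A and Q = ?q' and Q' = "?r \<langle>e', e\<rangle>"],
          (rule linear_intros | use x e in simp)+)
    finally show ?thesis .
  qed
  have "(coaction M \<cdot> action M) \<rhd> x = ?q (\<eta> ?A \<rhd> un)"
    using x by (simp add: coaction_def action_def Let_def)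
  also have "\<dots> = ?r (\<eta> ?A \<rhd> un) (?m\<^sup>\<dagger> \<rhd> x)"
    by (rule linear_eq_on_pairs[where t = "\<eta> ?A \<rhd> un" and A = "?A\<^sup>\<star>" and B = ?A and Q = ?q and Q' = "\<lambda>t. ?r t (?m\<^sup>\<dagger> \<rhd> x)"],
        (rule linear_intros | rule 1 | use x in simp)+)
  also have "\<dots> = \<l> ?A \<rhd> (trace_mult M \<odot> \<one> ?A) \<rhd> ?m\<^sup>\<dagger> \<rhd> x"
    by (rule linear_eq_on_pairs[where t = "?m\<^sup>\<dagger> \<rhd> x" and A = ?A and B = ?A and Q = "?r (\<eta> ?A \<rhd> un)" and Q' = "\<lambda>s. \<l> ?A \<rhd> (trace_mult M \<odot> \<one> ?A) \<rhd> s"],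
        (rule linear_intros | use x in \<open>simp add: trace_mult_action[OF M] action_eq right_mult_def\<close>)+)
  finally show "(coaction M \<cdot> action M) \<rhd> x = (\<l> ?A \<cdot> (trace_mult M \<odot> \<one> ?A) \<cdot> ?m\<^sup>\<dagger>) \<rhd> x"
    using x trace_mult_typing[OF M] by simp
qed (use dagger_frobeniusD[OF M] action_typing[OF M] coaction_eq[OF M] trace_mult_typing[OF M] in simp_all)

text \<open>Conjugating right multiplication by \<open>x\<close> with the central self-adjoint
  \<open>z\<close> gives right multiplication by \<open>z z x\<close>. The two copies of
  \<open>z\<close> then pass through the comultiplication and turn the trace into the
  counit.\<close>

lemma normaliser_retraction:
  assumes M: "dagger_frobenius_algebra M" and z: "normaliser M z"
  shows "coaction M \<cdot> double z \<cdot> action M = \<one> (Car M)" and "z \<in> Arr V" and "Dom V z = Car M" and "Cod V z = Car M"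
proof -
  note [simp] = dagger_frobeniusD[OF M] action_typing[OF M] trace_mult_typing[OF M] coaction_eq[OF M]
  have z': "central M z" "positive_definite (Car M) z" "trace_mult M \<cdot> z \<cdot> z = (Unt M)\<^sup>\<dagger>"
    using z unfolding normaliser_def by blast+
  note zt [simp] = positive_definiteD[OF z'(2)]
  let ?A = "Car M" and ?m = "Mult M"
  show "z \<in> Arr V" "Dom V z = ?A" "Cod V z = ?A" by simp_all
  have 1: "double z \<cdot> action M = action M \<cdot> z \<cdot> z"
    by (rule evaluation_arrow_ext[OF dual_pair_Dual[of ?A], where X = ?A and B = ?A])
      (simp_all add: action_eq app_central[OF z'(1) M])
  have "?m \<cdot> (z \<odot> \<one> ?A) = z \<cdot> ?m" using z'(1) by (simp add: central_def)
  from arg_cong[OF this, of "\<lambda>f. f\<^sup>\<dagger>"] have 2: "?m\<^sup>\<dagger> \<cdot> z = (z \<odot> \<one> ?A) \<cdot> ?m\<^sup>\<dagger>" by (simp add: dagger_Comp)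
  have "coaction M \<cdot> double z \<cdot> action M = (coaction M \<cdot> action M) \<cdot> z \<cdot> z" unfolding 1 by (simp add: comp_assoc)
  also have "\<dots> = \<l> ?A \<cdot> (trace_mult M \<odot> \<one> ?A) \<cdot> (?m\<^sup>\<dagger> \<cdot> z) \<cdot> z"
    unfolding coaction_action[OF M] by (simp add: comp_assoc)
  also have "\<dots> = \<l> ?A \<cdot> ((trace_mult M \<odot> \<one> ?A) \<cdot> (z \<odot> \<one> ?A) \<cdot> (z \<odot> \<one> ?A)) \<cdot> ?m\<^sup>\<dagger>"
    by (simp add: 2 comp_assoc)
  also have "(trace_mult M \<odot> \<one> ?A) \<cdot> (z \<odot> \<one> ?A) \<cdot> (z \<odot> \<one> ?A) = (Unt M)\<^sup>\<dagger> \<odot> \<one> ?A"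
    using z'(3) by (simp add: interchange)
  also have "\<l> ?A \<cdot> ((Unt M)\<^sup>\<dagger> \<odot> \<one> ?A) \<cdot> ?m\<^sup>\<dagger> = \<one> ?A" by (rule dagger_frobenius_eqs(4)[OF M])
  finally show "coaction M \<cdot> double z \<cdot> action M = \<one> (Car M)" .
qed

end


section \<open>The category CP*[V] and pants algebras\<close>

context dagger_compact_category
begin

abbreviation cpstar_object :: "('o, 'm) algebra_data \<Rightarrow> bool" where
  "cpstar_object M \<equiv> dagger_frobenius_algebra M \<and> normalisable M"

definition cpstar_map :: "('o, 'm) algebra_data \<Rightarrow> ('o, 'm) algebra_data \<Rightarrow> 'm \<Rightarrow> bool" where
  "cpstar_map M N f \<longleftrightarrow> f \<in> Arr V \<and> Dom V f = Car M \<and> Cod V f = Car N \<and>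
     completely_positive (Car M) (Car N) (action N \<cdot> f \<cdot> coaction M)"

lemma coaction_typing [simp]:
  assumes M: "dagger_frobenius_algebra M"
  shows "coaction M \<in> Arr V" "Dom V (coaction M) = D (Car M)" "Cod V (coaction M) = Car M"
  using action_typing[OF M] by (simp_all add: coaction_eq[OF M])

lemma cpstar_map_Id:
  assumes M: "cpstar_object M"
  shows "cpstar_map M M (\<one> (Car M))"
proof -
  note [simp] = dagger_frobeniusD[OF conjunct1[OF M]] coaction_typing[OF conjunct1[OF M]]
  show ?thesis using M
    by (auto simp: cpstar_map_def action_coaction intro!: completely_positiveI[where X = "Car M" and g = "(Mult M)\<^sup>\<dagger>"])
qed

text \<open>The retraction at the middle algebra splits the composite into three completely positive
  maps, the double of a normaliser being the middle one.\<close>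

lemma cpstar_map_Comp:
  assumes o: "dagger_frobenius_algebra M" "cpstar_object N" "dagger_frobenius_algebra K"
    and f: "cpstar_map M N f" and g: "cpstar_map N K g"
  shows "cpstar_map M K (g \<cdot> f)"
proof -
  have N: "dagger_frobenius_algebra N" using o(2) by simp
  obtain z where z: "normaliser N z" using o(2) unfolding normalisable_def by blast
  note zr = normaliser_retraction[OF N z]
  note [simp] = zr(2-) dagger_frobeniusD[OF o(1)] dagger_frobeniusD[OF N] dagger_frobeniusD[OF o(3)]
    action_typing[OF o(1)] action_typing[OF N] action_typing[OF o(3)]
    coaction_typing[OF o(1)] coaction_typing[OF N] coaction_typing[OF o(3)]
  have fg [simp]: "f \<in> Arr V" "Dom V f = Car M" "Cod V f = Car N" "g \<in> Arr V" "Dom V g = Car N" "Cod V g = Car K"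
    using f g by (auto simp: cpstar_map_def)
  have "action K \<cdot> (g \<cdot> f) \<cdot> coaction M = action K \<cdot> g \<cdot> (coaction N \<cdot> double z \<cdot> action N) \<cdot> f \<cdot> coaction M"
    unfolding zr(1) by (simp add: comp_assoc)
  also have "\<dots> = (action K \<cdot> g \<cdot> coaction N) \<cdot> double z \<cdot> (action N \<cdot> f \<cdot> coaction M)"
    by (simp add: comp_assoc)
  finally show ?thesis using f g
    by (auto simp: cpstar_map_def intro!: cp_Comp[of _ "Car N"] cp_double)
qed

lemma cpstar_map_dagger:
  assumes o: "dagger_frobenius_algebra M" "dagger_frobenius_algebra N" and f: "cpstar_map M N f"
  shows "cpstar_map N M (f\<^sup>\<dagger>)"
proof -
  note [simp] = dagger_frobeniusD[OF o(1)] dagger_frobeniusD[OF o(2)] action_typing[OF o(1)] action_typing[OF o(2)]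
  have [simp]: "f \<in> Arr V" "Dom V f = Car M" "Cod V f = Car N" using f by (auto simp: cpstar_map_def)
  have "action M \<cdot> f\<^sup>\<dagger> \<cdot> coaction N = (action N \<cdot> f \<cdot> coaction M)\<^sup>\<dagger>"
    by (simp add: coaction_eq[OF o(1)] coaction_eq[OF o(2)] dagger_Comp comp_assoc)
  then show ?thesis using f cp_dagger by (simp add: cpstar_map_def)
qed

lemma action_tensor:
  assumes M: "dagger_frobenius_algebra M" and N: "dagger_frobenius_algebra N"
  shows "action (tensor_algebra M N) = (double_tensor (Car M) (Car N))\<^sup>\<dagger> \<cdot> (action M \<odot> action N)"
  using dagger_frobeniusD[OF M] dagger_frobeniusD[OF N] by (simp add: action_eq right_mult_tensor)

text \<open>Actions of tensor algebras are tensor products of actions up to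
  \<open>double_tensor\<close>, so the claim reduces to the tensor product of two completely
  positive maps in CPM[V].\<close>

lemma cpstar_map_tensor:
  assumes o: "dagger_frobenius_algebra M" "dagger_frobenius_algebra N" "dagger_frobenius_algebra M'" "dagger_frobenius_algebra N'"
    and f: "cpstar_map M N f" and g: "cpstar_map M' N' g"
  shows "cpstar_map (tensor_algebra M M') (tensor_algebra N N') (f \<odot> g)"
proof -
  note t = dagger_frobenius_tensor[OF o(1,3)] dagger_frobenius_tensor[OF o(2,4)]
  note [simp] = dagger_frobeniusD[OF o(1)] dagger_frobeniusD[OF o(2)] dagger_frobeniusD[OF o(3)] dagger_frobeniusD[OF o(4)]
     action_typing[OF o(1)] action_typing[OF o(2)] action_typing[OF o(3)] action_typing[OF o(4)]
  have [simp]: "f \<in> Arr V" "Dom V f = Car M" "Cod V f = Car N" "g \<in> Arr V" "Dom V g = Car M'" "Cod V g = Car N'"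
    using f g by (auto simp: cpstar_map_def)
  have "action (tensor_algebra N N') \<cdot> (f \<odot> g) \<cdot> coaction (tensor_algebra M M') =
     cpm_tensor (Car M) (Car M') (Car N) (Car N') (action N \<cdot> f \<cdot> coaction M) (action N' \<cdot> g \<cdot> coaction M')"
    by (simp add: coaction_eq[OF t(1)] coaction_eq[OF o(1)] coaction_eq[OF o(3)] action_tensor[OF o(1,3)] action_tensor[OF o(2,4)]
        cpm_tensor_def dagger_Comp comp_assoc) (simp add: interchange flip: comp_assoc)
  then show ?thesis using f g by (simp add: cpstar_map_def cp_tensor)
qed

text \<open>A multiplicative unitary intertwines the actions,
  \<open>action N \<cdot> f = double f \<cdot> action M\<close>, which reduces the claim to the
  identity of \<open>M\<close>. All coherence isomorphisms and the structure maps of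
  \<open>L\<close> are of this kind.\<close>

lemma cpstar_map_unitary:
  assumes M: "cpstar_object M" and N: "cpstar_object N" and f: "unitary (Car M) (Car N) f"
    and hom: "f \<cdot> Mult M = Mult N \<cdot> (f \<odot> f)"
  shows "cpstar_map M N f" "cpstar_map N M (f\<^sup>\<dagger>)"
proof -
  have o: "dagger_frobenius_algebra M" "dagger_frobenius_algebra N" using M N by auto
  note ff [simp] = unitaryD(1-3)[OF f]
  note [simp] = dagger_frobeniusD[OF o(1)] dagger_frobeniusD[OF o(2)] action_typing[OF o(1)] action_typing[OF o(2)] coaction_typing[OF o(1)] coaction_typing[OF o(2)]
  have inv: "f \<rhd> f\<^sup>\<dagger> \<rhd> y = y" if "valid y" "cod y = Car N" for y
    using that unitaryD(5)[OF f] app_Comp[of y "f\<^sup>\<dagger>" f] by simp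
  have h: "f \<rhd> Mult M \<rhd> \<langle>x, y\<rangle> = Mult N \<rhd> \<langle>f \<rhd> x, f \<rhd> y\<rangle>" if "valid x" "valid y" "cod x = Car M" "cod y = Car M" for x y
    using arg_cong[OF hom, of "\<lambda>g. g \<rhd> \<langle>x, y\<rangle>"] that by simp
  have "action N \<cdot> f = double f \<cdot> action M"
    by (rule evaluation_arrow_ext[OF dual_pair_Dual[of "Car N"], where X = "Car M" and B = "Car N"])
      (simp_all add: action_eq h inv)
  then have "action N \<cdot> f \<cdot> coaction M = double f \<cdot> (action M \<cdot> coaction M)" by (simp flip: comp_assoc)
  moreover have "completely_positive (Car M) (Car M) (action M \<cdot> coaction M)"
    using cpstar_map_Id[OF M] by (simp add: cpstar_map_def)
  ultimately show "cpstar_map M N f" by (auto simp: cpstar_map_def intro!: cp_Comp[of _ "Car M"] cp_double)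
  then show "cpstar_map N M (f\<^sup>\<dagger>)" by (rule cpstar_map_dagger[OF o])
qed

lemma cpstar_object_tensor: "cpstar_object M \<Longrightarrow> cpstar_object N \<Longrightarrow> cpstar_object (tensor_algebra M N)"
  by (simp add: dagger_frobenius_tensor normalisable_tensor)

lemma cpstar_object_unit: "cpstar_object unit_algebra"
  by (simp add: dagger_frobenius_unit normalisable_unit)

section \<open>CP*[V] as a dagger symmetric monoidal category\<close>

lemma CPstar_simps [simp]:
  "M \<in> Obj CPstar \<longleftrightarrow> cpstar_object M" "Dom CPstar = src" "Cod CPstar = tgt" "\<one>\<^bsub>CPstar\<^esub> M = Arrow M (\<one> (Car M)) M"
  "g' \<cdot>\<^bsub>CPstar\<^esub> f' = Arrow (src f') (mor g' \<cdot> mor f') (tgt g')" "f'\<^sup>\<dagger>\<^bsub>CPstar\<^esub> = Arrow (tgt f') ((mor f')\<^sup>\<dagger>) (src f')"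
  "M \<otimes>\<^bsub>CPstar\<^esub> N = tensor_algebra M N" "\<I>\<^bsub>CPstar\<^esub> = unit_algebra"
  "f' \<odot>\<^bsub>CPstar\<^esub> g' = Arrow (tensor_algebra (src f') (src g')) (mor f' \<odot> mor g') (tensor_algebra (tgt f') (tgt g'))"
  "\<a>\<^bsub>CPstar\<^esub> M N K = Arrow (tensor_algebra (tensor_algebra M N) K) (\<a> (Car M) (Car N) (Car K)) (tensor_algebra M (tensor_algebra N K))"
  "\<l>\<^bsub>CPstar\<^esub> M = Arrow (tensor_algebra unit_algebra M) (\<l> (Car M)) M"
  "\<r>\<^bsub>CPstar\<^esub> M = Arrow (tensor_algebra M unit_algebra) (\<r> (Car M)) M"
  "\<sigma>\<^bsub>CPstar\<^esub> M N = Arrow (tensor_algebra M N) (\<sigma> (Car M) (Car N)) (tensor_algebra N M)"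
  by (simp_all add: CPstar_def Let_def)

lemma CPstar_hom_iff:
  "x \<in> hom CPstar M N \<longleftrightarrow> cpstar_object M \<and> cpstar_object N \<and> (\<exists>f. x = Arrow M f N \<and> cpstar_map M N f)"
  by (auto simp: CPstar_def Let_def hom_def cpstar_map_def)

lemma CPstar_homE:
  assumes "x \<in> hom CPstar M N"
  obtains f where "x = Arrow M f N" "cpstar_object M" "cpstar_object N" "cpstar_map M N f" "f \<in> Arr V"
    "Dom V f = Car M" "Cod V f = Car N"
  using assms unfolding CPstar_hom_iff cpstar_map_def by blast

lemma CPstar_category: "category CPstar"
proof
  fix f assume "f \<in> Arr CPstar"
  then show "Dom CPstar f \<in> Obj CPstar" "Cod CPstar f \<in> Obj CPstar" by (auto simp: CPstar_def Let_def)
next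
  fix M assume "M \<in> Obj CPstar"
  then show "\<one>\<^bsub>CPstar\<^esub> M \<in> hom CPstar M M" by (simp add: CPstar_hom_iff cpstar_map_Id)
next
  fix f g M N K assume "f \<in> hom CPstar M N" "g \<in> hom CPstar N K"
  then show "g \<cdot>\<^bsub>CPstar\<^esub> f \<in> hom CPstar M K" by (auto simp: CPstar_hom_iff intro: cpstar_map_Comp)
next
  fix f M N assume "f \<in> hom CPstar M N"
  then show "\<one>\<^bsub>CPstar\<^esub> N \<cdot>\<^bsub>CPstar\<^esub> f = f" "f \<cdot>\<^bsub>CPstar\<^esub> \<one>\<^bsub>CPstar\<^esub> M = f" by (auto elim!: CPstar_homE)
next
  fix f g h M N K L assume "f \<in> hom CPstar M N" "g \<in> hom CPstar N K" "h \<in> hom CPstar K L"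
  then show "(h \<cdot>\<^bsub>CPstar\<^esub> g) \<cdot>\<^bsub>CPstar\<^esub> f = h \<cdot>\<^bsub>CPstar\<^esub> g \<cdot>\<^bsub>CPstar\<^esub> f"
    by (auto elim!: CPstar_homE simp: comp_assoc)
qed

lemma CPstar_dagger_category: "dagger_category CPstar"
proof (intro dagger_category.intro CPstar_category dagger_category_axioms.intro)
  fix f M N assume "f \<in> hom CPstar M N"
  then show "f\<^sup>\<dagger>\<^bsub>CPstar\<^esub> \<in> hom CPstar N M" by (auto simp: CPstar_hom_iff intro: cpstar_map_dagger)
next
  fix M assume "M \<in> Obj CPstar"
  then show "(\<one>\<^bsub>CPstar\<^esub> M)\<^sup>\<dagger>\<^bsub>CPstar\<^esub> = \<one>\<^bsub>CPstar\<^esub> M" by (auto dest: dagger_frobeniusD(1))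
next
  fix f g M N K assume "f \<in> hom CPstar M N" "g \<in> hom CPstar N K"
  then show "(g \<cdot>\<^bsub>CPstar\<^esub> f)\<^sup>\<dagger>\<^bsub>CPstar\<^esub> = f\<^sup>\<dagger>\<^bsub>CPstar\<^esub> \<cdot>\<^bsub>CPstar\<^esub> g\<^sup>\<dagger>\<^bsub>CPstar\<^esub>" by (auto elim!: CPstar_homE simp: dagger_Comp)
next
  fix f M N assume "f \<in> hom CPstar M N"
  then show "(f\<^sup>\<dagger>\<^bsub>CPstar\<^esub>)\<^sup>\<dagger>\<^bsub>CPstar\<^esub> = f" by (auto elim!: CPstar_homE)
qed

lemma CPstar_unitary:
  assumes "cpstar_object M" "cpstar_object N" "unitary (Car M) (Car N) f" "f \<cdot> Mult M = Mult N \<cdot> (f \<odot> f)"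
  shows "dagger_category.unitary CPstar M N (Arrow M f N)"
  unfolding dagger_category.unitary_def[OF CPstar_dagger_category]
  using assms cpstar_map_unitary[OF assms] by (simp add: CPstar_hom_iff unitary_def)

lemma CPstar_Assoc_unitary:
  assumes o: "cpstar_object M" "cpstar_object N" "cpstar_object K"
  shows "dagger_category.unitary CPstar (tensor_algebra (tensor_algebra M N) K) (tensor_algebra M (tensor_algebra N K))
    (Arrow (tensor_algebra (tensor_algebra M N) K) (\<a> (Car M) (Car N) (Car K)) (tensor_algebra M (tensor_algebra N K)))"
proof (rule CPstar_unitary)
  note [simp] = dagger_frobeniusD[OF conjunct1[OF o(1)]] dagger_frobeniusD[OF conjunct1[OF o(2)]] dagger_frobeniusD[OF conjunct1[OF o(3)]]
  let ?A = "Car M" and ?B = "Car N" and ?E = "Car K"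
  show "cpstar_object (tensor_algebra (tensor_algebra M N) K)" "cpstar_object (tensor_algebra M (tensor_algebra N K))"
    using o by (simp_all only: cpstar_object_tensor)
  show "unitary (Car (tensor_algebra (tensor_algebra M N) K)) (Car (tensor_algebra M (tensor_algebra N K))) (\<a> ?A ?B ?E)"
    by (simp add: Assoc_unitary)
  show "\<a> ?A ?B ?E \<cdot> Mult (tensor_algebra (tensor_algebra M N) K) = Mult (tensor_algebra M (tensor_algebra N K)) \<cdot> (\<a> ?A ?B ?E \<odot> \<a> ?A ?B ?E)"
  proof (rule free_ext)
    let ?v = "\<langle>\<langle>\<langle>var 0 ?A, var 1 ?B\<rangle>, var 2 ?E\<rangle>, \<langle>\<langle>var 3 ?A, var 4 ?B\<rangle>, var 5 ?E\<rangle>\<rangle>"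
    show "free ?v" by (intro free_pair free_var) simp_all
    show "(\<a> ?A ?B ?E \<cdot> Mult (tensor_algebra (tensor_algebra M N) K)) \<rhd> ?v = (Mult (tensor_algebra M (tensor_algebra N K)) \<cdot> (\<a> ?A ?B ?E \<odot> \<a> ?A ?B ?E)) \<rhd> ?v"
      by (simp add: disjnt_def)
  qed simp_all
qed

lemma CPstar_Lunit_unitary:
  assumes M: "cpstar_object M"
  shows "dagger_category.unitary CPstar (tensor_algebra unit_algebra M) M (Arrow (tensor_algebra unit_algebra M) (\<l> (Car M)) M)"
    "dagger_category.unitary CPstar (tensor_algebra M unit_algebra) M (Arrow (tensor_algebra M unit_algebra) (\<r> (Car M)) M)"
proof -
  note [simp] = dagger_frobeniusD[OF conjunct1[OF M]]
  let ?A = "Car M"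
  have l: "\<l> ?A \<cdot> Mult (tensor_algebra unit_algebra M) = Mult M \<cdot> (\<l> ?A \<odot> \<l> ?A)"
  proof (rule free_ext)
    let ?v = "\<langle>\<langle>un, var 0 ?A\<rangle>, \<langle>un, var 1 ?A\<rangle>\<rangle>"
    show "free ?v" by (intro free_pair free_var free_un) simp_all
    show "(\<l> ?A \<cdot> Mult (tensor_algebra unit_algebra M)) \<rhd> ?v = (Mult M \<cdot> (\<l> ?A \<odot> \<l> ?A)) \<rhd> ?v" by simp
  qed simp_all
  have r: "\<r> ?A \<cdot> Mult (tensor_algebra M unit_algebra) = Mult M \<cdot> (\<r> ?A \<odot> \<r> ?A)"
  proof (rule free_ext)
    let ?v = "\<langle>\<langle>var 0 ?A, un\<rangle>, \<langle>var 1 ?A, un\<rangle>\<rangle>"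
    show "free ?v" by (intro free_pair free_var free_un) simp_all
    show "(\<r> ?A \<cdot> Mult (tensor_algebra M unit_algebra)) \<rhd> ?v = (Mult M \<cdot> (\<r> ?A \<odot> \<r> ?A)) \<rhd> ?v" by simp
  qed simp_all
  show "dagger_category.unitary CPstar (tensor_algebra unit_algebra M) M (Arrow (tensor_algebra unit_algebra M) (\<l> ?A) M)"
    "dagger_category.unitary CPstar (tensor_algebra M unit_algebra) M (Arrow (tensor_algebra M unit_algebra) (\<r> ?A) M)"
    using M l r by (auto intro!: CPstar_unitary Lunit_unitary Runit_unitary cpstar_object_tensor cpstar_object_unit
        dagger_frobenius_tensor normalisable_tensor dagger_frobenius_unit normalisable_unit)
qed

lemma CPstar_Sym_unitary:
  assumes o: "cpstar_object M" "cpstar_object N"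
  shows "dagger_category.unitary CPstar (tensor_algebra M N) (tensor_algebra N M) (Arrow (tensor_algebra M N) (\<sigma> (Car M) (Car N)) (tensor_algebra N M))"
proof (rule CPstar_unitary)
  note [simp] = dagger_frobeniusD[OF conjunct1[OF o(1)]] dagger_frobeniusD[OF conjunct1[OF o(2)]]
  let ?A = "Car M" and ?B = "Car N"
  show "cpstar_object (tensor_algebra M N)" "cpstar_object (tensor_algebra N M)"
    using o by (simp_all only: cpstar_object_tensor)
  show "unitary (Car (tensor_algebra M N)) (Car (tensor_algebra N M)) (\<sigma> ?A ?B)" by (simp add: Sym_unitary)
  show "\<sigma> ?A ?B \<cdot> Mult (tensor_algebra M N) = Mult (tensor_algebra N M) \<cdot> (\<sigma> ?A ?B \<odot> \<sigma> ?A ?B)"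
    by (rule TensorO_ext4[of ?A ?B ?A ?B]) simp_all
qed

lemma CPstar_dagger_symmetric_monoidal_category: "dagger_symmetric_monoidal_category CPstar"
proof (intro dagger_symmetric_monoidal_category.intro CPstar_dagger_category dagger_symmetric_monoidal_category_axioms.intro,
    unfold CPstar_simps(1))
  fix M N assume o: "cpstar_object M" "cpstar_object N"
  then have [simp]: "Car M \<in> Obj V" "Car N \<in> Obj V" by (simp_all add: dagger_frobeniusD)
  show "cpstar_object (M \<otimes>\<^bsub>CPstar\<^esub> N)" using cpstar_object_tensor[OF o] by simp
  show "\<one>\<^bsub>CPstar\<^esub> M \<odot>\<^bsub>CPstar\<^esub> \<one>\<^bsub>CPstar\<^esub> N = \<one>\<^bsub>CPstar\<^esub> (M \<otimes>\<^bsub>CPstar\<^esub> N)" by simp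
  show "dagger_category.unitary CPstar (M \<otimes>\<^bsub>CPstar\<^esub> N) (N \<otimes>\<^bsub>CPstar\<^esub> M) (\<sigma>\<^bsub>CPstar\<^esub> M N)"
    using CPstar_Sym_unitary[OF o] by simp
  show "(\<one>\<^bsub>CPstar\<^esub> M \<odot>\<^bsub>CPstar\<^esub> \<l>\<^bsub>CPstar\<^esub> N) \<cdot>\<^bsub>CPstar\<^esub> \<a>\<^bsub>CPstar\<^esub> M \<I>\<^bsub>CPstar\<^esub> N = \<r>\<^bsub>CPstar\<^esub> M \<odot>\<^bsub>CPstar\<^esub> \<one>\<^bsub>CPstar\<^esub> N"
    by (simp add: triangle)
  show "\<sigma>\<^bsub>CPstar\<^esub> N M \<cdot>\<^bsub>CPstar\<^esub> \<sigma>\<^bsub>CPstar\<^esub> M N = \<one>\<^bsub>CPstar\<^esub> (M \<otimes>\<^bsub>CPstar\<^esub> N)" by (simp add: Sym_Sym)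
next
  show "cpstar_object \<I>\<^bsub>CPstar\<^esub>" using cpstar_object_unit by simp
next
  fix f g M N M' N' assume *: "f \<in> hom CPstar M N" "g \<in> hom CPstar M' N'"
  from * show "f \<odot>\<^bsub>CPstar\<^esub> g \<in> hom CPstar (M \<otimes>\<^bsub>CPstar\<^esub> M') (N \<otimes>\<^bsub>CPstar\<^esub> N')"
    by (auto simp: CPstar_hom_iff cpstar_map_tensor dagger_frobenius_tensor normalisable_tensor)
  from * show "(f \<odot>\<^bsub>CPstar\<^esub> g)\<^sup>\<dagger>\<^bsub>CPstar\<^esub> = f\<^sup>\<dagger>\<^bsub>CPstar\<^esub> \<odot>\<^bsub>CPstar\<^esub> g\<^sup>\<dagger>\<^bsub>CPstar\<^esub>" by (auto elim!: CPstar_homE)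
  from * show "\<sigma>\<^bsub>CPstar\<^esub> N N' \<cdot>\<^bsub>CPstar\<^esub> f \<odot>\<^bsub>CPstar\<^esub> g = g \<odot>\<^bsub>CPstar\<^esub> f \<cdot>\<^bsub>CPstar\<^esub> \<sigma>\<^bsub>CPstar\<^esub> M M'"
    by (auto elim!: CPstar_homE simp: sym_nat)
next
  fix f g f' g' M N K M' N' K'
  assume "f \<in> hom CPstar M N" "g \<in> hom CPstar N K" "f' \<in> hom CPstar M' N'" "g' \<in> hom CPstar N' K'"
  then show "(g \<cdot>\<^bsub>CPstar\<^esub> f) \<odot>\<^bsub>CPstar\<^esub> (g' \<cdot>\<^bsub>CPstar\<^esub> f') = (g \<odot>\<^bsub>CPstar\<^esub> g') \<cdot>\<^bsub>CPstar\<^esub> (f \<odot>\<^bsub>CPstar\<^esub> f')"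
    by (auto elim!: CPstar_homE simp: interchange)
next
  fix M N K assume o: "cpstar_object M" "cpstar_object N" "cpstar_object K"
  then have [simp]: "Car M \<in> Obj V" "Car N \<in> Obj V" "Car K \<in> Obj V" by (simp_all add: dagger_frobeniusD)
  show "dagger_category.unitary CPstar ((M \<otimes>\<^bsub>CPstar\<^esub> N) \<otimes>\<^bsub>CPstar\<^esub> K) (M \<otimes>\<^bsub>CPstar\<^esub> N \<otimes>\<^bsub>CPstar\<^esub> K) (\<a>\<^bsub>CPstar\<^esub> M N K)"
    using CPstar_Assoc_unitary[OF o] by simp
  show "\<a>\<^bsub>CPstar\<^esub> N K M \<cdot>\<^bsub>CPstar\<^esub> \<sigma>\<^bsub>CPstar\<^esub> M (N \<otimes>\<^bsub>CPstar\<^esub> K) \<cdot>\<^bsub>CPstar\<^esub> \<a>\<^bsub>CPstar\<^esub> M N K =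
     (\<one>\<^bsub>CPstar\<^esub> N \<odot>\<^bsub>CPstar\<^esub> \<sigma>\<^bsub>CPstar\<^esub> M K) \<cdot>\<^bsub>CPstar\<^esub> \<a>\<^bsub>CPstar\<^esub> N M K \<cdot>\<^bsub>CPstar\<^esub> (\<sigma>\<^bsub>CPstar\<^esub> M N \<odot>\<^bsub>CPstar\<^esub> \<one>\<^bsub>CPstar\<^esub> K)"
    by (simp add: hexagon)
next
  fix M assume M: "cpstar_object M"
  show "dagger_category.unitary CPstar (\<I>\<^bsub>CPstar\<^esub> \<otimes>\<^bsub>CPstar\<^esub> M) M (\<l>\<^bsub>CPstar\<^esub> M)"
    "dagger_category.unitary CPstar (M \<otimes>\<^bsub>CPstar\<^esub> \<I>\<^bsub>CPstar\<^esub>) M (\<r>\<^bsub>CPstar\<^esub> M)"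
    using CPstar_Lunit_unitary[OF M] by simp_all
next
  fix f g h M M' N N' K K' assume "f \<in> hom CPstar M M'" "g \<in> hom CPstar N N'" "h \<in> hom CPstar K K'"
  then show "\<a>\<^bsub>CPstar\<^esub> M' N' K' \<cdot>\<^bsub>CPstar\<^esub> (f \<odot>\<^bsub>CPstar\<^esub> g) \<odot>\<^bsub>CPstar\<^esub> h = f \<odot>\<^bsub>CPstar\<^esub> (g \<odot>\<^bsub>CPstar\<^esub> h) \<cdot>\<^bsub>CPstar\<^esub> \<a>\<^bsub>CPstar\<^esub> M N K"
    by (auto elim!: CPstar_homE simp: assoc_nat)
next
  fix f M N assume "f \<in> hom CPstar M N"
  then show "\<l>\<^bsub>CPstar\<^esub> N \<cdot>\<^bsub>CPstar\<^esub> \<one>\<^bsub>CPstar\<^esub> \<I>\<^bsub>CPstar\<^esub> \<odot>\<^bsub>CPstar\<^esub> f = f \<cdot>\<^bsub>CPstar\<^esub> \<l>\<^bsub>CPstar\<^esub> M"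
    "\<r>\<^bsub>CPstar\<^esub> N \<cdot>\<^bsub>CPstar\<^esub> f \<odot>\<^bsub>CPstar\<^esub> \<one>\<^bsub>CPstar\<^esub> \<I>\<^bsub>CPstar\<^esub> = f \<cdot>\<^bsub>CPstar\<^esub> \<r>\<^bsub>CPstar\<^esub> M"
    by (auto elim!: CPstar_homE simp: lunit_nat runit_nat)
next
  fix M N K L assume o: "cpstar_object M" "cpstar_object N" "cpstar_object K" "cpstar_object L"
  then have "Car M \<in> Obj V" "Car N \<in> Obj V" "Car K \<in> Obj V" "Car L \<in> Obj V" by (simp_all add: dagger_frobeniusD)
  then show "\<a>\<^bsub>CPstar\<^esub> M N (K \<otimes>\<^bsub>CPstar\<^esub> L) \<cdot>\<^bsub>CPstar\<^esub> \<a>\<^bsub>CPstar\<^esub> (M \<otimes>\<^bsub>CPstar\<^esub> N) K L =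
     (\<one>\<^bsub>CPstar\<^esub> M \<odot>\<^bsub>CPstar\<^esub> \<a>\<^bsub>CPstar\<^esub> N K L) \<cdot>\<^bsub>CPstar\<^esub> \<a>\<^bsub>CPstar\<^esub> M (N \<otimes>\<^bsub>CPstar\<^esub> K) L \<cdot>\<^bsub>CPstar\<^esub> (\<a>\<^bsub>CPstar\<^esub> M N K \<odot>\<^bsub>CPstar\<^esub> \<one>\<^bsub>CPstar\<^esub> L)"
    by (simp add: pentagon)
qed

section \<open>Pants algebras as Frobenius algebras, and their actions\<close>

lemma L_obj_simps [simp]: "Car (L_obj A) = D A" "Mult (L_obj A) = pants_mult A" "Unt (L_obj A) = \<eta> A"
  by (simp_all add: L_obj_def pants_algebra_def pants_mult_def)

lemma dagger_frobenius_pants: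
  assumes A [simp]: "A \<in> Obj V"
  shows "dagger_frobenius_algebra (L_obj A)"
  unfolding L_obj_def pants_algebra_def pants_mult_def[symmetric]
proof (rule dagger_frobeniusI)
  let ?m = "pants_mult A"
  show "?m \<cdot> (?m \<odot> \<one> (D A)) = ?m \<cdot> (\<one> (D A) \<odot> ?m) \<cdot> \<a> (D A) (D A) (D A)"
  proof (rule free_ext)
    let ?v = "\<langle>\<langle>\<langle>var 0 (A\<^sup>\<star>), var 1 A\<rangle>, \<langle>var 2 (A\<^sup>\<star>), var 3 A\<rangle>\<rangle>, \<langle>var 4 (A\<^sup>\<star>), var 5 A\<rangle>\<rangle>"
    show "free ?v" by (intro free_pair free_var) simp_all
    show "(?m \<cdot> (?m \<odot> \<one> (D A))) \<rhd> ?v = (?m \<cdot> (\<one> (D A) \<odot> ?m) \<cdot> \<a> (D A) (D A) (D A)) \<rhd> ?v"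
      by (simp add: disjnt_def scale_left_commute)
  qed simp_all
  \<comment> \<open>Tested on the action, the unit laws say that the cup represents the identity
    operator.\<close>
  have u: "?m \<rhd> \<langle>\<eta> A \<rhd> un, T\<rangle> = T" "?m \<rhd> \<langle>T, \<eta> A \<rhd> un\<rangle> = T" if T: "valid T" "cod T = D A" for T
    by (rule evaluation_nondegenerate[OF dual_pair_Dual[OF A] A]; use T in simp)+
  show "?m \<cdot> (\<eta> A \<odot> \<one> (D A)) = \<l> (D A)"
    by (rule free_ext[of "\<langle>un, var 0 (D A)\<rangle>"], intro free_pair free_un free_var) (simp_all add: u)
  show "?m \<cdot> (\<one> (D A) \<odot> \<eta> A) = \<r> (D A)"
    by (rule free_ext[of "\<langle>var 0 (D A), un\<rangle>"], intro free_pair free_un free_var) (simp_all add: u)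
  show "(\<one> (D A) \<odot> ?m) \<cdot> \<a> (D A) (D A) (D A) \<cdot> (?m\<^sup>\<dagger> \<odot> \<one> (D A)) = ?m\<^sup>\<dagger> \<cdot> ?m"
  proof (rule TensorO_ext4[of "A\<^sup>\<star>" A "A\<^sup>\<star>" A])
    fix x y z w assume *: "valid x" "valid y" "valid z" "valid w" "cod x = A\<^sup>\<star>" "cod y = A" "cod z = A\<^sup>\<star>" "cod w = A"
      "apart (names x) (names y)" "apart (names x) (names z)" "apart (names x) (names w)"
      "apart (names y) (names z)" "apart (names y) (names w)" "apart (names z) (names w)"
    \<comment> \<open>The cup that the comultiplication creates is made an argument
      \<open>t\<close>, so that both sides can be compared with a pair in its place.\<close>
    let ?i = "\<lambda>t y. (\<a> (A\<^sup>\<star>) A (D A))\<^sup>\<dagger> \<rhd> \<langle>x, \<a> A (A\<^sup>\<star>) A \<rhd> \<langle>t, y\<rangle>\<rangle>"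
    let ?e = "(\<epsilon> A)\<^sup>\<dagger> \<rhd> un"
    have i: "?m\<^sup>\<dagger> \<rhd> \<langle>x, y\<rangle> = ?i ?e y" if "valid y" "cod y = A" for y
      using * that by (simp add: pants_mult_def)
    let ?Q = "\<lambda>t. (\<one> (D A) \<odot> ?m) \<rhd> \<a> (D A) (D A) (D A) \<rhd> \<langle>?i t y, \<langle>z, w\<rangle>\<rangle>" and ?R = "\<lambda>t. (tr A \<rhd> \<langle>z, y\<rangle>) \<bullet> ?i t w"
    have "?Q ?e = ?R ?e"
      by (rule linear_eq_on_pairs[where t = ?e and A = A and B = "A\<^sup>\<star>" and Q = ?Q and Q' = ?R],
          (rule linear_intros | use * in simp)+)
    then show "((\<one> (D A) \<odot> ?m) \<cdot> \<a> (D A) (D A) (D A) \<cdot> (?m\<^sup>\<dagger> \<odot> \<one> (D A))) \<rhd> \<langle>\<langle>x, y\<rangle>, \<langle>z, w\<rangle>\<rangle> = (?m\<^sup>\<dagger> \<cdot> ?m) \<rhd> \<langle>\<langle>x, y\<rangle>, \<langle>z, w\<rangle>\<rangle>"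
      using * by (simp add: i)
  qed simp_all
qed simp_all

text \<open>Multiplying \<open>\<langle>y', y\<rangle>\<close> by \<open>S\<close> from the right
  applies the operator \<open>S\<close> to \<open>y\<close> and leaves \<open>y'\<close> alone. That
  is \<open>\<one> \<otimes> S\<close>, which is what the adjoint of the partial trace over
  \<open>A\<^sup>\<star>\<close> yields.\<close>

lemma action_pants:
  assumes A [simp]: "A \<in> Obj V"
  shows "action (L_obj A) = (partial_tr (A\<^sup>\<star>) A)\<^sup>\<dagger>"
proof (rule evaluation_arrow_ext[OF dual_pair_Dual[of "D A"], where X = "D A" and B = "D A"])
  fix S Y assume SY: "valid S" "valid Y" "cod S = D A" "cod Y = D A" "apart (names S) (names Y)"
  let ?Q = "\<lambda>Y. ev (D A) \<rhd> \<langle>action (L_obj A) \<rhd> S, Y\<rangle>" and ?R = "\<lambda>Y. ev (D A) \<rhd> \<langle>(partial_tr (A\<^sup>\<star>) A)\<^sup>\<dagger> \<rhd> S, Y\<rangle>"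
  note [simp] = action_typing[OF dagger_frobenius_pants[OF A]]
  have 1: "?Q \<langle>y', y\<rangle> = ?R \<langle>y', y\<rangle>"
    if y: "valid y'" "valid y" "cod y' = A\<^sup>\<star>" "cod y = A" "apart (names y') (names y)" "apart (names y') (names S)" "apart (names y) (names S)" for y' y
  proof -
    have "?Q \<langle>y', y\<rangle> = pants_mult A \<rhd> \<langle>\<langle>y', y\<rangle>, S\<rangle>" using y SY by (simp add: action_eq)
    also have "\<dots> = \<langle>y', ev A \<rhd> \<langle>S, y\<rangle>\<rangle>"
      by (rule linear_eq_on_pairs[where t = S and A = "A\<^sup>\<star>" and B = A and Q = "\<lambda>S. pants_mult A \<rhd> \<langle>\<langle>y', y\<rangle>, S\<rangle>" and Q' = "\<lambda>S. \<langle>y', ev A \<rhd> \<langle>S, y\<rangle>\<rangle>"],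
          (rule linear_intros | use y SY in simp)+)
    also have "\<dots> = ?R \<langle>y', y\<rangle>" using y SY by (simp add: partial_tr_def dagger_Comp)
    finally show ?thesis .
  qed
  show "?Q Y = ?R Y"
    by (rule linear_eq_on_pairs[where t = Y and A = "A\<^sup>\<star>" and B = A and Q = ?Q and Q' = ?R], (rule linear_intros | rule 1 | use SY in simp)+)
qed (use action_typing[OF dagger_frobenius_pants[OF A]] in simp_all)

lemma coaction_pants: "A \<in> Obj V \<Longrightarrow> coaction (L_obj A) = partial_tr (A\<^sup>\<star>) A"
  by (simp add: coaction_eq dagger_frobenius_pants action_pants)

text \<open>As \<open>L\<close> leaves the underlying morphisms unchanged, its structure
  isomorphisms are those of the doubling functor.\<close>

definition L_tensor :: "'o \<Rightarrow> 'o \<Rightarrow> (('o, 'm) algebra_data, 'm) arrow" where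
  "L_tensor A B = Arrow (L_obj (A \<otimes> B)) (double_tensor A B) (tensor_algebra (L_obj A) (L_obj B))"

definition L_unit :: "(('o, 'm) algebra_data, 'm) arrow" where
  "L_unit = Arrow (L_obj \<I>) (tr \<I>) unit_algebra"

text \<open>On both sides the product is composition of operators in the same order, and the action
  of \<open>D A \<otimes> D B\<close> on \<open>A \<otimes> B\<close> is faithful.\<close>

lemma double_tensor_pants_mult:
  assumes [simp]: "A \<in> Obj V" "B \<in> Obj V"
  shows "double_tensor A B \<cdot> pants_mult (A \<otimes> B) =
    Mult (tensor_algebra (L_obj A) (L_obj B)) \<cdot> (double_tensor A B \<odot> double_tensor A B)"
proof -
  let ?\<mu> = "Mult (tensor_algebra (L_obj A) (L_obj B))" and ?P = "D A \<otimes> D B" and ?E = "A \<otimes> B" and ?d = "double_tensor A B"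
  have m: "model ?P ?E (ev2 A B) ?d" using model_tensor[OF model_Id[of A] model_Id[of B]] by simp
  have e: "ev2 A B \<cdot> (?\<mu> \<odot> \<one> ?E) = ev2 A B \<cdot> (\<one> ?P \<odot> ev2 A B) \<cdot> \<a> ?P ?P ?E \<cdot> (\<sigma> ?P ?P \<odot> \<one> ?E)"
  proof (rule free_ext)
    let ?v = "\<langle>\<langle>\<langle>var 0 (D A), var 1 (D B)\<rangle>, \<langle>var 2 (D A), var 3 (D B)\<rangle>\<rangle>, \<langle>var 4 A, var 5 B\<rangle>\<rangle>"
    show "free ?v" by (intro free_pair free_var) simp_all
    show "(ev2 A B \<cdot> (?\<mu> \<odot> \<one> ?E)) \<rhd> ?v = (ev2 A B \<cdot> (\<one> ?P \<odot> ev2 A B) \<cdot> \<a> ?P ?P ?E \<cdot> (\<sigma> ?P ?P \<odot> \<one> ?E)) \<rhd> ?v"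
      by (simp add: disjnt_def)
  qed simp_all
  show ?thesis
  proof (rule model_ext[OF m, where X = "D ?E \<otimes> D ?E"])
    show "ev2 A B \<cdot> ((?d \<cdot> pants_mult ?E) \<odot> \<one> ?E) = ev2 A B \<cdot> ((?\<mu> \<cdot> (?d \<odot> ?d)) \<odot> \<one> ?E)"
    proof (rule TensorO_ext3[of "D ?E" "D ?E" ?E])
      fix S T y assume *: "valid S" "valid T" "valid y" "cod S = D ?E" "cod T = D ?E" "cod y = ?E"
        "apart (names S) (names T)" "apart (names S) (names y)" "apart (names T) (names y)"
      have "(ev2 A B \<cdot> ((?\<mu> \<cdot> (?d \<odot> ?d)) \<odot> \<one> ?E)) \<rhd> \<langle>\<langle>S, T\<rangle>, y\<rangle> = (ev2 A B \<cdot> (?\<mu> \<odot> \<one> ?E)) \<rhd> \<langle>\<langle>?d \<rhd> S, ?d \<rhd> T\<rangle>, y\<rangle>"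
        using * by simp
      also have "\<dots> = (ev2 A B \<cdot> ((?d \<cdot> pants_mult ?E) \<odot> \<one> ?E)) \<rhd> \<langle>\<langle>S, T\<rangle>, y\<rangle>" unfolding e using * by simp
      finally show "(ev2 A B \<cdot> ((?d \<cdot> pants_mult ?E) \<odot> \<one> ?E)) \<rhd> \<langle>\<langle>S, T\<rangle>, y\<rangle> = (ev2 A B \<cdot> ((?\<mu> \<cdot> (?d \<odot> ?d)) \<odot> \<one> ?E)) \<rhd> \<langle>\<langle>S, T\<rangle>, y\<rangle>" by simp
    qed simp_all
  qed simp_all
qed

end


section \<open>The functor L\<close>

context positive_dimensional_dagger_compact_category
begin

text \<open>The trace of \<open>\<one> \<otimes> T\<close> on
  \<open>A\<^sup>\<star> \<otimes> A\<close> is the dimension of \<open>A\<^sup>\<star>\<close>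
  times the trace of \<open>T\<close>. As the counit is \<open>tr A\<close>, a multiple of the
  identity is enough to normalise.\<close>

lemma normalisable_pants:
  assumes A [simp]: "A \<in> Obj V"
  shows "normalisable (L_obj A)"
proof -
  note M = dagger_frobenius_pants[OF A]
  note [simp] = trace_mult_typing[OF M]
  \<comment> \<open>The hypothesis is applied to \<open>A\<^sup>\<star>\<close>, since its dimension
    is the factor to be cancelled.\<close>
  obtain s where s: "positive_definite \<I> s"
    and n: "\<l> (A\<^sup>\<star>) \<cdot> ((s \<cdot> s \<cdot> dimension (A\<^sup>\<star>)) \<odot> \<one> (A\<^sup>\<star>)) \<cdot> (\<l> (A\<^sup>\<star>))\<^sup>\<dagger> = \<one> (A\<^sup>\<star>)"
    using positive_dimensional[of "A\<^sup>\<star>"] by auto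
  note [simp] = positive_definiteD(1-3)[OF s]
  let ?z = "\<l> (D A) \<cdot> (s \<odot> \<one> (D A)) \<cdot> (\<l> (D A))\<^sup>\<dagger>"
  let ?s = "s \<rhd> un" and ?d = "tr (A\<^sup>\<star>) \<rhd> \<eta> (A\<^sup>\<star>) \<rhd> un"
  have d: "(?d \<bullet> ?s \<bullet> ?s) \<bullet> x = x" if "valid x" "cod x = A\<^sup>\<star>" for x
  proof -
    have "x = (s \<rhd> s \<rhd> ?d) \<bullet> x"
      using arg_cong[OF n, of "\<lambda>f. f \<rhd> x"] that by (simp add: dimension_def)
    moreover have "s \<rhd> s \<rhd> ?d = ?d \<bullet> ?s \<bullet> ?s"
      using app_scalar[of s ?d] app_scalar[of s ?s] by simp
    ultimately show ?thesis by simp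
  qed
  have t: "trace_mult (L_obj A) \<rhd> S = ?d \<bullet> (tr A \<rhd> S)" if S: "valid S" "cod S = D A" for S
  proof -
    have "trace_mult (L_obj A) = (tr (D A) \<cdot> (double_tensor (A\<^sup>\<star>) A)\<^sup>\<dagger>) \<cdot> (\<eta> (A\<^sup>\<star>) \<odot> \<one> (D A)) \<cdot> (\<l> (D A))\<^sup>\<dagger>"
      by (simp add: trace_mult_action[OF M] action_pants partial_tr_def dagger_Comp comp_assoc)
    then show ?thesis using S by (simp add: tr_double_tensor_dagger)
  qed
  have "trace_mult (L_obj A) \<cdot> ?z \<cdot> ?z = (Unt (L_obj A))\<^sup>\<dagger>"
  proof (rule TensorO_ext[of "A\<^sup>\<star>" A])
    fix x y assume xy: "valid x" "valid y" "cod x = A\<^sup>\<star>" "cod y = A" "apart (names x) (names y)"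
    \<comment> \<open>The scalar formed from \<open>s\<close> and the dimension is not known to be
      \<open>un\<close>; it is only known to fix elements of \<open>A\<^sup>\<star>\<close>. It is
      therefore attached to the leg \<open>x\<close> before it is cancelled.\<close>
    have "(trace_mult (L_obj A) \<cdot> ?z \<cdot> ?z) \<rhd> \<langle>x, y\<rangle> = tr A \<rhd> \<langle>(?d \<bullet> ?s \<bullet> ?s) \<bullet> x, y\<rangle>"
      using xy by (simp add: t scale_left_commute)
    then show "(trace_mult (L_obj A) \<cdot> ?z \<cdot> ?z) \<rhd> \<langle>x, y\<rangle> = (Unt (L_obj A))\<^sup>\<dagger> \<rhd> \<langle>x, y\<rangle>"
      unfolding d[OF xy(1,3)] by simp
  qed simp_all
  moreover have "central (L_obj A) ?z" unfolding central_def
    by (intro conjI; (rule TensorO_ext[of "D A" "D A"])?) (simp_all add: hom_def)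
  ultimately show ?thesis unfolding normalisable_def normaliser_def
    using positive_definite_scalar[OF s, of "D A"] by auto
qed

lemma cpstar_object_pants: "A \<in> Obj V \<Longrightarrow> cpstar_object (L_obj A)"
  by (simp add: dagger_frobenius_pants normalisable_pants)

text \<open>Forwards, coaction and action are a partial trace and the adjoint of one, both
  completely positive. Backwards, the normaliser retractions of both pants algebras recover
  \<open>f\<close> from its composite with action and coaction, using only completely positive
  maps.\<close>

lemma cpstar_map_pants_iff:
  assumes [simp]: "A \<in> Obj V" "B \<in> Obj V"
  shows "cpstar_map (L_obj A) (L_obj B) f \<longleftrightarrow> completely_positive A B f"
proof
  note MN = dagger_frobenius_pants[of A] dagger_frobenius_pants[of B]
  note [simp] = action_pants coaction_pants
  assume f: "completely_positive A B f"
  have "completely_positive (D A) (D B) ((partial_tr (B\<^sup>\<star>) B)\<^sup>\<dagger> \<cdot> f \<cdot> partial_tr (A\<^sup>\<star>) A)"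
    by (rule cp_Comp[OF cp_Comp[OF cp_partial_tr f] cp_dagger[OF cp_partial_tr]]) simp_all
  then show "cpstar_map (L_obj A) (L_obj B) f"
    using completely_positiveD[OF f] by (simp add: cpstar_map_def)
next
  note [simp] = action_pants coaction_pants
  assume "cpstar_map (L_obj A) (L_obj B) f"
  then have f: "f \<in> Arr V" "Dom V f = D A" "Cod V f = D B"
    "completely_positive (D A) (D B) ((partial_tr (B\<^sup>\<star>) B)\<^sup>\<dagger> \<cdot> f \<cdot> partial_tr (A\<^sup>\<star>) A)" by (simp_all add: cpstar_map_def)
  obtain z where z: "normaliser (L_obj A) z" using normalisable_pants[of A] unfolding normalisable_def by auto
  obtain w where w: "normaliser (L_obj B) w" using normalisable_pants[of B] unfolding normalisable_def by auto
  note zr = normaliser_retraction[OF dagger_frobenius_pants[of A] z, simplified]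
  note wr = normaliser_retraction[OF dagger_frobenius_pants[of B] w, simplified]
  note [simp] = zr(2-) wr(2-) f(1-3)
  have "f = (partial_tr (B\<^sup>\<star>) B \<cdot> double w \<cdot> (partial_tr (B\<^sup>\<star>) B)\<^sup>\<dagger>) \<cdot> f \<cdot> (partial_tr (A\<^sup>\<star>) A \<cdot> double z \<cdot> (partial_tr (A\<^sup>\<star>) A)\<^sup>\<dagger>)"
    unfolding zr(1) wr(1) by simp
  also have "\<dots> = (partial_tr (B\<^sup>\<star>) B \<cdot> double w) \<cdot> ((partial_tr (B\<^sup>\<star>) B)\<^sup>\<dagger> \<cdot> f \<cdot> partial_tr (A\<^sup>\<star>) A) \<cdot> double z \<cdot> (partial_tr (A\<^sup>\<star>) A)\<^sup>\<dagger>"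
    by (simp add: comp_assoc)
  also have "completely_positive A B \<dots>"
    by (intro cp_Comp[of _ "D A"] cp_Comp[of _ "D B"] cp_partial_tr cp_double cp_dagger[OF cp_partial_tr] f(4)) simp_all
  finally show "completely_positive A B f" .
qed

lemma L_functor: "category_functor CPM CPstar L_obj L_arr"
proof (intro category_functor.intro CPM_category CPstar_category category_functor_axioms.intro)
  fix A assume "A \<in> Obj CPM"
  then show "L_obj A \<in> Obj CPstar" "L_arr (\<one>\<^bsub>CPM\<^esub> A) = \<one>\<^bsub>CPstar\<^esub> (L_obj A)"
    by (simp_all add: cpstar_object_pants L_arr_def)
next
  fix f A B assume "f \<in> hom CPM A B"
  then show "L_arr f \<in> hom CPstar (L_obj A) (L_obj B)"
    by (auto simp: CPM_hom_iff CPstar_hom_iff L_arr_def cpstar_map_pants_iff cpstar_object_pants)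
next
  fix f g A B E assume "f \<in> hom CPM A B" "g \<in> hom CPM B E"
  then show "L_arr (g \<cdot>\<^bsub>CPM\<^esub> f) = L_arr g \<cdot>\<^bsub>CPstar\<^esub> L_arr f" by (simp add: L_arr_def)
qed

lemma L_full: "full_functor CPM CPstar L_obj L_arr"
proof (intro full_functor.intro L_functor full_functor_axioms.intro subsetI)
  fix A B x assume "A \<in> Obj CPM" "B \<in> Obj CPM" and "x \<in> hom CPstar (L_obj A) (L_obj B)"
  then obtain f where "x = L_arr (Arrow A f B)" "Arrow A f B \<in> hom CPM A B"
    by (auto simp: CPM_hom_iff CPstar_hom_iff L_arr_def cpstar_map_pants_iff)
  then show "x \<in> L_arr ` hom CPM A B" by blast
qed

lemma L_faithful: "faithful_functor CPM CPstar L_obj L_arr"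
  by (intro faithful_functor.intro L_functor faithful_functor_axioms.intro inj_onI)
    (auto simp: CPM_hom_iff L_arr_def)

lemma L_tensor_unitary:
  assumes [simp]: "A \<in> Obj V" "B \<in> Obj V"
  shows "dagger_category.unitary CPstar (L_obj (A \<otimes> B)) (tensor_algebra (L_obj A) (L_obj B)) (L_tensor A B)"
  unfolding L_tensor_def
proof (rule CPstar_unitary)
  show "cpstar_object (L_obj (A \<otimes> B))" by (rule cpstar_object_pants) simp
  show "cpstar_object (tensor_algebra (L_obj A) (L_obj B))" by (intro cpstar_object_tensor cpstar_object_pants) simp_all
  show "unitary (Car (L_obj (A \<otimes> B))) (Car (tensor_algebra (L_obj A) (L_obj B))) (double_tensor A B)"
    by (simp add: double_tensor_unitary)
  show "double_tensor A B \<cdot> Mult (L_obj (A \<otimes> B)) = Mult (tensor_algebra (L_obj A) (L_obj B)) \<cdot> (double_tensor A B \<odot> double_tensor A B)"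
    using double_tensor_pants_mult[of A B] by simp
qed

lemma L_unit_unitary: "dagger_category.unitary CPstar (L_obj \<I>) unit_algebra L_unit"
  unfolding L_unit_def
proof (rule CPstar_unitary)
  show "cpstar_object (L_obj \<I>)" by (rule cpstar_object_pants) simp
  show "cpstar_object unit_algebra" by (rule cpstar_object_unit)
  show "unitary (Car (L_obj \<I>)) (Car unit_algebra) (tr \<I>)" by (simp add: tr_unit_unitary)
  show "tr \<I> \<cdot> Mult (L_obj \<I>) = Mult unit_algebra \<cdot> (tr \<I> \<odot> tr \<I>)"
  proof (rule TensorO_ext[of "D \<I>" "D \<I>"])
    fix S T assume *: "valid S" "valid T" "cod S = D \<I>" "cod T = D \<I>" "apart (names S) (names T)"
    \<comment> \<open>The trace of an operator on \<open>\<I>\<close> is its value at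
      \<open>un\<close>, and a product acts by applying its factors one after the other.\<close>
    have "tr \<I> \<rhd> pants_mult \<I> \<rhd> \<langle>S, T\<rangle> = ev \<I> \<rhd> \<langle>T, (tr \<I> \<rhd> S) \<bullet> un\<rangle>" using * by (simp add: ev_un flip: ev_un[of "pants_mult \<I> \<rhd> \<langle>S, T\<rangle>"])
    also have "\<dots> = (tr \<I> \<rhd> S) \<bullet> (tr \<I> \<rhd> T)" using * by (simp add: ev_un del: scale_un)
    finally show "(tr \<I> \<cdot> Mult (L_obj \<I>)) \<rhd> \<langle>S, T\<rangle> = (Mult unit_algebra \<cdot> (tr \<I> \<odot> tr \<I>)) \<rhd> \<langle>S, T\<rangle>" using * by simp
  qed simp_all
qed

text \<open>Naturality of \<open>L_tensor\<close> holds because the tensor product of CPM[V] is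
  defined by conjugation with \<open>double_tensor\<close>; the other laws are the coherence laws of
  \<open>double_tensor\<close>.\<close>

lemma L_strongly_monoidal: "strongly_dagger_symmetric_monoidal_functor CPM CPstar L_obj L_arr L_tensor L_unit"
proof (intro strongly_dagger_symmetric_monoidal_functor.intro L_functor CPM_dagger_symmetric_monoidal_category
    CPstar_dagger_symmetric_monoidal_category strongly_dagger_symmetric_monoidal_functor_axioms.intro, unfold CPM_simps(1))
  fix f A B assume "f \<in> hom CPM A B"
  then show "L_arr (f\<^sup>\<dagger>\<^bsub>CPM\<^esub>) = (L_arr f)\<^sup>\<dagger>\<^bsub>CPstar\<^esub>" by (simp add: L_arr_def)
next
  fix A B assume "A \<in> Obj V" "B \<in> Obj V"
  then show "dagger_category.unitary CPstar (L_obj (A \<otimes>\<^bsub>CPM\<^esub> B)) (L_obj A \<otimes>\<^bsub>CPstar\<^esub> L_obj B) (L_tensor A B)"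
    by (simp add: L_tensor_unitary)
next
  fix A B assume "A \<in> Obj V" "B \<in> Obj V"
  then show "L_tensor B A \<cdot>\<^bsub>CPstar\<^esub> L_arr (\<sigma>\<^bsub>CPM\<^esub> A B) = \<sigma>\<^bsub>CPstar\<^esub> (L_obj A) (L_obj B) \<cdot>\<^bsub>CPstar\<^esub> L_tensor A B"
    by (simp add: L_tensor_def L_arr_def pure_arrow_eq double_tensor_Sym)
next
  show "dagger_category.unitary CPstar (L_obj \<I>\<^bsub>CPM\<^esub>) \<I>\<^bsub>CPstar\<^esub> L_unit" by (simp add: L_unit_unitary)
next
  fix f g A A' B B' assume "f \<in> hom CPM A A'" "g \<in> hom CPM B B'"
  then show "L_tensor A' B' \<cdot>\<^bsub>CPstar\<^esub> L_arr (f \<odot>\<^bsub>CPM\<^esub> g) = (L_arr f \<odot>\<^bsub>CPstar\<^esub> L_arr g) \<cdot>\<^bsub>CPstar\<^esub> L_tensor A B"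
    by (auto elim!: CPM_homE simp: L_tensor_def L_arr_def cpm_tensor_def)
next
  fix A B E assume "A \<in> Obj V" "B \<in> Obj V" "E \<in> Obj V"
  then show "\<a>\<^bsub>CPstar\<^esub> (L_obj A) (L_obj B) (L_obj E) \<cdot>\<^bsub>CPstar\<^esub> (L_tensor A B \<odot>\<^bsub>CPstar\<^esub> \<one>\<^bsub>CPstar\<^esub> (L_obj E)) \<cdot>\<^bsub>CPstar\<^esub> L_tensor (A \<otimes>\<^bsub>CPM\<^esub> B) E =
    (\<one>\<^bsub>CPstar\<^esub> (L_obj A) \<odot>\<^bsub>CPstar\<^esub> L_tensor B E) \<cdot>\<^bsub>CPstar\<^esub> L_tensor A (B \<otimes>\<^bsub>CPM\<^esub> E) \<cdot>\<^bsub>CPstar\<^esub> L_arr (\<a>\<^bsub>CPM\<^esub> A B E)"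
    by (simp add: L_tensor_def L_arr_def pure_arrow_eq double_tensor_Assoc)
next
  fix A assume "A \<in> Obj V"
  then show "\<l>\<^bsub>CPstar\<^esub> (L_obj A) \<cdot>\<^bsub>CPstar\<^esub> (L_unit \<odot>\<^bsub>CPstar\<^esub> \<one>\<^bsub>CPstar\<^esub> (L_obj A)) \<cdot>\<^bsub>CPstar\<^esub> L_tensor \<I>\<^bsub>CPM\<^esub> A = L_arr (\<l>\<^bsub>CPM\<^esub> A)"
    and "\<r>\<^bsub>CPstar\<^esub> (L_obj A) \<cdot>\<^bsub>CPstar\<^esub> (\<one>\<^bsub>CPstar\<^esub> (L_obj A) \<odot>\<^bsub>CPstar\<^esub> L_unit) \<cdot>\<^bsub>CPstar\<^esub> L_tensor A \<I>\<^bsub>CPM\<^esub> = L_arr (\<r>\<^bsub>CPM\<^esub> A)"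
    by (simp_all add: L_tensor_def L_unit_def L_arr_def pure_arrow_eq double_tensor_Lunit double_tensor_Runit)
qed

end

theorem theorem4p4:
  fixes V :: "('o, 'm) dagger_compact_data"
  assumes "positive_dimensional_dagger_compact_category V"
  shows "let CPM = dagger_compact_category.CPM V;
             CPstar = dagger_compact_category.CPstar V;
             L\<^sub>o = dagger_compact_category.L_obj V;
             L\<^sub>a = dagger_compact_category.L_arr V
         in category_functor CPM CPstar L\<^sub>o L\<^sub>a \<and>
            full_functor CPM CPstar L\<^sub>o L\<^sub>a \<and>
            faithful_functor CPM CPstar L\<^sub>o L\<^sub>a \<and>
            (\<exists>\<phi> \<phi>\<^sub>0. strongly_dagger_symmetric_monoidal_functor CPM CPstar L\<^sub>o L\<^sub>a \<phi> \<phi>\<^sub>0)"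
proof -
  interpret positive_dimensional_dagger_compact_category V by fact
  show ?thesis unfolding Let_def using L_functor L_full L_faithful L_strongly_monoidal by blast
qed

end
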